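(* Let $X$ be a separable r.i. space on $(-1,1)$ such that $0<\underline{\alpha}_X\le\overline{\alpha}_X<1$, and let $T_X\colon X\to X$ be the finite Hilbert transform on $X$. Suppose that $p_X\ge2\ge q_X$ and that, for those cases when either $p_X=2$ or $q_X=2$ occurs, they are not attained (that is, if $p_X=2$ then $p_X$ is not attained, and if $q_X=2$ then $q_X$ is not attained). Then $\sigma_{\mathrm{pt}}(T_X)=\sigma_{\mathrm{r}}(T_X)=\emptyset$ and $\sigma_{\mathrm{c}}(T_X)=\sigma(T_X)$.
   Context: The interval $(-1,1)$ carries Lebesgue measure; $L^0$ is the space of (equivalence classes of) complex-valued measurable functions on $(-1,1)$, and $L^p=L^p(-1,1)$. For $f\in L^0$, $f^*\colon[0,2]\to[0,\infty]$ denotes its decreasing rearrangement. A rearrangement invariant (r.i.) space $X$ on $(-1,1)$ is a (nonzero) Banach space $X\subseteq L^0$ such that if $g\in L^0$, $f\in X$ and $g^*\le f^*$, then $g\in X$ and $\|g\|_X\le\|f\|_X$; all r.i. spaces are assumed to satisfy the Fatou property: if $(f_n)\subseteq X$, $0\le f_n\uparrow f$ a.e. and $\sup_n\|f_n\|_X<\infty$, then $f\in X$ and $\|f_n\|_X\to\|f\|_X$. For $t>0$ the dilation operator $E_t\colon X\to X$ is $E_t(f)(s):=f(st)$ if $-1\le st\le1$ and $0$ otherwise. The lower and upper Boyd indices of $X$ are $\underline{\alpha}_X:=\sup_{0<t<1}\frac{\log\|E_{1/t}\|_{X\to X}}{\log t}$ and $\overline{\alpha}_X:=\inf_{1<t<\infty}\frac{\log\|E_{1/t}\|_{X\to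 X}}{\log t}$. The finite Hilbert transform of $f\in L^1(-1,1)$ is $(T(f))(t)=\lim_{\varepsilon\to0^+}\frac{1}{\pi i}\left(\int_{-1}^{t-\varepsilon}+\int_{t+\varepsilon}^1\right)\frac{f(x)}{x-t}\,dx$, which exists for a.e. $t\in(-1,1)$. If $0<\underline{\alpha}_X\le\overline{\alpha}_X<1$, then $T$ maps $X$ boundedly into $X$ (Boyd); this operator is denoted $T_X$. For a bounded operator $B$ on a Banach space $Y$, with spectrum $\sigma(B)$: $\sigma_{\mathrm{pt}}(B)$ is the set of eigenvalues; $\sigma_{\mathrm{c}}(B)$ is the set of $\lambda\in\sigma(B)$ for which $\lambda I-B$ is injective with dense range; $\sigma_{\mathrm{r}}(B)$ is the set of $\lambda\in\sigma(B)$ for which $\lambda I-B$ is injective and its range is not dense. For $1<p<\infty$, $L^{p,\infty}$ is the space of $f\in L^0$ with $f^*(t)\le M t^{-1/p}$, $0<t\le2$, for some constant $M$, and $L^{p,1}$ is the space of $f\in L^0$ with $\int_0^2t^{\frac1p-1}f^*(t)\,dt<\infty$. The index $p_X\in(1,\infty)$ is $p_X:=\inf\{p\in(1,\infty):|x|^{-1/p}\in X\}=\inf\{p\in(1,\infty):L^{p,\infty}\subseteq X\}$; it is attained if this infimum is attained, i.e. if $L^{p_X,\infty}\subseteq X$. The index $q_X\in(1,\infty)$ is $q_X:=\sup\{q\in(1,\infty):X\subseteq L^{q,1}\}$; it is attained if this supremum is attained, i.e. if $X\subseteq L^{q_X,1}$. *)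

theory Defs
  imports "HOL-Analysis.Analysis" "HOL-Library.Complex_Order"
begin

section \<open>The space of classes of measurable functions on the interval (-1,1)\<close>

abbreviation leb_I :: "real measure" where
  "leb_I \<equiv> lebesgue_on {-1<..<1}"

text \<open>Partial equivalence relation: functions that are not measurable are related to nothing.
  Values outside the interval are irrelevant.\<close>

definition ae_eq :: "(real \<Rightarrow> complex) \<Rightarrow> (real \<Rightarrow> complex) \<Rightarrow> bool" where
  "ae_eq f g \<longleftrightarrow> f \<in> borel_measurable leb_I \<and> g \<in> borel_measurable leb_I \<and>
                (AE x in leb_I. f x = g x)"

quotient_type L0 = "real \<Rightarrow> complex" / partial: ae_eq
proof (rule part_equivpI)
  show "\<exists>f. ae_eq f f"
    by (rule exI[of _ "\<lambda>_. 0"]) (simp add: ae_eq_def)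
  show "symp ae_eq"
    by (rule sympI) (auto simp: ae_eq_def elim: AE_mp)
  show "transp ae_eq"
  proof (rule transpI)
    fix f g h assume "ae_eq f g" "ae_eq g h"
    then show "ae_eq f h"
      unfolding ae_eq_def by (auto elim: eventually_elim2)
  qed
qed

instantiation L0 :: ab_group_add
begin

lift_definition zero_L0 :: L0 is "\<lambda>_. 0"
  by (simp add: ae_eq_def)

lift_definition plus_L0 :: "L0 \<Rightarrow> L0 \<Rightarrow> L0" is "\<lambda>f g x. f x + g x"
  unfolding ae_eq_def by (auto elim: eventually_elim2)

lift_definition minus_L0 :: "L0 \<Rightarrow> L0 \<Rightarrow> L0" is "\<lambda>f g x. f x - g x"
  unfolding ae_eq_def by (auto elim: eventually_elim2)

lift_definition uminus_L0 :: "L0 \<Rightarrow> L0" is "\<lambda>f x. - f x"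
  unfolding ae_eq_def by (auto elim: eventually_mono)

instance
  by standard (transfer; simp add: ae_eq_def algebra_simps)+

end

lift_definition scale_L0 :: "complex \<Rightarrow> L0 \<Rightarrow> L0" is "\<lambda>c f x. c * f x"
  unfolding ae_eq_def by (auto elim: eventually_mono)

global_interpretation L0: vector_space scale_L0
  by standard (transfer; simp add: ae_eq_def algebra_simps)+


section \<open>Rearrangement invariant spaces\<close>

text \<open>The value may be infinite at \<open>t = 0\<close>.\<close>

lift_definition rearr :: "L0 \<Rightarrow> real \<Rightarrow> ennreal" is
  "\<lambda>f t. Inf {s :: ennreal. emeasure leb_I {x \<in> space leb_I. s < ennreal (norm (f x))} \<le> ennreal t}"
proof -
  fix f g assume fg: "ae_eq f g"
  then have [measurable]: "f \<in> borel_measurable leb_I" "g \<in> borel_measurable leb_I"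
    by (auto simp: ae_eq_def)
  have "emeasure leb_I {x \<in> space leb_I. s < ennreal (norm (f x))} =
        emeasure leb_I {x \<in> space leb_I. s < ennreal (norm (g x))}" for s
  proof (rule emeasure_eq_AE)
    show "AE x in leb_I. (x \<in> {x \<in> space leb_I. s < ennreal (norm (f x))}) =
                         (x \<in> {x \<in> space leb_I. s < ennreal (norm (g x))})"
      using fg unfolding ae_eq_def by (auto elim: eventually_mono)
  qed measurable
  then show "(\<lambda>t. Inf {s :: ennreal. emeasure leb_I {x \<in> space leb_I. s < ennreal (norm (f x))} \<le> ennreal t}) =
             (\<lambda>t. Inf {s :: ennreal. emeasure leb_I {x \<in> space leb_I. s < ennreal (norm (g x))} \<le> ennreal t})"
    by simp
qed

definition rearr_le :: "L0 \<Rightarrow> L0 \<Rightarrow> bool" where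
  "rearr_le g f \<longleftrightarrow> (\<forall>t\<in>{0..2}. rearr g t \<le> rearr f t)"

text \<open>A normed space is a carrier \<open>X\<close> with a norm \<open>N\<close>, whose values off the carrier are irrelevant.\<close>

definition norm_on :: "L0 set \<Rightarrow> (L0 \<Rightarrow> real) \<Rightarrow> bool" where
  "norm_on X N \<longleftrightarrow> L0.subspace X \<and>
     (\<forall>f\<in>X. 0 \<le> N f) \<and> (\<forall>f\<in>X. N f = 0 \<longleftrightarrow> f = 0) \<and>
     (\<forall>c. \<forall>f\<in>X. N (scale_L0 c f) = cmod c * N f) \<and>
     (\<forall>f\<in>X. \<forall>g\<in>X. N (f + g) \<le> N f + N g)"

text \<open>The cut-off is there because \<^locale>\<open>Metric_space\<close> constrains the distance
  off the carrier as well.\<close>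

definition ndist :: "L0 set \<Rightarrow> (L0 \<Rightarrow> real) \<Rightarrow> L0 \<Rightarrow> L0 \<Rightarrow> real" where
  "ndist X N f g = (if f \<in> X \<and> g \<in> X then N (f - g) else 0)"

abbreviation ntopology :: "L0 set \<Rightarrow> (L0 \<Rightarrow> real) \<Rightarrow> L0 topology" where
  "ntopology X N \<equiv> Metric_space.mtopology X (ndist X N)"

lemma Metric_space_ndist:
  assumes "norm_on X N"
  shows "Metric_space X (ndist X N)"
proof
  have sub: "L0.subspace X" and nn: "\<And>f. f \<in> X \<Longrightarrow> 0 \<le> N f"
    and z: "\<And>f. f \<in> X \<Longrightarrow> N f = 0 \<longleftrightarrow> f = 0"
    and sc: "\<And>c f. f \<in> X \<Longrightarrow> N (scale_L0 c f) = cmod c * N f"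
    and tri: "\<And>f g. f \<in> X \<Longrightarrow> g \<in> X \<Longrightarrow> N (f + g) \<le> N f + N g"
    using assms unfolding norm_on_def by auto
  have diff: "\<And>f g. f \<in> X \<Longrightarrow> g \<in> X \<Longrightarrow> f - g \<in> X"
    using sub by (rule L0.subspace_diff)
  show "0 \<le> ndist X N x y" for x y
    by (simp add: ndist_def nn diff)
  show "ndist X N x y = ndist X N y x" for x y
  proof -
    have "N (y - x) = N (x - y)" if "x \<in> X" "y \<in> X"
      using sc[of "x - y" "-1"] diff that by simp
    then show ?thesis by (simp add: ndist_def)
  qed
  show "(ndist X N x y = 0) = (x = y)" if "x \<in> X" "y \<in> X" for x y
    using that by (simp add: ndist_def z diff)
  show "ndist X N x z \<le> ndist X N x y + ndist X N y z" if "x \<in> X" "y \<in> X" "z \<in> X" for x y z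
    using that tri[of "x - y" "y - z"] by (simp add: ndist_def diff)
qed

definition banach_on :: "L0 set \<Rightarrow> (L0 \<Rightarrow> real) \<Rightarrow> bool" where
  "banach_on X N \<longleftrightarrow> norm_on X N \<and> Metric_space.mcomplete X (ndist X N)"

text \<open>Below, \<open>\<le>\<close> on complex numbers is the order of \<^theory>\<open>HOL-Library.Complex_Order\<close>,
  in which \<open>0 \<le> z\<close> says that \<open>z\<close> is real and nonnegative.\<close>

definition fatou_property :: "L0 set \<Rightarrow> (L0 \<Rightarrow> real) \<Rightarrow> bool" where
  "fatou_property X N \<longleftrightarrow>
     (\<forall>(F :: nat \<Rightarrow> L0) (f :: L0).
        (\<forall>n. F n \<in> X) \<and>
        (AE x in leb_I. (\<forall>n. 0 \<le> rep_L0 (F n) x) \<and> incseq (\<lambda>n. rep_L0 (F n) x) \<and>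
                        (\<lambda>n. rep_L0 (F n) x) \<longlonglongrightarrow> rep_L0 f x) \<and>
        bdd_above (range (\<lambda>n. N (F n)))
        \<longrightarrow> f \<in> X \<and> (\<lambda>n. N (F n)) \<longlonglongrightarrow> N f)"

definition ri_space :: "L0 set \<Rightarrow> (L0 \<Rightarrow> real) \<Rightarrow> bool" where
  "ri_space X N \<longleftrightarrow> banach_on X N \<and> X \<noteq> {0} \<and>
     (\<forall>g. \<forall>f\<in>X. rearr_le g f \<longrightarrow> g \<in> X \<and> N g \<le> N f) \<and>
     fatou_property X N"


section \<open>Bounded operators and their spectrum\<close>

definition bounded_op_on :: "L0 set \<Rightarrow> (L0 \<Rightarrow> real) \<Rightarrow> (L0 \<Rightarrow> L0) \<Rightarrow> bool" where
  "bounded_op_on X N B \<longleftrightarrow> (\<forall>f\<in>X. B f \<in> X) \<and>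
     (\<forall>f\<in>X. \<forall>g\<in>X. B (f + g) = B f + B g) \<and>
     (\<forall>c. \<forall>f\<in>X. B (scale_L0 c f) = scale_L0 c (B f)) \<and>
     (\<exists>K. \<forall>f\<in>X. N (B f) \<le> K * N f)"

definition opnorm_on :: "L0 set \<Rightarrow> (L0 \<Rightarrow> real) \<Rightarrow> (L0 \<Rightarrow> L0) \<Rightarrow> real" where
  "opnorm_on X N B = (SUP f\<in>{f\<in>X. N f \<le> 1}. N (B f))"

definition shifted :: "(L0 \<Rightarrow> L0) \<Rightarrow> complex \<Rightarrow> L0 \<Rightarrow> L0" where
  "shifted B c f = scale_L0 c f - B f"

definition spectrum_on :: "L0 set \<Rightarrow> (L0 \<Rightarrow> real) \<Rightarrow> (L0 \<Rightarrow> L0) \<Rightarrow> complex set" where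
  "spectrum_on X N B =
     {c. \<not> (\<exists>R. bounded_op_on X N R \<and>
               (\<forall>f\<in>X. R (shifted B c f) = f \<and> shifted B c (R f) = f))}"

definition point_spectrum_on :: "L0 set \<Rightarrow> (L0 \<Rightarrow> L0) \<Rightarrow> complex set" where
  "point_spectrum_on X B = {c. \<exists>f\<in>X. f \<noteq> 0 \<and> B f = scale_L0 c f}"

definition dense_range_on :: "L0 set \<Rightarrow> (L0 \<Rightarrow> real) \<Rightarrow> (L0 \<Rightarrow> L0) \<Rightarrow> bool" where
  "dense_range_on X N B \<longleftrightarrow> ntopology X N closure_of (B ` X) = X"

definition continuous_spectrum_on :: "L0 set \<Rightarrow> (L0 \<Rightarrow> real) \<Rightarrow> (L0 \<Rightarrow> L0) \<Rightarrow> complex set" where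
  "continuous_spectrum_on X N B =
     {c \<in> spectrum_on X N B. inj_on (shifted B c) X \<and> dense_range_on X N (shifted B c)}"

definition residual_spectrum_on :: "L0 set \<Rightarrow> (L0 \<Rightarrow> real) \<Rightarrow> (L0 \<Rightarrow> L0) \<Rightarrow> complex set" where
  "residual_spectrum_on X N B =
     {c \<in> spectrum_on X N B. inj_on (shifted B c) X \<and> \<not> dense_range_on X N (shifted B c)}"


section \<open>Boyd indices\<close>

lemma AE_lebesgue_scale:
  fixes t :: real
  assumes "t \<noteq> 0" and "AE x in lebesgue. P x"
  shows "AE s in lebesgue. P (s * t)"
proof -
  have eq: "lebesgue = density (distr lebesgue lebesgue (\<lambda>x. t * x)) (\<lambda>x. ennreal \<bar>t\<bar>)"
    using lebesgue_real_scale[OF assms(1)] .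
  have "AE x in density (distr lebesgue lebesgue (\<lambda>x. t * x)) (\<lambda>x. ennreal \<bar>t\<bar>). P x"
    using assms(2) by (subst eq[symmetric])
  then have "AE x in distr lebesgue lebesgue (\<lambda>x. t * x). P x"
    using assms(1) by (subst (asm) AE_density) auto
  moreover have "(\<lambda>x. t * x) \<in> lebesgue \<rightarrow>\<^sub>M lebesgue"
    using lebesgue_measurable_scaling[where 'a = real, of t] by (simp add: real_scaleR_def[abs_def])
  ultimately have "AE s in lebesgue. P (t * s)"
    by (rule AE_distrD[rotated])
  then show ?thesis by (simp add: mult.commute)
qed

text \<open>Only meant for \<open>t > 0\<close>; the dilation is set to \<open>0\<close> for other \<open>t\<close>, as for \<open>t = 0\<close>
  the formula does not respect null sets.  The endpoints \<open>s * t = 1\<close> and \<open>s * t = -1\<close>, where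
  an element of \<^typ>\<open>L0\<close> has no values, are left out; this changes the result on a null set only.\<close>

lift_definition dilation :: "real \<Rightarrow> L0 \<Rightarrow> L0" is
  "\<lambda>t f s. if t > 0 \<and> -1 < s * t \<and> s * t < 1 then f (s * t) else 0"
proof -
  fix t :: real and f g :: "real \<Rightarrow> complex"
  assume fg: "ae_eq f g"
  let ?E = "\<lambda>h s. if t > 0 \<and> -1 < s * t \<and> s * t < 1 then h (s * t) else (0 :: complex)"
  have meas: "?E h \<in> borel_measurable leb_I" if "h \<in> borel_measurable leb_I" for h
  proof (cases "t > 0")
    case True
    let ?h = "\<lambda>x. if x \<in> {-1<..<1} then h x else 0"
    have "?h \<in> borel_measurable lebesgue"
      using that by (intro borel_measurable_if_I) auto
    moreover have "(\<lambda>s. t * s) \<in> lebesgue \<rightarrow>\<^sub>M lebesgue"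
      using lebesgue_measurable_scaling[where 'a = real, of t] by (simp add: real_scaleR_def[abs_def])
    ultimately have "(\<lambda>s. ?h (t * s)) \<in> borel_measurable lebesgue"
      by (rule measurable_compose[rotated])
    moreover have "(\<lambda>s. ?h (t * s)) = ?E h"
      using True by (auto simp: fun_eq_iff mult.commute)
    ultimately have "?E h \<in> borel_measurable lebesgue" by simp
    then show ?thesis by (rule measurable_restrict_space1)
  qed simp
  have "AE s in leb_I. ?E f s = ?E g s"
  proof (cases "t > 0")
    case True
    have "AE x in lebesgue. x \<in> {-1<..<1} \<longrightarrow> f x = g x"
      using fg by (simp add: ae_eq_def AE_restrict_space_iff)
    then have "AE s in lebesgue. s * t \<in> {-1<..<1} \<longrightarrow> f (s * t) = g (s * t)"
      using True AE_lebesgue_scale[of t "\<lambda>x. x \<in> {-1<..<1} \<longrightarrow> f x = g x"] by simp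
    then show ?thesis
      by (subst AE_restrict_space_iff) (auto elim: eventually_mono)
  qed simp
  with meas fg show "ae_eq (?E f) (?E g)"
    unfolding ae_eq_def by blast
qed

definition lower_boyd_index :: "L0 set \<Rightarrow> (L0 \<Rightarrow> real) \<Rightarrow> real" where
  "lower_boyd_index X N = (SUP t\<in>{0<..<1}. ln (opnorm_on X N (dilation (1 / t))) / ln t)"

definition upper_boyd_index :: "L0 set \<Rightarrow> (L0 \<Rightarrow> real) \<Rightarrow> real" where
  "upper_boyd_index X N = (INF t\<in>{1<..}. ln (opnorm_on X N (dilation (1 / t))) / ln t)"


section \<open>Lorentz spaces and the associated indices\<close>

definition weak_Lp :: "real \<Rightarrow> L0 set" where
  "weak_Lp p = {f. \<exists>M::real. \<forall>t\<in>{0<..2}. rearr f t \<le> ennreal (M * t powr (- 1 / p))}"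

definition lorentz_p1 :: "real \<Rightarrow> L0 set" where
  "lorentz_p1 p =
     {f. (\<integral>\<^sup>+t\<in>{0<..2}. ennreal (t powr (1 / p - 1)) * rearr f t \<partial>lborel) < \<infinity>}"

lift_definition abs_power :: "real \<Rightarrow> L0" is "\<lambda>a x. complex_of_real (\<bar>x\<bar> powr a)"
proof -
  fix a :: real
  have "(\<lambda>x. complex_of_real (\<bar>x\<bar> powr a)) \<in> borel_measurable lborel" by measurable
  then have "(\<lambda>x. complex_of_real (\<bar>x\<bar> powr a)) \<in> borel_measurable leb_I"
    by (intro measurable_restrict_space1 measurable_completion)
  then show "ae_eq (\<lambda>x. complex_of_real (\<bar>x\<bar> powr a)) (\<lambda>x. complex_of_real (\<bar>x\<bar> powr a))"
    by (simp add: ae_eq_def)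
qed

definition p_index :: "L0 set \<Rightarrow> real" where
  "p_index X = Inf {p. 1 < p \<and> abs_power (- 1 / p) \<in> X}"

definition p_index_attained :: "L0 set \<Rightarrow> bool" where
  "p_index_attained X \<longleftrightarrow> weak_Lp (p_index X) \<subseteq> X"

definition q_index :: "L0 set \<Rightarrow> real" where
  "q_index X = Sup {q. 1 < q \<and> X \<subseteq> lorentz_p1 q}"

definition q_index_attained :: "L0 set \<Rightarrow> bool" where
  "q_index_attained X \<longleftrightarrow> X \<subseteq> lorentz_p1 (q_index X)"


section \<open>The finite Hilbert transform\<close>

definition fht_fun :: "(real \<Rightarrow> complex) \<Rightarrow> real \<Rightarrow> complex" where
  "fht_fun f t = Lim (at_right 0) (\<lambda>\<epsilon>. 1 / (complex_of_real pi * \<i>) *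
     ((LINT x:{-1<..<t-\<epsilon>}|lebesgue. f x / complex_of_real (x - t)) +
      (LINT x:{t+\<epsilon><..<1}|lebesgue. f x / complex_of_real (x - t))))"

text \<open>Meaningful on classes of integrable functions, for which the limit exists almost everywhere
  and is measurable; elsewhere the value is arbitrary.\<close>

definition fht :: "L0 \<Rightarrow> L0" where
  "fht f = abs_L0 (fht_fun (rep_L0 f))"

lemma fht_abs_L0:
  assumes f: "f \<in> borel_measurable leb_I"
  shows "fht (abs_L0 f) = abs_L0 (fht_fun f)"
proof -
  define g where "g = rep_L0 (abs_L0 f)"
  have "ae_eq f f" using f by (simp add: ae_eq_def)
  then have gf: "ae_eq g f"
    unfolding g_def using Quotient3_L0 by (metis Quotient3_rep_abs)
  have ae: "AE x in lebesgue. -1 < x \<and> x < 1 \<longrightarrow> g x = f x"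
    using gf by (simp add: ae_eq_def AE_restrict_space_iff)
  have int: "(LINT x:A|lebesgue. g x / complex_of_real (x - t)) =
             (LINT x:A|lebesgue. f x / complex_of_real (x - t))"
    if A: "A \<in> sets lebesgue" "A \<subseteq> {-1<..<1}" for A t
  proof -
    have meas: "(\<lambda>x. indicator A x *\<^sub>R (h x / complex_of_real (x - t))) \<in> borel_measurable lebesgue"
      if h: "h \<in> borel_measurable leb_I" for h
    proof -
      have "(\<lambda>x. if x \<in> {-1<..<1} then h x else 0) \<in> borel_measurable lebesgue"
        using h by (intro borel_measurable_if_I) auto
      moreover have "(\<lambda>x. complex_of_real (x - t)) \<in> borel_measurable lebesgue"
        by (intro measurable_completion) measurable
      ultimately have "(\<lambda>x. indicator A x *\<^sub>R ((if x \<in> {-1<..<1} then h x else 0) / complex_of_real (x - t)))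
                       \<in> borel_measurable lebesgue"
        using A(1) by (intro borel_measurable_scaleR borel_measurable_divide borel_measurable_indicator)
      moreover have "(\<lambda>x. indicator A x *\<^sub>R ((if x \<in> {-1<..<1} then h x else 0) / complex_of_real (x - t)))
                   = (\<lambda>x. indicator A x *\<^sub>R (h x / complex_of_real (x - t)))"
        using A(2) by (auto simp: fun_eq_iff indicator_def)
      ultimately show ?thesis by simp
    qed
    show ?thesis
      unfolding set_lebesgue_integral_def
    proof (rule integral_cong_AE)
      show "AE x in lebesgue. indicator A x *\<^sub>R (g x / complex_of_real (x - t)) =
                              indicator A x *\<^sub>R (f x / complex_of_real (x - t))"
        using ae by (rule eventually_mono) (use A(2) in \<open>auto simp: indicator_def\<close>)
    qed (rule meas, use gf in \<open>simp add: ae_eq_def\<close>)+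
  qed
  have eq: "fht_fun g t = fht_fun f t" if t: "t \<in> space leb_I" for t
  proof -
    have "\<forall>\<^sub>F \<epsilon> in at_right 0. (0::real) < \<epsilon>"
      by (simp add: eventually_at_right_less)
    then have ev: "\<forall>\<^sub>F \<epsilon> in at_right 0. 1 / (complex_of_real pi * \<i>) *
        ((LINT x:{-1<..<t-\<epsilon>}|lebesgue. g x / complex_of_real (x - t)) +
         (LINT x:{t+\<epsilon><..<1}|lebesgue. g x / complex_of_real (x - t))) =
       1 / (complex_of_real pi * \<i>) *
        ((LINT x:{-1<..<t-\<epsilon>}|lebesgue. f x / complex_of_real (x - t)) +
         (LINT x:{t+\<epsilon><..<1}|lebesgue. f x / complex_of_real (x - t)))"
    proof eventually_elim
      case (elim \<epsilon>)
      have sub: "{-1<..<t-\<epsilon>} \<subseteq> {-1<..<1}" "{t+\<epsilon><..<1} \<subseteq> {-1<..<1}"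
        using t elim by auto
      have "{-1<..<t-\<epsilon>} \<in> sets lebesgue" "{t+\<epsilon><..<1} \<in> sets lebesgue"
        by auto
      then show ?case by (simp only: int sub)
    qed
    show ?thesis
      unfolding fht_fun_def Topological_Spaces.Lim_def
      using tendsto_cong[OF ev] by simp
  qed
  have ae_cong: "ae_eq (fht_fun g) = ae_eq (fht_fun f)"
  proof
    fix h
    have "fht_fun g \<in> borel_measurable leb_I \<longleftrightarrow> fht_fun f \<in> borel_measurable leb_I"
      by (rule measurable_cong) (rule eq)
    moreover have "(AE x in leb_I. fht_fun g x = h x) \<longleftrightarrow> (AE x in leb_I. fht_fun f x = h x)"
      by (rule AE_cong) (simp add: eq)
    ultimately show "ae_eq (fht_fun g) h = ae_eq (fht_fun f) h"
      by (simp add: ae_eq_def)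
  qed
  have quot: "quot_type ae_eq Abs_L0 Rep_L0"
    by (rule quot_type.intro[OF L0_equivp])
       (use Rep_L0 Rep_L0_inverse Abs_L0_inverse Rep_L0_inject in auto)
  show ?thesis
    unfolding fht_def g_def[symmetric]
    unfolding abs_L0_def quot_type.abs_def[OF quot] ae_cong ..
qed

end

theory Submission
 imports Defs "HOL-Complex_Analysis.Complex_Analysis"
begin

text \<open>Let \<open>w = ((1 - x) / (1 + x))\<^sup>a\<close> with \<open>0 \<le> Re a < 1\<close>.  Up to constants \<open>w\<close> and the Hilbert transform of
 \<open>w\<close> are the boundary values of \<open>((z - 1) / (z + 1))\<^sup>a\<close>, so for a suitable \<open>a\<close> the operator \<open>\<mu> - T\<close> maps a
 bounded function onto \<open>1 / (x - z)\<close>, up to an arbitrarily small error, or onto \<open>d / (x - z) + 1\<close>.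
 By the Parseval formula and the uniqueness of Cauchy transforms a solution of \<open>T f = - \<mu> f\<close> vanishes in the
 first case, and is a multiple of one function \<open>v\<close> with \<open>|v| = (1 - x)\<^sup>-\<^sup>r (1 + x)\<^sup>r\<^sup>-\<^sup>1\<close> in the second.  If \<open>v\<close> belongs
 to \<open>X\<close>, so does \<open>|x|\<^sup>-\<^sup>1\<^sup>/\<^sup>2\<close>, and \<open>p\<^sub>X = 2\<close> is attained.  If the range is not dense, then
 integration against \<open>v\<close> is bounded on \<open>X\<close>, and \<open>q\<^sub>X = 2\<close> is attained.\<close>

text \<open>The exponent solves exp (2 pi i a) = (\<mu> + 1) / (\<mu> - 1): the two boundary values
  of ((z - 1) / (z + 1))^a have mean cos (pi a) w and a jump proportional to sin (pi a) w, and for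
  this a all terms in w cancel. Solutions are unique up to integers, so 0 <= Re a < 1 can be
  arranged; none exists for \<mu> = 1 and \<mu> = -1, which are limits of imaginary exponents,
  whence the small error. For Re a = 0 the weight is bounded. For Re a > 0 it is unbounded at -1; a
  factor 1 + x restores boundedness and produces the extra constant 1. The exponents r and 1 - r of
  v add up to 1, so one of them is at least 1/2: this is the origin of the critical index 2. The
  obstacle is the Parseval formula, because a principal value does not admit Fubini. It is proved
  for conjugate Poisson integrals and carried to the boundary. An element of X is only known to lie
  in some L^p, with p > 1 possibly close to 1, so the limit rests on the estimate of M. Riesz; it is
  taken in L^1 with weight 1 / (1 + t^2), which is enough against bounded test functions of compact
  support.\<close>

abbreviation (input) cr :: "real => complex" where
 "cr == complex_of_real"

abbreviation (input) bm :: "'a measure => ('a => 'b::topological_space) set" where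
 "bm == borel_measurable"

abbreviation (input) L1 :: "(real => 'b::{banach, second_countable_topology}) => bool" where
 "L1 == integrable lborel"

abbreviation nnint :: "(real => ennreal) => ennreal" (binder "NN " 60) where
 "nnint f == nn_integral lborel f"

text \<open>The names of the Henstock-Kurzweil integral shadow these facts.\<close>

lemmas integrable_dominated = Bochner_Integration.integrable_bound
lemmas integral_norm_le = Bochner_Integration.integral_norm_bound_integral
lemmas integral_congr = Bochner_Integration.integral_cong
lemmas integral_plus = Bochner_Integration.integral_add
lemmas integrable_plus = Bochner_Integration.integrable_add
lemmas integral_sub = Bochner_Integration.integral_diff
lemmas integrable_sub = Bochner_Integration.integrable_diff

section \<open>Lebesgue points\<close>

text \<open>Truncation of \<open>f\<close> in value and support reduces to bounded functions of
  bounded support. Their measurability supplies continuous functions converging a.e.; projected onto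
  the ball of radius \<open>M\<close> and cut off, these have an integrable majorant, and dominated
  convergence applies.\<close>

lemma integrable_approx_continuous:
 fixes f :: "real => complex"
 assumes f: "L1 f" and e: "e > 0"
 obtains g where "continuous_on UNIV g" "L1 g" "(LBINT x. norm (f x - g x)) < e"
proof -
 define h where "h M x = (if norm (f x) <= real M & \<bar>x\<bar> <= real M then f x else 0)" for M x
 have [measurable]: "f \<in> bm lborel" using f by auto
 have hm [measurable]: "h M \<in> bm lborel" for M
  unfolding h_def by measurable
 have "(%M. \<integral>x. norm (f x - h M x) \<partial>lborel) \<longlonglongrightarrow> (\<integral>x. 0 \<partial>(lborel :: real measure))"
 proof (rule integral_dominated_convergence[where w = "%x. norm (f x)"])
  show "AE x in lborel. (%M. norm (f x - h M x)) \<longlonglongrightarrow> 0"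
  proof (rule AE_I2)
   fix x
   obtain K where K: "norm (f x) <= real K" "\<bar>x\<bar> <= real K"
    by (metis max.bounded_iff real_arch_simple)
   have "\<forall>\<^sub>F M in sequentially. 0 = norm (f x - h M x)"
    unfolding eventually_sequentially
    by (rule exI[of _ K]) (use K in \<open>auto simp: h_def\<close>)
   then show "(%M. norm (f x - h M x)) \<longlonglongrightarrow> 0"
    by (rule Lim_transform_eventually[OF tendsto_const])
  qed
  show "!!i. AE x in lborel. norm (norm (f x - h i x)) <= norm (f x)"
   by (auto simp: h_def)
 qed (use f in auto)
 then have "\<forall>\<^sub>F M in sequentially. (LBINT x. norm (f x - h M x)) < e / 2"
  by (rule order_tendstoD) (use e in auto)
 then obtain M where M: "(LBINT x. norm (f x - h M x)) < e / 2"
  by (auto simp: eventually_sequentially)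
 have hint: "L1 (h M)"
  by (rule integrable_dominated[OF f]) (auto simp: h_def)
 have "h M \<in> bm lebesgue"
  by (simp add: measurable_completion)
 then have "h M measurable_on UNIV"
  by (rule lebesgue_measurable_imp_measurable_on) auto
 then obtain Z g where Z: "negligible Z" and g: "!!n. continuous_on UNIV (g n)"
  and gl: "!!x. x \<notin> Z ==> (%n. g n x) \<longlonglongrightarrow> h M x"
  unfolding measurable_on_def by auto
 \<comment> \<open>\<open>c\<close> is 1 on [-M, M] and vanishes outside [-M - 1, M + 1]. The
   nearest point map is continuous and fixes the values of \<open>h M\<close>, so the modification
   of \<open>g n\<close> does not disturb its limit.\<close>
 define c where "c x = max 0 (min 1 (real M + 1 - \<bar>x\<bar>))" for x :: real
 define k where "k n x = c x *\<^sub>R closest_point (cball 0 (real M)) (g n x)" for n x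
 have ccont: "continuous_on UNIV c" unfolding c_def by (intro continuous_intros)
 have kc: "continuous_on UNIV (k n)" for n
 proof -
  have "continuous_on UNIV (%x. closest_point (cball 0 (real M)) (g n x))"
   using continuous_on_compose[OF g[of n] continuous_on_closest_point[of "cball 0 (real M)" "range (g n)"]]
   by (simp add: o_def)
  then show ?thesis unfolding k_def using ccont by (intro continuous_intros)
 qed
 have km [measurable]: "k n \<in> bm lborel" for n
  using borel_measurable_continuous_onI[OF kc] by simp
 have kb: "norm (k n x) <= real M * indicator {- (real M + 1)..real M + 1} x" for n x
 proof -
  have "closest_point (cball 0 (real M)) (g n x) \<in> cball 0 (real M)"
   by (rule closest_point_in_set) auto
  then have 1: "norm (closest_point (cball 0 (real M)) (g n x)) <= real M" by simp
  have "norm (k n x) = \<bar>c x\<bar> * norm (closest_point (cball 0 (real M)) (g n x))"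
   by (simp add: k_def)
  also have "... <= indicator {- (real M + 1)..real M + 1} x * real M"
   by (rule mult_mono) (use 1 in \<open>auto simp: c_def indicator_def max_def min_def\<close>)
  finally show ?thesis by (simp add: mult.commute)
 qed
 have bint: "L1 (%x. real M * indicator {- (real M + 1)..real M + 1} x)"
  by (intro integrable_mult_right integrable_real_indicator) auto
 have kint: "L1 (k n)" for n
  by (rule integrable_dominated[OF bint]) (use kb in \<open>auto intro!: AE_I2 simp: abs_mult\<close>)
 have "(%n. \<integral>x. norm (h M x - k n x) \<partial>lborel) \<longlonglongrightarrow> (\<integral>x. 0 \<partial>(lborel :: real measure))"
 proof (rule integral_dominated_convergence[where w = "%x. norm (h M x) + real M * indicator {- (real M + 1)..real M + 1} x"])
  have "AE x in lebesgue. x \<notin> Z"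
   using Z AE_not_in negligible_iff_null_sets by blast
  then have ae: "AE x in lborel. x \<notin> Z"
   by (simp add: AE_completion_iff)
  show "AE x in lborel. (%n. norm (h M x - k n x)) \<longlonglongrightarrow> 0"
   using ae
  proof eventually_elim
   case (elim x)
   have hin: "h M x \<in> cball 0 (real M)" by (auto simp: h_def)
   have "continuous_on UNIV (closest_point (cball (0::complex) (real M)))"
    by (rule continuous_on_closest_point) auto
   then have "isCont (closest_point (cball (0::complex) (real M))) (h M x)"
    by (simp add: continuous_on_eq_continuous_at)
   then have "(%n. closest_point (cball 0 (real M)) (g n x)) \<longlonglongrightarrow> closest_point (cball 0 (real M)) (h M x)"
    using gl[OF elim] by (rule isCont_tendsto_compose)
   then have "(%n. k n x) \<longlonglongrightarrow> c x *\<^sub>R h M x"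
    unfolding k_def using hin by (intro tendsto_intros) (simp add: closest_point_self)
   moreover have "c x *\<^sub>R h M x = h M x" by (auto simp: c_def h_def)
   ultimately show ?case
    using tendsto_norm_zero[OF LIM_zero[of "%n. k n x" "h M x"]]
    by (simp add: norm_minus_commute)
  qed
  show "!!i. AE x in lborel. norm (norm (h M x - k i x)) <= norm (h M x) + real M * indicator {- (real M + 1)..real M + 1} x"
  proof (rule AE_I2)
   fix i x
   show "norm (norm (h M x - k i x)) <= norm (h M x) + real M * indicator {- (real M + 1)..real M + 1} x"
    using kb[of i x] norm_triangle_ineq4[of "h M x" "k i x"] by simp
  qed
 qed (use hint bint in auto)
 then have "\<forall>\<^sub>F n in sequentially. (LBINT x. norm (h M x - k n x)) < e / 2"
  by (rule order_tendstoD) (use e in auto)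
 then obtain n where n: "(LBINT x. norm (h M x - k n x)) < e / 2"
  by (auto simp: eventually_sequentially)
 have "(LBINT x. norm (f x - k n x)) <= (LBINT x. norm (f x - h M x) + norm (h M x - k n x))"
 proof (rule integral_mono)
  show "norm (f x - k n x) <= norm (f x - h M x) + norm (h M x - k n x)" for x
   using norm_triangle_ineq[of "f x - h M x" "h M x - k n x"] by simp
 qed (use f hint kint in auto)
 also have "... = (LBINT x. norm (f x - h M x)) + (LBINT x. norm (h M x - k n x))"
  by (rule integral_plus) (use f hint kint in auto)
 also have "... < e" using M n by simp
 finally show ?thesis using that kc kint by blast
qed

text \<open>The weak (1,1) estimate for maximal functions, in a form suited to limits: the radii are
  arbitrarily small, so disjoint balls cover \<open>S\<close> up to a null set, and adding their
  inequalities gives the constant 2 / s, where 2 is the ratio of length to radius. \<open>S\<close>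
  is arbitrary, hence the measurable superset \<open>T\<close>.\<close>

lemma vitali_weak_type:
 fixes g :: "real => ennreal" and s :: real
 assumes [measurable]: "g \<in> bm lborel" and s: "s > 0"
  and S: "!!x d. x \<in> S ==> 0 < d ==> \<exists>r. 0 < r & r < d & ennreal (s * r) <= (\<integral>\<^sup>+y\<in>cball x r. g y \<partial>lborel)"
 shows "\<exists>T. T \<in> sets lebesgue & S \<subseteq> T & emeasure lebesgue T <= ennreal (2 / s) * (NN y. g y)"
proof -
 define K where "K = {(x, r). 0 < r & ennreal (s * r) <= (\<integral>\<^sup>+y\<in>cball x r. g y \<partial>lborel)}"
 have K1: "0 < snd i" if "i \<in> K" for i using that by (auto simp: K_def)
 have K2: "\<exists>i. i \<in> K & x \<in> cball (fst i) (snd i) & snd i < d" if xd: "x \<in> S" "0 < d" for x d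
 proof -
  obtain r where "0 < r" "r < d" "ennreal (s * r) <= (\<integral>\<^sup>+y\<in>cball x r. g y \<partial>lborel)"
   using S[OF xd] by blast
  then show ?thesis by (intro exI[of _ "(x, r)"]) (auto simp: K_def)
 qed
 obtain C where C: "countable C" "C \<subseteq> K"
  and disj: "pairwise (%i j. disjnt (cball (fst i) (snd i)) (cball (fst j) (snd j))) C"
  and neg: "negligible (S - (\<Union>i\<in>C. cball (fst i) (snd i)))"
  by (rule Vitali_covering_theorem_cballs[of K snd S fst, OF K1 K2]) (assumption | rule that)+
 define B where "B i = cball (fst i) (snd i)" for i :: "real \<times> real"
 define U where "U = (\<Union>i\<in>C. B i)"
 define \<nu> where "\<nu> = density lborel g"
 have Bm: "B i \<in> sets borel" for i unfolding B_def by (rule borel_closed) simp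
 have dis: "disjoint_family_on B C"
  using disj by (auto simp: disjoint_family_on_def pairwise_def disjnt_def B_def)
 have [measurable]: "U \<in> sets borel" unfolding U_def B_def
  by (intro sets.countable_UN'' C) auto
 have Bs: "ennreal (s * snd i) <= emeasure \<nu> (B i)" if "i \<in> C" for i
  using that C(2) unfolding \<nu>_def K_def B_def by (auto simp: emeasure_density)
 have Be: "emeasure lborel (B i) <= ennreal (2 / s) * emeasure \<nu> (B i)" if "i \<in> C" for i
 proof -
  have r: "0 < snd i" using that C(2) by (auto simp: K_def)
  have "emeasure lborel (B i) = ennreal (2 * snd i)"
   using r by (simp add: B_def cball_eq_atLeastAtMost)
  also have "... = ennreal (2 / s) * ennreal (s * snd i)"
   using s r by (simp flip: ennreal_mult)
  also have "... <= ennreal (2 / s) * emeasure \<nu> (B i)"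
   using Bs[OF that] by (rule mult_left_mono) simp
  finally show ?thesis .
 qed
 have "emeasure lborel U = (\<integral>\<^sup>+i. emeasure lborel (B i) \<partial>count_space C)"
  unfolding U_def by (rule emeasure_UN_countable) (use C dis Bm in auto)
 also have "... <= (\<integral>\<^sup>+i. ennreal (2 / s) * emeasure \<nu> (B i) \<partial>count_space C)"
  by (rule nn_integral_mono) (use Be in auto)
 also have "... = ennreal (2 / s) * (\<integral>\<^sup>+i. emeasure \<nu> (B i) \<partial>count_space C)"
  by (rule nn_integral_cmult) auto
 also have "(\<integral>\<^sup>+i. emeasure \<nu> (B i) \<partial>count_space C) = emeasure \<nu> U"
  unfolding U_def by (rule emeasure_UN_countable[symmetric]) (use C dis Bm in \<open>auto simp: \<nu>_def\<close>)
 also have "emeasure \<nu> U <= emeasure \<nu> UNIV"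
  by (rule emeasure_mono) (auto simp: \<nu>_def)
 also have "... = (NN y. g y)"
  unfolding \<nu>_def by (simp add: emeasure_density)
 finally have U: "emeasure lborel U <= ennreal (2 / s) * (NN y. g y)"
  by (simp add: mult_left_mono)
 have N: "S - U \<in> null_sets lebesgue"
  using neg unfolding U_def B_def by (simp add: negligible_iff_null_sets)
 have Us: "U \<in> sets lebesgue" by auto
 have "emeasure lebesgue (U \<union> (S - U)) = emeasure lebesgue U"
  by (rule emeasure_Un_null_set[OF Us N])
 also have "... = emeasure lborel U" by simp
 finally show ?thesis
  using U N Us by (intro exI[of _ "U \<union> (S - U)"] conjI sets.Un) (auto simp del: Un_Diff_cancel)
qed

text \<open>The extended nonnegative integral gives a meaning to this for integrable and merely
  locally integrable \<open>f\<close> alike. The radius \<open>r\<close> stands for the length 2 r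
  of the ball, a factor absorbed by \<open>e\<close>.\<close>

definition lebesgue_point :: "(real => complex) => real => bool" where
 "lebesgue_point f t \<longleftrightarrow> (\<forall>e>0. \<exists>d>0. \<forall>r. 0 < r & r < d -->
   (\<integral>\<^sup>+x\<in>cball t r. ennreal (norm (f x - f t)) \<partial>lborel) <= ennreal (e * r))"

lemma nn_integral_cball_const:
 fixes t :: real
 shows "0 <= c ==> 0 < r ==> (\<integral>\<^sup>+x\<in>cball t r. ennreal c \<partial>lborel) = ennreal (2 * c * r)"
 using emeasure_lborel_Icc[of "t - r" "t + r"] ennreal_mult[of c "2 * r"]
 by (simp add: nn_integral_cmult_indicator cball_eq_atLeastAtMost mult_ac)

text \<open>Subtract a continuous \<open>g\<close> close to \<open>f\<close> in L1. At a bad point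
  either the averages of |f - g| are large at small scales, which the weak estimate controls, or |f
  - g| itself is large, which Markov's inequality controls.\<close>

theorem AE_lebesgue_point:
 fixes f :: "real => complex"
 assumes f: "L1 f"
 shows "AE t in lborel. lebesgue_point f t"
proof -
 have [measurable]: "f \<in> bm lborel" using f by auto
 have [measurable]: "cball (t::real) r \<in> sets borel" for t r by (rule borel_closed) simp
 define S where "S e = {t. \<forall>d>0. \<exists>r. 0 < r & r < d \<and>
   ennreal (e * r) < (\<integral>\<^sup>+x\<in>cball t r. ennreal (norm (f x - f t)) \<partial>lborel)}" for e :: real
 have neg: "negligible (S e)" if e: "e > 0" for e
 proof (rule negligible_outer_le[THEN iffD2], intro allI impI)
  fix \<eta> :: real assume \<eta>: "\<eta> > 0"
  \<comment> \<open>Each of the two exceptional sets below has measure at most (8 / e) D, with D the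
    L1 distance; the bound \<eta> e / 16 makes the sum at most \<eta>. The thresholds e / 4 and e /
    8 add up to 3 e r / 4 over a ball of radius r.\<close>
  obtain g where gc: "continuous_on UNIV g" and gi: "L1 g"
   and fg: "(LBINT x. norm (f x - g x)) < \<eta> * e / 16"
   using integrable_approx_continuous[OF f, of "\<eta> * e / 16"] \<eta> e by auto
  have [measurable]: "g \<in> bm lborel" using gi by auto
  define D where "D = (LBINT x. norm (f x - g x))"
  have Dn: "(NN x. ennreal (norm (f x - g x))) = ennreal D"
   unfolding D_def by (rule nn_integral_eq_integral) (use f gi in auto)
  have D0: "D >= 0" unfolding D_def by auto
  define S' where "S' = {t. \<forall>d>0. \<exists>r. 0 < r & r < d \<and>
   ennreal (e / 4 * r) <= (\<integral>\<^sup>+x\<in>cball t r. ennreal (norm (f x - g x)) \<partial>lborel)}"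
  obtain T where T: "T \<in> sets lebesgue" "S' \<subseteq> T"
    "emeasure lebesgue T <= ennreal (2 / (e / 4)) * (NN y. ennreal (norm (f y - g y)))"
   using vitali_weak_type[of "%x. ennreal (norm (f x - g x))" "e / 4" S'] e
   unfolding S'_def by auto
  define V where "V = {x. ennreal (e / 8) <= ennreal (norm (f x - g x))}"
  have [measurable]: "V \<in> sets borel" unfolding V_def by measurable
  have "emeasure lborel V <= ennreal (8 / e) * (NN x. ennreal (norm (f x - g x)) * indicator UNIV x)"
  proof -
   have "V = {x \<in> UNIV. 1 <= ennreal (8 / e) * ennreal (norm (f x - g x))}"
    unfolding V_def using e
    by (simp add: ennreal_mult'[symmetric] divide_simps mult.commute del: ennreal_1 flip: ennreal_1)
   then show ?thesis
    using nn_integral_Markov_inequality[of "%x. ennreal (norm (f x - g x))" UNIV lborel "ennreal (8/e)"]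
    by simp
  qed
  then have V: "emeasure lebesgue V <= ennreal (8 / e) * ennreal D"
   using Dn by simp
  have sub: "S e \<subseteq> T \<union> V"
  proof
   fix t assume t: "t \<in> S e"
   show "t \<in> T \<union> V"
   proof (rule ccontr)
    assume n: "t \<notin> T \<union> V"
    then have "t \<notin> S'" using T(2) by auto
    then obtain d where d: "d > 0" "!!r. 0 < r ==> r < d ==>
      (\<integral>\<^sup>+x\<in>cball t r. ennreal (norm (f x - g x)) \<partial>lborel) < ennreal (e / 4 * r)"
     unfolding S'_def by (auto simp: not_le)
    have ft: "norm (f t - g t) < e / 8" using n e unfolding V_def by (auto simp: not_le ennreal_less_iff)
    have "isCont g t" using gc by (simp add: continuous_on_eq_continuous_at)
    then obtain d' where d': "d' > 0" "!!x. dist x t < d' ==> dist (g x) (g t) < e / 8"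
    proof -
     have "e / 8 > 0" using e by simp
     from this \<open>isCont g t\<close> have "\<exists>d'>0. \<forall>x. dist x t < d' --> dist (g x) (g t) < e / 8"
      unfolding continuous_at_eps_delta dist_norm by blast
     then show ?thesis using that by blast
    qed
    obtain r where r: "0 < r" "r < min d d'"
      "ennreal (e * r) < (\<integral>\<^sup>+x\<in>cball t r. ennreal (norm (f x - f t)) \<partial>lborel)"
     proof -
     have "0 < min d d'" using d(1) d'(1) by simp
     then show ?thesis using t that unfolding S_def by blast
    qed
    have "(\<integral>\<^sup>+x\<in>cball t r. ennreal (norm (f x - f t)) \<partial>lborel)
      <= (NN x. (ennreal (norm (f x - g x)) * indicator (cball t r) x + ennreal (e/4) * indicator (cball t r) x))"
    proof (rule nn_integral_mono)
     fix x
     show "ennreal (norm (f x - f t)) * indicator (cball t r) x <= ennreal (norm (f x - g x)) * indicator (cball t r) x + ennreal (e/4) * indicator (cball t r) x"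
     proof (cases "x \<in> cball t r")
      case True
      then have "dist x t < d'" using r by (auto simp: dist_commute)
      then have "norm (g x - g t) < e / 8" using d'(2) by (simp add: dist_norm)
      then have "norm (f x - f t) <= norm (f x - g x) + e / 4"
       using ft norm_triangle_ineq[of "f x - g x" "g x - g t"] norm_triangle_ineq[of "f x - g t" "g t - f t"]
       by (simp add: norm_minus_commute)
      then show ?thesis using True e by (simp flip: ennreal_plus)
     qed simp
    qed
    also have "... = (\<integral>\<^sup>+x\<in>cball t r. ennreal (norm (f x - g x)) \<partial>lborel) + (\<integral>\<^sup>+x\<in>cball t r. ennreal (e/4) \<partial>lborel)"
     by (rule nn_integral_add) auto
    also have "... <= ennreal (e / 4 * r) + ennreal (2 * (e/4) * r)"
     using d(2)[of r] r e by (intro add_mono) (auto simp: nn_integral_cball_const)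
    also have "... <= ennreal (e * r)"
     using r e by (simp flip: ennreal_plus)
    finally show False using r(3) by simp
   qed
  qed
  have "emeasure lebesgue (T \<union> V) <= emeasure lebesgue T + emeasure lebesgue V"
   by (rule emeasure_subadditive) (use T in auto)
  also have "... <= ennreal (8 / e) * ennreal D + ennreal (8 / e) * ennreal D"
   using T(3) V Dn by (intro add_mono) (auto simp: field_simps)
  also have "... = ennreal (16 / e * D)"
   using e D0 by (simp flip: ennreal_mult ennreal_plus)
  also have "... <= ennreal \<eta>"
   using fg e unfolding D_def[symmetric] by (intro ennreal_leI) (simp add: field_simps)
  finally have em: "emeasure lebesgue (T \<union> V) <= ennreal \<eta>" .
  have ms: "T \<union> V \<in> sets lebesgue" using T by auto
  have "T \<union> V \<in> lmeasurable"
   using ms le_less_trans[OF em ennreal_less_top] by (simp add: fmeasurable_def)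
  moreover have "measure lebesgue (T \<union> V) <= \<eta>"
   using em \<eta> by (simp add: measure_def enn2real_leI)
  ultimately show "\<exists>T. S e \<subseteq> T & T \<in> lmeasurable & measure lebesgue T <= \<eta>"
   using sub by blast
 qed
 have "\<forall>n::nat. AE t in lebesgue. t \<notin> S (1 / real (Suc n))"
  using neg by (auto simp: negligible_iff_null_sets intro!: AE_not_in)
 then have "AE t in lebesgue. \<forall>n::nat. t \<notin> S (1 / real (Suc n))"
  by (simp add: AE_all_countable)
 then have "AE t in lebesgue. lebesgue_point f t"
 proof eventually_elim
  case (elim t)
  show ?case unfolding lebesgue_point_def
  proof (intro allI impI)
   fix e :: real assume "e > 0"
   then obtain n where n: "1 / real (Suc n) < e" by (meson nat_approx_posE)
   from elim obtain d where "d > 0" and d: "!!r. 0 < r ==> r < d ==> (\<integral>\<^sup>+x\<in>cball t r. ennreal (norm (f x - f t)) \<partial>lborel) <= ennreal (1 / real (Suc n) * r)"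
    unfolding S_def mem_Collect_eq not_all not_ex not_imp de_Morgan_conj not_less by (meson linorder_not_less)
   have "ennreal (1 / real (Suc n) * r) <= ennreal (e * r)" if "r > 0" for r
    using n that by (intro ennreal_leI mult_right_mono) auto
   then show "\<exists>d>0. \<forall>r. 0 < r & r < d --> (\<integral>\<^sup>+x\<in>cball t r. ennreal (norm (f x - f t)) \<partial>lborel) <= ennreal (e * r)"
    using d \<open>d > 0\<close> by (meson order_trans)
  qed
 qed
 then show ?thesis by (simp add: AE_completion_iff)
qed

section \<open>The Poisson kernel at Lebesgue points\<close>

lemma poisson_dyadic_bound:
 fixes s y :: real
 assumes y: "y > 0"
 shows "ennreal (y / (s^2 + y^2)) <= (\<Sum>j. ennreal (4 * (1/4)^j / y) * indicator {- (2^j * y)..2^j * y} s)"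
proof -
 have "\<exists>j. \<bar>s\<bar> <= 2^j * y"
 proof -
  obtain j :: nat where "\<bar>s\<bar> / y < 2 ^ j" using real_arch_pow[of 2 "\<bar>s\<bar> / y"] by auto
  then have "\<bar>s\<bar> <= 2^j * y" using y by (simp add: field_simps)
  then show ?thesis ..
 qed
 \<comment> \<open>For the least \<open>j\<close> the point lies outside the preceding interval, so
   the kernel is at most 4^(1 - j) / y (and at most 1 / y if j = 0); this single term of the series
   suffices.\<close>
 then obtain j where j: "\<bar>s\<bar> <= 2^j * y" "!!i. i < j ==> \<not> \<bar>s\<bar> <= 2^i * y"
  using exists_least_iff[of "%j. \<bar>s\<bar> <= 2^j * y"] by blast
 have "y / (s^2 + y^2) <= 4 * (1/4)^j / y"
 proof (cases j)
  case 0
  have "y / (s^2 + y^2) <= y / y^2"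
   using y by (intro divide_left_mono) (auto simp: add_nonneg_pos)
  also have "... = 1 / y" using y by (simp add: power2_eq_square)
  finally show ?thesis using 0 y by (simp add: field_simps)
 next
  case (Suc i)
  then have "2^i * y < \<bar>s\<bar>" using j(2)[of i] by auto
  then have "(2^i * y)^2 < \<bar>s\<bar>^2" using y by (intro power_strict_mono) auto
  moreover have "(2^i * y)^2 = 4^i * y^2"
   by (simp add: power_mult_distrib power2_eq_square flip: power_mult_distrib)
  ultimately have s: "4^i * y^2 < s^2" by simp
  have "y / (s^2 + y^2) <= y / (4^i * y^2)"
  proof (rule divide_left_mono)
   show "4 ^ i * y^2 <= s^2 + y^2" using s zero_le_power2[of y] by linarith
  qed (use y in \<open>auto simp: add_nonneg_pos\<close>)
  also have "... = 4 * (1/4)^j / y" using y Suc by (simp add: power2_eq_square power_divide)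
  finally show ?thesis .
 qed
 then have "ennreal (y / (s^2 + y^2)) <= ennreal (4 * (1/4)^j / y) * indicator {- (2^j * y)..2^j * y} s"
  using j(1) by (auto simp: ennreal_leI abs_le_iff)
 also have "... <= (\<Sum>j. ennreal (4 * (1/4)^j / y) * indicator {- (2^j * y)..2^j * y} s)"
 proof -
  have "F j <= suminf F" for F :: "nat => ennreal"
   using sum_le_suminf[of F "{j}"] by simp
  then show ?thesis .
 qed
 finally show ?thesis .
qed

text \<open>Integrate the dyadic majorant: the interval of radius 2^j y contributes at most (4 4^-j
  / y) (e 2^j y) = 4 e 2^-j, and these terms sum to 8 e. The minimum with \<open>d\<close> keeps
  every radius within the range of the hypothesis.\<close>

lemma poisson_local_bound:
 fixes g :: "real => ennreal"
 assumes [measurable]: "g \<in> bm lborel" and y: "y > 0" and e: "e >= 0" and d: "d > 0"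
  and g: "!!r. 0 < r ==> r <= d ==> (\<integral>\<^sup>+x\<in>cball t r. g x \<partial>lborel) <= ennreal (e * r)"
 shows "(\<integral>\<^sup>+x\<in>cball t d. ennreal (y / ((x - t)^2 + y^2)) * g x \<partial>lborel) <= ennreal (8 * e)"
proof -
 have [measurable]: "cball t r \<in> sets borel" for r by (rule borel_closed) simp
 have "(\<integral>\<^sup>+x\<in>cball t d. ennreal (y / ((x - t)^2 + y^2)) * g x \<partial>lborel)
   <= (NN x. (\<Sum>j. ennreal (4 * (1/4)^j / y) * (g x * indicator (cball t (min d (2^j * y))) x)))"
 proof (rule nn_integral_mono)
  fix x
  have "ennreal (y / ((x - t)^2 + y^2)) * g x * indicator (cball t d) x
    <= (\<Sum>j. ennreal (4 * (1/4)^j / y) * indicator {- (2^j * y)..2^j * y} (x - t)) * (g x * indicator (cball t d) x)"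
   using mult_right_mono[OF poisson_dyadic_bound[OF y, of "x - t"], of "g x * indicator (cball t d) x"]
   by (simp add: mult.assoc)
  also have "... = (\<Sum>j. ennreal (4 * (1/4)^j / y) * indicator {- (2^j * y)..2^j * y} (x - t) * (g x * indicator (cball t d) x))"
   by simp
  also have "... = (\<Sum>j. ennreal (4 * (1/4)^j / y) * (g x * indicator (cball t (min d (2^j * y))) x))"
   by (intro suminf_cong) (auto simp: indicator_def dist_real_def abs_le_iff)
  finally show "ennreal (y / ((x - t)^2 + y^2)) * g x * indicator (cball t d) x <= ..." .
 qed
 also have "... = (\<Sum>j. \<integral>\<^sup>+x. ennreal (4 * (1/4)^j / y) * (g x * indicator (cball t (min d (2^j * y))) x) \<partial>lborel)"
 proof (rule nn_integral_suminf)
  fix j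
  show "(%x. ennreal (4 * (1/4)^j / y) * (g x * indicator (cball t (min d (2^j * y))) x)) \<in> bm lborel"
   by measurable
 qed
 also have "... <= (\<Sum>j. ennreal (4 * e * (1/2)^j))"
 proof (intro suminf_le allI)
  fix j
  have "(NN x. ennreal (4 * (1/4)^j / y) * (g x * indicator (cball t (min d (2^j * y))) x))
    = ennreal (4 * (1/4)^j / y) * (\<integral>\<^sup>+x\<in>cball t (min d (2^j * y)). g x \<partial>lborel)"
   by (rule nn_integral_cmult) auto
  also have "... <= ennreal (4 * (1/4)^j / y) * ennreal (e * min d (2^j * y))"
   using g[of "min d (2^j * y)"] d y by (intro mult_left_mono) auto
  also have "... <= ennreal (4 * (1/4)^j / y) * ennreal (e * (2^j * y))"
   using e by (intro mult_left_mono ennreal_leI) auto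
  also have "... = ennreal (4 * e * (1/2)^j)"
   using y e by (subst ennreal_mult[symmetric]) (auto simp: power_divide power_mult_distrib[symmetric] field_simps simp flip: power_mult_distrib)
  finally show "(NN x. ennreal (4 * (1/4)^j / y) * (g x * indicator (cball t (min d (2^j * y))) x)) <= ennreal (4 * e * (1/2)^j)" .
 qed auto
 also have "... = ennreal (8 * e)"
 proof (rule suminf_ennreal_eq)
  have "(%j. 4 * e * (1/2)^j) sums (4 * e * (1 / (1 - 1/2)))"
   by (intro sums_mult geometric_sums) auto
  then show "(%j. 4 * e * (1/2)^j) sums (8 * e)" by simp
 qed (use e in auto)
 finally show ?thesis .
qed

text \<open>The part near \<open>t\<close> is small uniformly in \<open>y\<close> by the dyadic
  estimate, and the tail is O(y) because of the weighted integrability.\<close>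

lemma poisson_kernel_limit:
 fixes g :: "real => ennreal"
 assumes [measurable]: "g \<in> bm lborel"
  and fin: "(NN x. g x * ennreal (1 / (1 + x^2))) < \<infinity>"
  and lp: "!!e. e > 0 ==> \<exists>d>0. \<forall>r. 0 < r & r < d --> (\<integral>\<^sup>+x\<in>cball t r. g x \<partial>lborel) <= ennreal (e * r)"
 shows "((%y. \<integral>\<^sup>+x. ennreal (y / ((x - t)^2 + y^2)) * g x \<partial>lborel) \<longlongrightarrow> 0) (at_right 0)"
proof (rule order_tendstoI)
 have [measurable]: "cball t r \<in> sets borel" for r by (rule borel_closed) simp
 fix a :: ennreal assume a: "0 < a"
 obtain e where e: "e > 0" "ennreal (9 * e) < a"
 proof -
  obtain b where b: "0 < b" "b < a" using dense[OF a] by blast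
  then obtain c where c: "b = ennreal c" "0 <= c" by (metis ennreal_cases less_top not_less_iff_gr_or_eq order.strict_trans2 top_greatest)
  with b show ?thesis by (intro that[of "c / 9"]) (auto simp: ennreal_less_iff)
 qed
 obtain d0 where d0: "d0 > 0" "!!r. 0 < r ==> r < d0 ==> (\<integral>\<^sup>+x\<in>cball t r. g x \<partial>lborel) <= ennreal (e * r)"
  using lp[OF e(1)] by blast
 define d where "d = d0 / 2"
 have d: "d > 0" "!!r. 0 < r ==> r <= d ==> (\<integral>\<^sup>+x\<in>cball t r. g x \<partial>lborel) <= ennreal (e * r)"
  using d0 by (auto simp: d_def)
 define A where "A = enn2real (NN x. g x * ennreal (1 / (1 + x^2)))"
 have A: "(NN x. g x * ennreal (1 / (1 + x^2))) = ennreal A" "A >= 0"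
  using fin by (auto simp: A_def)
 \<comment> \<open>Chosen so that 1 + x^2 <= B (x - t)^2 outside the ball, from 1 + x^2 <= 1 + 2 t^2
   + 2 (x - t)^2 and (x - t)^2 > d^2.\<close>
 define B where "B = (1 + 2 * t^2) / d^2 + 2"
 have B: "B >= 0" unfolding B_def by (auto intro!: add_nonneg_nonneg divide_nonneg_nonneg)
 have tail: "(\<integral>\<^sup>+x\<in>-cball t d. ennreal (y / ((x - t)^2 + y^2)) * g x \<partial>lborel) <= ennreal (y * B * A)" if y: "y > 0" for y
 proof -
  have "(\<integral>\<^sup>+x\<in>-cball t d. ennreal (y / ((x - t)^2 + y^2)) * g x \<partial>lborel)
    <= (NN x. ennreal (y * B) * (g x * ennreal (1 / (1 + x^2))))"
  proof (rule nn_integral_mono)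
   fix x
   show "ennreal (y / ((x - t)^2 + y^2)) * g x * indicator (-cball t d) x <= ennreal (y * B) * (g x * ennreal (1 / (1 + x^2)))"
   proof (cases "x \<in> cball t d")
    case False
    then have xt: "\<bar>x - t\<bar> > d" by (auto simp: dist_real_def)
    then have sq: "(x - t)^2 > d^2" using d(1) by (metis abs_of_pos abs_le_square_iff not_le power2_abs)
    have "0 <= (x - 2 * t)^2" by simp
    then have "1 + x^2 <= 1 + 2 * t^2 + 2 * (x - t)^2"
     by (simp add: power2_eq_square algebra_simps)
    also have "... <= (1 + 2 * t^2) / d^2 * (x - t)^2 + 2 * (x - t)^2"
    proof -
     have "(1 + 2 * t^2) / d^2 * d^2 <= (1 + 2 * t^2) / d^2 * (x - t)^2"
      using sq by (intro mult_left_mono) auto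
     then show ?thesis using d(1) by simp
    qed
    also have "... = B * (x - t)^2" by (simp add: B_def algebra_simps)
    finally have 1: "1 + x^2 <= B * (x - t)^2" .
    have p: "0 < (x - t)^2" using sq by (meson le_less_trans zero_le_power2)
    have "y / ((x - t)^2 + y^2) <= y / (x - t)^2"
     using y p by (intro divide_left_mono mult_pos_pos add_pos_nonneg) auto
    also have "... <= y * (B / (1 + x^2))"
    proof -
     have "1 / (x - t)^2 <= B / (1 + x^2)"
      using 1 p mult_right_mono[OF 1, of "1 / ((x - t)^2 * (1 + x^2))"] by (simp add: field_simps add_pos_nonneg)
     then show ?thesis using y mult_left_mono[of "1 / (x-t)^2" "B / (1 + x^2)" y] by simp
    qed
    finally have "ennreal (y / ((x - t)^2 + y^2)) <= ennreal (y * B) * ennreal (1 / (1 + x^2))"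
     using y B by (simp add: ennreal_leI flip: ennreal_mult)
    from mult_right_mono[OF this, of "g x"] show ?thesis using False
     by (simp add: mult_ac)
   qed simp
  qed
  also have "... = ennreal (y * B) * ennreal A"
   unfolding A(1)[symmetric] by (rule nn_integral_cmult) auto
  finally show ?thesis using y B A by (simp add: ennreal_mult)
 qed
 have bd: "(NN x. ennreal (y / ((x - t)^2 + y^2)) * g x) <= ennreal (8 * e + y * B * A)" if y: "y > 0" for y
 proof -
  have "(NN x. ennreal (y / ((x - t)^2 + y^2)) * g x)
   = (NN x. (ennreal (y / ((x - t)^2 + y^2)) * g x * indicator (cball t d) x + ennreal (y / ((x - t)^2 + y^2)) * g x * indicator (-cball t d) x))"
   by (rule nn_integral_cong) (auto simp: indicator_def)
  also have "... = (\<integral>\<^sup>+x\<in>cball t d. ennreal (y / ((x - t)^2 + y^2)) * g x \<partial>lborel) + (\<integral>\<^sup>+x\<in>-cball t d. ennreal (y / ((x - t)^2 + y^2)) * g x \<partial>lborel)"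
   by (rule nn_integral_add) auto
  also have "... <= ennreal (8 * e) + ennreal (y * B * A)"
   using poisson_local_bound[of g y e d t] tail y d e by (intro add_mono) auto
  also have "... = ennreal (8 * e + y * B * A)"
   using e y A B by (simp add: ennreal_plus)
  finally show ?thesis .
 qed
 have "((%y. 8 * e + y * B * A) \<longlongrightarrow> 8 * e + 0 * B * A) (at_right 0)"
  by (intro tendsto_intros)
 then have "\<forall>\<^sub>F y in at_right 0. 8 * e + y * B * A < 9 * e"
  by (rule order_tendstoD) (use e in auto)
 moreover have "\<forall>\<^sub>F y in at_right (0::real). 0 < y" by (simp add: eventually_at_right_less)
 ultimately show "\<forall>\<^sub>F y in at_right 0. (NN x. ennreal (y / ((x - t)^2 + y^2)) * g x) < a"
 proof eventually_elim
  case (elim y)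
  have "(NN x. ennreal (y / ((x - t)^2 + y^2)) * g x) <= ennreal (8 * e + y * B * A)"
   using bd elim by blast
  also have "... <= ennreal (9 * e)" using elim by (intro ennreal_leI) auto
  finally show ?case using e by simp
 qed
qed simp

section \<open>Cauchy transforms and Poisson integrals\<close>

definition cauchyT :: "(real => complex) => complex => complex" where
 "cauchyT f z = (LBINT x. f x / (cr x - z))"

definition poisson :: "(real => complex) => real => real => complex" where
 "poisson f y t = (LBINT x. (y / ((x - t)^2 + y^2)) *\<^sub>R f x) / of_real pi"

lemma norm_cauchy_denom: "\<bar>Im z\<bar> <= norm (cr x - z)"
 using abs_Im_le_cmod[of "cr x - z"] by simp

lemma cauchy_denom_nz: "Im z ~= 0 ==> cr x - z ~= 0"
 by (metis Im_complex_of_real right_minus_eq)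

lemma norm_cauchy_integrand:
 assumes "Im z ~= 0"
 shows "norm (c / (cr x - z)) <= norm c / \<bar>Im z\<bar>"
 using norm_cauchy_denom[of z x] assms by (simp add: norm_divide frac_le)

lemma cauchy_integrable:
 assumes f: "L1 f" and z: "Im z ~= 0"
 shows "L1 (%x. f x / (cr x - z))"
proof (rule integrable_dominated)
 have [measurable]: "f \<in> bm lborel" using f by auto
 show "L1 (%x. norm (f x) / \<bar>Im z\<bar>)" using f by simp
 show "(%x. f x / (cr x - z)) \<in> bm lborel" by measurable
 show "AE x in lborel. norm (f x / (cr x - z)) <= norm (norm (f x) / \<bar>Im z\<bar>)"
  using norm_cauchy_integrand[OF z] by simp
qed

lemma cauchyT_bound:
 assumes f: "L1 f" and z: "Im z ~= 0"
 shows "norm (cauchyT f z) <= (LBINT x. norm (f x)) / \<bar>Im z\<bar>"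
proof -
 have "norm (cauchyT f z) <= (LBINT x. norm (f x / (cr x - z)))"
  unfolding cauchyT_def by (rule integral_norm_bound)
 also have "... <= (LBINT x. norm (f x) / \<bar>Im z\<bar>)"
  by (rule integral_mono) (use f cauchy_integrable[OF f z] norm_cauchy_integrand[OF z] in auto)
 finally show ?thesis by simp
qed

lemma cauchyT_add:
 assumes "L1 f" "L1 g" "Im z ~= 0"
 shows "cauchyT (%x. f x + g x) z = cauchyT f z + cauchyT g z"
 unfolding cauchyT_def
 using integral_plus[OF cauchy_integrable[OF assms(1,3)] cauchy_integrable[OF assms(2,3)]]
 by (simp add: add_divide_distrib)

lemma cauchyT_diff:
 assumes "L1 f" "L1 g" "Im z ~= 0"
 shows "cauchyT (%x. f x - g x) z = cauchyT f z - cauchyT g z"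
 unfolding cauchyT_def
 using integral_sub[OF cauchy_integrable[OF assms(1,3)] cauchy_integrable[OF assms(2,3)]]
 by (simp add: diff_divide_distrib)

lemma cauchyT_cmult: "cauchyT (%x. c * f x) z = c * cauchyT f z"
 unfolding cauchyT_def
 using integral_mult_right_zero[of lborel c "%x. f x / (cr x - z)"] by simp

lemma cauchyT_cnj: "cauchyT (%x. cnj (f x)) z = cnj (cauchyT f (cnj z))"
proof -
 have "(LBINT x. cnj (f x / (cr x - cnj z))) = cnj (LBINT x. f x / (cr x - cnj z))"
  by (rule Bochner_Integration.integral_cnj)
 then show ?thesis unfolding cauchyT_def by simp
qed

lemma cauchyT_has_field_derivative:
 assumes f: "L1 f" and z0: "Im z0 ~= 0"
 shows "(cauchyT f has_field_derivative (LBINT x. f x / (cr x - z0)^2)) (at z0)"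
proof -
 have [measurable]: "f \<in> bm lborel" using f by auto
 define y where "y = \<bar>Im z0\<bar>"
 have y: "y > 0" using z0 by (simp add: y_def)
 define D where "D = (LBINT x. f x / (cr x - z0)^2)"
 define A where "A = (LBINT x. norm (f x))"
 have A: "A >= 0" unfolding A_def by simp
 have d0: "norm (cr x - z0) >= y" for x using norm_cauchy_denom[of z0 x] by (simp add: y_def)
 have Di: "L1 (%x. f x / (cr x - z0)^2)"
 proof (rule integrable_dominated)
  show "L1 (%x. norm (f x) / y^2)" using f by simp
  show "AE x in lborel. norm (f x / (cr x - z0)^2) <= norm (norm (f x) / y^2)"
  proof (rule AE_I2)
   fix x
   have "y^2 <= (norm (cr x - z0))^2" using d0[of x] y by (intro power_mono) auto
   then show "norm (f x / (cr x - z0)^2) <= norm (norm (f x) / y^2)"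
    using y by (simp add: norm_divide norm_power frac_le)
  qed
 qed measurable
 have main: "norm ((cauchyT f z - cauchyT f z0) / (z - z0) - D) <= norm (z - z0) * (A * (2 / y ^ 3))"
  if z: "z ~= z0" "norm (z - z0) < y / 2" for z
 proof -
  have imz: "\<bar>Im z\<bar> >= y / 2"
   using z(2) abs_Im_le_cmod[of "z - z0"] unfolding y_def by simp
  then have iz: "Im z ~= 0" using y by auto
  have eq: "(cauchyT f z - cauchyT f z0) / (z - z0) - D = (LBINT x. (z - z0) * (f x / ((cr x - z) * (cr x - z0)^2)))"
  proof -
   have "(cauchyT f z - cauchyT f z0) / (z - z0) - D = (LBINT x. (f x / (cr x - z) - f x / (cr x - z0)) / (z - z0) - f x / (cr x - z0)^2)"
    unfolding cauchyT_def D_def using cauchy_integrable[OF f iz] cauchy_integrable[OF f z0] Di by simp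
   also have "... = (LBINT x. (z - z0) * (f x / ((cr x - z) * (cr x - z0)^2)))"
   proof (rule integral_congr[OF refl])
    fix x
    show "(f x / (cr x - z) - f x / (cr x - z0)) / (z - z0) - f x / (cr x - z0)^2 = (z - z0) * (f x / ((cr x - z) * (cr x - z0)^2))"
     using z(1) cauchy_denom_nz[OF iz, of x] cauchy_denom_nz[OF z0, of x]
     by (simp add: divide_simps) (simp add: power2_eq_square algebra_simps)
   qed
   finally show ?thesis .
  qed
  have "norm ... <= (LBINT x. norm (z - z0) * (norm (f x) * (2 / y ^ 3)))"
  proof (rule integral_norm_le)
   have b: "norm (f x / ((cr x - z) * (cr x - z0)^2)) <= norm (f x) * (2 / y ^ 3)" for x
   proof -
    have "y / 2 * y^2 <= norm (cr x - z) * (norm (cr x - z0))^2"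
     using d0[of x] y norm_cauchy_denom[of z x] imz by (intro mult_mono power_mono) auto
    then have "norm (f x) / (norm (cr x - z) * (norm (cr x - z0))^2) <= norm (f x) / (y / 2 * y^2)"
     using y by (intro divide_left_mono mult_pos_pos) (use cauchy_denom_nz[OF iz, of x] cauchy_denom_nz[OF z0, of x] in auto)
    then show ?thesis by (simp add: norm_divide norm_mult norm_power power3_eq_cube power2_eq_square mult.assoc)
   qed
   show "norm ((z - z0) * (f x / ((cr x - z) * (cr x - z0)^2))) <= norm (z - z0) * (norm (f x) * (2 / y ^ 3))" for x
    unfolding norm_mult[of "z - z0"] using b by (intro mult_left_mono) auto
   show "L1 (%x. (z - z0) * (f x / ((cr x - z) * (cr x - z0)^2)))"
   proof (rule integrable_dominated)
    show "L1 (%x. norm (z - z0) * (norm (f x) * (2 / y ^ 3)))" using f by auto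
    show "AE x in lborel. norm ((z - z0) * (f x / ((cr x - z) * (cr x - z0)^2))) <= norm (norm (z - z0) * (norm (f x) * (2 / y ^ 3)))"
    proof (rule AE_I2)
     fix x
     have "norm ((z - z0) * (f x / ((cr x - z) * (cr x - z0)^2))) <= norm (z - z0) * (norm (f x) * (2 / y ^ 3))"
      unfolding norm_mult[of "z - z0"] using b by (intro mult_left_mono) auto
     also have "... <= norm (norm (z - z0) * (norm (f x) * (2 / y ^ 3)))" by (metis abs_ge_self real_norm_def)
     finally show "norm ((z - z0) * (f x / ((cr x - z) * (cr x - z0)^2))) <= norm (norm (z - z0) * (norm (f x) * (2 / y ^ 3)))" .
    qed
   qed measurable
  qed (use f in auto)
  also have "... = norm (z - z0) * (A * (2 / y ^ 3))" by (simp add: A_def)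
  finally show ?thesis using eq by simp
 qed
 have "((%z. (cauchyT f z - cauchyT f z0) / (z - z0) - D) \<longlongrightarrow> 0) (at z0)"
 proof (rule Lim_null_comparison)
  show "\<forall>\<^sub>F z in at z0. norm ((cauchyT f z - cauchyT f z0) / (z - z0) - D) <= norm (z - z0) * (A * (2 / y ^ 3))"
   unfolding eventually_at using main y by (intro exI[of _ "y / 2"]) (auto simp: dist_norm)
  have "((%z. norm (z - z0) * (A * (2 / y ^ 3))) \<longlongrightarrow> norm (z0 - z0) * (A * (2 / y ^ 3))) (at z0)"
   by (intro tendsto_intros)
  then show "((%z. norm (z - z0) * (A * (2 / y ^ 3))) \<longlongrightarrow> 0) (at z0)" by simp
 qed
 then show ?thesis unfolding has_field_derivative_iff D_def using LIM_zero_iff by blast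
qed

lemma cauchyT_holomorphic:
 assumes "L1 f" "S \<subseteq> {z. Im z ~= 0}"
 shows "cauchyT f holomorphic_on S"
 unfolding holomorphic_on_def field_differentiable_def
 using cauchyT_has_field_derivative[OF assms(1)] assms(2) has_field_derivative_at_within by blast

lemma cauchyT_tendsto:
 assumes f: "L1 f" and z: "Im z ~= 0" and g: "(g \<longlongrightarrow> z) F"
 shows "((%n. cauchyT f (g n)) \<longlongrightarrow> cauchyT f z) F"
 using DERIV_isCont[OF cauchyT_has_field_derivative[OF f z]] g by (rule isCont_tendsto_compose)

text \<open>For |x| <= 1 and |Im z| >= y the distance |x - z| is comparable to 1 + |z|. The
  resulting decay of order 1 / |z| makes powers p > 1 of Cauchy transforms integrable along
  horizontal lines.\<close>

lemma cauchyT_decay: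
 assumes f: "L1 f" and supp: "!!x. \<bar>x\<bar> > 1 ==> f x = 0" and y: "y > 0" and z: "y <= \<bar>Im z\<bar>"
 shows "norm (cauchyT f z) <= (LBINT x. norm (f x)) * ((y + 2) / y) / (1 + norm z)"
proof -
 have z': "Im z ~= 0" using z y by auto
 have b: "norm (f x / (cr x - z)) <= norm (f x) * ((y + 2) / y / (1 + norm z))" for x
 proof (cases "\<bar>x\<bar> > 1")
  case False
  have 1: "norm (cr x - z) >= y" using norm_cauchy_denom[of z x] z by simp
  have "norm z <= norm (cr x - z) + norm (cr x)"
   using norm_triangle_ineq4[of "cr x" "cr x - z"] by simp
  then have "1 + norm z <= norm (cr x - z) + 2" using False by simp
  also have "... <= norm (cr x - z) + 2 / y * norm (cr x - z)"
   using mult_left_mono[OF 1, of "2 / y"] y by simp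
  also have "... = (y + 2) / y * norm (cr x - z)" using y by (simp add: field_simps)
  finally have le: "1 + norm z <= (y + 2) / y * norm (cr x - z)" .
  have p: "0 < norm (cr x - z)" using 1 y by linarith
  have "1 / norm (cr x - z) <= (y + 2) / y / (1 + norm z)"
  proof -
   have "0 < 1 + norm z" by (simp add: add_pos_nonneg)
   from divide_right_mono[OF le, of "(1 + norm z) * norm (cr x - z)"] this p
   show ?thesis by simp
  qed
  from mult_left_mono[OF this, of "norm (f x)"] show ?thesis
   by (simp add: norm_divide)
 qed (use supp in simp)
 have "norm (cauchyT f z) <= (LBINT x. norm (f x) * ((y + 2) / y / (1 + norm z)))"
  unfolding cauchyT_def
  by (rule integral_norm_le) (use b f cauchy_integrable[OF f z'] in auto)
 then show ?thesis by simp
qed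

lemma poisson_kernel_nn_integral:
 assumes y: "y > 0"
 shows "(NN x. ennreal (y / ((x - t)^2 + y^2))) = ennreal pi"
proof -
 define k where "k s = y / (s^2 + y^2)" for s :: real
 have [measurable]: "k \<in> bm borel" unfolding k_def by measurable
 have k0: "k s >= 0" for s using y by (simp add: k_def)
 have half: "(\<integral>\<^sup>+s\<in>{0..}. ennreal (k s) \<partial>lborel) = ennreal (pi / 2 - arctan (0 / y))"
 proof (rule nn_integral_FTC_atLeast)
  show "((%s. arctan (s / y)) has_real_derivative k s) (at s)" for s
   unfolding k_def using y
   by (auto intro!: derivative_eq_intros simp: field_simps power2_eq_square)
  have "filterlim (%s. s / y) at_top at_top"
   using y by (intro filterlim_tendsto_pos_mult_at_top[OF tendsto_const[of "1 / y"] _ filterlim_ident, simplified] ) auto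
  then show "((%s. arctan (s / y)) \<longlongrightarrow> pi / 2) at_top"
   by (rule filterlim_compose[OF tendsto_arctan_at_top])
 qed (use k0 in auto)
 have "(\<integral>\<^sup>+s\<in>{..<0}. ennreal (k s) \<partial>lborel) = (NN s. ennreal (k (0 + (-1) * s)) * indicator {..<0} (0 + (-1) * s))"
  by (subst nn_integral_real_affine[where c = "-1" and t = 0]) auto
 also have "... = (\<integral>\<^sup>+s\<in>{0..}. ennreal (k s) \<partial>lborel)"
 proof (rule nn_integral_cong_AE)
  have "AE s in lborel. s ~= (0::real)" by (rule AE_lborel_singleton)
  then show "AE s in lborel. ennreal (k (0 + (-1) * s)) * indicator {..<0} (0 + (-1) * s) = ennreal (k s) * indicator {0..} s"
   by eventually_elim (auto simp: k_def indicator_def)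
 qed
 finally have half': "(\<integral>\<^sup>+s\<in>{..<0}. ennreal (k s) \<partial>lborel) = ennreal (pi / 2)" using half by simp
 have "(NN x. ennreal (y / ((x - t)^2 + y^2))) = (NN x. ennreal (k x))"
  by (subst nn_integral_real_affine[where c = 1 and t = t]) (auto simp: k_def)
 also have "... = (NN s. (ennreal (k s) * indicator {0..} s + ennreal (k s) * indicator {..<0} s))"
  by (rule nn_integral_cong) (auto simp: indicator_def)
 also have "... = (\<integral>\<^sup>+s\<in>{0..}. ennreal (k s) \<partial>lborel) + (\<integral>\<^sup>+s\<in>{..<0}. ennreal (k s) \<partial>lborel)"
  by (rule nn_integral_add) auto
 also have "... = ennreal pi" using half half' by (simp flip: ennreal_plus)
 finally show ?thesis .
qed

lemma poisson_kernel_integral: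
 assumes y: "y > 0"
 shows "L1 (%x. y / ((x - t)^2 + y^2))" "(LBINT x. y / ((x - t)^2 + y^2)) = pi"
proof -
 have 0: "0 <= y / ((x - t)^2 + y^2)" for x using y by simp
 have "has_bochner_integral lborel (%x. y / ((x - t)^2 + y^2)) pi"
  by (rule has_bochner_integral_nn_integral)
   (use 0 poisson_kernel_nn_integral[OF y, of t] in auto)
 then show "L1 (%x. y / ((x - t)^2 + y^2))" "(LBINT x. y / ((x - t)^2 + y^2)) = pi"
  by (auto simp: has_bochner_integral_iff)
qed

lemma poisson_kernel_le:
 fixes x t y :: real
 assumes y: "y > 0"
 shows "y / ((x - t)^2 + y^2) <= ((2 + 2 * t^2) / y + 2 * y) * (1 / (1 + x^2))"
proof -
 have "0 <= (x - 2 * t)^2" by simp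
 then have "1 + x^2 <= 1 + 2 * t^2 + 2 * (x - t)^2"
  by (simp add: power2_eq_square algebra_simps)
 also have "... <= ((2 + 2 * t^2) / y^2 + 2) * ((x - t)^2 + y^2)"
 proof -
  have "((2 + 2 * t^2) / y^2 + 2) * ((x - t)^2 + y^2) = (2 + 2 * t^2) / y^2 * (x - t)^2 + (2 + 2 * t^2) + 2 * (x - t)^2 + 2 * y^2"
   using y by (simp add: field_simps)
  moreover have "0 <= (2 + 2 * t^2) / y^2 * (x - t)^2" by simp
  ultimately show ?thesis using zero_le_power2[of y] by linarith
 qed
 finally have 1: "1 + x^2 <= ((2 + 2 * t^2) / y^2 + 2) * ((x - t)^2 + y^2)" .
 have p: "0 < (x - t)^2 + y^2" "0 < 1 + x^2" using y by (auto simp: add_nonneg_pos add_pos_nonneg)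
 have "1 / ((x - t)^2 + y^2) <= ((2 + 2 * t^2) / y^2 + 2) / (1 + x^2)"
  using 1 p by (simp add: pos_divide_le_eq pos_le_divide_eq)
 from mult_left_mono[OF this, of y]
 have "y / ((x - t)^2 + y^2) <= y * ((2 + 2 * t^2) / y^2 + 2) * (1 / (1 + x^2))" using y by simp
 also have "y * ((2 + 2 * t^2) / y^2 + 2) = (2 + 2 * t^2) / y + 2 * y"
  using y by (simp add: power2_eq_square field_simps)
 finally show ?thesis .
qed

lemma inverse_square_integrable: "L1 (%x::real. 1 / (1 + x^2))"
 and inverse_square_nn_integral: "(NN x. ennreal (1 / (1 + x^2))) = ennreal pi"
 using poisson_kernel_integral(1)[of 1 0] poisson_kernel_nn_integral[of 1 0] by (simp_all add: add.commute)

text \<open>Boundary values of Cauchy transforms decay only like 1 / |t|, so functions integrable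
  against 1 / (1 + x^2) have to be covered. Being a Lebesgue point is a local property, and
  truncation to [-n, n] reduces to the integrable case.\<close>

lemma AE_lebesgue_point_weighted:
 assumes f: "L1 (%x. f x / cr (1 + x^2))"
 shows "AE t in lborel. lebesgue_point f t"
proof -
 have nz: "cr (1 + x^2) ~= 0" for x :: real
  by (metis add_pos_nonneg less_irrefl of_real_eq_0_iff zero_le_power2 zero_less_one)
 have "(%x. f x / cr (1 + x^2) * cr (1 + x^2)) \<in> bm lborel"
  by (rule borel_measurable_times) (use f in auto)
 then have [measurable]: "f \<in> bm lborel" using nz by simp
 have "AE t in lborel. lebesgue_point (%x. indicator {-real n..real n} x *\<^sub>R f x) t" for n
 proof (rule AE_lebesgue_point)
  show "L1 (%x. indicator {-real n..real n} x *\<^sub>R f x)"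
  proof (rule integrable_dominated)
   show "L1 (%x. (1 + (real n)^2) *\<^sub>R (f x / cr (1 + x^2)))"
    using f by (rule integrable_scaleR_right)
   show "AE x in lborel. norm (indicator {-real n..real n} x *\<^sub>R f x) <= norm ((1 + (real n)^2) *\<^sub>R (f x / cr (1 + x^2)))"
   proof (rule AE_I2)
    fix x :: real
    show "norm (indicator {-real n..real n} x *\<^sub>R f x) <= norm ((1 + (real n)^2) *\<^sub>R (f x / cr (1 + x^2)))"
    proof (cases "x \<in> {-real n..real n}")
     case True
     then have "x^2 <= (real n)^2" by (simp add: abs_le_square_iff[symmetric] abs_le_iff)
     then have "norm (f x) * (1 + x^2) <= norm (f x) * (1 + (real n)^2)" by (intro mult_left_mono) auto
     moreover have "norm (cr (1 + x^2)) = 1 + x^2" by (simp only: norm_of_real) simp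
     moreover have "0 < 1 + x^2" by (simp add: add_pos_nonneg)
     ultimately show ?thesis using True
      by (simp only: norm_scaleR norm_divide) (simp add: field_simps)
    qed simp
   qed
  qed measurable
 qed
 then have "AE t in lborel. \<forall>n. lebesgue_point (%x. indicator {-real n..real n} x *\<^sub>R f x) t"
  by (simp add: AE_all_countable)
 then show ?thesis
 proof eventually_elim
  case (elim t)
  obtain n where n: "\<bar>t\<bar> < real n" using reals_Archimedean2 by blast
  show ?case unfolding lebesgue_point_def
  proof (intro allI impI)
   fix e :: real assume "e > 0"
   then obtain d where d: "d > 0" "!!r. 0 < r ==> r < d ==>
    (\<integral>\<^sup>+x\<in>cball t r. ennreal (norm (indicator {-real n..real n} x *\<^sub>R f x - indicator {-real n..real n} t *\<^sub>R f t)) \<partial>lborel) <= ennreal (e * r)"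
    using elim[rule_format, of n] unfolding lebesgue_point_def by blast
   show "\<exists>d>0. \<forall>r. 0 < r & r < d --> (\<integral>\<^sup>+x\<in>cball t r. ennreal (norm (f x - f t)) \<partial>lborel) <= ennreal (e * r)"
   proof (intro exI[of _ "min d (real n - \<bar>t\<bar>)"] conjI allI impI)
    show "0 < min d (real n - \<bar>t\<bar>)" using d n by auto
    fix r assume r: "0 < r & r < min d (real n - \<bar>t\<bar>)"
    have "(\<integral>\<^sup>+x\<in>cball t r. ennreal (norm (f x - f t)) \<partial>lborel) =
     (\<integral>\<^sup>+x\<in>cball t r. ennreal (norm (indicator {-real n..real n} x *\<^sub>R f x - indicator {-real n..real n} t *\<^sub>R f t)) \<partial>lborel)"
     by (rule nn_integral_cong) (use r n in \<open>auto simp: indicator_def dist_real_def\<close>)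
    then show "(\<integral>\<^sup>+x\<in>cball t r. ennreal (norm (f x - f t)) \<partial>lborel) <= ennreal (e * r)"
     using d(2)[of r] r by simp
   qed
  qed
 qed
qed

lemma weighted_borel:
 assumes f: "L1 (%x. f x / cr (1 + x^2))"
 shows "f \<in> bm lborel"
proof -
 have nz: "cr (1 + x^2) ~= 0" for x :: real
  by (metis add_pos_nonneg less_irrefl of_real_eq_0_iff zero_le_power2 zero_less_one)
 have "(%x. f x / cr (1 + x^2) * cr (1 + x^2)) \<in> bm lborel"
  by (rule borel_measurable_times) (use f in auto)
 then show ?thesis using nz by simp
qed

lemma weighted_of_integrable:
 assumes f: "L1 f"
 shows "L1 (%x. f x / cr (1 + x^2))"
proof (rule integrable_dominated[OF f])
 have [measurable]: "f \<in> bm lborel" using f by auto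
 show "(%x. f x / cr (1 + x^2)) \<in> bm lborel" by measurable
 show "AE x in lborel. norm (f x / cr (1 + x^2)) <= norm (f x)"
 proof (rule AE_I2)
  fix x :: real
  have n: "norm (cr (1 + x^2)) = 1 + x^2" by (simp only: norm_of_real) simp
  have "norm (f x) / (1 + x^2) <= norm (f x) / 1" by (rule divide_left_mono) (auto simp: add_pos_nonneg)
  then show "norm (f x / cr (1 + x^2)) <= norm (f x)" unfolding norm_divide n by simp
 qed
qed

text \<open>Any kernel dominated by the Poisson kernel averages out the oscillation of
  \<open>f\<close> at a Lebesgue point. This serves both the Poisson kernel itself and the
  difference of the truncated and the smooth Hilbert kernels.\<close>

lemma kernel_limit_at_lebesgue_point:
 fixes k :: "real => real => real"
 assumes f: "L1 (%x. f x / cr (1 + x^2))"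
  and lp: "lebesgue_point f t"
  and kb: "!!x y. y > 0 ==> \<bar>k y x\<bar> <= y / ((x - t)^2 + y^2)"
 shows "((%y. \<integral>x. k y x *\<^sub>R (f x - f t) \<partial>lborel) \<longlongrightarrow> 0) (at_right 0)"
proof -
 have [measurable]: "f \<in> bm lborel" by (rule weighted_borel[OF f])
 have n: "norm (cr (1 + x^2)) = 1 + x^2" for x :: real by (simp only: norm_of_real) simp
 have fin: "(NN x. ennreal (norm (f x - f t)) * ennreal (1 / (1 + x^2))) < \<infinity>"
 proof -
  have i: "L1 (%x. norm (f x / cr (1 + x^2)) + norm (f t) * (1 / (1 + x^2)))"
   by (intro integrable_plus integrable_norm integrable_mult_right f inverse_square_integrable)
  have "(NN x. ennreal (norm (f x - f t)) * ennreal (1 / (1 + x^2)))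
    <= (NN x. ennreal (norm (f x / cr (1 + x^2)) + norm (f t) * (1 / (1 + x^2))))"
  proof (rule nn_integral_mono)
   fix x :: real
   have "norm (f x - f t) * (1 / (1 + x^2)) <= (norm (f x) + norm (f t)) * (1 / (1 + x^2))"
    by (rule mult_right_mono[OF norm_triangle_ineq4]) simp
   also have "... = norm (f x / cr (1 + x^2)) + norm (f t) * (1 / (1 + x^2))"
    unfolding norm_divide n by (simp add: add_divide_distrib)
   finally have "ennreal (norm (f x - f t) * (1 / (1 + x^2))) <= ennreal (norm (f x / cr (1 + x^2)) + norm (f t) * (1 / (1 + x^2)))"
    by (rule ennreal_leI)
   then show "ennreal (norm (f x - f t)) * ennreal (1 / (1 + x^2)) <= ennreal (norm (f x / cr (1 + x^2)) + norm (f t) * (1 / (1 + x^2)))"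
    by (subst (asm) ennreal_mult) simp_all
  qed
  also have "... < \<infinity>"
   by (subst nn_integral_eq_integral[OF i]) (auto intro!: AE_I2 add_nonneg_nonneg)
  finally show ?thesis .
 qed
 have lim: "((%y. \<integral>\<^sup>+x. ennreal (y / ((x - t)^2 + y^2)) * ennreal (norm (f x - f t)) \<partial>lborel) \<longlongrightarrow> 0) (at_right 0)"
 proof (rule poisson_kernel_limit[OF _ fin])
  show "\<exists>d>0. \<forall>r. 0 < r & r < d --> (\<integral>\<^sup>+x\<in>cball t r. ennreal (norm (f x - f t)) \<partial>lborel) <= ennreal (e * r)" if "e > 0" for e
   using lp that unfolding lebesgue_point_def by blast
 qed measurable
 have bd: "ennreal (norm (LBINT x. k y x *\<^sub>R (f x - f t))) <= (NN x. ennreal (y / ((x - t)^2 + y^2)) * ennreal (norm (f x - f t)))" if y: "y > 0" for y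
 proof -
  have "ennreal (norm (LBINT x. k y x *\<^sub>R (f x - f t))) <= (NN x. ennreal (norm (k y x *\<^sub>R (f x - f t))))"
  proof (cases "L1 (%x. k y x *\<^sub>R (f x - f t))")
   case True
   then show ?thesis by (rule integral_norm_bound_ennreal)
  qed (simp add: not_integrable_integral_eq)
  also have "... <= (NN x. ennreal (y / ((x - t)^2 + y^2)) * ennreal (norm (f x - f t)))"
  proof (rule nn_integral_mono)
   fix x
   have "norm (k y x *\<^sub>R (f x - f t)) <= y / ((x - t)^2 + y^2) * norm (f x - f t)"
    unfolding norm_scaleR by (rule mult_right_mono[OF kb[OF y]]) simp
   then show "ennreal (norm (k y x *\<^sub>R (f x - f t))) <= ennreal (y / ((x - t)^2 + y^2)) * ennreal (norm (f x - f t))"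
    using y by (subst ennreal_mult[symmetric]) (auto intro!: ennreal_leI)
  qed
  finally show ?thesis .
 qed
 have "((%y. ennreal (norm (LBINT x. k y x *\<^sub>R (f x - f t)))) \<longlongrightarrow> 0) (at_right 0)"
 proof (rule tendsto_sandwich[OF _ _ tendsto_const lim])
  show "\<forall>\<^sub>F y in at_right 0. ennreal (norm (LBINT x. k y x *\<^sub>R (f x - f t))) <= (NN x. ennreal (y / ((x - t)^2 + y^2)) * ennreal (norm (f x - f t)))"
   using eventually_at_right_less[of "0::real"] by eventually_elim (rule bd)
 qed auto
 then have "((%y. ennreal (norm (LBINT x. k y x *\<^sub>R (f x - f t)))) \<longlongrightarrow> ennreal 0) (at_right 0)" by simp
 then have "((%y. norm (LBINT x. k y x *\<^sub>R (f x - f t))) \<longlongrightarrow> 0) (at_right 0)"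
  by (subst (asm) tendsto_ennreal_iff) auto
 then show ?thesis by (rule tendsto_norm_zero_cancel)
qed

lemma poisson_integrable:
 assumes f: "L1 (%x. f x / cr (1 + x^2))" and y: "y > 0"
 shows "L1 (%x. (y / ((x - t)^2 + y^2)) *\<^sub>R f x)"
proof (rule integrable_dominated)
 have [measurable]: "f \<in> bm lborel" by (rule weighted_borel[OF f])
 show "L1 (%x. ((2 + 2 * t^2) / y + 2 * y) *\<^sub>R (f x / cr (1 + x^2)))"
  using f by (rule integrable_scaleR_right)
 have n: "norm (cr (1 + x^2)) = 1 + x^2" for x :: real by (simp only: norm_of_real) simp
 show "AE x in lborel. norm ((y / ((x - t)^2 + y^2)) *\<^sub>R f x) <= norm (((2 + 2 * t^2) / y + 2 * y) *\<^sub>R (f x / cr (1 + x^2)))"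
 proof (rule AE_I2)
  fix x
  have "norm ((y / ((x - t)^2 + y^2)) *\<^sub>R f x) = y / ((x - t)^2 + y^2) * norm (f x)" using y by simp
  also have "... <= ((2 + 2 * t^2) / y + 2 * y) * (1 / (1 + x^2)) * norm (f x)"
   by (rule mult_right_mono[OF poisson_kernel_le[OF y]]) simp
  also have "... = norm (((2 + 2 * t^2) / y + 2 * y) *\<^sub>R (f x / cr (1 + x^2)))"
   using y by (simp only: norm_scaleR norm_divide n) simp
  finally show "norm ((y / ((x - t)^2 + y^2)) *\<^sub>R f x) <= norm (((2 + 2 * t^2) / y + 2 * y) *\<^sub>R (f x / cr (1 + x^2)))" .
 qed
 show "(%x. (y / ((x - t)^2 + y^2)) *\<^sub>R f x) \<in> bm lborel" by measurable
qed

lemma poisson_tendsto: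
 assumes f: "L1 (%x. f x / cr (1 + x^2))" and lp: "lebesgue_point f t"
 shows "((%y. poisson f y t) \<longlongrightarrow> f t) (at_right 0)"
proof -
 have "((%y. \<integral>x. (y / ((x - t)^2 + y^2)) *\<^sub>R (f x - f t) \<partial>lborel) \<longlongrightarrow> 0) (at_right 0)"
  by (rule kernel_limit_at_lebesgue_point[OF f lp]) simp
 moreover have "\<forall>\<^sub>F y in at_right 0. (LBINT x. (y / ((x - t)^2 + y^2)) *\<^sub>R (f x - f t)) = of_real pi * (poisson f y t - f t)"
  using eventually_at_right_less[of "0::real"]
 proof eventually_elim
  case (elim y)
  have "(LBINT x. (y / ((x - t)^2 + y^2)) *\<^sub>R (f x - f t)) = (LBINT x. (y / ((x - t)^2 + y^2)) *\<^sub>R f x) - (LBINT x. (y / ((x - t)^2 + y^2)) *\<^sub>R f t)"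
   using poisson_integrable[OF f elim, of t] poisson_kernel_integral(1)[OF elim, of t]
   by (simp add: scaleR_right_diff_distrib integral_sub)
  also have "(LBINT x. (y / ((x - t)^2 + y^2)) *\<^sub>R f t) = pi *\<^sub>R f t"
   using poisson_kernel_integral[OF elim, of t] by simp
  finally show ?case by (simp add: poisson_def scaleR_conv_of_real algebra_simps)
 qed
 ultimately have "((%y. of_real pi * (poisson f y t - f t)) \<longlongrightarrow> 0) (at_right 0)"
  by (rule Lim_transform_eventually)
 then have "((%y. (1 / of_real pi) * (of_real pi * (poisson f y t - f t))) \<longlongrightarrow> (1 / of_real pi) * 0) (at_right 0)"
  by (rule tendsto_mult[OF tendsto_const])
 then show ?thesis by (simp add: LIM_zero_iff)
qed

text \<open>Plemelj's jump relation at positive height: the two Cauchy kernels differ by 2 i y / ((x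
  - t)^2 + y^2). It recovers \<open>f\<close> from its Cauchy transform, which is the source of the
  uniqueness theorem.\<close>

lemma cauchyT_jump:
 assumes f: "L1 f" and y: "y > 0"
 shows "cauchyT f (Complex t y) - cauchyT f (Complex t (-y)) = 2 * of_real pi * \<i> * poisson f y t"
proof -
 have 1: "Im (Complex t y) ~= 0" "Im (Complex t (-y)) ~= 0" using y by auto
 have "cauchyT f (Complex t y) - cauchyT f (Complex t (-y)) = (LBINT x. f x / (of_real x - Complex t y) - f x / (of_real x - Complex t (-y)))"
  unfolding cauchyT_def using cauchy_integrable[OF f 1(1)] cauchy_integrable[OF f 1(2)] by simp
 also have "... = (LBINT x. (2 * \<i>) * ((y / ((x - t)^2 + y^2)) *\<^sub>R f x))"
 proof (rule integral_congr[OF refl])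
  fix x
  have p: "(x - t)^2 + y^2 > 0" using y by (simp add: add_nonneg_pos)
  have e: "(of_real x - Complex t y) * (of_real x - Complex t (-y)) = of_real ((x - t)^2 + y^2)"
   by (simp add: complex_eq_iff power2_eq_square algebra_simps)
  have d: "1 / (of_real x - Complex t y) - 1 / (of_real x - Complex t (-y)) = 2 * \<i> * of_real (y / ((x - t)^2 + y^2))"
  proof -
   have "1 / (of_real x - Complex t y) - 1 / (of_real x - Complex t (-y)) = ((of_real x - Complex t (-y)) - (of_real x - Complex t y)) / ((of_real x - Complex t y) * (of_real x - Complex t (-y)))"
    using cauchy_denom_nz[OF 1(1), of x] cauchy_denom_nz[OF 1(2), of x] by (simp add: diff_frac_eq)
   also have "(of_real x - Complex t (-y)) - (of_real x - Complex t y) = 2 * \<i> * of_real y"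
    by (simp add: complex_eq_iff)
   finally show ?thesis by (simp add: e)
  qed
  have "f x / (of_real x - Complex t y) - f x / (of_real x - Complex t (-y)) = f x * (1 / (of_real x - Complex t y) - 1 / (of_real x - Complex t (-y)))"
   by (simp add: algebra_simps)
  also have "... = (2 * \<i>) * ((y / ((x - t)^2 + y^2)) *\<^sub>R f x)" unfolding d scaleR_conv_of_real by (simp add: algebra_simps)
  finally show "f x / (of_real x - Complex t y) - f x / (of_real x - Complex t (-y)) = (2 * \<i>) * ((y / ((x - t)^2 + y^2)) *\<^sub>R f x)" .
 qed
 also have "... = 2 * \<i> * (LBINT x. (y / ((x - t)^2 + y^2)) *\<^sub>R f x)" by (rule integral_mult_right_zero)
 finally show ?thesis by (simp add: poisson_def)
qed

text \<open>The conjugate Poisson integral, with kernel (x - t) / ((x - t)^2 + y^2) and the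
  normalisation 1 / (pi i) of the finite Hilbert transform. As a mean of Cauchy transforms it
  inherits their bounds and boundary values.\<close>

definition cpoisson :: "(real => complex) => real => real => complex" where
 "cpoisson f y t = (cauchyT f (Complex t y) + cauchyT f (Complex t (-y))) / (2 * of_real pi * \<i>)"

definition trunc_hilbert :: "(real => complex) => real => real => complex" where
 "trunc_hilbert f y t = (LBINT x. (if \<bar>x - t\<bar> > y then f x / of_real (x - t) else 0)) / (of_real pi * \<i>)"

lemma cpoisson_eq:
 assumes f: "L1 f" and y: "y > 0"
 shows "L1 (%x. ((x - t) / ((x - t)^2 + y^2)) *\<^sub>R f x)"
  and "cpoisson f y t = (LBINT x. ((x - t) / ((x - t)^2 + y^2)) *\<^sub>R f x) / (of_real pi * \<i>)"
proof -
 have 1: "Im (Complex t y) ~= 0" "Im (Complex t (-y)) ~= 0" using y by auto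
 have pt: "f x / (of_real x - Complex t y) + f x / (of_real x - Complex t (-y)) = 2 * (((x - t) / ((x - t)^2 + y^2)) *\<^sub>R f x)" for x
 proof -
  have e: "(of_real x - Complex t y) * (of_real x - Complex t (-y)) = of_real ((x - t)^2 + y^2)"
   by (simp add: complex_eq_iff power2_eq_square algebra_simps)
  have d: "1 / (of_real x - Complex t y) + 1 / (of_real x - Complex t (-y)) = 2 * of_real ((x - t) / ((x - t)^2 + y^2))"
  proof -
   have "1 / (of_real x - Complex t y) + 1 / (of_real x - Complex t (-y)) = ((of_real x - Complex t (-y)) + (of_real x - Complex t y)) / ((of_real x - Complex t y) * (of_real x - Complex t (-y)))"
    using cauchy_denom_nz[OF 1(1), of x] cauchy_denom_nz[OF 1(2), of x] by (simp add: add_frac_eq)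
   also have "(of_real x - Complex t (-y)) + (of_real x - Complex t y) = 2 * of_real (x - t)"
    by (simp add: complex_eq_iff)
   finally show ?thesis by (simp add: e)
  qed
  have "f x / (of_real x - Complex t y) + f x / (of_real x - Complex t (-y)) = f x * (1 / (of_real x - Complex t y) + 1 / (of_real x - Complex t (-y)))"
   by (simp add: algebra_simps)
  also have "... = 2 * (((x - t) / ((x - t)^2 + y^2)) *\<^sub>R f x)" unfolding d scaleR_conv_of_real by (simp add: algebra_simps)
  finally show ?thesis .
 qed
 have "L1 (%x. (1/2) * (f x / (of_real x - Complex t y) + f x / (of_real x - Complex t (-y))))"
  using cauchy_integrable[OF f 1(1)] cauchy_integrable[OF f 1(2)] by simp
 then show i: "L1 (%x. ((x - t) / ((x - t)^2 + y^2)) *\<^sub>R f x)"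
  unfolding pt by simp
 have "cauchyT f (Complex t y) + cauchyT f (Complex t (-y)) = (LBINT x. f x / (of_real x - Complex t y) + f x / (of_real x - Complex t (-y)))"
  unfolding cauchyT_def using cauchy_integrable[OF f 1(1)] cauchy_integrable[OF f 1(2)] by simp
 also have "... = 2 * (LBINT x. ((x - t) / ((x - t)^2 + y^2)) *\<^sub>R f x)"
  unfolding pt by (rule integral_mult_right_zero)
 finally show "cpoisson f y t = (LBINT x. ((x - t) / ((x - t)^2 + y^2)) *\<^sub>R f x) / (of_real pi * \<i>)"
  by (simp add: cpoisson_def)
qed

text \<open>The difference \<open>q\<close> of the two kernels is bounded by the Poisson kernel and
  odd. The first property removes the oscillation of \<open>f\<close>, the second the contribution
  of the constant \<open>f t\<close>. So principal values can be computed as limits of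
  \<open>cpoisson\<close>.\<close>

lemma trunc_minus_conj_poisson_tendsto:
 assumes f: "L1 f" and lp: "lebesgue_point f t"
 shows "((%y. trunc_hilbert f y t - cpoisson f y t) \<longlongrightarrow> 0) (at_right 0)"
proof -
 have [measurable]: "f \<in> bm lborel" using f by auto
 define q where "q y s = (if \<bar>s\<bar> > y then 1 / s else 0) - s / (s^2 + y^2)" for y s :: real
 have [measurable]: "q y \<in> bm borel" for y unfolding q_def by measurable
 have qb: "\<bar>q y s\<bar> <= y / (s^2 + y^2)" if y: "y > 0" for y s
 proof -
  have p: "s^2 + y^2 > 0" using y by (simp add: add_nonneg_pos)
  show ?thesis
  proof (cases "\<bar>s\<bar> > y")
   case True
   then have s: "s ~= 0" using y by auto
   have "q y s = y^2 / (s * (s^2 + y^2))" using True s p unfolding q_def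
    by (simp add: field_simps power2_eq_square)
   then have "\<bar>q y s\<bar> = y * (y / \<bar>s\<bar>) / (s^2 + y^2)" using p y by (simp add: abs_mult power2_eq_square)
   also have "... <= y * 1 / (s^2 + y^2)" using True y p s by (intro divide_right_mono mult_left_mono) auto
   finally show ?thesis by simp
  next
   case False
   then have "\<bar>q y s\<bar> = \<bar>s\<bar> / (s^2 + y^2)" using p by (simp add: q_def abs_divide)
   also have "... <= y / (s^2 + y^2)" using False p by (intro divide_right_mono) auto
   finally show ?thesis .
  qed
 qed
 have qi: "L1 (%x. q y (x - t))" if y: "y > 0" for y
  by (rule integrable_dominated[OF poisson_kernel_integral(1)[OF y, of t]])
    (use qb[OF y] y in \<open>auto intro!: AE_I2\<close>)
 have q0: "(LBINT x. q y (x - t)) = 0" if y: "y > 0" for y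
 proof -
  have "(LBINT x. q y (x - t)) = (LBINT x. q y ((2 * t + (-1) * x) - t))"
   by (subst lborel_integral_real_affine[where c = "-1" and t = "2 * t"]) auto
  also have "... = (LBINT x. - q y (x - t))"
  proof (rule integral_congr[OF refl])
   fix x
   have "q y (- s) = - q y s" for s by (simp add: q_def)
   from this[of "x - t"] show "q y ((2 * t + (-1) * x) - t) = - q y (x - t)" by (simp add: algebra_simps)
  qed
  finally show ?thesis by simp
 qed
 have "((%y. \<integral>x. q y (x - t) *\<^sub>R (f x - f t) \<partial>lborel) \<longlongrightarrow> 0) (at_right 0)"
  by (rule kernel_limit_at_lebesgue_point[OF weighted_of_integrable[OF f] lp]) (rule qb)
 moreover have "\<forall>\<^sub>F y in at_right 0. (LBINT x. q y (x - t) *\<^sub>R (f x - f t)) = of_real pi * \<i> * (trunc_hilbert f y t - cpoisson f y t)"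
  using eventually_at_right_less[of "0::real"]
 proof eventually_elim
  case (elim y)
  have Ti: "L1 (%x. if \<bar>x - t\<bar> > y then f x / of_real (x - t) else 0)"
  proof (rule integrable_dominated)
   show "L1 (%x. f x / of_real y)" using f by simp
   show "AE x in lborel. norm (if \<bar>x - t\<bar> > y then f x / of_real (x - t) else 0) <= norm (f x / cr y)"
    using elim by (auto intro!: AE_I2 divide_left_mono simp: norm_divide simp flip: of_real_diff)
  qed measurable
  have qf: "q y (x - t) *\<^sub>R f x = (if \<bar>x - t\<bar> > y then f x / of_real (x - t) else 0) - ((x - t) / ((x - t)^2 + y^2)) *\<^sub>R f x" for x
   unfolding q_def by (simp add: scaleR_conv_of_real algebra_simps)
  have i1: "L1 (%x. q y (x - t) *\<^sub>R f x)"
   unfolding qf using Ti cpoisson_eq(1)[OF f elim] by (rule integrable_sub)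
  have "(LBINT x. q y (x - t) *\<^sub>R (f x - f t)) = (LBINT x. q y (x - t) *\<^sub>R f x) - (LBINT x. q y (x - t) *\<^sub>R f t)"
   using i1 qi[OF elim] by (simp add: scaleR_right_diff_distrib integral_sub)
  also have "(LBINT x. q y (x - t) *\<^sub>R f t) = 0" using q0[OF elim] qi[OF elim] by simp
  also have "(LBINT x. q y (x - t) *\<^sub>R f x) = (LBINT x. (if \<bar>x - t\<bar> > y then f x / of_real (x - t) else 0)) - (LBINT x. ((x - t) / ((x - t)^2 + y^2)) *\<^sub>R f x)"
   unfolding qf using Ti cpoisson_eq(1)[OF f elim] by (rule integral_sub)
  finally show ?case by (simp add: trunc_hilbert_def cpoisson_eq(2)[OF f elim] algebra_simps)
 qed
 ultimately have "((%y. of_real pi * \<i> * (trunc_hilbert f y t - cpoisson f y t)) \<longlongrightarrow> 0) (at_right 0)"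
  by (rule Lim_transform_eventually)
 then have "((%y. (1 / (of_real pi * \<i>)) * (of_real pi * \<i> * (trunc_hilbert f y t - cpoisson f y t))) \<longlongrightarrow> (1 / (of_real pi * \<i>)) * 0) (at_right 0)"
  by (rule tendsto_mult[OF tendsto_const])
 then show ?thesis by simp
qed

section \<open>The theorem of M. Riesz\<close>

lemma powr_decay_integrable:
 fixes p :: real
 assumes p: "p > 1"
 shows "L1 (%t::real. (1 + \<bar>t\<bar>) powr (-p))"
proof -
 define k where "k t = (1 + \<bar>t\<bar>) powr (-p)" for t :: real
 have [measurable]: "k \<in> bm borel" unfolding k_def by measurable
 have k0: "k s >= 0" for s by (simp add: k_def)
 have half: "(\<integral>\<^sup>+s\<in>{0..}. ennreal (k s) \<partial>lborel) = ennreal (0 - (- ((1 + 0) powr (1 - p)) / (p - 1)))"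
 proof (rule nn_integral_FTC_atLeast)
  show "((%s. - ((1 + s) powr (1 - p)) / (p - 1)) has_real_derivative k s) (at s)" if s: "0 <= s" for s
  proof -
   have "((%s. (1 + s) powr (1 - p)) has_real_derivative ((1 - p) * (1 + s) powr (1 - p - 1) * 1)) (at s)"
    by (rule derivative_eq_intros refl | use s in simp)+
   from DERIV_cdivide[OF DERIV_minus[OF this], of "p - 1"]
   have "((%s. - ((1 + s) powr (1 - p)) / (p - 1)) has_real_derivative - ((1 - p) * (1 + s) powr (1 - p - 1) * 1) / (p - 1)) (at s)" .
   moreover have "- ((1 - p) * x * 1) / (p - 1) = x" for x :: real using p by (simp add: divide_eq_eq algebra_simps)
   ultimately show ?thesis using s by (simp add: k_def)
  qed
  have "((%s::real. (1 + s) powr (1 - p)) \<longlongrightarrow> 0) at_top"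
  proof (rule tendsto_neg_powr)
   show "1 - p < 0" using p by simp
   show "filterlim (%s::real. 1 + s) at_top at_top"
    by (rule filterlim_tendsto_add_at_top[OF tendsto_const filterlim_ident])
  qed
  then have "((%s::real. - ((1 + s) powr (1 - p)) / (p - 1)) \<longlongrightarrow> - 0 / (p - 1)) at_top"
   by (intro tendsto_intros) (use p in auto)
  then show "((%s::real. - ((1 + s) powr (1 - p)) / (p - 1)) \<longlongrightarrow> 0) at_top" by simp
 qed (use k0 in auto)
 have "(\<integral>\<^sup>+s\<in>{..<0}. ennreal (k s) \<partial>lborel) = (NN s. ennreal (k (0 + (-1) * s)) * indicator {..<0} (0 + (-1) * s))"
  by (subst nn_integral_real_affine[where c = "-1" and t = 0]) auto
 also have "... <= (\<integral>\<^sup>+s\<in>{0..}. ennreal (k s) \<partial>lborel)"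
  by (rule nn_integral_mono) (auto simp: k_def indicator_def)
 finally have half': "(\<integral>\<^sup>+s\<in>{..<0}. ennreal (k s) \<partial>lborel) < \<infinity>" using half by (simp add: le_less_trans)
 have "(NN x. ennreal (k x)) = (NN s. (ennreal (k s) * indicator {0..} s + ennreal (k s) * indicator {..<0} s))"
  by (rule nn_integral_cong) (auto simp: indicator_def)
 also have "... = (\<integral>\<^sup>+s\<in>{0..}. ennreal (k s) \<partial>lborel) + (\<integral>\<^sup>+s\<in>{..<0}. ennreal (k s) \<partial>lborel)"
  by (rule nn_integral_add) auto
 also have "... < \<infinity>" using half half' by simp
 finally have "L1 k" using k0 by (simp add: integrable_iff_bounded)
 then show ?thesis unfolding k_def .
qed

lemma Re_closed_segment: "Re a = c ==> Re b = c ==> z \<in> closed_segment a b ==> Re z = c"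
 unfolding closed_segment_def by clarsimp (simp add: left_diff_distrib)

lemma Im_closed_segment: "Im a = c ==> Im b = c ==> z \<in> closed_segment a b ==> Im z = c"
 unfolding closed_segment_def by clarsimp (simp add: left_diff_distrib)

lemma Im_closed_segment_ge:
 assumes "y <= Im a" "y <= Im b" "z \<in> closed_segment a b"
 shows "y <= Im z"
proof -
 have "convex {z. y <= Im z}" by (rule convex_halfspace_Im_ge)
 then have "closed_segment a b \<subseteq> {z. y <= Im z}" using assms(1,2) by (intro closed_segment_subset) auto
 then show ?thesis using assms(3) by auto
qed

text \<open>Closing the line by a large rectangle on which the integrand decays.\<close>

lemma halfplane_line_integral:
 assumes hol: "G holomorphic_on {z. Im z > c}" and c: "c >= 0" and y: "y > c" and p: "p > 1"
  and bound: "!!z. Im z >= y ==> norm (G z) <= K * (1 + norm z) powr (-p)"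
 shows "L1 (%t. G (Complex t y))" "(LBINT t. G (Complex t y)) = 0"
proof -
 have op: "open {z. Im z > c}" and cv: "convex {z. Im z > c}"
  by (rule open_halfspace_Im_gt, rule convex_halfspace_Im_gt)
 \<comment> \<open>A primitive on the convex half-plane replaces contour integration: the integral
   over [-n, n] is a difference of two of its values, which is estimated along the other three sides
   of a rectangle of height n and width 2 n.\<close>
 obtain \<Gamma> where \<Gamma>: "!!z. Im z > c ==> (\<Gamma> has_field_derivative G z) (at z within {z. Im z > c})"
  using holomorphic_convex_primitive'[OF cv op hol] by auto
 have \<Gamma>': "(\<Gamma> has_field_derivative G z) (at z)" if "Im z > c" for z
  using \<Gamma>[OF that] at_within_open[OF _ op, of z] that by auto
 define g where "g t = G (Complex t y)" for t
 have "0 <= norm (G (Complex 0 y))" by simp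
 also have "... <= K * (1 + norm (Complex 0 y)) powr (-p)" by (rule bound) simp
 finally have K: "0 <= K" by (auto simp: zero_le_mult_iff add_nonneg_eq_0_iff powr_def split: if_splits)
 have Ceq: "Complex t y = of_real t + \<i> * of_real y" for t by (simp add: complex_eq_iff)
 have gcont: "continuous_on UNIV g"
 proof -
  have "continuous_on UNIV (%t. of_real t + \<i> * of_real y)" by (intro continuous_intros)
  moreover have "range (%t. of_real t + \<i> * of_real y) \<subseteq> {z. c < Im z}" using y by auto
  ultimately show ?thesis unfolding g_def Ceq
   by (rule continuous_on_compose2[OF holomorphic_on_imp_continuous_on[OF hol]])
 qed
 have [measurable]: "g \<in> bm borel" by (rule borel_measurable_continuous_onI[OF gcont])
 have gb: "norm (g t) <= K * (1 + \<bar>t\<bar>) powr (-p)" for t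
 proof -
  have "\<bar>t\<bar> <= norm (Complex t y)" using abs_Re_le_cmod[of "Complex t y"] by simp
  then have "(1 + norm (Complex t y)) powr (-p) <= (1 + \<bar>t\<bar>) powr (-p)" using p by (intro powr_mono2') auto
  then show ?thesis using bound[of "Complex t y"] mult_left_mono[OF _ K] unfolding g_def by (force intro: order_trans)
 qed
 have wi: "L1 (%t. K * (1 + \<bar>t\<bar>) powr (-p))"
  using powr_decay_integrable[OF p] by simp
 have gi: "L1 g"
  by (rule integrable_dominated[OF wi]) (use gb K in \<open>auto intro!: AE_I2\<close>)
 define I where "I n = (LBINT t. indicator {-real n..real n} t *\<^sub>R g t)" for n :: nat
 have lim1: "I \<longlonglongrightarrow> (LBINT t. g t)"
  unfolding I_def
 proof (rule integral_dominated_convergence[where w = "%t. K * (1 + \<bar>t\<bar>) powr (-p)"])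
  show "AE t in lborel. (%n. indicator {-real n..real n} t *\<^sub>R g t) \<longlonglongrightarrow> g t"
  proof (rule AE_I2)
   fix t
   obtain m where m: "\<bar>t\<bar> <= real m" using real_arch_simple by blast
   have "\<forall>\<^sub>F n in sequentially. g t = indicator {-real n..real n} t *\<^sub>R g t"
    unfolding eventually_sequentially
    by (rule exI[of _ m]) (use m in \<open>auto simp: indicator_def\<close>)
   then show "(%n. indicator {-real n..real n} t *\<^sub>R g t) \<longlonglongrightarrow> g t"
    by (rule Lim_transform_eventually[OF tendsto_const])
  qed
  show "AE t in lborel. norm (indicator {-real n..real n} t *\<^sub>R g t) <= K * (1 + \<bar>t\<bar>) powr (-p)" for n
   using gb K by (auto intro!: AE_I2 simp: indicator_def)
 qed (use wi in auto)
 have Ibd: "norm (I n) <= 4 * K * (1 + real n) powr (1 - p)" for n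
 proof -
  define a b d e where "a = Complex (real n) y" and "b = Complex (real n) (y + real n)"
   and "d = Complex (- real n) (y + real n)" and "e = Complex (- real n) y"
  have "I n = \<Gamma> (Complex (real n) y) - \<Gamma> (Complex (- real n) y)"
   unfolding I_def
  proof (rule integral_FTC_Icc)
   show "- real n <= real n" by simp
   show "continuous_on {- real n..real n} g" using gcont continuous_on_subset by blast
   fix t
   have "((%t. of_real t + \<i> * of_real y) has_vector_derivative 1) (at t)"
    by (auto intro!: derivative_eq_intros simp: has_vector_derivative_def scaleR_conv_of_real)
   from field_vector_diff_chain_at[OF this, of \<Gamma> "g t"]
   have "((%t. \<Gamma> (Complex t y)) has_vector_derivative g t) (at t)"
    using \<Gamma>'[of "Complex t y"] y unfolding g_def o_def Ceq by simp
   then show "((%t. \<Gamma> (Complex t y)) has_vector_derivative g t) (at t within {- real n..real n})"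
    by (rule has_vector_derivative_at_within)
  qed
  then have I: "I n = (\<Gamma> a - \<Gamma> b) + (\<Gamma> b - \<Gamma> d) + (\<Gamma> d - \<Gamma> e)" by (simp add: a_def b_def d_def e_def)
  define B where "B = K * (1 + real n) powr (-p)"
  have seg: "norm (\<Gamma> u - \<Gamma> v) <= B * norm (u - v)"
   if uv: "y <= Im u" "y <= Im v" and far: "!!z. z \<in> closed_segment u v ==> real n <= norm z" for u v
  proof (rule field_differentiable_bound)
   fix z assume z: "z \<in> closed_segment u v"
   have iz: "y <= Im z" by (rule Im_closed_segment_ge[OF uv z])
   show "(\<Gamma> has_field_derivative G z) (at z within closed_segment u v)"
    by (rule has_field_derivative_at_within[OF \<Gamma>']) (use iz y in auto)
   have "(1 + norm z) powr (-p) <= (1 + real n) powr (-p)" using far[OF z] p by (intro powr_mono2') auto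
   from mult_left_mono[OF this K] show "norm (G z) <= B"
    using bound[OF iz] unfolding B_def by linarith
  qed auto
  have "norm (\<Gamma> a - \<Gamma> b) <= B * norm (a - b)"
  proof (rule seg)
   fix z assume "z \<in> closed_segment a b"
   then have "Re z = real n" by (rule Re_closed_segment[rotated 2]) (auto simp: a_def b_def)
   then show "real n <= norm z" using abs_Re_le_cmod[of z] by simp
  qed (auto simp: a_def b_def)
  moreover have "norm (\<Gamma> b - \<Gamma> d) <= B * norm (b - d)"
  proof (rule seg)
   fix z assume "z \<in> closed_segment b d"
   then have z: "Im z = y + real n" by (rule Im_closed_segment[rotated 2]) (auto simp: b_def d_def)
   have r: "\<bar>Re z\<bar> <= norm z" by (rule abs_Re_le_cmod)
   show "real n <= norm z" using z c y abs_Im_le_cmod[of z] by simp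
  qed (auto simp: b_def d_def)
  moreover have "norm (\<Gamma> d - \<Gamma> e) <= B * norm (d - e)"
  proof (rule seg)
   fix z assume "z \<in> closed_segment d e"
   then have "Re z = - real n" by (rule Re_closed_segment[rotated 2]) (auto simp: d_def e_def)
   then show "real n <= norm z" using abs_Re_le_cmod[of z] by simp
  qed (auto simp: d_def e_def)
  moreover have "norm (a - b) = real n" "norm (d - e) = real n" "norm (b - d) = 2 * real n"
   by (simp_all add: a_def b_def d_def e_def cmod_def real_sqrt_mult)
  ultimately have "norm (I n) <= B * real n + B * (2 * real n) + B * real n"
   unfolding I using norm_triangle_ineq[of "(\<Gamma> a - \<Gamma> b) + (\<Gamma> b - \<Gamma> d)" "\<Gamma> d - \<Gamma> e"] norm_triangle_ineq[of "\<Gamma> a - \<Gamma> b" "\<Gamma> b - \<Gamma> d"] by simp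
  also have "... = 4 * (B * real n)" by simp
  also have "... <= 4 * (B * (1 + real n))" using K by (intro mult_left_mono) (auto simp: B_def)
  also have "... = 4 * K * (1 + real n) powr (1 - p)"
   by (simp add: B_def powr_diff powr_minus divide_simps)
  finally show ?thesis .
 qed
 have lim2: "I \<longlonglongrightarrow> 0"
 proof (rule Lim_null_comparison)
  show "\<forall>\<^sub>F n in sequentially. norm (I n) <= 4 * K * (1 + real n) powr (1 - p)" using Ibd by simp
  have "((%n. (1 + real n) powr (1 - p)) \<longlonglongrightarrow> 0)"
  proof (rule tendsto_neg_powr)
   show "1 - p < 0" using p by simp
   show "filterlim (%n. 1 + real n) at_top sequentially"
    by (rule filterlim_tendsto_add_at_top[OF tendsto_const filterlim_real_sequentially])
  qed
  from tendsto_mult_right_zero[OF this, of "4 * K"] show "(%n. 4 * K * (1 + real n) powr (1 - p)) \<longlonglongrightarrow> 0" .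
 qed
 show "L1 (%t. G (Complex t y))" using gi unfolding g_def .
 show "(LBINT t. G (Complex t y)) = 0" using LIMSEQ_unique[OF lim1 lim2] unfolding g_def .
qed

text \<open>In polar form the claim reads 1 <= A (cos \<phi>)^p - B cos (p \<phi>) for |\<phi>| < pi
  / 2. Close to the ends of this range the second term has the right sign, as pi / 2 < p |\<phi>| <
  pi there; elsewhere cos \<phi> is bounded below and a large \<open>A\<close> wins.\<close>

lemma angle_inequality:
 fixes p :: real
 assumes p: "1 < p" "p < 2"
 obtains A B where "A > 0" "B >= 0"
  "!!z. Re z > 0 ==> norm z powr p <= A * (Re z) powr p - B * Re (z powr of_real p)"
proof -
 \<comment> \<open>The midpoint of pi / (2 p), where cos (p \<phi>) changes sign, and pi /
   2.\<close>
 define \<theta> where "\<theta> = pi / 4 + pi / (4 * p)"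
 have p\<theta>: "p * \<theta> = pi * p / 4 + pi / 4" using p by (simp add: \<theta>_def field_simps)
 have \<theta>: "0 < \<theta>" "\<theta> < pi / 2" using p by (auto simp: \<theta>_def field_simps add_pos_pos)
 have p\<theta>1: "pi / 2 < p * \<theta>" "p * \<theta> < pi" unfolding p\<theta> using p pi_gt_zero
  by (auto simp: field_simps)
 have c: "cos (p * \<theta>) < 0"
  using cos_monotone_0_pi[of "pi / 2" "p * \<theta>"] p\<theta>1 by simp
 have c\<theta>: "cos \<theta> > 0" using \<theta> by (intro cos_gt_zero_pi) auto
 define B where "B = 1 / (- cos (p * \<theta>))"
 define A where "A = (1 + B) / (cos \<theta>) powr p"
 have B: "B > 0" using c by (simp add: B_def)
 have A: "A > 0" using c\<theta> B by (simp add: A_def)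
 have key: "1 <= A * (cos \<phi>) powr p - B * cos (p * \<phi>)" if "\<bar>\<phi>\<bar> < pi / 2" for \<phi>
 proof (cases "\<bar>\<phi>\<bar> < \<theta>")
  case True
  have "cos \<theta> <= cos \<bar>\<phi>\<bar>" using True \<theta> by (intro cos_monotone_0_pi_le) auto
  then have "(cos \<theta>) powr p <= (cos \<phi>) powr p" using c\<theta> p by (intro powr_mono2) auto
  then have "A * (cos \<theta>) powr p <= A * (cos \<phi>) powr p" using A by (intro mult_left_mono) auto
  moreover have "A * (cos \<theta>) powr p = 1 + B" using c\<theta> by (simp add: A_def)
  moreover have "B * cos (p * \<phi>) <= B * 1" using B by (intro mult_left_mono) auto
  ultimately show ?thesis by linarith
 next
  case False
  have "p * \<theta> <= p * \<bar>\<phi>\<bar>" "p * \<bar>\<phi>\<bar> <= p * (pi / 2)" using False that p by auto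
  moreover have "p * (pi / 2) <= pi" using p by simp
  moreover have "0 <= p * \<theta>" using \<theta> p by simp
  ultimately have "cos (p * \<bar>\<phi>\<bar>) <= cos (p * \<theta>)" by (intro cos_monotone_0_pi_le) linarith+
  moreover have "cos (p * \<bar>\<phi>\<bar>) = cos (p * \<phi>)" by (cases "\<phi> >= 0") auto
  ultimately have "B * cos (p * \<phi>) <= B * cos (p * \<theta>)" using B by (intro mult_left_mono) auto
  moreover have "B * cos (p * \<theta>) = -1" using c by (simp add: B_def)
  moreover have "0 <= A * (cos \<phi>) powr p" using A by simp
  ultimately show ?thesis by linarith
 qed
 show thesis
 proof (rule that[of A B])
  fix z :: complex assume z: "Re z > 0"
  then have nz: "z ~= 0" by auto
  have arg: "\<bar>Arg z\<bar> < pi / 2" using z Arg_Re_pos by blast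
  have 1: "Re z = norm z * cos (Arg z)" using cos_Arg[OF nz] nz by simp
  have 2: "Re (z powr of_real p) = norm z powr p * cos (p * Arg z)"
   using nz by (simp add: powr_def Ln_Arg Re_exp distrib_left)
  have cp: "0 < cos (Arg z)" using arg by (intro cos_gt_zero_pi) auto
  have "norm z powr p * 1 <= norm z powr p * (A * (cos (Arg z)) powr p - B * cos (p * Arg z))"
   by (rule mult_left_mono[OF key[OF arg]]) simp
  also have "... = A * (Re z) powr p - B * Re (z powr of_real p)"
   unfolding 2 1 using cp by (simp add: powr_mult algebra_simps)
  finally show "norm z powr p <= A * (Re z) powr p - B * Re (z powr of_real p)" by simp
 qed (use A B in auto)
qed

lemma Im_cauchyT_real:
 fixes f :: "real => real"
 assumes f: "L1 f" and y: "y > 0"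
 shows "L1 (%x. f x * (y / ((x - t)^2 + y^2)))"
  "Im (cauchyT (%x. of_real (f x)) (Complex t y)) = (LBINT x. f x * (y / ((x - t)^2 + y^2)))"
proof -
 have fi: "L1 (%x. cr (f x))" using f by simp
 have i: "L1 (%x. cr (f x) / (cr x - Complex t y))"
  by (rule cauchy_integrable[OF fi]) (use y in simp)
 have pt: "Im (cr (f x) / (cr x - Complex t y)) = f x * (y / ((x - t)^2 + y^2))" for x
  by (simp add: Im_divide power2_eq_square)
 show "L1 (%x. f x * (y / ((x - t)^2 + y^2)))"
  using integrable_Im[OF i] unfolding pt .
 show "Im (cauchyT (%x. of_real (f x)) (Complex t y)) = (LBINT x. f x * (y / ((x - t)^2 + y^2)))"
  unfolding cauchyT_def using integral_Im[OF i] unfolding pt by simp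
qed

text \<open>Convexity of s^p in tangent form, obtained from Young's inequality with the conjugate
  exponents p and p / (p - 1).\<close>

lemma powr_tangent:
 fixes a m p :: real
 assumes p: "p > 1" and a: "a >= 0" and m: "m > 0"
 shows "m powr p + p * m powr (p - 1) * (a - m) <= a powr p"
proof -
 define q where "q = p / (p - 1)"
 have q: "q > 1" "1 / p + 1 / q = 1" using p by (auto simp: q_def field_simps)
 have "a * m powr (p - 1) <= a powr p / p + (m powr (p - 1)) powr q / q"
  by (rule Youngs_inequality) (use p q a in auto)
 also have "(m powr (p - 1)) powr q = m powr p" using p by (simp add: powr_powr q_def)
 finally have "p * (a * m powr (p - 1)) <= p * (a powr p / p + m powr p / q)" using p by (intro mult_left_mono) auto
 also have "... = a powr p + (p - 1) * m powr p" using p by (simp add: q_def field_simps)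
 finally have "p * (a * m powr (p - 1)) <= a powr p + (p - 1) * m powr p" .
 moreover have "m powr (p - 1) * m = m powr p" using m by (simp add: powr_diff)
 ultimately show ?thesis by (simp add: algebra_simps)
qed

text \<open>Jensen's inequality for the probability density given by the Poisson kernel over pi,
  from the tangent of s^p at the mean \<open>m\<close>.\<close>

lemma poisson_jensen:
 fixes f :: "real => real"
 assumes f: "L1 f" "!!x. f x >= 0" and fp: "L1 (%x. f x powr p)"
  and y: "y > 0" and p: "p > 1"
 shows "((LBINT x. f x * (y / ((x - t)^2 + y^2))) / pi) powr p <= (LBINT x. f x powr p * (y / ((x - t)^2 + y^2))) / pi"
proof -
 define k where "k x = y / ((x - t)^2 + y^2)" for x
 have k0: "k x >= 0" for x using y by (simp add: k_def)
 have ki: "L1 k" "(LBINT x. k x) = pi"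
  using poisson_kernel_integral[OF y, of t] by (simp_all add: k_def[abs_def])
 have fk: "L1 (%x. f x * k x)" "L1 (%x. f x powr p * k x)"
  using Im_cauchyT_real(1)[OF f(1) y, of t] Im_cauchyT_real(1)[OF fp y, of t] by (simp_all add: k_def)
 define m where "m = (LBINT x. f x * k x) / pi"
 have m0: "m >= 0" unfolding m_def using f(2) k0 by (intro divide_nonneg_pos Bochner_Integration.integral_nonneg) auto
 show ?thesis
 proof (cases "m = 0")
  case True
  have "0 <= (LBINT x. f x powr p * k x) / pi" using k0 by (intro divide_nonneg_pos Bochner_Integration.integral_nonneg) auto
  then show ?thesis using True p unfolding m_def k_def by simp
 next
  case False
  then have m: "m > 0" using m0 by simp
  have i: "L1 (%x. (m powr p - p * m powr (p - 1) * m) * k x + p * m powr (p - 1) * (f x * k x))"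
   using ki fk by auto
  have "(LBINT x. (m powr p - p * m powr (p - 1) * m) * k x + p * m powr (p - 1) * (f x * k x)) <= (LBINT x. f x powr p * k x)"
  proof (rule integral_mono[OF i fk(2)])
   fix x
   show "(m powr p - p * m powr (p - 1) * m) * k x + p * m powr (p - 1) * (f x * k x) <= f x powr p * k x"
    using mult_right_mono[OF powr_tangent[OF p f(2)[of x] m] k0[of x]] by (simp add: algebra_simps)
  qed
  also have "(LBINT x. (m powr p - p * m powr (p - 1) * m) * k x + p * m powr (p - 1) * (f x * k x))
    = (m powr p - p * m powr (p - 1) * m) * pi + p * m powr (p - 1) * (LBINT x. f x * k x)"
   using ki fk by simp
  also have "(LBINT x. f x * k x) = m * pi" by (simp add: m_def)
  finally have "m powr p * pi <= (LBINT x. f x powr p * k x)" by (simp add: algebra_simps)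
  then have "m powr p <= (LBINT x. f x powr p * k x) / pi" by (simp add: pos_le_divide_eq)
  then show ?thesis unfolding m_def k_def .
 qed
qed

text \<open>For \<open>f\<close> >= 0, not a.e. zero, H = - i C f has positive real part in the
  upper half-plane (C denotes the Cauchy transform), so H^p is holomorphic there and integrates to
  zero over horizontal lines. In the angle inequality only A (Re H)^p survives; Re H is pi times a
  Poisson integral, which Jensen and Fubini bound in L^p.\<close>

lemma riesz_nonneg:
 fixes p :: real
 assumes p: "1 < p" "p < 2"
 obtains C where "C > 0" "!!f y. L1 f ==> (!!x. f x >= 0) ==> (!!x. \<bar>x\<bar> > 1 ==> f x = 0) ==>
   L1 (%x. f x powr p) ==> y > 0 ==>
   (NN t. ennreal (norm (cauchyT (%x. of_real (f x)) (Complex t y)) powr p)) <= ennreal C * (NN x. ennreal (f x powr p))"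
proof -
 obtain A B where A: "A > 0" and B: "B >= 0"
  and AB: "!!z. Re z > 0 ==> norm z powr p <= A * (Re z) powr p - B * Re (z powr of_real p)"
  using angle_inequality[OF p] by blast
 show thesis
 proof (rule that[of "A * pi powr p"])
  show "A * pi powr p > 0" using A by simp
  fix f :: "real => real" and y :: real
  assume f: "L1 f" "!!x. f x >= 0" and supp: "!!x. \<bar>x\<bar> > 1 ==> f x = 0"
   and fp: "L1 (%x. f x powr p)" and y: "y > 0"
  have [measurable]: "f \<in> bm borel" using f by auto
  define F where "F x = cr (f x)" for x
  have Fi: "L1 F" unfolding F_def using f by simp
  define H where "H z = - \<i> * cauchyT F z" for z
  define u where "u t = Im (cauchyT F (Complex t y))" for t
  have ReH: "Re (H z) = Im (cauchyT F z)" for z by (simp add: H_def)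
  show "(NN t. ennreal (norm (cauchyT (%x. of_real (f x)) (Complex t y)) powr p)) <= ennreal (A * pi powr p) * (NN x. ennreal (f x powr p))"
  \<comment> \<open>Unless \<open>f\<close> vanishes a.e., the imaginary part of its Cauchy
    transform is strictly positive, which keeps H off the branch cut of the power.\<close>
  proof (cases "AE x in lborel. f x = 0")
   case True
   have "cauchyT F z = 0" for z
    unfolding cauchyT_def F_def
    by (rule integral_eq_zero_AE) (use True in \<open>auto elim: eventually_mono\<close>)
   then show ?thesis using p unfolding F_def by simp
  next
   case False
   have pos: "Im (cauchyT F z) > 0" if z: "Im z > 0" for z
   proof -
    define k where "k x = f x * (Im z / ((x - Re z)^2 + (Im z)^2))" for x
    have kp: "0 < Im z / ((x - Re z)^2 + (Im z)^2)" for x using z by (simp add: add_nonneg_pos)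
    have k: "L1 k" "Im (cauchyT F z) = (LBINT x. k x)"
     using Im_cauchyT_real[OF f(1) z, of "Re z"] unfolding F_def k_def by auto
    have k0: "k x >= 0" for x unfolding k_def using f(2)[of x] less_imp_le[OF kp[of x]] by (rule mult_nonneg_nonneg)
    have "(LBINT x. k x) ~= 0"
    proof
     assume "(LBINT x. k x) = 0"
     then have "AE x in lborel. k x = 0" using integral_nonneg_eq_0_iff_AE[OF k(1)] k0 by simp
     then have "AE x in lborel. f x = 0"
      by eventually_elim (use kp in \<open>auto simp: k_def\<close>)
     then show False using False by simp
    qed
    moreover have "(LBINT x. k x) >= 0" using k0 by (intro Bochner_Integration.integral_nonneg) auto
    ultimately show ?thesis using k(2) by simp
   qed
   define G where "G z = H z powr of_real p" for z
   define M where "M = (LBINT x. norm (F x)) * ((y + 2) / y)"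
   have M: "M >= 0" unfolding M_def using y by (intro mult_nonneg_nonneg Bochner_Integration.integral_nonneg) auto
   have Hb: "norm (H z) <= M / (1 + norm z)" if "Im z >= y" for z
    using cauchyT_decay[OF Fi _ y, of z] supp that y unfolding H_def M_def F_def by (simp add: norm_mult)
   have nG: "norm (G z) = norm (H z) powr p" for z
    unfolding G_def using norm_powr_real_powr'[of "of_real p" "H z"] by simp
   have hol: "G holomorphic_on {z. Im z > 0}"
   proof -
    have "cauchyT F holomorphic_on {z. Im z > 0}" by (rule cauchyT_holomorphic[OF Fi]) auto
    then have "H holomorphic_on {z. Im z > 0}" unfolding H_def by (intro holomorphic_intros)
    then show ?thesis unfolding G_def
     by (intro holomorphic_intros) (use pos ReH complex_nonpos_Reals_iff in \<open>auto simp: not_le\<close>)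
   qed
   have Gb: "norm (G z) <= M powr p * (1 + norm z) powr (-p)" if "Im z >= y" for z
   proof -
    have "norm (G z) <= (M / (1 + norm z)) powr p" unfolding nG using Hb[OF that] p by (intro powr_mono2) auto
    also have "... = M powr p * (1 + norm z) powr (-p)"
     using M by (simp add: powr_divide powr_minus divide_simps)
    finally show ?thesis .
   qed
   note G = halfplane_line_integral[OF hol order_refl y p(1) Gb]
   have Hi: "L1 (%t. norm (H (Complex t y)) powr p)"
    using integrable_norm[OF G(1)] unfolding nG .
   have Hm [measurable]: "(%t. H (Complex t y)) \<in> bm lborel"
   proof -
    have "continuous_on UNIV (%t. H (of_real t + \<i> * of_real y))"
     unfolding H_def
     by (intro continuous_intros continuous_on_compose2[OF holomorphic_on_imp_continuous_on[OF cauchyT_holomorphic[OF Fi, of "{z. Im z ~= 0}"]]])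
       (use y in auto)
    moreover have "Complex t y = of_real t + \<i> * of_real y" for t by (simp add: complex_eq_iff)
    ultimately show ?thesis using borel_measurable_continuous_onI by simp
   qed
   have u0: "u t > 0" for t unfolding u_def using pos y by simp
   have um [measurable]: "u \<in> bm lborel"
   proof -
    have "(%t. Re (H (Complex t y))) \<in> bm lborel" by measurable
    then show ?thesis unfolding ReH u_def by simp
   qed
   have ui: "L1 (%t. u t powr p)"
   proof (rule integrable_dominated[OF Hi])
    show "AE t in lborel. norm (u t powr p) <= norm (norm (H (Complex t y)) powr p)"
    proof (rule AE_I2)
     fix t
     have "u t <= norm (H (Complex t y))" using complex_Re_le_cmod[of "H (Complex t y)"] unfolding ReH u_def by simp
     then show "norm (u t powr p) <= norm (norm (H (Complex t y)) powr p)"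
      using u0[of t] p by (simp add: powr_mono2)
    qed
   qed measurable
   have rhs: "L1 (%t. A * u t powr p - B * Re (G (Complex t y)))"
    using ui integrable_Re[OF G(1)] by (intro integrable_sub integrable_mult_right)
   have "(LBINT t. norm (H (Complex t y)) powr p) <= (LBINT t. A * u t powr p - B * Re (G (Complex t y)))"
    by (rule integral_mono[OF Hi rhs]) (use AB[of "H (Complex _ y)"] pos y in \<open>simp add: ReH u_def G_def\<close>)
   also have "... = A * (LBINT t. u t powr p) - B * (LBINT t. Re (G (Complex t y)))"
    using ui integrable_Re[OF G(1)] by simp
   also have "(LBINT t. Re (G (Complex t y))) = 0" using integral_Re[OF G(1)] G(2) by simp
   finally have 1: "(LBINT t. norm (H (Complex t y)) powr p) <= A * (LBINT t. u t powr p)" by simp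
   have ub: "u t powr p <= pi powr p * ((LBINT x. f x powr p * (y / ((x - t)^2 + y^2))) / pi)" for t
   proof -
    have ueq: "u t = (LBINT x. f x * (y / ((x - t)^2 + y^2)))"
     unfolding u_def F_def by (rule Im_cauchyT_real(2)[OF f(1) y])
    have "u t powr p = pi powr p * (u t / pi) powr p" using u0[of t] by (simp add: powr_divide)
    also have "... <= pi powr p * ((LBINT x. f x powr p * (y / ((x - t)^2 + y^2))) / pi)"
     unfolding ueq by (intro mult_left_mono poisson_jensen[OF f fp y p(1)]) simp
    finally show ?thesis .
   qed
   have "(NN t. ennreal (u t powr p)) <= (NN t. ennreal (pi powr p / pi) * (NN x. ennreal (f x powr p) * ennreal (y / ((x - t)^2 + y^2))))"
   proof (rule nn_integral_mono)
    fix t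
    have "ennreal (u t powr p) <= ennreal (pi powr p / pi * (LBINT x. f x powr p * (y / ((x - t)^2 + y^2))))"
     using ub[of t] by (intro ennreal_leI) simp
    also have "... = ennreal (pi powr p / pi) * ennreal (LBINT x. f x powr p * (y / ((x - t)^2 + y^2)))"
     using y by (intro ennreal_mult Bochner_Integration.integral_nonneg) auto
    also have "ennreal (LBINT x. f x powr p * (y / ((x - t)^2 + y^2))) = (NN x. ennreal (f x powr p * (y / ((x - t)^2 + y^2))))"
     using Im_cauchyT_real(1)[OF fp y, of t] y by (intro nn_integral_eq_integral[symmetric]) auto
    also have "... = (NN x. ennreal (f x powr p) * ennreal (y / ((x - t)^2 + y^2)))"
     using y by (intro nn_integral_cong ennreal_mult) auto
    finally show "ennreal (u t powr p) <= ennreal (pi powr p / pi) * (NN x. ennreal (f x powr p) * ennreal (y / ((x - t)^2 + y^2)))" .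
   qed
   also have "... = ennreal (pi powr p / pi) * (NN t. (NN x. ennreal (f x powr p) * ennreal (y / ((x - t)^2 + y^2))))"
    by (rule nn_integral_cmult) measurable
   also have "(NN t. (NN x. ennreal (f x powr p) * ennreal (y / ((x - t)^2 + y^2))))
     = (NN x. (NN t. ennreal (f x powr p) * ennreal (y / ((x - t)^2 + y^2))))"
    by (rule lborel_pair.Fubini') measurable
   also have "... = (NN x. ennreal pi * ennreal (f x powr p))"
   proof (rule nn_integral_cong)
    fix x
    have "(NN t. ennreal (f x powr p) * ennreal (y / ((x - t)^2 + y^2))) = ennreal (f x powr p) * (NN t. ennreal (y / ((t - x)^2 + y^2)))"
     by (subst nn_integral_cmult) (auto simp: power2_commute)
    then show "(NN t. ennreal (f x powr p) * ennreal (y / ((x - t)^2 + y^2))) = ennreal pi * ennreal (f x powr p)"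
     using poisson_kernel_nn_integral[OF y, of x] by (simp add: mult.commute)
   qed
   also have "... = ennreal pi * (NN x. ennreal (f x powr p))"
    by (rule nn_integral_cmult) measurable
   also have "ennreal (pi powr p / pi) * (ennreal pi * (NN x. ennreal (f x powr p))) = ennreal (pi powr p) * (NN x. ennreal (f x powr p))"
    by (simp add: mult.assoc[symmetric] flip: ennreal_mult)
   finally have 2: "(NN t. ennreal (u t powr p)) <= ennreal (pi powr p) * (NN x. ennreal (f x powr p))" .
   have "(NN t. ennreal (norm (cauchyT F (Complex t y)) powr p)) = (NN t. ennreal (norm (H (Complex t y)) powr p))"
    by (simp add: H_def norm_mult)
   also have "... = ennreal (LBINT t. norm (H (Complex t y)) powr p)"
    by (rule nn_integral_eq_integral[OF Hi]) simp
   also have "... <= ennreal (A * (LBINT t. u t powr p))" by (rule ennreal_leI[OF 1])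
   also have "... = ennreal A * ennreal (LBINT t. u t powr p)"
    using A by (intro ennreal_mult Bochner_Integration.integral_nonneg) auto
   also have "ennreal (LBINT t. u t powr p) = (NN t. ennreal (u t powr p))"
    by (rule nn_integral_eq_integral[symmetric, OF ui]) simp
   also have "ennreal A * ... <= ennreal A * (ennreal (pi powr p) * (NN x. ennreal (f x powr p)))"
    by (rule mult_left_mono[OF 2]) simp
   also have "... = ennreal (A * pi powr p) * (NN x. ennreal (f x powr p))"
    using A by (simp add: mult.assoc ennreal_mult)
   finally show ?thesis unfolding F_def .
  qed
 qed
qed

lemma powr_sum4_le:
 fixes a b c d :: real
 assumes "a >= 0" "b >= 0" "c >= 0" "d >= 0" "p > 0"
 shows "(a + b + c + d) powr p <= 4 powr p * (a powr p + b powr p + c powr p + d powr p)"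
proof -
 define m where "m = max (max a b) (max c d)"
 have m: "m >= 0" "a + b + c + d <= 4 * m" unfolding m_def using assms by auto
 have "m powr p <= a powr p + b powr p + c powr p + d powr p"
  unfolding m_def max_def using assms by auto
 moreover have "(a + b + c + d) powr p <= (4 * m) powr p" using m assms by (intro powr_mono2) auto
 moreover have "(4 * m) powr p = 4 powr p * m powr p" using m by (simp add: powr_mult)
 ultimately show ?thesis by (smt (verit) mult_left_mono powr_ge_zero)
qed

text \<open>Split into the positive and negative parts of the real and imaginary part. The factor
  4^p comes from the power of a sum of four terms, the factor 4 from adding their four
  integrals.\<close>

theorem riesz_cauchyT:
 fixes p :: real
 assumes p: "1 < p" "p < 2"
 obtains C where "C > 0" "!!f y. L1 f ==> (!!x. \<bar>x\<bar> > 1 ==> f x = 0) ==>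
   L1 (%x. norm (f x) powr p) ==> y > 0 ==>
   (NN t. ennreal (norm (cauchyT f (Complex t y)) powr p)) <= ennreal C * (NN x. ennreal (norm (f x) powr p))"
proof -
 obtain C where C: "C > 0" and Cb: "!!f y. L1 f ==> (!!x. f x >= 0) ==> (!!x. \<bar>x\<bar> > 1 ==> f x = 0) ==>
   L1 (%x. f x powr p) ==> y > 0 ==>
   (NN t. ennreal (norm (cauchyT (%x. of_real (f x)) (Complex t y)) powr p)) <= ennreal C * (NN x. ennreal (f x powr p))"
  using riesz_nonneg[OF p] by blast
 show thesis
 proof (rule that[of "4 powr p * (4 * C)"])
  show "4 powr p * (4 * C) > 0" using C by simp
  fix f :: "real => complex" and y :: real
  assume f: "L1 f" and supp: "!!x. \<bar>x\<bar> > 1 ==> f x = 0"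
   and fp: "L1 (%x. norm (f x) powr p)" and y: "y > 0"
  have [measurable]: "f \<in> bm lborel" using f by auto
  define R where "R = (NN x. ennreal (norm (f x) powr p))"
  define c where "c g t = cauchyT (%x. cr (g x)) (Complex t y)" for g t
  have one: "L1 g & c g \<in> bm lborel & (NN t. ennreal (norm (c g t) powr p)) <= ennreal C * R"
   if g: "g \<in> bm lborel" "!!x. 0 <= g x" "!!x. g x <= norm (f x)" for g :: "real => real"
  proof -
   note [measurable] = g(1)
   have gi: "L1 g"
    by (rule integrable_dominated[OF f]) (use g in \<open>auto intro!: AE_I2\<close>)
   have gp: "L1 (%x. g x powr p)"
    by (rule integrable_dominated[OF fp]) (use g p in \<open>auto intro!: AE_I2 powr_mono2\<close>)
   have "(NN t. ennreal (norm (c g t) powr p)) <= ennreal C * (NN x. ennreal (g x powr p))"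
    unfolding c_def
   proof (rule Cb[OF gi g(2) _ gp y])
    show "g x = 0" if "\<bar>x\<bar> > 1" for x using supp[OF that] g(2,3)[of x] by simp
   qed
   also have "... <= ennreal C * R"
    unfolding R_def using g p by (intro mult_left_mono nn_integral_mono ennreal_leI powr_mono2) auto
   finally have "(NN t. ennreal (norm (c g t) powr p)) <= ennreal C * R" .
   moreover have "c g \<in> bm lborel"
   proof -
    have gi': "L1 (%x. cr (g x))" using gi by simp
    have "continuous_on UNIV (%t. cauchyT (%x. cr (g x)) (of_real t + \<i> * of_real y))"
     by (intro continuous_on_compose2[OF holomorphic_on_imp_continuous_on[OF cauchyT_holomorphic[OF gi', of "{z. Im z ~= 0}"]]] continuous_intros)
       (use y in auto)
    moreover have "Complex t y = of_real t + \<i> * of_real y" for t by (simp add: complex_eq_iff)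
    ultimately show ?thesis unfolding c_def using borel_measurable_continuous_onI by simp
   qed
   ultimately show ?thesis using gi by blast
  qed
  define g1 g2 g3 g4 where "g1 x = max 0 (Re (f x))" and "g2 x = max 0 (- Re (f x))"
   and "g3 x = max 0 (Im (f x))" and "g4 x = max 0 (- Im (f x))" for x
  have gm [measurable]: "g1 \<in> bm borel" "g2 \<in> bm borel"
   "g3 \<in> bm borel" "g4 \<in> bm borel"
   unfolding g1_def g2_def g3_def g4_def by measurable
  have o1: "L1 g1 & c g1 \<in> bm lborel & (NN t. ennreal (norm (c g1 t) powr p)) <= ennreal C * R"
   by (rule one) (use abs_Re_le_cmod[of "f _"] in \<open>auto simp: g1_def abs_le_iff\<close>)
  have o2: "L1 g2 & c g2 \<in> bm lborel & (NN t. ennreal (norm (c g2 t) powr p)) <= ennreal C * R"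
   by (rule one) (use abs_Re_le_cmod[of "f _"] in \<open>auto simp: g2_def abs_le_iff\<close>)
  have o3: "L1 g3 & c g3 \<in> bm lborel & (NN t. ennreal (norm (c g3 t) powr p)) <= ennreal C * R"
   by (rule one) (use abs_Im_le_cmod[of "f _"] in \<open>auto simp: g3_def abs_le_iff\<close>)
  have o4: "L1 g4 & c g4 \<in> bm lborel & (NN t. ennreal (norm (c g4 t) powr p)) <= ennreal C * R"
   by (rule one) (use abs_Im_le_cmod[of "f _"] in \<open>auto simp: g4_def abs_le_iff\<close>)
  have yz: "Im (Complex t y) ~= 0" for t using y by simp
  have dec: "cauchyT f (Complex t y) = (c g1 t - c g2 t) + \<i> * (c g3 t - c g4 t)" for t
  proof -
   have i: "L1 (%x. cr (g1 x))" "L1 (%x. cr (g2 x))"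
    "L1 (%x. cr (g3 x))" "L1 (%x. cr (g4 x))"
    using o1 o2 o3 o4 by auto
   have feq: "f = (%x. (cr (g1 x) - cr (g2 x)) + \<i> * (cr (g3 x) - cr (g4 x)))"
    by (auto simp: fun_eq_iff complex_eq_iff g1_def g2_def g3_def g4_def max_def)
   have "cauchyT f (Complex t y) = cauchyT (%x. cr (g1 x) - cr (g2 x)) (Complex t y) + cauchyT (%x. \<i> * (cr (g3 x) - cr (g4 x))) (Complex t y)"
    by (subst feq, rule cauchyT_add[OF _ _ yz]) (use i in auto)
   also have "... = (c g1 t - c g2 t) + \<i> * (c g3 t - c g4 t)"
    unfolding cauchyT_cmult cauchyT_diff[OF i(1,2) yz] cauchyT_diff[OF i(3,4) yz] c_def ..
   finally show ?thesis .
  qed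
  have pt: "ennreal (norm (cauchyT f (Complex t y)) powr p) <= ennreal (4 powr p) * (ennreal (norm (c g1 t) powr p) + ennreal (norm (c g2 t) powr p) + ennreal (norm (c g3 t) powr p) + ennreal (norm (c g4 t) powr p))" for t
  proof -
   have "norm (cauchyT f (Complex t y)) <= norm (c g1 t) + norm (c g2 t) + norm (c g3 t) + norm (c g4 t)"
    unfolding dec using norm_triangle_ineq[of "c g1 t - c g2 t" "\<i> * (c g3 t - c g4 t)"] norm_triangle_ineq4[of "c g1 t" "c g2 t"] norm_triangle_ineq4[of "c g3 t" "c g4 t"]
    by (simp add: norm_mult)
   then have "norm (cauchyT f (Complex t y)) powr p <= (norm (c g1 t) + norm (c g2 t) + norm (c g3 t) + norm (c g4 t)) powr p"
    using p by (intro powr_mono2) auto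
   also have "... <= 4 powr p * (norm (c g1 t) powr p + norm (c g2 t) powr p + norm (c g3 t) powr p + norm (c g4 t) powr p)"
    by (rule powr_sum4_le) (use p in auto)
   finally have "ennreal (norm (cauchyT f (Complex t y)) powr p) <= ennreal (4 powr p * (norm (c g1 t) powr p + norm (c g2 t) powr p + norm (c g3 t) powr p + norm (c g4 t) powr p))"
    by (rule ennreal_leI)
   then show ?thesis by (simp add: ennreal_mult ennreal_plus)
  qed
  have m [measurable]: "c g1 \<in> bm lborel" "c g2 \<in> bm lborel" "c g3 \<in> bm lborel" "c g4 \<in> bm lborel"
   using o1 o2 o3 o4 by blast+
  have "(NN t. ennreal (norm (cauchyT f (Complex t y)) powr p)) <=
    (NN t. ennreal (4 powr p) * (ennreal (norm (c g1 t) powr p) + ennreal (norm (c g2 t) powr p) + ennreal (norm (c g3 t) powr p) + ennreal (norm (c g4 t) powr p)))"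
   by (rule nn_integral_mono) (rule pt)
  also have "... = ennreal (4 powr p) * ((NN t. ennreal (norm (c g1 t) powr p)) + (NN t. ennreal (norm (c g2 t) powr p)) + (NN t. ennreal (norm (c g3 t) powr p)) + (NN t. ennreal (norm (c g4 t) powr p)))"
   by (simp add: nn_integral_cmult nn_integral_add)
  also have "... <= ennreal (4 powr p) * (ennreal C * R + ennreal C * R + ennreal C * R + ennreal C * R)"
   using o1 o2 o3 o4 by (intro mult_left_mono add_mono) auto
  also have "... = ennreal (4 powr p * (4 * C)) * R"
  proof -
   have "ennreal C * R + ennreal C * R + ennreal C * R + ennreal C * R = 4 * (ennreal C * R)"
   proof -
    have "(4::ennreal) = 1 + 1 + 1 + 1" by simp
    then show ?thesis by (simp only: distrib_right mult_1)
   qed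
   also have "... = ennreal (4 * C) * R" using C by (simp add: ennreal_mult mult.assoc)
   finally show ?thesis using C by (simp add: ennreal_mult mult.assoc)
  qed
  finally show "(NN t. ennreal (norm (cauchyT f (Complex t y)) powr p)) <= ennreal (4 powr p * (4 * C)) * (NN x. ennreal (norm (f x) powr p))"
   unfolding R_def .
 qed
qed

section \<open>Boundary values\<close>

lemma halfplane_dist:
 assumes d: "d > 0" "Im b <= Im z - d"
 shows "(1 + norm z) / (1 + (1 + norm b) / d) <= norm (z - b)"
proof -
 have 1: "d <= norm (z - b)" using abs_Im_le_cmod[of "z - b"] d by simp
 have 2: "norm z <= norm (z - b) + norm b" using norm_triangle_ineq[of "z - b" b] by simp
 have "1 + norm b <= norm (z - b) * ((1 + norm b) / d)"
  using mult_right_mono[OF 1, of "(1 + norm b) / d"] d by simp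
 then have "1 + norm z <= norm (z - b) * (1 + (1 + norm b) / d)"
  using 2 by (simp add: algebra_simps)
 moreover have "0 < 1 + (1 + norm b) / d" using d by (simp add: add_pos_nonneg)
 ultimately show ?thesis by (simp add: pos_divide_le_eq)
qed

text \<open>As a function of s, 1 / (x - s - i \<eta>) is holomorphic in the upper half-plane, so
  its Poisson integral is its value at s = t + i y. Subtracting this value cancels the pole of the
  Poisson kernel at t + i y, and the remainder \<open>G\<close> integrates to zero over a horizontal
  line.\<close>

lemma poisson_of_cauchy_kernel:
 assumes y: "y > 0" and \<eta>: "\<eta> > 0"
 shows "(LBINT s. (y / ((s - t)^2 + y^2)) *\<^sub>R (1 / (of_real x - Complex s \<eta>))) = of_real pi / (of_real x - Complex t (y + \<eta>))"
proof -
 \<comment> \<open>The line integral is taken at height \<sigma>. The two remaining poles, moved up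
   by \<sigma>, have to stay below the real axis, whence \<sigma> < y and \<sigma> < \<eta>.\<close>
 define \<sigma> where "\<sigma> = min y \<eta> / 2"
 have \<sigma>: "0 < \<sigma>" "\<sigma> < y" "\<sigma> < \<eta>" using y \<eta> by (auto simp: \<sigma>_def min_def)
 define a where "a = Complex x (- \<eta>)"
 define \<zeta> where "\<zeta> = Complex t y"
 have a\<zeta>: "a - \<zeta> = of_real x - Complex t (y + \<eta>)" by (simp add: a_def \<zeta>_def complex_eq_iff)
 have a\<zeta>0: "a - \<zeta> ~= 0" using y \<eta> by (auto simp: a_def \<zeta>_def complex_eq_iff)
 define b1 b2 where "b1 = Complex t (\<sigma> - y)" and "b2 = Complex x (\<sigma> - \<eta>)"
 define G where "G z = of_real y / ((z - b1) * (b2 - z) * (a - \<zeta>))" for z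
 have hol: "G holomorphic_on {z. Im z > 0}"
 proof -
  have "z ~= b1" "b2 ~= z" if "Im z > 0" for z using that \<sigma> by (auto simp: b1_def b2_def)
  then show ?thesis unfolding G_def using a\<zeta>0 by (intro holomorphic_intros) auto
 qed
 define c1 c2 where "c1 = 1 + (1 + norm b1) / y" and "c2 = 1 + (1 + norm b2) / \<eta>"
 have c: "c1 > 0" "c2 > 0" using y \<eta> by (auto simp: c1_def c2_def intro!: add_pos_nonneg)
 have bound: "norm (G z) <= y * c1 * c2 / norm (a - \<zeta>) * (1 + norm z) powr (-2)" if z: "Im z >= \<sigma>" for z
 proof -
  have 1: "(1 + norm z) / c1 <= norm (z - b1)" unfolding c1_def
   by (rule halfplane_dist) (use z y in \<open>auto simp: b1_def\<close>)
  have 2: "(1 + norm z) / c2 <= norm (b2 - z)" unfolding c2_def norm_minus_commute[of b2]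
   by (rule halfplane_dist) (use z \<eta> in \<open>auto simp: b2_def\<close>)
  have p: "0 < 1 + norm z" by (simp add: add_pos_nonneg)
  have "norm (G z) = y / (norm (z - b1) * norm (b2 - z) * norm (a - \<zeta>))"
   using y by (simp add: G_def norm_divide norm_mult)
  also have "... <= y / ((1 + norm z) / c1 * ((1 + norm z) / c2) * norm (a - \<zeta>))"
  proof (rule divide_left_mono)
   show "(1 + norm z) / c1 * ((1 + norm z) / c2) * norm (a - \<zeta>) <= norm (z - b1) * norm (b2 - z) * norm (a - \<zeta>)"
    using 1 2 c p by (intro mult_right_mono mult_mono) auto
   have "0 < (1 + norm z) / c1" "0 < (1 + norm z) / c2" using c p by auto
   then show "0 < norm (z - b1) * norm (b2 - z) * norm (a - \<zeta>) * ((1 + norm z) / c1 * ((1 + norm z) / c2) * norm (a - \<zeta>))"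
    using 1 2 a\<zeta>0 by (intro mult_pos_pos) auto
  qed (use y in auto)
  also have "... = y * c1 * c2 / norm (a - \<zeta>) * (1 + norm z) powr (-2)"
  proof -
   have "(1 + norm z) powr (-2) = 1 / ((1 + norm z) * (1 + norm z))"
    using p by (simp add: powr_minus powr_numeral power2_eq_square divide_simps)
   then show ?thesis using c p by (simp add: mult_ac)
  qed
  finally show ?thesis .
 qed
 have G0: "(LBINT s. G (Complex s \<sigma>)) = 0" and Gi: "L1 (%s. G (Complex s \<sigma>))"
  using halfplane_line_integral[OF hol order_refl \<sigma>(1) _ bound] by auto
 have ds: "(y / ((s - t)^2 + y^2)) *\<^sub>R (1 / (of_real x - Complex s \<eta>)) = G (Complex s \<sigma>) + (y / ((s - t)^2 + y^2)) *\<^sub>R (1 / (a - \<zeta>))" for s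
 proof -
  have e1: "Complex s \<sigma> - b1 = Complex (s - t) y" "b2 - Complex s \<sigma> = of_real x - Complex s \<eta>"
   by (simp_all add: b1_def b2_def complex_eq_iff)
  have n1: "Complex (s - t) y ~= 0" "Complex (s - t) (- y) ~= 0" "of_real x - Complex s \<eta> ~= 0"
   using y \<eta> by (auto simp: complex_eq_iff)
  have e2: "cr ((s - t)^2 + y^2) = Complex (s - t) y * Complex (s - t) (- y)"
   by (simp add: complex_eq_iff power2_eq_square)
  have e3: "(a - \<zeta>) - (of_real x - Complex s \<eta>) = Complex (s - t) (- y)"
   by (simp add: a_def \<zeta>_def complex_eq_iff)
  have "1 / (of_real x - Complex s \<eta>) - 1 / (a - \<zeta>) = Complex (s - t) (- y) / ((of_real x - Complex s \<eta>) * (a - \<zeta>))"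
   unfolding e3[symmetric] using n1 a\<zeta>0 by (simp add: diff_frac_eq)
  then have "(y / ((s - t)^2 + y^2)) *\<^sub>R (1 / (of_real x - Complex s \<eta>) - 1 / (a - \<zeta>)) = of_real y / (Complex (s - t) y * Complex (s - t) (- y)) * (Complex (s - t) (- y) / ((of_real x - Complex s \<eta>) * (a - \<zeta>)))"
   by (simp only: scaleR_conv_of_real of_real_divide e2)
  also have "... = G (Complex s \<sigma>)"
   unfolding G_def e1 using n1 by simp
  finally show ?thesis by (simp add: scaleR_right_diff_distrib algebra_simps)
 qed
 have "(LBINT s. (y / ((s - t)^2 + y^2)) *\<^sub>R (1 / (of_real x - Complex s \<eta>))) = (LBINT s. G (Complex s \<sigma>)) + (LBINT s. (y / ((s - t)^2 + y^2)) *\<^sub>R (1 / (a - \<zeta>)))"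
  unfolding ds by (rule integral_plus[OF Gi]) (use poisson_kernel_integral(1)[OF y, of t] in auto)
 also have "(LBINT s. (y / ((s - t)^2 + y^2)) *\<^sub>R (1 / (a - \<zeta>))) = pi *\<^sub>R (1 / (a - \<zeta>))"
  using poisson_kernel_integral[OF y, of t] by simp
 finally show ?thesis using G0 by (simp add: a\<zeta> scaleR_conv_of_real)
qed

lemma cauchyT_line_continuous:
 assumes f: "L1 f" and y: "y ~= 0"
 shows "continuous_on UNIV (%t. cauchyT f (Complex t y))"
proof -
 have "continuous_on UNIV (%t. cauchyT f (of_real t + \<i> * of_real y))"
  by (intro continuous_on_compose2[OF holomorphic_on_imp_continuous_on[OF cauchyT_holomorphic[OF f, of "{z. Im z ~= 0}"]]] continuous_intros)
    (use y in auto)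
 moreover have "Complex t y = of_real t + \<i> * of_real y" for t by (simp add: complex_eq_iff)
 ultimately show ?thesis by simp
qed

lemma cauchyT_line_measurable:
 "L1 f ==> y ~= 0 ==> (%t. cauchyT f (Complex t y)) \<in> bm borel"
 by (rule borel_measurable_continuous_onI[OF cauchyT_line_continuous])

lemma integrable_product:
 fixes g :: "real => real" and h :: "real => real"
 assumes g: "L1 g" and h: "L1 h"
 shows "integrable (lborel \<Otimes>\<^sub>M lborel) (%(s, x). g s * h x)"
proof -
 have [measurable]: "g \<in> bm lborel" "h \<in> bm lborel" using g h by auto
 show ?thesis
 proof (rule lborel_pair.Fubini_integrable)
  show "(%(s, x). g s * h x) \<in> borel_measurable (lborel \<Otimes>\<^sub>M lborel)" by measurable
  show "L1 (%x. LINT y|lborel. norm (case (x, y) of (s, x) => g s * h x))"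
   using g h by (simp add: abs_mult)
  show "AE x in lborel. L1 (%y. case (x, y) of (s, x) => g s * h x)"
   using h by auto
 qed
qed

text \<open>Fubini applied to the reproducing property of the Cauchy kernel. In the limit of small
  \<eta> it represents a Cauchy transform as the Poisson integral of its boundary values.\<close>

lemma poisson_cauchyT:
 assumes f: "L1 f" and y: "y > 0" and \<eta>: "\<eta> > 0"
 shows "poisson (%s. cauchyT f (Complex s \<eta>)) y t = cauchyT f (Complex t (y + \<eta>))"
proof -
 have [measurable]: "f \<in> bm lborel" using f by auto
 have [measurable]: "(%s. Complex s \<eta>) \<in> bm borel"
 proof -
  have "(%s. of_real s + \<i> * of_real \<eta>) \<in> bm borel" by measurable
  moreover have "Complex s \<eta> = of_real s + \<i> * of_real \<eta>" for s by (simp add: complex_eq_iff)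
  ultimately show ?thesis by simp
 qed
 define k where "k s = y / ((s - t)^2 + y^2)" for s
 have [measurable]: "k \<in> bm borel" unfolding k_def by measurable
 have k0: "k s >= 0" for s using y by (simp add: k_def)
 have ki: "L1 k" using poisson_kernel_integral(1)[OF y, of t] by (simp add: k_def[abs_def])
 define \<Phi> where "\<Phi> s x = k s *\<^sub>R (f x / (of_real x - Complex s \<eta>))" for s x
 have "integrable (lborel \<Otimes>\<^sub>M lborel) (%(s, x). \<Phi> s x)"
 proof (rule integrable_dominated)
  show "integrable (lborel \<Otimes>\<^sub>M lborel) (%(s, x). k s * (norm (f x) / \<eta>))"
   by (rule integrable_product[OF ki]) (use f in auto)
  show "(%(s, x). \<Phi> s x) \<in> borel_measurable (lborel \<Otimes>\<^sub>M lborel)"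
   unfolding \<Phi>_def by measurable
  show "AE p in lborel \<Otimes>\<^sub>M lborel. norm (case p of (s, x) => \<Phi> s x) <= norm (case p of (s, x) => k s * (norm (f x) / \<eta>))"
  proof (rule AE_I2, clarify)
   fix s x
   have "norm (\<Phi> s x) = k s * norm (f x / (of_real x - Complex s \<eta>))" using k0 by (simp add: \<Phi>_def)
   also have "... <= k s * (norm (f x) / \<eta>)"
    using norm_cauchy_integrand[of "Complex s \<eta>" "f x" x] \<eta> by (intro mult_left_mono k0) auto
   finally show "norm (\<Phi> s x) <= norm (k s * (norm (f x) / \<eta>))" using k0 \<eta> by simp
  qed
 qed
 from lborel_pair.Fubini_integral[OF this]
 have sw: "(LBINT x. (LBINT s. \<Phi> s x)) = (LBINT s. (LBINT x. \<Phi> s x))" by simp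
 have "(LBINT s. \<Phi> s x) = of_real pi * (f x / (of_real x - Complex t (y + \<eta>)))" for x
 proof -
  have "(LBINT s. \<Phi> s x) = (LBINT s. f x * (k s *\<^sub>R (1 / (of_real x - Complex s \<eta>))))"
   by (rule integral_congr[OF refl]) (simp add: \<Phi>_def scaleR_conv_of_real)
  also have "... = f x * (LBINT s. (k s *\<^sub>R (1 / (of_real x - Complex s \<eta>))))"
   by (rule integral_mult_right_zero)
  also have "... = f x * (of_real pi / (of_real x - Complex t (y + \<eta>)))"
   unfolding k_def poisson_of_cauchy_kernel[OF y \<eta>] ..
  finally show ?thesis by simp
 qed
 moreover have "(LBINT x. \<Phi> s x) = k s *\<^sub>R cauchyT f (Complex s \<eta>)" for s
  unfolding \<Phi>_def cauchyT_def by simp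
 ultimately have "(LBINT s. k s *\<^sub>R cauchyT f (Complex s \<eta>)) = (LBINT x. of_real pi * (f x / (of_real x - Complex t (y + \<eta>))))"
  using sw by simp
 also have "... = of_real pi * cauchyT f (Complex t (y + \<eta>))"
  unfolding cauchyT_def by (rule integral_mult_right_zero)
 finally show ?thesis by (simp add: poisson_def k_def)
qed

section \<open>Convergence of Cauchy transforms to boundary values in weighted L1\<close>

lemma L1_complete:
 fixes g :: "nat => real => complex"
 assumes g: "!!n. L1 (g n)"
  and cau: "!!e. e > 0 ==> \<exists>M. \<forall>m\<ge>M. \<forall>n\<ge>M. (LBINT t. norm (g m t - g n t)) <= e"
 obtains h where "L1 h" "(%n. \<integral>t. norm (g n t - h t) \<partial>lborel) \<longlonglongrightarrow> 0"
proof -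
 have [measurable]: "g n \<in> bm lborel" for n using g by auto
 have "\<forall>k. \<exists>M. \<forall>m\<ge>M. \<forall>n\<ge>M. (LBINT t. norm (g m t - g n t)) <= (1/2)^k"
  using cau by simp
 then obtain M where M: "!!k m n. m >= M k ==> n >= M k ==> (LBINT t. norm (g m t - g n t)) <= (1/2)^k"
  by metis
 \<comment> \<open>At least every \<open>M j\<close> with j <= k, and strictly increasing: a
   subsequence whose increments are summable in norm.\<close>
 define r where "r k = (\<Sum>j\<le>k. M j) + k" for k
 have rM: "M k <= r k" for k
  unfolding r_def using member_le_sum[of k "{..k}" M] by simp
 have rS: "r k < r (Suc k)" for k unfolding r_def by simp
 define f where "f k t = g (r (Suc k)) t - g (r k) t" for k t
 have fi: "L1 (f k)" for k unfolding f_def by (rule integrable_sub[OF g g])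
 have fb: "(LBINT t. norm (f k t)) <= (1/2)^k" for k
  unfolding f_def by (rule M) (use rM[of k] rS[of k] in auto)
 have sm: "summable (%k. \<integral>t. norm (f k t) \<partial>lborel)"
  by (rule summable_comparison_test[OF _ summable_geometric[of "1/2::real"]])
    (use fb in \<open>auto intro!: exI[of _ 0]\<close>)
 have "(NN t. (\<Sum>k. ennreal (norm (f k t)))) = (\<Sum>k. \<integral>\<^sup>+t. ennreal (norm (f k t)) \<partial>lborel)"
  by (rule nn_integral_suminf) (use fi in auto)
 also have "... = (\<Sum>k. ennreal (LBINT t. norm (f k t)))"
  by (intro suminf_cong nn_integral_eq_integral) (use fi in auto)
 also have "... < \<infinity>" using sm by (simp add: suminf_ennreal2 less_top[symmetric])
 finally have fin: "(NN t. (\<Sum>k. ennreal (norm (f k t)))) ~= \<infinity>" by simp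
 have "AE t in lborel. (\<Sum>k. ennreal (norm (f k t))) ~= \<infinity>"
  by (rule nn_integral_PInf_AE[OF _ fin]) (use fi in auto)
 then have as: "AE t in lborel. summable (%k. norm (f k t))"
  by eventually_elim (rule summable_suminf_not_top, auto)
 have Fi: "L1 (%t. \<Sum>k. f k t)" by (rule integrable_suminf[OF fi as sm])
 have Wi: "L1 (%t. \<Sum>k. norm (f k t))"
  by (rule integrable_suminf) (use fi as sm in auto)
 define h where "h t = g (r 0) t + (\<Sum>k. f k t)" for t
 have hi: "L1 h" unfolding h_def using g Fi by (rule integrable_plus)
 have tele: "g (r n) t - h t = (\<Sum>k<n. f k t) - (\<Sum>k. f k t)" for n t
  unfolding h_def f_def using sum_lessThan_telescope[of "%k. g (r k) t" n] by simp
 have sub: "(%n. \<integral>t. norm (g (r n) t - h t) \<partial>lborel) \<longlonglongrightarrow> (\<integral>t. 0 \<partial>(lborel :: real measure))"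
 proof (rule integral_dominated_convergence[where w = "%t. 2 * (\<Sum>k. norm (f k t))"])
  show "AE t in lborel. (%n. norm (g (r n) t - h t)) \<longlonglongrightarrow> 0"
   using as
  proof eventually_elim
   case (elim t)
   have "(%n. \<Sum>k<n. f k t) \<longlonglongrightarrow> (\<Sum>k. f k t)" by (rule summable_LIMSEQ[OF summable_norm_cancel[OF elim]])
   then show ?case unfolding tele by (intro tendsto_norm_zero LIM_zero)
  qed
  show "AE t in lborel. norm (norm (g (r n) t - h t)) <= 2 * (\<Sum>k. norm (f k t))" for n
   using as
  proof eventually_elim
   case (elim t)
   have "norm (\<Sum>k<n. f k t) <= (\<Sum>k<n. norm (f k t))" by (rule norm_sum)
   also have "... <= (\<Sum>k. norm (f k t))" by (rule sum_le_suminf[OF elim]) auto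
   finally show ?case unfolding tele
    using norm_triangle_ineq4[of "\<Sum>k<n. f k t" "\<Sum>k. f k t"] summable_norm[OF elim] by simp
  qed
 qed (use g hi Wi in auto)
 have "(%n. \<integral>t. norm (g n t - h t) \<partial>lborel) \<longlonglongrightarrow> 0"
 proof (rule LIMSEQ_I)
  fix e :: real assume e: "e > 0"
  obtain M1 where M1: "!!m n. m >= M1 ==> n >= M1 ==> (LBINT t. norm (g m t - g n t)) <= e / 2"
   using cau[of "e / 2"] e by auto
  have "\<forall>\<^sub>F n in sequentially. (LBINT t. norm (g (r n) t - h t)) < e / 2"
   using sub e by (intro order_tendstoD) auto
  then obtain k0 where k0: "!!k. k >= k0 ==> (LBINT t. norm (g (r k) t - h t)) < e / 2"
   by (auto simp: eventually_sequentially)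
  define k where "k = max k0 M1"
  have rk: "r k >= M1" unfolding r_def k_def by simp
  have "norm ((LBINT t. norm (g n t - h t)) - 0) < e" if n: "n >= M1" for n
  proof -
   have "(LBINT t. norm (g n t - h t)) <= (LBINT t. norm (g n t - g (r k) t) + norm (g (r k) t - h t))"
   proof (rule integral_mono)
    show "norm (g n t - h t) <= norm (g n t - g (r k) t) + norm (g (r k) t - h t)" for t
     using norm_triangle_ineq[of "g n t - g (r k) t" "g (r k) t - h t"] by simp
   qed (use g hi in auto)
   also have "... = (LBINT t. norm (g n t - g (r k) t)) + (LBINT t. norm (g (r k) t - h t))"
    by (rule integral_plus) (use g hi in auto)
   also have "... < e" using M1[OF n rk] k0[of k] by (simp add: k_def)
   finally show ?thesis by simp
  qed
  then show "\<exists>no. \<forall>n\<ge>no. norm ((LBINT t. norm (g n t - h t)) - 0) < e" by blast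
 qed
 then show thesis using that hi by blast
qed

definition eta :: "nat => real" where "eta n = 1 / (real n + 1)"

lemma eta_pos: "0 < eta n" and eta_le_1: "eta n <= 1"
 by (simp_all add: eta_def)

lemma eta_tendsto: "eta \<longlonglongrightarrow> 0"
 using LIMSEQ_inverse_real_of_nat by (simp add: eta_def[abs_def] inverse_eq_divide add.commute)

lemma eta_at_right: "filterlim eta (at_right 0) sequentially"
 unfolding filterlim_at using eta_tendsto eta_pos by (auto simp: order_less_imp_not_eq2)

text \<open>The weight reflects that a Cauchy transform is in general only of order 1 / |t| on a
  horizontal line, hence not integrable there.\<close>

definition wnorm :: "(real => complex) => ennreal" where
 "wnorm g = (NN t. ennreal (norm (g t) / (1 + t^2)))"

lemma wnorm_triangle:
 assumes [measurable]: "f \<in> bm lborel" "g \<in> bm lborel"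
 shows "wnorm (%t. f t + g t) <= wnorm f + wnorm g"
proof -
 have "wnorm (%t. f t + g t) <= (NN t. (ennreal (norm (f t) / (1 + t^2)) + ennreal (norm (g t) / (1 + t^2))))"
  unfolding wnorm_def
 proof (rule nn_integral_mono)
  fix t :: real
  have "norm (f t + g t) / (1 + t^2) <= norm (f t) / (1 + t^2) + norm (g t) / (1 + t^2)"
   unfolding add_divide_distrib[symmetric] by (rule divide_right_mono[OF norm_triangle_ineq]) simp
  from ennreal_leI[OF this] show "ennreal (norm (f t + g t) / (1 + t^2)) <= ennreal (norm (f t) / (1 + t^2)) + ennreal (norm (g t) / (1 + t^2))"
   by (simp add: ennreal_plus)
 qed
 also have "... = wnorm f + wnorm g" unfolding wnorm_def by (rule nn_integral_add) measurable
 finally show ?thesis .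
qed

lemma wnorm_cmult_unit: "norm c = 1 ==> wnorm (%t. c * g t) = wnorm g"
 by (simp add: wnorm_def norm_mult)

text \<open>Where |g| <= s the weight contributes s pi; where |g| > s, |g| <= s^(1 - r) |g|^r. The
  level \<open>s\<close> remains free, so that smallness in L^r yields smallness of
  \<open>wnorm\<close>.\<close>

lemma wnorm_le_powr:
 assumes [measurable]: "g \<in> bm lborel" and s: "s > 0" and r: "r >= 1"
 shows "wnorm g <= ennreal (s * pi) + ennreal (s powr (1 - r)) * (NN t. ennreal (norm (g t) powr r))"
proof -
 have "wnorm g <= (NN t. (ennreal s * ennreal (1 / (1 + t^2)) + ennreal (s powr (1 - r)) * ennreal (norm (g t) powr r)))"
  unfolding wnorm_def
 proof (rule nn_integral_mono)
  fix t :: real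
  have q: "1 <= 1 + t^2" by simp
  have "norm (g t) / (1 + t^2) <= s * (1 / (1 + t^2)) + s powr (1 - r) * norm (g t) powr r"
  proof (cases "norm (g t) <= s")
   case True
   then have "norm (g t) / (1 + t^2) <= s / (1 + t^2)" by (rule divide_right_mono) simp
   then show ?thesis by (simp add: add_increasing2)
  next
   case False
   have "norm (g t) / (1 + t^2) <= norm (g t) / 1" using q by (intro divide_left_mono) (auto simp: add_pos_nonneg)
   also have "... = norm (g t) powr (1 - r) * norm (g t) powr r"
    using False s by (simp flip: powr_add)
   also have "... <= s powr (1 - r) * norm (g t) powr r"
    using False s r by (intro mult_right_mono powr_mono2') auto
   finally show ?thesis using s by (simp add: add_increasing)
  qed
  from ennreal_leI[OF this] show "ennreal (norm (g t) / (1 + t^2)) <= ennreal s * ennreal (1 / (1 + t^2)) + ennreal (s powr (1 - r)) * ennreal (norm (g t) powr r)"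
   using s by (subst (asm) ennreal_plus) (auto simp: ennreal_mult[symmetric])
 qed
 also have "... = ennreal s * (NN t. ennreal (1 / (1 + t^2))) + ennreal (s powr (1 - r)) * (NN t. ennreal (norm (g t) powr r))"
  by (simp add: nn_integral_add nn_integral_cmult)
 also have "ennreal s * (NN t. ennreal (1 / (1 + t^2))) = ennreal (s * pi)"
  using s by (simp add: inverse_square_nn_integral ennreal_mult)
 finally show ?thesis .
qed

text \<open>For real \<open>f\<close> the square of the Cauchy transform integrates to zero, so that its real and
 imaginary parts have equal L2 norms.\<close>

lemma cauchyT_diff_L2:
 fixes f :: "real => real"
 assumes f: "L1 f" and supp: "!!x. \<bar>x\<bar> > 1 ==> f x = 0" and \<eta>: "\<eta> > 0" and \<delta>: "\<delta> > 0"
 defines "D \<equiv> %t. cauchyT (%x. of_real (f x)) (Complex t \<eta>) - cauchyT (%x. of_real (f x)) (Complex t \<delta>)"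
 shows "(NN t. ennreal (norm (D t) powr 2)) = 2 * (NN t. ennreal ((Im (D t))^2))"
proof -
 define F where "F x = cr (f x)" for x
 have Fi: "L1 F" unfolding F_def using f by simp
 \<comment> \<open>Both Cauchy transforms are moved to the common height \<sigma>, which lies below
   \<eta> and \<delta>, so that their difference \<open>E\<close> is holomorphic in the open upper
   half-plane.\<close>
 define \<sigma> where "\<sigma> = min \<eta> \<delta> / 2"
 have \<sigma>: "0 < \<sigma>" "\<sigma> < \<eta>" "\<sigma> < \<delta>" using \<eta> \<delta> by (auto simp: \<sigma>_def min_def)
 define E where "E z = cauchyT F (z + Complex 0 (\<eta> - \<sigma>)) - cauchyT F (z + Complex 0 (\<delta> - \<sigma>))" for z
 have ED: "E (Complex t \<sigma>) = D t" for t
 proof -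
  have "Complex t \<sigma> + Complex 0 (\<eta> - \<sigma>) = Complex t \<eta>" "Complex t \<sigma> + Complex 0 (\<delta> - \<sigma>) = Complex t \<delta>"
   by (simp_all add: complex_eq_iff)
  then show ?thesis unfolding E_def D_def F_def by simp
 qed
 have hol: "(%z. (E z)^2) holomorphic_on {z. Im z > 0}"
 proof -
  have 1: "(%z. cauchyT F (z + Complex 0 (a - \<sigma>))) holomorphic_on {z. Im z > 0}" if "\<sigma> < a" for a
  proof -
   have "(cauchyT F \<circ> (%z. z + Complex 0 (a - \<sigma>))) holomorphic_on {z. Im z > 0}"
    by (rule holomorphic_on_compose_gen[OF _ cauchyT_holomorphic[OF Fi, of "{z. Im z ~= 0}"]])
      (use that in \<open>auto intro!: holomorphic_intros\<close>)
   then show ?thesis by (simp add: o_def)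
  qed
  show ?thesis unfolding E_def using 1[OF \<sigma>(2)] 1[OF \<sigma>(3)] by (intro holomorphic_intros) auto
 qed
 define K where "K = (LBINT x. norm (F x)) * ((\<sigma> + 2) / \<sigma>)"
 have K: "K >= 0" unfolding K_def using \<sigma> by (intro mult_nonneg_nonneg Bochner_Integration.integral_nonneg) auto
 have bound: "norm ((E z)^2) <= 4 * K^2 * (1 + norm z) powr (-2)" if z: "Im z >= \<sigma>" for z
 proof -
  have p: "0 < 1 + norm z" by (simp add: add_pos_nonneg)
  have 1: "norm (cauchyT F (z + Complex 0 (a - \<sigma>))) <= K / (1 + norm z)" if a: "\<sigma> < a" for a
  proof -
   define w where "w = z + Complex 0 (a - \<sigma>)"
   have w: "Im w >= \<sigma>" "Re w = Re z" "Im z <= Im w" using a z by (auto simp: w_def)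
   have "(Im z)^2 <= (Im w)^2" using w z \<sigma> by (intro power_mono) auto
   then have "norm z <= norm w" using w(2) by (simp add: cmod_def)
   moreover have "norm (cauchyT F w) <= K / (1 + norm w)"
    unfolding K_def by (rule cauchyT_decay[OF Fi _ \<sigma>(1)]) (use w \<sigma> supp in \<open>auto simp: F_def\<close>)
   moreover have "K / (1 + norm w) <= K / (1 + norm z)" using K calculation(1) p by (intro divide_left_mono) auto
   ultimately show ?thesis unfolding w_def by linarith
  qed
  have "norm (E z) <= 2 * (K / (1 + norm z))"
   unfolding E_def using norm_triangle_ineq4 1[OF \<sigma>(2)] 1[OF \<sigma>(3)] by (smt (verit))
  then have "(norm (E z))^2 <= (2 * (K / (1 + norm z)))^2" by (intro power_mono) auto
  also have "... = 4 * K^2 * (1 + norm z) powr (-2)"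
   using p by (simp add: powr_minus powr_numeral power_divide power_mult_distrib divide_simps)
  finally show ?thesis by (simp add: norm_power)
 qed
 note L = halfplane_line_integral[OF hol order_refl \<sigma>(1) _ bound, unfolded ED]
 have i1: "L1 (%t. (D t)^2)" and i0: "(LBINT t. (D t)^2) = 0" using L by auto
 have i2: "L1 (%t. (norm (D t))^2)" using integrable_norm[OF i1] by (simp add: norm_power)
 have nm: "(norm (D t))^2 = Re ((D t)^2) + 2 * (Im (D t))^2" for t
  by (simp add: cmod_power2 Re_power2)
 have i3: "L1 (%t. 2 * (Im (D t))^2)"
 proof -
  have "L1 (%t. (norm (D t))^2 - Re ((D t)^2))"
   using i2 integrable_Re[OF i1] by (rule integrable_sub)
  then show ?thesis unfolding nm by simp
 qed
 have "(LBINT t. (norm (D t))^2) = (LBINT t. Re ((D t)^2)) + (LBINT t. 2 * (Im (D t))^2)"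
  unfolding nm by (rule integral_plus[OF integrable_Re[OF i1] i3])
 also have "(LBINT t. Re ((D t)^2)) = 0" using integral_Re[OF i1] i0 by simp
 finally have eq: "(LBINT t. (norm (D t))^2) = (LBINT t. 2 * (Im (D t))^2)" by simp
 have "(NN t. ennreal (norm (D t) powr 2)) = (NN t. ennreal ((norm (D t))^2))"
  by (intro nn_integral_cong) (simp add: powr_numeral)
 also have "... = ennreal (LBINT t. (norm (D t))^2)" by (rule nn_integral_eq_integral[OF i2]) simp
 also have "... = (NN t. ennreal (2 * (Im (D t))^2))"
  unfolding eq by (rule nn_integral_eq_integral[symmetric, OF i3]) simp
 also have "... = (NN t. 2 * ennreal ((Im (D t))^2))"
  by (intro nn_integral_cong) (simp add: ennreal_mult)
 also have "... = 2 * (NN t. ennreal ((Im (D t))^2))"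
 proof (rule nn_integral_cmult)
  have m: "D \<in> bm lborel" unfolding D_def
   using cauchyT_line_measurable[OF Fi[unfolded F_def], of \<eta>] cauchyT_line_measurable[OF Fi[unfolded F_def], of \<delta>] \<eta> \<delta> by simp
  then show "(%t. ennreal ((Im (D t))^2)) \<in> bm lborel" by measurable
 qed
 finally show ?thesis .
qed

definition cauchy_L1w :: "(real => complex) => bool" where
 "cauchy_L1w f \<longleftrightarrow> (\<forall>e>0. \<exists>M. \<forall>m\<ge>M. \<forall>n\<ge>M. wnorm (%t. cauchyT f (Complex t (eta m)) - cauchyT f (Complex t (eta n))) <= ennreal e)"

text \<open>A majorant independent of the height. For |t| <= 2 the kernel has mass pi < 4 and 1 +
  t^2 <= 5, which gives 20; for |t| > 2 it is at most 4 / t^2 on a support of length 2.\<close>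

lemma poisson_bounded_decay:
 fixes f :: "real => real"
 assumes f: "L1 f" and supp: "!!x. \<bar>x\<bar> > 1 ==> f x = 0" and B: "!!x. \<bar>f x\<bar> <= B"
  and y: "0 < y" "y <= 1"
 shows "\<bar>Im (cauchyT (%x. of_real (f x)) (Complex t y))\<bar> <= 20 * B / (1 + t^2)"
proof -
 have B0: "B >= 0" using B[of 0] by simp
 define k where "k x = y / ((x - t)^2 + y^2)" for x
 have k0: "k x >= 0" for x using y by (simp add: k_def)
 have ki: "L1 k" "(LBINT x. k x) = pi"
  using poisson_kernel_integral[OF y(1), of t] by (simp_all add: k_def[abs_def])
 have fk: "L1 (%x. f x * k x)" using Im_cauchyT_real(1)[OF f y(1), of t] by (simp add: k_def)
 have eq: "Im (cauchyT (%x. of_real (f x)) (Complex t y)) = (LBINT x. f x * k x)"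
  unfolding k_def by (rule Im_cauchyT_real(2)[OF f y(1)])
 show ?thesis
 proof (cases "\<bar>t\<bar> <= 2")
  case True
  have "\<bar>\<integral>x. f x * k x \<partial>lborel\<bar> <= (LBINT x. B * k x)"
  proof -
   have "norm (LBINT x. f x * k x) <= (LBINT x. B * k x)"
    by (rule integral_norm_le[OF fk])
      (use ki B k0 in \<open>auto simp: abs_mult intro!: mult_right_mono\<close>)
   then show ?thesis by simp
  qed
  also have "... = B * pi" using ki by simp
  also have "... <= B * 4" using B0 pi_less_4 by (intro mult_left_mono) auto
  also have "... <= 20 * B / (1 + t^2)"
  proof -
   have "t^2 <= 2^2" using True abs_le_square_iff[of t 2] by simp
   then have "B * 4 * (1 + t^2) <= B * 4 * 5" using B0 by (intro mult_left_mono) auto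
   then show ?thesis by (simp add: pos_le_divide_eq add_pos_nonneg)
  qed
  finally show ?thesis unfolding eq .
 next
  case False
  have kb: "\<bar>f x * k x\<bar> <= B * (4 / t^2) * indicator {-1..1} x" for x
  proof (cases "\<bar>x\<bar> > 1")
   case False
   then have x: "\<bar>x\<bar> <= 1" by simp
   have "\<bar>t\<bar> / 2 <= \<bar>x - t\<bar>" using x \<open>\<not> \<bar>t\<bar> <= 2\<close> by linarith
   then have "(\<bar>t\<bar> / 2)^2 <= (x - t)^2" by (metis abs_ge_zero abs_le_square_iff abs_of_nonneg divide_nonneg_pos zero_less_numeral)
   then have 1: "t^2 / 4 <= (x - t)^2 + y^2" by (simp add: power_divide add_increasing2)
   have tp: "0 < t^2 / 4" using \<open>\<not> \<bar>t\<bar> <= 2\<close> by auto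
   have "k x <= 1 / (t^2 / 4)" unfolding k_def using 1 tp y by (intro frac_le) auto
   then have "k x <= 4 / t^2" by simp
   then have "\<bar>f x\<bar> * k x <= B * (4 / t^2)" using B k0 B0 by (intro mult_mono) auto
   then show ?thesis using x k0[of x] by (simp add: abs_mult abs_le_iff)
  qed (use supp B0 in simp)
  have "norm (LBINT x. f x * k x) <= (LBINT x. B * (4 / t^2) * indicator {-1..1::real} x)"
   by (rule integral_norm_le[OF fk]) (use kb in auto)
  also have "... = B * (4 / t^2) * 2" by simp
  also have "... <= 20 * B / (1 + t^2)"
  proof -
   have "2^2 <= \<bar>t\<bar>^2" using False by (intro power_mono) auto
   then have t2: "4 <= t^2" by simp
   then have "8 / t^2 <= 20 / (1 + t^2)" by (simp add: divide_simps add_pos_nonneg)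
   from mult_left_mono[OF this B0] show ?thesis by (simp add: mult.commute)
  qed
  finally show ?thesis unfolding eq by simp
 qed
qed

text \<open>The imaginary parts are pi times Poisson integrals and converge in L2 by dominated
  convergence. The L2 identity for differences carries this over to the full Cauchy transforms, and
  splitting at a level turns it into weighted L1.\<close>

lemma cauchy_L1w_real_bounded:
 fixes f :: "real => real"
 assumes f: "L1 f" and supp: "!!x. \<bar>x\<bar> > 1 ==> f x = 0" and B: "!!x. \<bar>f x\<bar> <= B"
 shows "cauchy_L1w (%x. of_real (f x))"
proof -
 define F where "F x = cr (f x)" for x
 have [measurable]: "f \<in> bm borel" using f by auto
 have B0: "B >= 0" using B[of 0] by simp
 have Fi: "L1 F" unfolding F_def using f by simp
 define u where "u n t = Im (cauchyT F (Complex t (eta n)))" for n t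
 have [measurable]: "u n \<in> bm borel" for n
 proof -
  have "(%t. cauchyT F (Complex t (eta n))) \<in> bm borel"
   by (rule cauchyT_line_measurable[OF Fi]) (use eta_pos[of n] in simp)
  then show ?thesis unfolding u_def by measurable
 qed
 have ub: "\<bar>u n t\<bar> <= 20 * B / (1 + t^2)" for n t
  unfolding u_def F_def by (rule poisson_bounded_decay[OF f supp B eta_pos eta_le_1])
 have fb: "\<bar>pi * f t\<bar> <= 8 * B / (1 + t^2)" for t
 proof (cases "\<bar>t\<bar> > 1")
  case False
  then have "t^2 <= 1" by (simp add: abs_square_le_1)
  have "\<bar>pi * f t\<bar> <= 4 * B" using B[of t] pi_less_4 by (simp add: abs_mult mult_mono)
  also have "... <= 8 * B / (1 + t^2)"
  proof -
   have "4 * B * (1 + t^2) <= 4 * B * 2" using B0 \<open>t^2 <= 1\<close> by (intro mult_left_mono) auto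
   then show ?thesis by (simp add: pos_le_divide_eq add_pos_nonneg)
  qed
  finally show ?thesis .
 qed (use supp B0 in simp)
 define e where "e n = (LBINT t. (u n t - pi * f t)^2)" for n
 define W where "W t = (28 * B)^2 * (1 / (1 + t^2))" for t :: real
 have Wi: "L1 W" unfolding W_def using inverse_square_integrable by (rule integrable_mult_right)
 have dom: "(u n t - pi * f t)^2 <= W t" for n t
 proof -
  have q: "1 <= 1 + t^2" by simp
  have "\<bar>u n t - pi * f t\<bar> <= 28 * B / (1 + t^2)"
  proof -
   have "20 * B / (1 + t^2) + 8 * B / (1 + t^2) = 28 * B / (1 + t^2)"
    unfolding add_divide_distrib[symmetric] by simp
   then show ?thesis using ub[of n t] fb[of t] by linarith
  qed
  then have "\<bar>u n t - pi * f t\<bar>^2 <= (28 * B / (1 + t^2))^2" by (intro power_mono) auto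
  also have "... = (28 * B)^2 * (1 / (1 + t^2)) * (1 / (1 + t^2))" by (simp add: power_divide power2_eq_square)
  also have "... <= (28 * B)^2 * (1 / (1 + t^2)) * 1"
   using q by (intro mult_left_mono) (auto simp: pos_divide_le_eq add_pos_nonneg)
  finally show ?thesis by (simp add: W_def)
 qed
 have di: "L1 (%t. (u n t - pi * f t)^2)" for n
  by (rule integrable_dominated[OF Wi]) (use dom in \<open>auto intro!: AE_I2 intro: order_trans[OF _ abs_ge_self]\<close>)
 have e0: "e \<longlonglongrightarrow> 0"
 proof -
  have "e \<longlonglongrightarrow> (\<integral>t. 0 \<partial>(lborel :: real measure))"
   unfolding e_def
  proof (rule integral_dominated_convergence[OF _ _ Wi])
   have "AE t in lborel. lebesgue_point F t" by (rule AE_lebesgue_point[OF Fi])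
   then show "AE t in lborel. (%n. (u n t - pi * f t)^2) \<longlonglongrightarrow> 0"
   proof eventually_elim
    case (elim t)
    have "((%y. poisson F y t) \<longlongrightarrow> F t) (at_right 0)"
     by (rule poisson_tendsto[OF weighted_of_integrable[OF Fi] elim])
    then have "(%n. poisson F (eta n) t) \<longlonglongrightarrow> F t" by (rule filterlim_compose[OF _ eta_at_right])
    then have "(%n. pi * Re (poisson F (eta n) t)) \<longlonglongrightarrow> pi * Re (F t)" by (intro tendsto_intros)
    moreover have "pi * Re (poisson F (eta n) t) = u n t" for n
    proof -
     have "L1 (%x. (eta n / ((x - t)^2 + (eta n)^2)) *\<^sub>R F x)"
      by (rule poisson_integrable[OF weighted_of_integrable[OF Fi] eta_pos])
     from integral_Re[OF this]
     have "Re (LBINT x. (eta n / ((x - t)^2 + (eta n)^2)) *\<^sub>R F x) = (LBINT x. f x * (eta n / ((x - t)^2 + (eta n)^2)))"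
      by (simp add: F_def mult.commute)
     then show ?thesis
      unfolding u_def F_def Im_cauchyT_real(2)[OF f eta_pos] poisson_def by (simp add: F_def)
    qed
    ultimately have "(%n. u n t) \<longlonglongrightarrow> pi * f t" by (simp add: F_def)
    then have "(%n. (u n t - pi * f t)^2) \<longlonglongrightarrow> (pi * f t - pi * f t)^2" by (intro tendsto_intros)
    then show ?case by simp
   qed
   show "AE t in lborel. norm ((u n t - pi * f t)^2) <= W t" for n using dom by auto
  qed measurable
  then show ?thesis by simp
 qed
 have L2: "(NN t. ennreal (norm (cauchyT F (Complex t (eta m)) - cauchyT F (Complex t (eta n))) powr 2)) <= ennreal (4 * e m + 4 * e n)" for m n
 proof -
  have "(NN t. ennreal (norm (cauchyT F (Complex t (eta m)) - cauchyT F (Complex t (eta n))) powr 2))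
    = 2 * (NN t. ennreal ((u m t - u n t)^2))"
   unfolding F_def u_def using cauchyT_diff_L2[OF f supp eta_pos[of m] eta_pos[of n]] by simp
  also have "... <= 2 * (NN t. ennreal (2 * (u m t - pi * f t)^2 + 2 * (u n t - pi * f t)^2))"
  proof (intro mult_left_mono nn_integral_mono ennreal_leI)
   fix t
   have "0 <= ((u m t - pi * f t) + (u n t - pi * f t))^2" by simp
   then show "(u m t - u n t)^2 <= 2 * (u m t - pi * f t)^2 + 2 * (u n t - pi * f t)^2"
    by (simp add: power2_eq_square algebra_simps)
  qed auto
  also have "(NN t. ennreal (2 * (u m t - pi * f t)^2 + 2 * (u n t - pi * f t)^2)) = ennreal (2 * e m + 2 * e n)"
   using di[of m] di[of n] by (subst nn_integral_eq_integral) (auto simp: e_def)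
  also have "2 * ennreal (2 * e m + 2 * e n) = ennreal (2 * (2 * e m + 2 * e n))"
   by (subst ennreal_mult) (auto simp: e_def intro!: add_nonneg_nonneg Bochner_Integration.integral_nonneg)
  finally show ?thesis by simp
 qed
 show ?thesis unfolding cauchy_L1w_def F_def[symmetric]
 proof (intro allI impI)
  fix \<epsilon> :: real assume \<epsilon>: "\<epsilon> > 0"
  \<comment> \<open>With this \<open>s\<close> the first term of the splitting is half of
    \<epsilon>, and \<kappa> is then chosen so that 8 \<kappa> / s is the other half.\<close>
  define s where "s = \<epsilon> / (2 * pi)"
  have s: "s > 0" using \<epsilon> by (simp add: s_def)
  define \<kappa> where "\<kappa> = s * \<epsilon> / 16"
  have \<kappa>: "\<kappa> > 0" using s \<epsilon> by (simp add: \<kappa>_def)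
  have "\<forall>\<^sub>F n in sequentially. e n < \<kappa>" by (rule order_tendstoD(2)[OF e0 \<kappa>])
  then obtain M where M: "!!n. n >= M ==> e n < \<kappa>" by (auto simp: eventually_sequentially)
  have "wnorm (%t. cauchyT F (Complex t (eta m)) - cauchyT F (Complex t (eta n))) <= ennreal \<epsilon>" if mn: "m >= M" "n >= M" for m n
  proof -
   have meas: "(%t. cauchyT F (Complex t (eta m)) - cauchyT F (Complex t (eta n))) \<in> bm lborel"
    using cauchyT_line_measurable[OF Fi, of "eta m"] cauchyT_line_measurable[OF Fi, of "eta n"] eta_pos[of m] eta_pos[of n] by simp
   have "wnorm (%t. cauchyT F (Complex t (eta m)) - cauchyT F (Complex t (eta n)))
    <= ennreal (s * pi) + ennreal (s powr (1 - 2)) * (NN t. ennreal (norm (cauchyT F (Complex t (eta m)) - cauchyT F (Complex t (eta n))) powr 2))"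
    by (rule wnorm_le_powr[OF meas s]) simp
   also have "... <= ennreal (s * pi) + ennreal (s powr (1 - 2)) * ennreal (4 * e m + 4 * e n)"
    by (intro add_left_mono mult_left_mono L2) simp
   also have "... <= ennreal (s * pi) + ennreal (s powr (1 - 2)) * ennreal (8 * \<kappa>)"
    using M[OF mn(1)] M[OF mn(2)] by (intro add_left_mono mult_left_mono ennreal_leI) auto
   also have "... = ennreal (s * pi + s powr (1 - 2) * (8 * \<kappa>))"
   proof -
    have "ennreal (s powr (1 - 2)) * ennreal (8 * \<kappa>) = ennreal (s powr (1 - 2) * (8 * \<kappa>))"
     using \<kappa> by (intro ennreal_mult[symmetric]) auto
    moreover have "ennreal (s * pi) + ennreal (s powr (1 - 2) * (8 * \<kappa>)) = ennreal (s * pi + s powr (1 - 2) * (8 * \<kappa>))"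
     using s \<kappa> by (intro ennreal_plus[symmetric]) auto
    ultimately show ?thesis by simp
   qed
   also have "s * pi + s powr (1 - 2) * (8 * \<kappa>) = \<epsilon>"
    using s by (simp add: \<kappa>_def powr_minus divide_simps) (simp add: s_def)
   finally show ?thesis .
  qed
  then show "\<exists>M. \<forall>m\<ge>M. \<forall>n\<ge>M. wnorm (%t. cauchyT F (Complex t (eta m)) - cauchyT F (Complex t (eta n))) <= ennreal \<epsilon>" by blast
 qed
qed

lemma borel_measurable_cnj:
 "u \<in> bm M ==> (%x. cnj (u x)) \<in> bm M"
 by (rule measurable_compose[OF _ borel_measurable_continuous_onI]) (auto intro: continuous_intros)

lemma cauchyT_line_meas:
 "L1 f ==> y ~= 0 ==> (%t. cauchyT f (Complex t y)) \<in> bm lborel"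
 using cauchyT_line_measurable by simp

lemma cauchy_L1w_bounded:
 fixes f :: "real => complex"
 assumes f: "L1 f" and supp: "!!x. \<bar>x\<bar> > 1 ==> f x = 0" and B: "!!x. norm (f x) <= B"
 shows "cauchy_L1w f"
proof -
 define f1 f2 where "f1 x = cr (Re (f x))" and "f2 x = cr (Im (f x))" for x
 have c1: "cauchy_L1w f1" unfolding f1_def
  by (rule cauchy_L1w_real_bounded[where B = B]) (use f supp B abs_Re_le_cmod order_trans in \<open>auto, blast\<close>)
 have c2: "cauchy_L1w f2" unfolding f2_def
  by (rule cauchy_L1w_real_bounded[where B = B]) (use f supp B abs_Im_le_cmod order_trans in \<open>auto, blast\<close>)
 have i: "L1 f1" "L1 f2" unfolding f1_def f2_def using f by auto
 have nz: "Im (Complex t (eta n)) ~= 0" "eta n ~= 0" for t n using eta_pos[of n] by auto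
 have dec: "cauchyT f (Complex t (eta n)) = cauchyT f1 (Complex t (eta n)) + \<i> * cauchyT f2 (Complex t (eta n))" for t n
 proof -
  have "f = (%x. f1 x + \<i> * f2 x)" by (auto simp: fun_eq_iff f1_def f2_def complex_eq_iff)
  then show ?thesis using cauchyT_add[OF i(1) integrable_mult_right[OF i(2), of \<i>] nz(1)[of t n]] by (simp add: cauchyT_cmult)
 qed
 show ?thesis unfolding cauchy_L1w_def
 proof (intro allI impI)
  fix e :: real assume e: "e > 0"
  obtain M1 where M1: "!!m n. m >= M1 ==> n >= M1 ==> wnorm (%t. cauchyT f1 (Complex t (eta m)) - cauchyT f1 (Complex t (eta n))) <= ennreal (e / 2)"
   using c1 e unfolding cauchy_L1w_def by (metis half_gt_zero)
  obtain M2 where M2: "!!m n. m >= M2 ==> n >= M2 ==> wnorm (%t. cauchyT f2 (Complex t (eta m)) - cauchyT f2 (Complex t (eta n))) <= ennreal (e / 2)"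
   using c2 e unfolding cauchy_L1w_def by (metis half_gt_zero)
  have "wnorm (%t. cauchyT f (Complex t (eta m)) - cauchyT f (Complex t (eta n))) <= ennreal e" if mn: "m >= max M1 M2" "n >= max M1 M2" for m n
  proof -
   note [measurable] = cauchyT_line_meas[OF i(1) nz(2)] cauchyT_line_meas[OF i(2) nz(2)]
   have "wnorm (%t. cauchyT f (Complex t (eta m)) - cauchyT f (Complex t (eta n))) =
    wnorm (%t. (cauchyT f1 (Complex t (eta m)) - cauchyT f1 (Complex t (eta n))) + \<i> * (cauchyT f2 (Complex t (eta m)) - cauchyT f2 (Complex t (eta n))))"
    unfolding dec by (simp add: algebra_simps)
   also have "... <= wnorm (%t. cauchyT f1 (Complex t (eta m)) - cauchyT f1 (Complex t (eta n))) + wnorm (%t. \<i> * (cauchyT f2 (Complex t (eta m)) - cauchyT f2 (Complex t (eta n))))"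
    by (rule wnorm_triangle) measurable
   also have "wnorm (%t. \<i> * (cauchyT f2 (Complex t (eta m)) - cauchyT f2 (Complex t (eta n)))) = wnorm (%t. cauchyT f2 (Complex t (eta m)) - cauchyT f2 (Complex t (eta n)))"
    by (rule wnorm_cmult_unit) simp
   also have "wnorm (%t. cauchyT f1 (Complex t (eta m)) - cauchyT f1 (Complex t (eta n))) + ... <= ennreal (e / 2) + ennreal (e / 2)"
    using mn by (intro add_mono M1 M2) auto
   also have "... = ennreal e" using e by (simp flip: ennreal_plus)
   finally show ?thesis .
  qed
  then show "\<exists>M. \<forall>m\<ge>M. \<forall>n\<ge>M. wnorm (%t. cauchyT f (Complex t (eta m)) - cauchyT f (Complex t (eta n))) <= ennreal e" by blast
 qed
qed

text \<open>Bounded truncations are covered already, and the remainder is small in L^p; the estimate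
  of M. Riesz makes its Cauchy transforms small uniformly in the height.\<close>

lemma cauchy_L1w_Lp:
 fixes f :: "real => complex"
 assumes p: "1 < p" "p < 2" and f: "L1 f" and supp: "!!x. \<bar>x\<bar> > 1 ==> f x = 0"
  and fp: "L1 (%x. norm (f x) powr p)"
 shows "cauchy_L1w f"
 unfolding cauchy_L1w_def
proof (intro allI impI)
 fix e :: real assume e: "e > 0"
 have [measurable]: "f \<in> bm lborel" using f by auto
 obtain C where C: "C > 0" and riesz: "!!f y. L1 f ==> (!!x. \<bar>x\<bar> > 1 ==> f x = 0) ==>
   L1 (%x. norm (f x) powr p) ==> y > 0 ==>
   (NN t. ennreal (norm (cauchyT f (Complex t y)) powr p)) <= ennreal C * (NN x. ennreal (norm (f x) powr p))"
  using riesz_cauchyT[OF p] by blast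
 \<comment> \<open>s pi = e / 8, and \<kappa> below makes the other term e / 8. The remainder at two
   heights thus costs e / 2, as much as the bounded part.\<close>
 define s where "s = e / (8 * pi)"
 have s: "s > 0" using e by (simp add: s_def)
 define b where "b k x = (if norm (f x) <= real k then f x else 0)" for k x
 define r where "r k x = f x - b k x" for k x
 have [measurable]: "b k \<in> bm lborel" for k unfolding b_def by measurable
 have [measurable]: "r k \<in> bm lborel" for k unfolding r_def by measurable
 have bi: "L1 (b k)" for k
  by (rule integrable_dominated[OF f]) (auto simp: b_def)
 have rf: "norm (r k x) <= norm (f x)" for k x by (auto simp: r_def b_def)
 have ri: "L1 (r k)" for k
  by (rule integrable_dominated[OF f]) (use rf in auto)
 have rp: "L1 (%x. norm (r k x) powr p)" for k
  by (rule integrable_dominated[OF fp]) (use rf p in \<open>auto intro!: AE_I2 powr_mono2\<close>)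
 have "(%k. \<integral>x. norm (r k x) powr p \<partial>lborel) \<longlonglongrightarrow> (\<integral>x. 0 \<partial>(lborel :: real measure))"
 proof (rule integral_dominated_convergence[OF _ _ fp])
  show "AE x in lborel. (%k. norm (r k x) powr p) \<longlonglongrightarrow> 0"
  proof (rule AE_I2)
   fix x
   obtain K where K: "norm (f x) <= real K" using real_arch_simple by blast
   have "\<forall>\<^sub>F k in sequentially. 0 = norm (r k x) powr p"
    unfolding eventually_sequentially
    by (rule exI[of _ K]) (use K p in \<open>auto simp: r_def b_def\<close>)
   then show "(%k. norm (r k x) powr p) \<longlonglongrightarrow> 0"
    by (rule Lim_transform_eventually[OF tendsto_const])
  qed
  show "AE x in lborel. norm (norm (r k x) powr p) <= norm (f x) powr p" for k
   using rf p by (auto intro!: AE_I2 powr_mono2)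
 qed measurable
 moreover define \<kappa> where "\<kappa> = (e / 8) / (s powr (1 - p) * C)"
 have \<kappa>: "\<kappa> > 0" using e s C by (simp add: \<kappa>_def)
 ultimately have "\<forall>\<^sub>F k in sequentially. (LBINT x. norm (r k x) powr p) < \<kappa>"
  by (intro order_tendstoD(2)) auto
 then obtain k where k: "(LBINT x. norm (r k x) powr p) < \<kappa>" by (auto simp: eventually_sequentially)
 have bs: "b k x = 0" "r k x = 0" if "\<bar>x\<bar> > 1" for x using supp[OF that] by (simp_all add: b_def r_def)
 have nz: "Im (Complex t (eta n)) ~= 0" "eta n ~= 0" for t n using eta_pos[of n] by auto
 note [measurable] = cauchyT_line_meas[OF ri nz(2)] cauchyT_line_meas[OF bi nz(2)]
 have w: "wnorm (%t. cauchyT (r k) (Complex t (eta n))) <= ennreal (e / 4)" for n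
 proof -
  have "wnorm (%t. cauchyT (r k) (Complex t (eta n))) <= ennreal (s * pi) + ennreal (s powr (1 - p)) * (NN t. ennreal (norm (cauchyT (r k) (Complex t (eta n))) powr p))"
   by (rule wnorm_le_powr[OF _ s]) (use p in auto)
  also have "... <= ennreal (s * pi) + ennreal (s powr (1 - p)) * (ennreal C * (NN x. ennreal (norm (r k x) powr p)))"
   by (intro add_left_mono mult_left_mono riesz ri rp eta_pos bs) auto
  also have "(NN x. ennreal (norm (r k x) powr p)) = ennreal (LBINT x. norm (r k x) powr p)"
   by (rule nn_integral_eq_integral[OF rp]) simp
  also have "ennreal (s * pi) + ennreal (s powr (1 - p)) * (ennreal C * ...) <= ennreal (s * pi) + ennreal (s powr (1 - p)) * (ennreal C * ennreal \<kappa>)"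
   using k by (intro add_left_mono mult_left_mono ennreal_leI) auto
  also have "... = ennreal (s * pi + s powr (1 - p) * (C * \<kappa>))"
  proof -
   have "ennreal (s powr (1 - p)) * (ennreal C * ennreal \<kappa>) = ennreal (s powr (1 - p) * (C * \<kappa>))"
    using \<kappa> C by (simp only: ennreal_mult[symmetric] less_imp_le powr_ge_zero mult_nonneg_nonneg)
   moreover have "ennreal (s * pi) + ennreal (s powr (1 - p) * (C * \<kappa>)) = ennreal (s * pi + s powr (1 - p) * (C * \<kappa>))"
    using s \<kappa> C by (intro ennreal_plus[symmetric]) auto
   ultimately show ?thesis by simp
  qed
  also have "s * pi + s powr (1 - p) * (C * \<kappa>) = e / 4"
   using s C by (simp add: \<kappa>_def) (simp add: s_def)
  finally show ?thesis .
 qed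
 have "cauchy_L1w (b k)"
  by (rule cauchy_L1w_bounded[OF bi bs(1), where B = "real k"]) (auto simp: b_def)
 then obtain M where M: "!!m n. m >= M ==> n >= M ==> wnorm (%t. cauchyT (b k) (Complex t (eta m)) - cauchyT (b k) (Complex t (eta n))) <= ennreal (e / 2)"
  using e unfolding cauchy_L1w_def by (metis half_gt_zero)
 have dec: "cauchyT f (Complex t (eta n)) = cauchyT (b k) (Complex t (eta n)) + cauchyT (r k) (Complex t (eta n))" for t n
  using cauchyT_add[OF bi[of k] ri[of k] nz(1)[of t n]] by (simp add: r_def)
 have "wnorm (%t. cauchyT f (Complex t (eta m)) - cauchyT f (Complex t (eta n))) <= ennreal e" if mn: "m >= M" "n >= M" for m n
 proof -
  have "wnorm (%t. cauchyT f (Complex t (eta m)) - cauchyT f (Complex t (eta n))) =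
    wnorm (%t. (cauchyT (b k) (Complex t (eta m)) - cauchyT (b k) (Complex t (eta n))) + (cauchyT (r k) (Complex t (eta m)) + (-1) * cauchyT (r k) (Complex t (eta n))))"
   unfolding dec by (simp add: algebra_simps)
  also have "... <= wnorm (%t. cauchyT (b k) (Complex t (eta m)) - cauchyT (b k) (Complex t (eta n))) + wnorm (%t. cauchyT (r k) (Complex t (eta m)) + (-1) * cauchyT (r k) (Complex t (eta n)))"
   by (rule wnorm_triangle) measurable
  also have "... <= ennreal (e / 2) + (ennreal (e / 4) + ennreal (e / 4))"
  proof (intro add_mono M mn)
   have "wnorm (%t. cauchyT (r k) (Complex t (eta m)) + (-1) * cauchyT (r k) (Complex t (eta n))) <= wnorm (%t. cauchyT (r k) (Complex t (eta m))) + wnorm (%t. (-1) * cauchyT (r k) (Complex t (eta n)))"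
    by (rule wnorm_triangle) measurable
   also have "wnorm (%t. (-1) * cauchyT (r k) (Complex t (eta n))) = wnorm (%t. cauchyT (r k) (Complex t (eta n)))"
    by (rule wnorm_cmult_unit) simp
   also have "wnorm (%t. cauchyT (r k) (Complex t (eta m))) + ... <= ennreal (e / 4) + ennreal (e / 4)"
    by (intro add_mono w)
   finally show "wnorm (%t. cauchyT (r k) (Complex t (eta m)) + (-1) * cauchyT (r k) (Complex t (eta n))) <= ennreal (e / 4) + ennreal (e / 4)" .
  qed
  also have "... = ennreal e" using e by (simp flip: ennreal_plus)
  finally show ?thesis .
 qed
 then show "\<exists>M. \<forall>m\<ge>M. \<forall>n\<ge>M. wnorm (%t. cauchyT f (Complex t (eta m)) - cauchyT f (Complex t (eta n))) <= ennreal e" by blast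
qed

lemma norm_of_real_1_plus_square: "norm (cr (1 + x^2)) = 1 + x^2"
 by (simp only: norm_of_real) simp

lemma of_real_1_plus_square_nz: "cr (1 + x^2) ~= 0"
 by (metis add_pos_nonneg less_irrefl of_real_eq_0_iff zero_le_power2 zero_less_one)

text \<open>The limit \<open>h\<close> exists by completeness of weighted L1. Passing to the limit
  in the semigroup property shows that the Cauchy transform is the Poisson integral of
  \<open>h\<close>; so it converges at every Lebesgue point of \<open>h\<close>, and for all heights
  rather than along a sequence.\<close>

lemma cauchyT_boundary:
 assumes f: "L1 f" and c: "cauchy_L1w f"
 obtains h where "L1 (%x. h x / cr (1 + x^2))"
  "(%n. \<integral>t. norm (cauchyT f (Complex t (eta n)) - h t) / (1 + t^2) \<partial>lborel) \<longlonglongrightarrow> 0"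
  "AE t in lborel. ((%y. cauchyT f (Complex t y)) \<longlongrightarrow> h t) (at_right 0)"
proof -
 have nz: "Im (Complex t (eta n)) ~= 0" "eta n ~= 0" for t n using eta_pos[of n] by auto
 note [measurable] = cauchyT_line_meas[OF f nz(2)]
 define g where "g n t = cauchyT f (Complex t (eta n)) / cr (1 + t^2)" for n t
 have [measurable]: "g n \<in> bm lborel" for n unfolding g_def by measurable
 have gi: "L1 (g n)" for n
 proof (rule integrable_dominated)
  show "L1 (%t. ((LBINT x. norm (f x)) / eta n) * (1 / (1 + t^2)))"
   using inverse_square_integrable by (rule integrable_mult_right)
  show "AE t in lborel. norm (g n t) <= norm (((LBINT x. norm (f x)) / eta n) * (1 / (1 + t^2)))"
  proof (rule AE_I2)
   fix t :: real
   have "norm (g n t) = norm (cauchyT f (Complex t (eta n))) / (1 + t^2)"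
    unfolding g_def norm_divide norm_of_real_1_plus_square ..
   also have "... <= ((LBINT x. norm (f x)) / eta n) / (1 + t^2)"
    using cauchyT_bound[OF f nz(1)[of t n]] eta_pos[of n] by (intro divide_right_mono) auto
   also have "... = ((LBINT x. norm (f x)) / eta n) * (1 / (1 + t^2))" by simp
   also have "... <= norm (((LBINT x. norm (f x)) / eta n) * (1 / (1 + t^2)))"
    unfolding real_norm_def by (rule abs_ge_self)
   finally show "norm (g n t) <= norm (((LBINT x. norm (f x)) / eta n) * (1 / (1 + t^2)))" .
  qed
 qed measurable
 have gw: "ennreal (LBINT t. norm (g m t - g n t)) = wnorm (%t. cauchyT f (Complex t (eta m)) - cauchyT f (Complex t (eta n)))" for m n
 proof -
  have "ennreal (LBINT t. norm (g m t - g n t)) = (NN t. ennreal (norm (g m t - g n t)))"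
   by (rule nn_integral_eq_integral[symmetric]) (use gi in auto)
  then show ?thesis unfolding wnorm_def g_def diff_divide_distrib[symmetric] norm_divide norm_of_real_1_plus_square .
 qed
 have "\<exists>M. \<forall>m\<ge>M. \<forall>n\<ge>M. (LBINT t. norm (g m t - g n t)) <= e" if e: "e > 0" for e
 proof -
  obtain M where M: "!!m n. m >= M ==> n >= M ==> wnorm (%t. cauchyT f (Complex t (eta m)) - cauchyT f (Complex t (eta n))) <= ennreal e"
   using c e unfolding cauchy_L1w_def by blast
  have "(LBINT t. norm (g m t - g n t)) <= e" if "m >= M" "n >= M" for m n
   using M[OF that] e unfolding gw[symmetric] by (subst (asm) ennreal_le_iff) auto
  then show ?thesis by blast
 qed
 from L1_complete[OF gi this] obtain h0 where h0: "L1 h0" "(%n. \<integral>t. norm (g n t - h0 t) \<partial>lborel) \<longlonglongrightarrow> 0"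
  by blast
 define h where "h t = h0 t * cr (1 + t^2)" for t
 have h0h: "h0 t = h t / cr (1 + t^2)" for t using of_real_1_plus_square_nz[of t] by (simp add: h_def)
 have hi: "L1 (%x. h x / cr (1 + x^2))" using h0(1) unfolding h0h .
 have gh: "norm (g n t - h0 t) = norm (cauchyT f (Complex t (eta n)) - h t) / (1 + t^2)" for n t
  unfolding g_def h0h diff_divide_distrib[symmetric] norm_divide norm_of_real_1_plus_square ..
 have lim: "(%n. \<integral>t. norm (cauchyT f (Complex t (eta n)) - h t) / (1 + t^2) \<partial>lborel) \<longlonglongrightarrow> 0"
  using h0(2) unfolding gh .
 \<comment> \<open>For fixed \<open>y\<close> and \<open>t\<close> the Poisson kernel is at most a
   multiple \<open>K\<close> of the weight 1 / (1 + x^2), so weighted L1 convergence passes through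
   the Poisson integral.\<close>
 have rep: "poisson h y t = cauchyT f (Complex t y)" if y: "y > 0" for y t
 proof -
  define K where "K = (2 + 2 * t^2) / y + 2 * y"
  have K: "K >= 0" using y by (simp add: K_def)
  have gi': "L1 (%x. cauchyT f (Complex x (eta n)) / cr (1 + x^2))" for n using gi[of n] unfolding g_def .
  have dif: "norm (cauchyT f (Complex t (y + eta n)) - poisson h y t) <= K / pi * (LBINT x. norm (g n x - h0 x))" for n
  proof -
   have "cauchyT f (Complex t (y + eta n)) - poisson h y t = poisson (%s. cauchyT f (Complex s (eta n))) y t - poisson h y t"
    using poisson_cauchyT[OF f y eta_pos[of n]] by simp
   also have "... = (LBINT x. (y / ((x - t)^2 + y^2)) *\<^sub>R (cauchyT f (Complex x (eta n)) - h x)) / of_real pi"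
    unfolding poisson_def diff_divide_distrib[symmetric]
    using poisson_integrable[OF gi' y, of t n] poisson_integrable[OF hi y, of t]
    by (simp add: scaleR_right_diff_distrib integral_sub)
   finally have eq: "norm (cauchyT f (Complex t (y + eta n)) - poisson h y t) = norm (LBINT x. (y / ((x - t)^2 + y^2)) *\<^sub>R (cauchyT f (Complex x (eta n)) - h x)) / pi"
    by (simp add: norm_divide)
   have "norm (LBINT x. (y / ((x - t)^2 + y^2)) *\<^sub>R (cauchyT f (Complex x (eta n)) - h x)) <= (LBINT x. K * norm (g n x - h0 x))"
   proof (rule integral_norm_le)
    show "L1 (%x. (y / ((x - t)^2 + y^2)) *\<^sub>R (cauchyT f (Complex x (eta n)) - h x))"
     unfolding scaleR_right_diff_distrib using poisson_integrable[OF gi' y] poisson_integrable[OF hi y]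
     by (rule integrable_sub)
    show "L1 (%x. K * norm (g n x - h0 x))" using gi h0(1) by auto
    fix x
    have "norm ((y / ((x - t)^2 + y^2)) *\<^sub>R (cauchyT f (Complex x (eta n)) - h x)) = y / ((x - t)^2 + y^2) * norm (cauchyT f (Complex x (eta n)) - h x)"
     using y by simp
    also have "... <= K * (1 / (1 + x^2)) * norm (cauchyT f (Complex x (eta n)) - h x)"
     unfolding K_def by (rule mult_right_mono[OF poisson_kernel_le[OF y]]) simp
    also have "... = K * norm (g n x - h0 x)" unfolding gh by simp
    finally show "norm ((y / ((x - t)^2 + y^2)) *\<^sub>R (cauchyT f (Complex x (eta n)) - h x)) <= K * norm (g n x - h0 x)" .
   qed
   then have "norm (LBINT x. (y / ((x - t)^2 + y^2)) *\<^sub>R (cauchyT f (Complex x (eta n)) - h x)) / pi <= K * (LBINT x. norm (g n x - h0 x)) / pi"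
    by (intro divide_right_mono) auto
   then show ?thesis unfolding eq by simp
  qed
  have "(%n. cauchyT f (Complex t (y + eta n)) - poisson h y t) \<longlonglongrightarrow> 0"
  proof (rule Lim_null_comparison)
   show "\<forall>\<^sub>F n in sequentially. norm (cauchyT f (Complex t (y + eta n)) - poisson h y t) <= K / pi * (LBINT x. norm (g n x - h0 x))"
    using dif by simp
   show "(%n. K / pi * (LBINT x. norm (g n x - h0 x))) \<longlonglongrightarrow> 0"
    by (rule tendsto_mult_right_zero[OF h0(2)])
  qed
  then have 1: "(%n. cauchyT f (Complex t (y + eta n))) \<longlonglongrightarrow> poisson h y t" by (rule LIM_zero_cancel)
  have "(%n. Complex t (y + eta n)) \<longlonglongrightarrow> Complex t (y + 0)"
   unfolding Complex_eq by (intro tendsto_intros eta_tendsto)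
  then have "(%n. Complex t (y + eta n)) \<longlonglongrightarrow> Complex t y" by simp
  then have 2: "(%n. cauchyT f (Complex t (y + eta n))) \<longlonglongrightarrow> cauchyT f (Complex t y)"
   by (rule cauchyT_tendsto[OF f, rotated]) (use y in simp)
  show ?thesis by (rule LIMSEQ_unique[OF 1 2])
 qed
 have "AE t in lborel. lebesgue_point h t" by (rule AE_lebesgue_point_weighted[OF hi])
 then have "AE t in lborel. ((%y. cauchyT f (Complex t y)) \<longlongrightarrow> h t) (at_right 0)"
 proof eventually_elim
  case (elim t)
  have "((%y. poisson h y t) \<longlongrightarrow> h t) (at_right 0)" by (rule poisson_tendsto[OF hi elim])
  moreover have "\<forall>\<^sub>F y in at_right 0. poisson h y t = cauchyT f (Complex t y)"
   using eventually_at_right_less[of "0::real"] by eventually_elim (rule rep)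
  ultimately show ?case by (rule Lim_transform_eventually)
 qed
 with hi lim show thesis using that by blast
qed

text \<open>Boundary values from below are conjugates of boundary values from above for the
  conjugate function, so both halves of \<open>cpoisson\<close> converge. At Lebesgue points of
  \<open>f\<close> the truncated integrals have the same limit, hence \<open>H\<close> is the
  Hilbert transform of \<open>f\<close>.\<close>

theorem cpoisson_boundary:
 assumes p: "1 < p" "p < 2" and f: "L1 f" and supp: "!!x. \<bar>x\<bar> > 1 ==> f x = 0"
  and fp: "L1 (%x. norm (f x) powr p)"
 obtains H where "L1 (%x. H x / cr (1 + x^2))"
  "(%n. \<integral>t. norm (cpoisson f (eta n) t - H t) / (1 + t^2) \<partial>lborel) \<longlonglongrightarrow> 0"
  "AE t in lborel. ((%y. trunc_hilbert f y t) \<longlongrightarrow> H t) (at_right 0)"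
proof -
 define f' where "f' x = cnj (f x)" for x
 have f': "L1 f'" unfolding f'_def using f by (rule integrable_cnj)
 have c: "cauchy_L1w f" by (rule cauchy_L1w_Lp[OF p f supp fp])
 have c': "cauchy_L1w f'"
  by (rule cauchy_L1w_Lp[OF p f']) (use supp fp in \<open>auto simp: f'_def\<close>)
 obtain h where h: "L1 (%x. h x / cr (1 + x^2))"
  "(%n. \<integral>t. norm (cauchyT f (Complex t (eta n)) - h t) / (1 + t^2) \<partial>lborel) \<longlonglongrightarrow> 0"
  "AE t in lborel. ((%y. cauchyT f (Complex t y)) \<longlongrightarrow> h t) (at_right 0)"
  using cauchyT_boundary[OF f c] by blast
 obtain h' where h': "L1 (%x. h' x / cr (1 + x^2))"
  "(%n. \<integral>t. norm (cauchyT f' (Complex t (eta n)) - h' t) / (1 + t^2) \<partial>lborel) \<longlonglongrightarrow> 0"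
  "AE t in lborel. ((%y. cauchyT f' (Complex t y)) \<longlongrightarrow> h' t) (at_right 0)"
  using cauchyT_boundary[OF f' c'] by blast
 have low: "cauchyT f (Complex t (-y)) = cnj (cauchyT f' (Complex t y))" for t y
 proof -
  have "cauchyT f (Complex t (-y)) = cauchyT (%x. cnj (f' x)) (Complex t (-y))" by (simp add: f'_def)
  then show ?thesis unfolding cauchyT_cnj by (simp add: complex_eq_iff Complex_eq)
 qed
 define H where "H t = (h t + cnj (h' t)) / (2 * of_real pi * \<i>)" for t
 have cp: "cpoisson f y t = (cauchyT f (Complex t y) + cnj (cauchyT f' (Complex t y))) / (2 * of_real pi * \<i>)" for y t
  unfolding cpoisson_def low ..
 have [measurable]: "h \<in> bm lborel" "h' \<in> bm lborel" using weighted_borel h(1) h'(1) by blast+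
 have Hi: "L1 (%x. H x / cr (1 + x^2))"
 proof -
  have "L1 (%x. (h x / cr (1 + x^2) + cnj (h' x / cr (1 + x^2))) / (2 * of_real pi * \<i>))"
   using h(1) integrable_cnj[OF h'(1)] by (intro integrable_divide integrable_plus)
  then show ?thesis by (simp add: H_def add_divide_distrib mult.commute)
 qed
 have nz: "Im (Complex t (eta n)) ~= 0" "eta n ~= 0" for t n using eta_pos[of n] by auto
 have ci: "L1 (%t. norm (cauchyT u (Complex t (eta n)) - w t) / (1 + t^2))"
  if u: "L1 u" and w: "L1 (%x. w x / cr (1 + x^2))" for u w n
 proof -
  note [measurable] = cauchyT_line_meas[OF u nz(2)] weighted_borel[OF w]
  have "L1 (%t. (LBINT x. norm (u x)) / eta n * (1 / (1 + t^2)) + norm (w t / cr (1 + t^2)))"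
   by (intro integrable_plus integrable_mult_right inverse_square_integrable integrable_norm w)
  then show ?thesis
  proof (rule integrable_dominated)
   show "AE t in lborel. norm (norm (cauchyT u (Complex t (eta n)) - w t) / (1 + t^2)) <= norm ((LBINT x. norm (u x)) / eta n * (1 / (1 + t^2)) + norm (w t / cr (1 + t^2)))"
   proof (rule AE_I2)
    fix t :: real
    have "norm (cauchyT u (Complex t (eta n)) - w t) / (1 + t^2) <= ((LBINT x. norm (u x)) / eta n + norm (w t)) / (1 + t^2)"
     using cauchyT_bound[OF u nz(1)[of t n]] eta_pos[of n] norm_triangle_ineq4[of "cauchyT u (Complex t (eta n))" "w t"]
     by (intro divide_right_mono) auto
    also have "... = (LBINT x. norm (u x)) / eta n * (1 / (1 + t^2)) + norm (w t / cr (1 + t^2))"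
     unfolding norm_divide norm_of_real_1_plus_square by (simp add: add_divide_distrib)
    finally show "norm (norm (cauchyT u (Complex t (eta n)) - w t) / (1 + t^2)) <= norm ((LBINT x. norm (u x)) / eta n * (1 / (1 + t^2)) + norm (w t / cr (1 + t^2)))"
     unfolding real_norm_def by (intro order_trans[OF _ abs_ge_self]) (simp add: abs_of_nonneg)
   qed
  qed measurable
 qed
 have L: "(%n. \<integral>t. norm (cpoisson f (eta n) t - H t) / (1 + t^2) \<partial>lborel) \<longlonglongrightarrow> 0"
 proof (rule Lim_null_comparison)
  have pt: "norm (cpoisson f (eta n) t - H t) / (1 + t^2) <= norm (cauchyT f (Complex t (eta n)) - h t) / (1 + t^2) + norm (cauchyT f' (Complex t (eta n)) - h' t) / (1 + t^2)" for n t
  proof -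
   have "cpoisson f (eta n) t - H t = ((cauchyT f (Complex t (eta n)) - h t) + cnj (cauchyT f' (Complex t (eta n)) - h' t)) / (2 * of_real pi * \<i>)"
    unfolding cp H_def by (simp add: diff_divide_distrib[symmetric] algebra_simps)
   then have "norm (cpoisson f (eta n) t - H t) = norm ((cauchyT f (Complex t (eta n)) - h t) + cnj (cauchyT f' (Complex t (eta n)) - h' t)) / (2 * pi)"
    by (simp add: norm_divide norm_mult)
   also have "... <= norm ((cauchyT f (Complex t (eta n)) - h t) + cnj (cauchyT f' (Complex t (eta n)) - h' t)) / 1"
    by (rule divide_left_mono) (use pi_gt3 in auto)
   also have "... <= norm (cauchyT f (Complex t (eta n)) - h t) + norm (cauchyT f' (Complex t (eta n)) - h' t)"
    using norm_triangle_ineq[of "cauchyT f (Complex t (eta n)) - h t" "cnj (cauchyT f' (Complex t (eta n)) - h' t)"] by (simp only: complex_mod_cnj)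
   finally show ?thesis unfolding add_divide_distrib[symmetric] by (rule divide_right_mono) simp
  qed
  have "norm (LBINT t. norm (cpoisson f (eta n) t - H t) / (1 + t^2)) <= (LBINT t. norm (cauchyT f (Complex t (eta n)) - h t) / (1 + t^2)) + (LBINT t. norm (cauchyT f' (Complex t (eta n)) - h' t) / (1 + t^2))" for n
  proof -
   note [measurable] = cauchyT_line_meas[OF f nz(2)] cauchyT_line_meas[OF f' nz(2)]
   have "norm (LBINT t. norm (cpoisson f (eta n) t - H t) / (1 + t^2)) <= (LBINT t. norm (cauchyT f (Complex t (eta n)) - h t) / (1 + t^2) + norm (cauchyT f' (Complex t (eta n)) - h' t) / (1 + t^2))"
   proof (rule integral_norm_le)
    show i2: "L1 (%t. norm (cauchyT f (Complex t (eta n)) - h t) / (1 + t^2) + norm (cauchyT f' (Complex t (eta n)) - h' t) / (1 + t^2))"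
     by (intro integrable_plus ci f f' h(1) h'(1))
    show "L1 (%t. norm (cpoisson f (eta n) t - H t) / (1 + t^2))"
    proof (rule integrable_dominated[OF i2])
     have [measurable]: "(%t. cnj (cauchyT f' (Complex t (eta n)))) \<in> bm lborel" "(%t. cnj (h' t)) \<in> bm lborel"
      by (rule borel_measurable_cnj, measurable)+
     show "(%t. norm (cpoisson f (eta n) t - H t) / (1 + t^2)) \<in> bm lborel"
      unfolding cp H_def by measurable
     show "AE t in lborel. norm (norm (cpoisson f (eta n) t - H t) / (1 + t^2)) <= norm (norm (cauchyT f (Complex t (eta n)) - h t) / (1 + t^2) + norm (cauchyT f' (Complex t (eta n)) - h' t) / (1 + t^2))"
     proof (rule AE_I2)
      fix t
      show "norm (norm (cpoisson f (eta n) t - H t) / (1 + t^2)) <= norm (norm (cauchyT f (Complex t (eta n)) - h t) / (1 + t^2) + norm (cauchyT f' (Complex t (eta n)) - h' t) / (1 + t^2))"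
       using pt[of n t] by (simp add: abs_of_nonneg order_trans[OF _ abs_ge_self])
     qed
    qed
    show "norm (norm (cpoisson f (eta n) t - H t) / (1 + t^2)) <= norm (cauchyT f (Complex t (eta n)) - h t) / (1 + t^2) + norm (cauchyT f' (Complex t (eta n)) - h' t) / (1 + t^2)" for t
     using pt[of n t] by simp
   qed
   also have "... = (LBINT t. norm (cauchyT f (Complex t (eta n)) - h t) / (1 + t^2)) + (LBINT t. norm (cauchyT f' (Complex t (eta n)) - h' t) / (1 + t^2))"
    by (intro integral_plus ci f f' h(1) h'(1))
   finally show ?thesis .
  qed
  then show "\<forall>\<^sub>F n in sequentially. norm (LBINT t. norm (cpoisson f (eta n) t - H t) / (1 + t^2)) <= (LBINT t. norm (cauchyT f (Complex t (eta n)) - h t) / (1 + t^2)) + (LBINT t. norm (cauchyT f' (Complex t (eta n)) - h' t) / (1 + t^2))"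
   by simp
  show "(%n. (LBINT t. norm (cauchyT f (Complex t (eta n)) - h t) / (1 + t^2)) + (LBINT t. norm (cauchyT f' (Complex t (eta n)) - h' t) / (1 + t^2))) \<longlonglongrightarrow> 0"
   using tendsto_add[OF h(2) h'(2)] by simp
 qed
 have "AE t in lborel. lebesgue_point f t" by (rule AE_lebesgue_point[OF f])
 with h(3) h'(3) have A: "AE t in lborel. ((%y. trunc_hilbert f y t) \<longlongrightarrow> H t) (at_right 0)"
 proof eventually_elim
  case (elim t)
  have "((%y. cpoisson f y t) \<longlongrightarrow> H t) (at_right 0)"
   unfolding cp H_def using elim(1,2) by (intro tendsto_intros) auto
  from tendsto_add[OF trunc_minus_conj_poisson_tendsto[OF f elim(3)] this] show ?case by simp
 qed
 show thesis using that[OF Hi L A] .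
qed

text \<open>A bounded function with its bounded finite Hilbert transform on the interval. The
  transform is encoded through conjugate Poisson integrals, whose bound uniform in the height is
  recorded because it provides the majorant in the Parseval formula.\<close>

definition hilbert_pair :: "(real => complex) => (real => complex) => bool" where
 "hilbert_pair g g' \<longleftrightarrow> g \<in> bm borel & g' \<in> bm borel \<and>
   (\<exists>B. \<forall>x. norm (g x) <= B) & (\<forall>x. x \<notin> {-1<..<1} --> g x = 0) \<and>
   (\<exists>B. \<forall>y t. 0 < y & y <= 1 & t \<in> {-1<..<1} --> norm (cpoisson g y t) <= B) \<and>
   (AE t in lborel. t \<in> {-1<..<1} --> ((%y. cpoisson g y t) \<longlongrightarrow> g' t) (at_right 0))"

lemma bounded_support_integrable:
 fixes g :: "real => complex"
 assumes "g \<in> bm borel" "!!x. norm (g x) <= B" "!!x. x \<notin> {-1<..<1} ==> g x = 0"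
 shows "L1 g"
proof (rule integrable_dominated)
 show "L1 (%x. B * indicator {-1<..<1::real} x)" by (intro integrable_mult_right integrable_real_indicator) auto
 have "norm (g x) <= norm (B * indicator {-1<..<1::real} x)" for x
  using assms(2)[of x] assms(3)[of x] by (cases "x \<in> {-1<..<1}") auto
 then show "AE x in lborel. norm (g x) <= norm (B * indicator {-1<..<1::real} x)" by simp
qed (use assms in auto)

lemma hilbert_pair_integrable: "hilbert_pair g g' ==> L1 g"
 unfolding hilbert_pair_def using bounded_support_integrable by blast

lemma cpoisson_cmult: "cpoisson (%x. c * f x) y t = c * cpoisson f y t"
 by (simp add: cpoisson_def cauchyT_cmult algebra_simps)

lemma hilbert_pair_cmult:
 assumes "hilbert_pair f f'"
 shows "hilbert_pair (%x. c * f x) (%x. c * f' x)"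
proof -
 obtain B1 where B: "!!x. norm (f x) <= B1"
  using assms unfolding hilbert_pair_def by blast
 obtain C1 where C: "!!y t. 0 < y ==> y <= 1 ==> t \<in> {-1<..<1} ==> norm (cpoisson f y t) <= C1"
  using assms unfolding hilbert_pair_def by blast
 have "AE t in lborel. t \<in> {-1<..<1} --> ((%y. cpoisson f y t) \<longlongrightarrow> f' t) (at_right 0)"
  using assms unfolding hilbert_pair_def by blast+
 then have "AE t in lborel. t \<in> {-1<..<1} --> ((%y. cpoisson (%x. c * f x) y t) \<longlongrightarrow> c * f' t) (at_right 0)"
  unfolding cpoisson_cmult by eventually_elim (auto intro: tendsto_mult_left)
 moreover have "norm (c * f x) <= norm c * B1" for x using B by (simp add: norm_mult mult_left_mono)
 moreover have "norm (cpoisson (%x. c * f x) y t) <= norm c * C1" if "0 < y" "y <= 1" "t \<in> {-1<..<1}" for y t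
  unfolding cpoisson_cmult using C[OF that] by (simp add: norm_mult mult_left_mono)
 ultimately show ?thesis using assms unfolding hilbert_pair_def by auto
qed

lemma hilbert_pair_trunc:
 assumes "hilbert_pair g g'"
 shows "AE t in lborel. t \<in> {-1<..<1} --> ((%y. trunc_hilbert g y t) \<longlongrightarrow> g' t) (at_right 0)"
proof -
 note gi = hilbert_pair_integrable[OF assms]
 have "AE t in lborel. lebesgue_point g t" by (rule AE_lebesgue_point[OF gi])
 moreover have "AE t in lborel. t \<in> {-1<..<1} --> ((%y. cpoisson g y t) \<longlongrightarrow> g' t) (at_right 0)"
  using assms unfolding hilbert_pair_def by blast
 ultimately show ?thesis
 proof eventually_elim
  case (elim t)
  show ?case
  proof
   assume "t \<in> {-1<..<1}"
   with elim have "((%y. cpoisson g y t) \<longlongrightarrow> g' t) (at_right 0)" by blast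
   from tendsto_add[OF trunc_minus_conj_poisson_tendsto[OF gi elim(1)] this]
   show "((%y. trunc_hilbert g y t) \<longlongrightarrow> g' t) (at_right 0)" by simp
  qed
 qed
qed

text \<open>At positive height the kernel is bounded by 1 / y and odd, so Fubini applies and
  exchanging the variables changes the sign. The pairing is bilinear, without conjugation.\<close>

lemma cpoisson_skew:
 assumes f: "L1 f" and g: "L1 g" and y: "y > 0"
 shows "(LBINT t. cpoisson f y t * g t) = - (LBINT x. f x * cpoisson g y x)"
proof -
 have [measurable]: "f \<in> bm lborel" "g \<in> bm lborel" using f g by auto
 define k where "k s = s / (s^2 + y^2)" for s :: real
 have [measurable]: "k \<in> bm borel" unfolding k_def by measurable
 have kb: "\<bar>k s\<bar> <= 1 / y" for s
 proof -
  have "0 <= (\<bar>s\<bar> - y)^2" by simp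
  then have "2 * (\<bar>s\<bar> * y) <= s^2 + y^2" by (simp add: power2_diff)
  moreover have "0 <= \<bar>s\<bar> * y" using y by simp
  ultimately have "\<bar>s\<bar> * y <= s^2 + y^2" by linarith
  moreover have "0 < s^2 + y^2" using y by (simp add: add_nonneg_pos)
  ultimately show ?thesis using y by (simp add: k_def abs_divide divide_simps)
 qed
 define \<Phi> where "\<Phi> t x = k (x - t) *\<^sub>R (g t * f x)" for t x
 have "integrable (lborel \<Otimes>\<^sub>M lborel) (%(t, x). \<Phi> t x)"
 proof (rule integrable_dominated)
  show "integrable (lborel \<Otimes>\<^sub>M lborel) (%(t, x). (norm (g t) / y) * norm (f x))"
   by (rule integrable_product) (use f g in auto)
  show "(%(t, x). \<Phi> t x) \<in> borel_measurable (lborel \<Otimes>\<^sub>M lborel)"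
   unfolding \<Phi>_def by measurable
  show "AE p in lborel \<Otimes>\<^sub>M lborel. norm (case p of (t, x) => \<Phi> t x) <= norm (case p of (t, x) => (norm (g t) / y) * norm (f x))"
  proof (rule AE_I2, clarify)
   fix t x
   have "norm (\<Phi> t x) = \<bar>k (x - t)\<bar> * (norm (g t) * norm (f x))" by (simp add: \<Phi>_def norm_mult)
   also have "... <= 1 / y * (norm (g t) * norm (f x))" using kb by (intro mult_right_mono) auto
   finally show "norm (\<Phi> t x) <= norm (norm (g t) / y * norm (f x))" using y by simp
  qed
 qed
 from lborel_pair.Fubini_integral[OF this]
 have sw: "(LBINT x. (LBINT t. \<Phi> t x)) = (LBINT t. (LBINT x. \<Phi> t x))" by simp
 have 1: "(LBINT x. \<Phi> t x) = of_real pi * \<i> * (cpoisson f y t * g t)" for t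
 proof -
  have "(LBINT x. \<Phi> t x) = (LBINT x. g t * (k (x - t) *\<^sub>R f x))"
   by (rule integral_congr[OF refl]) (simp add: \<Phi>_def scaleR_conv_of_real)
  also have "... = g t * (LBINT x. k (x - t) *\<^sub>R f x)" by (rule integral_mult_right_zero)
  finally show ?thesis unfolding cpoisson_eq(2)[OF f y] k_def by simp
 qed
 have 2: "(LBINT t. \<Phi> t x) = - (of_real pi * \<i> * (f x * cpoisson g y x))" for x
 proof -
  have "(LBINT t. \<Phi> t x) = (LBINT t. (- f x) * (k (t - x) *\<^sub>R g t))"
  proof (rule integral_congr[OF refl])
   fix t
   have "k (x - t) = - k (t - x)" by (simp add: k_def power2_commute minus_divide_left)
   then show "\<Phi> t x = (- f x) * (k (t - x) *\<^sub>R g t)" by (simp add: \<Phi>_def scaleR_conv_of_real)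
  qed
  also have "... = (- f x) * (LBINT t. k (t - x) *\<^sub>R g t)" by (rule integral_mult_right_zero)
  finally show ?thesis unfolding cpoisson_eq(2)[OF g y] k_def by simp
 qed
 have "of_real pi * \<i> * (LBINT t. cpoisson f y t * g t) = (LBINT t. of_real pi * \<i> * (cpoisson f y t * g t))"
  by (rule integral_mult_right_zero[symmetric])
 also have "... = (LBINT x. - (of_real pi * \<i> * (f x * cpoisson g y x)))"
  using sw unfolding 1 2 by simp
 also have "... = - (of_real pi * \<i> * (LBINT x. f x * cpoisson g y x))"
  unfolding integral_minus integral_mult_right_zero ..
 finally have "of_real pi * \<i> * (LBINT t. cpoisson f y t * g t) = of_real pi * \<i> * (- (LBINT x. f x * cpoisson g y x))"
  by simp
 then show ?thesis by (subst (asm) mult_left_cancel) auto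
qed

text \<open>The limit of the skew symmetry at height 0. On the left, weighted L1 convergence is
  tested against a bounded function supported where the weight is at least 1/2; on the right, the
  uniform bound on \<open>cpoisson g\<close> gives dominated convergence for integrable
  \<open>f\<close>.\<close>

theorem hilbert_parseval:
 assumes f: "L1 f" and fs: "!!x. x \<notin> {-1<..<1} ==> f x = 0"
  and Hi: "L1 (%x. H x / cr (1 + x^2))"
  and HL: "(%n. \<integral>t. norm (cpoisson f (eta n) t - H t) / (1 + t^2) \<partial>lborel) \<longlonglongrightarrow> 0"
  and pair: "hilbert_pair g g'"
 shows "(LBINT t. H t * g t) = - (LBINT t. f t * g' t)"
proof -
 note gi = hilbert_pair_integrable[OF pair]
 have [measurable]: "f \<in> bm lborel" "g \<in> bm borel" "g' \<in> bm borel"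
  using f pair by (auto simp: hilbert_pair_def)
 have [measurable]: "H \<in> bm lborel" by (rule weighted_borel[OF Hi])
 obtain B where B: "!!x. norm (g x) <= B" using pair unfolding hilbert_pair_def by blast
 have B0: "B >= 0" using B[of 0] norm_ge_zero order_trans by blast
 have gs: "!!x. x \<notin> {-1<..<1} ==> g x = 0" using pair unfolding hilbert_pair_def by blast
 obtain C where C: "!!y t. 0 < y ==> y <= 1 ==> t \<in> {-1<..<1} ==> norm (cpoisson g y t) <= C"
  using pair unfolding hilbert_pair_def by blast
 have lim: "AE t in lborel. t \<in> {-1<..<1} --> ((%y. cpoisson g y t) \<longlongrightarrow> g' t) (at_right 0)"
  using pair unfolding hilbert_pair_def by blast
 have cm [measurable]: "(%t. cpoisson u (eta n) t) \<in> bm lborel" if "L1 u" for u n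
  unfolding cpoisson_def using cauchyT_line_meas[OF that, of "eta n"] cauchyT_line_meas[OF that, of "- eta n"] eta_pos[of n]
  by simp
 note [measurable] = cm[OF f] cm[OF gi]
 have cb: "norm (cpoisson f (eta n) t) <= (LBINT x. norm (f x)) / eta n" for n t
 proof -
  have "norm (cauchyT f (Complex t (eta n)) + cauchyT f (Complex t (- eta n))) <= 2 * ((LBINT x. norm (f x)) / eta n)"
   using cauchyT_bound[OF f, of "Complex t (eta n)"] cauchyT_bound[OF f, of "Complex t (- eta n)"] eta_pos[of n]
    norm_triangle_ineq[of "cauchyT f (Complex t (eta n))" "cauchyT f (Complex t (- eta n))"] by simp
  from divide_right_mono[OF this, of "2 * pi"]
  have "norm (cpoisson f (eta n) t) <= 2 * ((LBINT x. norm (f x)) / eta n) / (2 * pi)"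
   unfolding cpoisson_def norm_divide norm_mult by simp
  also have "... <= 2 * ((LBINT x. norm (f x)) / eta n) / 2"
   using pi_gt3 eta_pos[of n] by (intro divide_left_mono) auto
  finally show ?thesis by simp
 qed
 have Qi: "L1 (%t. cpoisson f (eta n) t * g t)" for n
 proof (rule integrable_dominated)
  show "L1 (%t. (LBINT x. norm (f x)) / eta n * norm (g t))" using gi by auto
  show "AE t in lborel. norm (cpoisson f (eta n) t * g t) <= norm ((LBINT x. norm (f x)) / eta n * norm (g t))"
  proof (rule AE_I2)
   fix t
   show "norm (cpoisson f (eta n) t * g t) <= norm ((LBINT x. norm (f x)) / eta n * norm (g t))"
    using mult_right_mono[OF cb[of n t], of "norm (g t)"] eta_pos[of n] by (simp add: norm_mult abs_mult)
  qed
 qed measurable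
 have gw: "norm (z * g t) <= 2 * B * (norm z / (1 + t^2))" for z t
 proof (cases "t \<in> {-1<..<1}")
  case True
  then have "t^2 <= 1" by (auto simp: abs_square_le_1 abs_le_iff)
  then have "norm z * B * (1 + t^2) <= norm z * B * 2" using B0 by (intro mult_left_mono) auto
  then have "norm z * B <= 2 * B * (norm z / (1 + t^2))" by (simp add: pos_le_divide_eq add_pos_nonneg mult_ac)
  moreover have "norm (z * g t) <= norm z * B" unfolding norm_mult by (rule mult_left_mono[OF B]) simp
  ultimately show ?thesis by linarith
 qed (use gs B0 in simp)
 have HGi: "L1 (%t. H t * g t)"
 proof (rule integrable_dominated)
  show "L1 (%t. 2 * B * norm (H t / cr (1 + t^2)))" using Hi by (intro integrable_mult_right integrable_norm)
  show "AE t in lborel. norm (H t * g t) <= norm (2 * B * norm (H t / cr (1 + t^2)))"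
  proof (rule AE_I2)
   fix t
   show "norm (H t * g t) <= norm (2 * B * norm (H t / cr (1 + t^2)))"
    using gw[of "H t" t] B0 unfolding norm_divide norm_of_real_1_plus_square by (simp add: abs_mult)
  qed
 qed measurable
 have dominated: "L1 (%t. norm (cpoisson f (eta n) t - H t) / (1 + t^2))" for n
 proof -
  have "L1 (%t. (LBINT x. norm (f x)) / eta n * (1 / (1 + t^2)) + norm (H t / cr (1 + t^2)))"
   by (intro integrable_plus integrable_mult_right inverse_square_integrable integrable_norm Hi)
  then show ?thesis
  proof (rule integrable_dominated)
   show "AE t in lborel. norm (norm (cpoisson f (eta n) t - H t) / (1 + t^2)) <= norm ((LBINT x. norm (f x)) / eta n * (1 / (1 + t^2)) + norm (H t / cr (1 + t^2)))"
   proof (rule AE_I2)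
    fix t :: real
    have "norm (cpoisson f (eta n) t - H t) / (1 + t^2) <= ((LBINT x. norm (f x)) / eta n + norm (H t)) / (1 + t^2)"
     using cb[of n t] norm_triangle_ineq4[of "cpoisson f (eta n) t" "H t"] by (intro divide_right_mono) auto
    also have "... = (LBINT x. norm (f x)) / eta n * (1 / (1 + t^2)) + norm (H t / cr (1 + t^2))"
     unfolding norm_divide norm_of_real_1_plus_square by (simp add: add_divide_distrib)
    finally show "norm (norm (cpoisson f (eta n) t - H t) / (1 + t^2)) <= norm ((LBINT x. norm (f x)) / eta n * (1 / (1 + t^2)) + norm (H t / cr (1 + t^2)))"
     unfolding real_norm_def by (intro order_trans[OF _ abs_ge_self]) (simp add: abs_of_nonneg)
   qed
  qed measurable
 qed
 have L1: "(%n. \<integral>t. cpoisson f (eta n) t * g t \<partial>lborel) \<longlonglongrightarrow> (LBINT t. H t * g t)"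
 proof (rule LIM_zero_cancel, rule Lim_null_comparison)
  have "norm ((LBINT t. cpoisson f (eta n) t * g t) - (LBINT t. H t * g t)) <= 2 * B * (LBINT t. norm (cpoisson f (eta n) t - H t) / (1 + t^2))" for n
  proof -
   have "(LBINT t. cpoisson f (eta n) t * g t) - (LBINT t. H t * g t) = (LBINT t. (cpoisson f (eta n) t - H t) * g t)"
    using Qi[of n] HGi by (simp add: left_diff_distrib)
   moreover have "norm (LBINT t. (cpoisson f (eta n) t - H t) * g t) <= (LBINT t. 2 * B * (norm (cpoisson f (eta n) t - H t) / (1 + t^2)))"
   proof (rule integral_norm_le)
    show "L1 (%t. (cpoisson f (eta n) t - H t) * g t)"
     unfolding left_diff_distrib using Qi HGi by (rule integrable_sub)
    show "L1 (%t. 2 * B * (norm (cpoisson f (eta n) t - H t) / (1 + t^2)))"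
     by (rule integrable_mult_right[OF dominated])
   qed (rule gw)
   moreover have "(LBINT t. 2 * B * (norm (cpoisson f (eta n) t - H t) / (1 + t^2))) = 2 * B * (LBINT t. norm (cpoisson f (eta n) t - H t) / (1 + t^2))"
    by (rule integral_mult_right_zero)
   ultimately show ?thesis by (simp only:)
  qed
  then show "\<forall>\<^sub>F n in sequentially. norm ((LBINT t. cpoisson f (eta n) t * g t) - (LBINT t. H t * g t)) <= 2 * B * (LBINT t. norm (cpoisson f (eta n) t - H t) / (1 + t^2))"
   by simp
  show "(%n. 2 * B * (LBINT t. norm (cpoisson f (eta n) t - H t) / (1 + t^2))) \<longlonglongrightarrow> 0"
   by (rule tendsto_mult_right_zero[OF HL])
 qed
 have L2: "(%n. \<integral>t. f t * cpoisson g (eta n) t \<partial>lborel) \<longlonglongrightarrow> (LBINT t. f t * g' t)"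
 proof (rule integral_dominated_convergence[where w = "%t. C * norm (f t)"])
  show "AE t in lborel. (%n. f t * cpoisson g (eta n) t) \<longlonglongrightarrow> f t * g' t"
   using lim
  proof eventually_elim
   case (elim t)
   show ?case
   proof (cases "t \<in> {-1<..<1}")
    case True
    then have "((%y. cpoisson g y t) \<longlongrightarrow> g' t) (at_right 0)" using elim by blast
    then have "(%n. cpoisson g (eta n) t) \<longlonglongrightarrow> g' t" by (rule filterlim_compose[OF _ eta_at_right])
    then show ?thesis by (rule tendsto_mult_left)
   qed (use fs in simp)
  qed
  show "AE t in lborel. norm (f t * cpoisson g (eta n) t) <= C * norm (f t)" for n
  proof (rule AE_I2)
   fix t
   show "norm (f t * cpoisson g (eta n) t) <= C * norm (f t)"
   proof (cases "t \<in> {-1<..<1}")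
    case True
    from mult_left_mono[OF C[OF eta_pos eta_le_1 this, of n], of "norm (f t)"] show ?thesis
     by (simp add: norm_mult mult.commute)
   qed (use fs in simp)
  qed
 qed (use f in auto)
 have "(%n. \<integral>t. cpoisson f (eta n) t * g t \<partial>lborel) \<longlonglongrightarrow> - (LBINT t. f t * g' t)"
  unfolding cpoisson_skew[OF f gi eta_pos] by (rule tendsto_minus[OF L2])
 then show ?thesis by (rule LIMSEQ_unique[OF L1])
qed

section \<open>Power weights and explicit Hilbert pairs\<close>

definition wt :: "complex => real => complex" where
 "wt a x = (if -1 < x & x < 1 then exp (a * of_real (ln ((1 - x) / (1 + x)))) else 0)"

text \<open>The quotient meets the cut of \<open>Ln\<close> only for z in [-1, 1]; hence this branch
  is holomorphic off the real line, and it tends to 1 at infinity.\<close>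

definition Wf :: "complex => complex => complex" where
 "Wf a z = exp (a * Ln ((z - 1) / (z + 1)))"

lemma wt_borel [measurable]: "wt a \<in> bm borel"
 unfolding wt_def[abs_def] by measurable

lemma wt_outside: "x \<notin> {-1<..<1} ==> wt a x = 0"
 by (auto simp: wt_def)

lemma norm_wt: "-1 < x ==> x < 1 ==> norm (wt a x) = (1 - x) powr (Re a) * (1 + x) powr (- Re a)"
 by (simp add: wt_def powr_def ln_div exp_add[symmetric] algebra_simps)

lemma powr_sing_integrable:
 fixes r :: real
 assumes r: "r < 1"
 shows "L1 (%x. indicator {-1<..<1} x * (1 + x) powr (-r))"
  and "L1 (%x. indicator {-1<..<1} x * (1 - x) powr (-r))"
proof -
 have "(%x. x powr (-r)) integrable_on {0<..2}"
  by (rule integrable_on_powr_from_0') (use r in auto)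
 then have "(%x. x powr (-r)) absolutely_integrable_on {0<..2}"
  by (rule nonnegative_absolutely_integrable_1) simp
 then have "integrable lebesgue (%x. indicator {0<..2} x * x powr (-r))"
  by (simp add: set_integrable_def)
 then have i: "L1 (%x. indicator {0<..2} x * x powr (-r))"
  by (subst (asm) integrable_completion) auto
 have 1: "L1 (%x. indicator {0<..2} (1 + 1 * x) * (1 + 1 * x) powr (-r))"
  by (rule lborel_integrable_real_affine[OF i]) simp
 show "L1 (%x. indicator {-1<..<1} x * (1 + x) powr (-r))"
  by (rule integrable_dominated[OF 1]) (auto intro!: AE_I2 simp: indicator_def)
 have 2: "L1 (%x. indicator {0<..2} (1 + (-1) * x) * (1 + (-1) * x) powr (-r))"
  by (rule lborel_integrable_real_affine[OF i]) simp
 show "L1 (%x. indicator {-1<..<1} x * (1 - x) powr (-r))"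
  by (rule integrable_dominated[OF 2]) (auto intro!: AE_I2 simp: indicator_def)
qed

lemma powr_le_2: "0 <= x ==> x <= 2 ==> 0 <= s ==> s <= 1 ==> x powr s <= (2::real)"
proof -
 assume a: "0 <= x" "x <= 2" "0 <= s" "s <= 1"
 have "x powr s <= 2 powr s" using a by (intro powr_mono2) auto
 also have "... <= 2 powr 1" using a by (intro powr_mono) auto
 finally show ?thesis by simp
qed

lemma wt_integrable:
 assumes a: "\<bar>Re a\<bar> < 1"
 shows "L1 (wt a)"
proof (rule integrable_dominated)
 define r where "r = \<bar>Re a\<bar>"
 show "L1 (%x. 2 * (indicator {-1<..<1} x * (1 + x) powr (-r) + indicator {-1<..<1} x * (1 - x) powr (-r)))"
  using powr_sing_integrable[of r] a unfolding r_def by (intro integrable_mult_right integrable_plus) auto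
 show "AE x in lborel. norm (wt a x) <= norm (2 * (indicator {-1<..<1} x * (1 + x) powr (-r) + indicator {-1<..<1} x * (1 - x) powr (-r)))"
 proof (rule AE_I2)
  fix x
  show "norm (wt a x) <= norm (2 * (indicator {-1<..<1} x * (1 + x) powr (-r) + indicator {-1<..<1} x * (1 - x) powr (-r)))"
  proof (cases "-1 < x & x < 1")
   case True
   have "norm (wt a x) <= 2 * ((1 + x) powr (-r) + (1 - x) powr (-r))"
   proof (cases "Re a >= 0")
    case True
    have "(1 - x) powr (Re a) * (1 + x) powr (- Re a) <= 2 * (1 + x) powr (-r)"
     unfolding r_def using True a \<open>-1 < x & x < 1\<close> by (intro mult_mono powr_le_2) auto
    also have "... <= 2 * ((1 + x) powr (-r) + (1 - x) powr (-r))" by simp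
    finally show ?thesis using norm_wt[of x a] \<open>-1 < x & x < 1\<close> by simp
   next
    case False
    have "(1 + x) powr (- Re a) * (1 - x) powr (Re a) <= 2 * (1 - x) powr (-r)"
     unfolding r_def using False a \<open>-1 < x & x < 1\<close> by (intro mult_mono powr_le_2) auto
    also have "... <= 2 * ((1 + x) powr (-r) + (1 - x) powr (-r))" by simp
    finally show ?thesis using norm_wt[of x a] \<open>-1 < x & x < 1\<close> by (simp add: mult.commute)
   qed
   then show ?thesis using True by simp
  qed (simp add: wt_def)
 qed
qed simp

lemma wt_has_vector_derivative:
 assumes x: "-1 < x" "x < 1"
 shows "(wt a has_vector_derivative (of_real (- 2 / (1 - x^2)) * (a * wt a x))) (at x)"
proof -
 have nz: "1 - x^2 = (1 - x) * (1 + x)" by (simp add: power2_eq_square algebra_simps)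
 have "((%x. ln ((1 - x) / (1 + x))) has_real_derivative - 2 / (1 - x^2)) (at x)"
  unfolding nz using x
  by (auto intro!: derivative_eq_intros simp: divide_simps)
 then have 1: "((%x. cr (ln ((1 - x) / (1 + x)))) has_vector_derivative of_real (- 2 / (1 - x^2))) (at x)"
  by (intro has_vector_derivative_of_real) (simp add: has_real_derivative_iff_has_vector_derivative)
 have 2: "((%s. exp (a * s)) has_field_derivative (a * exp (a * of_real (ln ((1 - x) / (1 + x)))))) (at (cr (ln ((1 - x) / (1 + x)))))"
  by (auto intro!: derivative_eq_intros)
 have "((%x. exp (a * cr (ln ((1 - x) / (1 + x))))) has_vector_derivative of_real (- 2 / (1 - x^2)) * (a * exp (a * of_real (ln ((1 - x) / (1 + x)))))) (at x)"
  using field_vector_diff_chain_at[OF 1 2] by (simp add: o_def)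
 then have "(wt a has_vector_derivative of_real (- 2 / (1 - x^2)) * (a * exp (a * of_real (ln ((1 - x) / (1 + x)))))) (at x)"
  by (rule has_vector_derivative_transform_within_open[where S = "{-1<..<1}"]) (use x in \<open>auto simp: wt_def\<close>)
 then show ?thesis using x by (simp add: wt_def)
qed

text \<open>Integrating \<open>((1 - x^2) w / (x - z))'\<close>, where \<open>(1 - x^2) w' = - 2 a w\<close>.\<close>

lemma cauchyT_wt_ode:
 assumes a: "\<bar>Re a\<bar> < 1" and z: "Im z ~= 0"
 shows "(1 - z^2) * (LBINT x. wt a x / (of_real x - z)^2) = - 2 * a * cauchyT (wt a) z - (LBINT x. wt a x)"
proof -
 note wi = wt_integrable[OF a]
 have nz: "cr x - z ~= 0" for x by (rule cauchy_denom_nz[OF z])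
 define \<Phi> where "\<Phi> x = of_real (1 - x^2) * wt a x / (of_real x - z)" for x
 define \<phi> where "\<phi> x = - wt a x - 2 * a * (wt a x / (of_real x - z)) - (1 - z^2) * (wt a x / (of_real x - z)^2)" for x
 have i1: "L1 (%x. wt a x / (of_real x - z))" by (rule cauchy_integrable[OF wi z])
 have i2: "L1 (%x. wt a x / (of_real x - z)^2)"
 proof (rule integrable_dominated)
  show "L1 (%x. norm (wt a x / (of_real x - z)) / \<bar>Im z\<bar>)" using i1 by simp
  show "AE x in lborel. norm (wt a x / (of_real x - z)^2) <= norm (norm (wt a x / (of_real x - z)) / \<bar>Im z\<bar>)"
  proof (rule AE_I2)
   fix x
   have e: "wt a x / (of_real x - z)^2 = (wt a x / (of_real x - z)) / (of_real x - z)" by (simp add: power2_eq_square)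
   have "norm (wt a x / (of_real x - z)^2) <= norm (wt a x / (of_real x - z)) / \<bar>Im z\<bar>"
    unfolding e by (rule norm_cauchy_integrand[OF z])
   then show "norm (wt a x / (of_real x - z)^2) <= norm (norm (wt a x / (of_real x - z)) / \<bar>Im z\<bar>)"
    by simp
  qed
 qed measurable
 have \<phi>i: "L1 \<phi>" unfolding \<phi>_def
  by (intro integrable_sub integrable_mult_right i1 i2) (use wi in simp)
 have deriv: "(\<Phi> has_vector_derivative \<phi> x) (at x)" if x: "x \<in> {-1<..<1}" for x
 proof -
  have x': "-1 < x" "x < 1" using x by auto
  have r: "cr (1 - x^2) ~= 0"
  proof -
   have "1 - x^2 = (1 - x) * (1 + x)" by (simp add: power2_eq_square algebra_simps)
   then have "1 - x^2 ~= 0" using x' by simp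
   then show ?thesis by (simp only: of_real_eq_0_iff) simp
  qed
  have 1: "((%x. cr (1 - x^2)) has_vector_derivative of_real (- 2 * x)) (at x)"
   by (rule has_vector_derivative_of_real) (auto intro!: derivative_eq_intros simp flip: has_real_derivative_iff_has_vector_derivative)
  have 2: "((%x. 1 / (cr x - z)) has_vector_derivative - (1 / (of_real x - z)^2)) (at x)"
  proof -
   have v: "((%x. cr x) has_vector_derivative 1) (at x)"
    by (auto intro!: derivative_eq_intros)
   have f: "((%s. 1 / (s - z)) has_field_derivative - (1 / (of_real x - z)^2)) (at (cr x))"
    using nz[of x] by (auto intro!: derivative_eq_intros simp: power2_eq_square)
   show ?thesis using field_vector_diff_chain_at[OF v f] by (simp add: o_def)
  qed
  have "((%x. of_real (1 - x^2) * wt a x * (1 / (of_real x - z))) has_vector_derivative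
    (of_real (1 - x^2) * wt a x) * (- (1 / (of_real x - z)^2)) + (of_real (1 - x^2) * (of_real (- 2 / (1 - x^2)) * (a * wt a x)) + of_real (- 2 * x) * wt a x) * (1 / (of_real x - z))) (at x)"
   by (intro has_vector_derivative_mult 1 2 wt_has_vector_derivative x')
  moreover have "(of_real (1 - x^2) * wt a x) * (- (1 / (of_real x - z)^2)) + (of_real (1 - x^2) * (of_real (- 2 / (1 - x^2)) * (a * wt a x)) + of_real (- 2 * x) * wt a x) * (1 / (of_real x - z)) = \<phi> x"
  proof -
   define d where "d = cr x - z"
   have xd: "cr x = z + d" by (simp add: d_def)
   have d0: "d ~= 0" using nz[of x] by (simp add: d_def)
   have e: "cr (1 - x^2) * (of_real (- 2 / (1 - x^2)) * (a * wt a x)) = - 2 * (a * wt a x)"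
    using r by (simp only: of_real_divide) (simp del: of_real_diff)
   have "(of_real (1 - x^2) * wt a x) * (- (1 / d^2)) + (- 2 * (a * wt a x) + of_real (- 2 * x) * wt a x) * (1 / d) = - wt a x - 2 * a * (wt a x / d) - (1 - z^2) * (wt a x / d^2)"
    using d0 by (simp add: xd divide_simps) (simp add: power2_eq_square algebra_simps)
   then show ?thesis unfolding e \<phi>_def d_def .
  qed
  ultimately show ?thesis unfolding \<Phi>_def by simp
 qed
 \<comment> \<open>As |Re a| < 1, both exponents are positive: the bound vanishes at the end points,
   which makes \<open>\<Phi>\<close> continuous on the closed interval and its boundary terms
   zero.\<close>
 have \<Phi>b: "norm (\<Phi> x) <= ((1 - x) powr (1 + Re a) * (1 + x) powr (1 - Re a)) / \<bar>Im z\<bar>" if x: "x \<in> {-1..1}" for x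
 proof (cases "x \<in> {-1<..<1}")
  case True
  then have x': "-1 < x" "x < 1" by auto
  have e: "1 - x^2 = (1 - x) * (1 + x)" by (simp add: power2_eq_square algebra_simps)
  have "norm (\<Phi> x) <= norm (of_real (1 - x^2) * wt a x) / \<bar>Im z\<bar>"
   unfolding \<Phi>_def by (rule norm_cauchy_integrand[OF z])
  also have "norm (of_real (1 - x^2) * wt a x) = (1 - x) * (1 + x) * ((1 - x) powr (Re a) * (1 + x) powr (- Re a))"
   unfolding norm_mult norm_of_real e norm_wt[OF x'] using x' by (simp add: abs_mult)
  also have "... = (1 - x) powr (1 + Re a) * (1 + x) powr (1 - Re a)"
   using x' powr_add[of "1 - x" 1 "Re a"] powr_add[of "1 + x" 1 "- Re a"] by simp
  finally show ?thesis .
 qed (simp add: \<Phi>_def wt_outside)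
 have bcont: "continuous_on {-1..1} (%x. ((1 - x) powr (1 + Re a) * (1 + x) powr (1 - Re a)) / \<bar>Im z\<bar>)"
  using a z by (intro continuous_intros continuous_on_powr') (auto simp: abs_less_iff)
 have cont: "continuous_on {-1..1} \<Phi>"
  unfolding continuous_on_eq_continuous_within
 proof
  fix x :: real assume x: "x \<in> {-1..1}"
  show "continuous (at x within {-1..1}) \<Phi>"
  proof (cases "x \<in> {-1<..<1}")
   case True
   show ?thesis by (rule continuous_at_imp_continuous_at_within, rule has_vector_derivative_continuous[OF deriv[OF True]])
  next
   case False
   then have xx: "x = -1 \<or> x = 1" using x by auto
   then have z0: "((1 - x) powr (1 + Re a) * (1 + x) powr (1 - Re a)) / \<bar>Im z\<bar> = 0" and P0: "\<Phi> x = 0" by (auto simp: \<Phi>_def)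
   have "((%x. ((1 - x) powr (1 + Re a) * (1 + x) powr (1 - Re a)) / \<bar>Im z\<bar>) \<longlongrightarrow> 0) (at x within {-1..1})"
    using bcont x unfolding continuous_on_def z0[symmetric] by blast
   then have "(\<Phi> \<longlongrightarrow> 0) (at x within {-1..1})"
    by (rule Lim_null_comparison[rotated]) (use \<Phi>b in \<open>auto simp: eventually_at_filter\<close>)
   then show ?thesis by (simp add: continuous_within P0)
  qed
 qed
 have "(\<phi> has_integral (\<Phi> 1 - \<Phi> (-1))) {-1..1}"
  by (rule fundamental_theorem_of_calculus_interior[OF _ cont deriv]) auto
 moreover have "\<Phi> 1 - \<Phi> (-1) = 0" by (simp add: \<Phi>_def)
 ultimately have "(\<phi> has_integral 0) {-1..1}" by simp
 then have "(\<phi> has_integral 0) UNIV"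
  by (rule has_integral_on_superset) (auto simp: \<phi>_def wt_def)
 moreover have "(\<phi> has_integral (LBINT x. \<phi> x)) UNIV" by (rule has_integral_integral_lborel[OF \<phi>i])
 ultimately have "(LBINT x. \<phi> x) = 0" using has_integral_unique by blast
 moreover have "(LBINT x. \<phi> x) = - (LBINT x. wt a x) - 2 * a * cauchyT (wt a) z - (1 - z^2) * (LBINT x. wt a x / (of_real x - z)^2)"
 proof -
  have "(LBINT x. \<phi> x) = (LBINT x. - wt a x) - (LBINT x. 2 * a * (wt a x / (of_real x - z))) - (LBINT x. (1 - z^2) * (wt a x / (of_real x - z)^2))"
  proof -
   have j: "L1 (%x. - wt a x)" "L1 (%x. 2 * a * (wt a x / (of_real x - z)))"
    "L1 (%x. (1 - z^2) * (wt a x / (of_real x - z)^2))"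
    by (rule integrable_minus[OF wi] integrable_mult_right[OF i1] integrable_mult_right[OF i2])+
   show ?thesis unfolding \<phi>_def
    by (simp only: integral_sub[OF integrable_sub[OF j(1,2)] j(3)] integral_sub[OF j(1,2)])
  qed
  then show ?thesis unfolding cauchyT_def integral_mult_right_zero integral_minus .
 qed
 ultimately show ?thesis by (simp add: algebra_simps)
qed

lemma Im_moebius: "Im ((z - 1) / (z + 1)) = 2 * Im z / (norm (z + 1))^2"
proof -
 have "Im z * (Re z + 1) - (Re z - 1) * Im z = 2 * Im z" by (simp add: algebra_simps)
 then show ?thesis by (simp add: Im_divide cmod_power2)
qed

lemma moebius_nz:
 assumes z: "Im z ~= 0"
 shows "z + 1 ~= 0" "z - 1 ~= 0" "Im ((z - 1) / (z + 1)) ~= 0" "(z - 1) / (z + 1) \<notin> \<real>\<^sub>\<le>\<^sub>0"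
proof -
 show 1: "z + 1 ~= 0" using z by (auto simp: complex_eq_iff)
 show "z - 1 ~= 0" using z by (auto simp: complex_eq_iff)
 show 3: "Im ((z - 1) / (z + 1)) ~= 0" unfolding Im_moebius using z 1 by simp
 then show "(z - 1) / (z + 1) \<notin> \<real>\<^sub>\<le>\<^sub>0" by (simp add: complex_nonpos_Reals_iff)
qed

lemma Wf_nz [simp]: "Wf a z ~= 0"
 by (simp add: Wf_def)

lemma Wf_has_field_derivative:
 assumes z: "Im z ~= 0"
 shows "(Wf a has_field_derivative Wf a z * (2 * a / (z^2 - 1))) (at z)"
proof -
 note nz = moebius_nz[OF z]
 have f: "z^2 - 1 = (z - 1) * (z + 1)" by (simp add: power2_eq_square algebra_simps)
 have "((%z. (z - 1) / (z + 1)) has_field_derivative 2 / (z + 1)^2) (at z)"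
  using nz by (auto intro!: derivative_eq_intros simp: power2_eq_square)
 then have "((%z. Ln ((z - 1) / (z + 1))) has_field_derivative (1 / ((z - 1) / (z + 1)) * (2 / (z + 1)^2))) (at z)"
  using DERIV_chain2[where f = Ln and g = "%z. (z - 1) / (z + 1)", OF has_field_derivative_Ln[OF nz(4)], where Db = "2 / (z + 1)^2" and s = UNIV]
  by (simp only: inverse_eq_divide)
 from DERIV_fun_exp[OF DERIV_cmult[OF this, of a]]
 have "(Wf a has_field_derivative Wf a z * (a * (1 / ((z - 1) / (z + 1)) * (2 / (z + 1)^2)))) (at z)"
  unfolding Wf_def .
 moreover have "a * (1 / ((z - 1) / (z + 1)) * (2 / (z + 1)^2)) = 2 * a / (z^2 - 1)"
  unfolding f using nz(1,2) by (simp add: divide_simps) (simp add: power2_eq_square algebra_simps)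
 ultimately show ?thesis by (simp only:)
qed

lemma Wf_far:
 assumes s: "s = 1 \<or> s = -1"
 shows "(%n. Wf a (Complex 0 (s * real n))) \<longlonglongrightarrow> 1"
proof -
 have lim: "(%n. 1 - 2 / (Complex 0 (s * real n) + 1)) \<longlonglongrightarrow> 1 - 0"
 proof (intro tendsto_intros)
  show "(%n. 2 / (Complex 0 (s * real n) + 1)) \<longlonglongrightarrow> 0"
  proof (rule tendsto_divide_0[OF tendsto_const], unfold filterlim_at_infinity_conv_norm_at_top)
   have "real n <= norm (Complex 0 (s * real n) + 1)" for n
    using abs_Im_le_cmod[of "Complex 0 (s * real n) + 1"] s by auto
   then show "filterlim (%n. norm (Complex 0 (s * real n) + 1)) at_top sequentially"
    by (intro filterlim_at_top_mono[OF filterlim_real_sequentially] always_eventually) auto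
  qed
 qed
 have eq: "1 - 2 / (Complex 0 (s * real n) + 1) = (Complex 0 (s * real n) - 1) / (Complex 0 (s * real n) + 1)" for n
 proof -
  have "Complex 0 (s * real n) + 1 ~= 0" by (auto simp: complex_eq_iff)
  then show ?thesis by (simp add: divide_simps)
 qed
 have "(%n. Ln ((Complex 0 (s * real n) - 1) / (Complex 0 (s * real n) + 1))) \<longlonglongrightarrow> Ln 1"
 proof (rule tendsto_Ln)
  show "(%n. (Complex 0 (s * real n) - 1) / (Complex 0 (s * real n) + 1)) \<longlonglongrightarrow> 1"
   using lim unfolding eq by simp
 qed (simp add: complex_nonpos_Reals_iff)
 then have "(%n. exp (a * Ln ((Complex 0 (s * real n) - 1) / (Complex 0 (s * real n) + 1)))) \<longlonglongrightarrow> exp (a * Ln 1)"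
  by (intro tendsto_exp tendsto_mult_left)
 then show ?thesis by (simp add: Wf_def)
qed

lemma cauchyT_far:
 assumes f: "L1 f" and s: "s = 1 \<or> s = -1"
 shows "(%n. cauchyT f (Complex 0 (s * real n))) \<longlonglongrightarrow> 0"
proof (rule Lim_null_comparison)
 show "\<forall>\<^sub>F n in sequentially. norm (cauchyT f (Complex 0 (s * real n))) <= (LBINT x. norm (f x)) / real n"
  using eventually_gt_at_top[of 0]
 proof eventually_elim
  case (elim n)
  then show ?case using cauchyT_bound[OF f, of "Complex 0 (s * real n)"] s by (auto simp: abs_mult)
 qed
 show "(%n. (LBINT x. norm (f x)) / real n) \<longlonglongrightarrow> 0"
  by (rule lim_const_over_n)
qed

text \<open>Adding \<open>k\<close> makes the differential equation of the Cauchy transform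
  homogeneous, and then it is the equation of \<open>Wf a\<close>. So the quotient \<open>J\<close>
  is constant in each half-plane, and its limit at infinity along the imaginary axis identifies the
  constant as \<open>k\<close>.\<close>

lemma cauchyT_wt_aux:
 assumes a: "\<bar>Re a\<bar> < 1" "a ~= 0" and z: "Im z ~= 0"
 defines "k \<equiv> (LBINT x. wt a x) / (2 * a)"
 shows "cauchyT (wt a) z = k * (Wf a z - 1)"
proof -
 note wi = wt_integrable[OF a(1)]
 define s where "s = sgn (Im z)"
 have s: "s = 1 \<or> s = -1" using z by (auto simp: s_def sgn_if)
 define S where "S = {w. s * Im w > 0}"
 have S0: "Im w ~= 0" if "w \<in> S" for w using that by (auto simp: S_def)
 have cv: "convex S"
 proof (cases "s = 1")
  case True
  then have "S = {w. Im w > 0}" by (auto simp: S_def)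
  then show ?thesis by (simp add: convex_halfspace_Im_gt)
 next
  case False
  then have "S = {w. Im w < 0}" using s by (auto simp: S_def)
  then show ?thesis by (simp add: convex_halfspace_Im_lt)
 qed
 define J where "J w = (cauchyT (wt a) w + k) / Wf a w" for w
 have dJ: "(J has_field_derivative 0) (at w within S)" if w: "w \<in> S" for w
 proof -
  note w0 = S0[OF w]
  note nz = moebius_nz[OF w0]
  define D where "D = (LBINT x. wt a x / (of_real x - w)^2)"
  have f: "w^2 - 1 = (w - 1) * (w + 1)" by (simp add: power2_eq_square algebra_simps)
  have f0: "w^2 - 1 ~= 0" unfolding f using nz by simp
  have "(1 - w^2) * D = - 2 * a * cauchyT (wt a) w - 2 * a * k"
   using cauchyT_wt_ode[OF a(1) w0] a(2) by (simp add: D_def k_def)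
  then have "(w^2 - 1) * D = 2 * a * (cauchyT (wt a) w + k)" by (simp add: algebra_simps)
  then have D: "D = 2 * a * (cauchyT (wt a) w + k) / (w^2 - 1)" using f0 by (simp add: eq_divide_eq mult.commute)
  have "(J has_field_derivative ((D + 0) * Wf a w - (cauchyT (wt a) w + k) * (Wf a w * (2 * a / (w^2 - 1)))) / (Wf a w * Wf a w)) (at w)"
   unfolding J_def
   by (intro DERIV_divide DERIV_add cauchyT_has_field_derivative[OF wi w0, folded D_def] Wf_has_field_derivative[OF w0] DERIV_const) simp
  then have "(J has_field_derivative 0) (at w)" unfolding D by (simp add: field_simps)
  then show ?thesis by (rule has_field_derivative_at_within)
 qed
 obtain c where c: "!!w. w \<in> S ==> J w = c"
  using has_field_derivative_zero_constant[OF cv dJ] by blast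
 have "(%n. J (Complex 0 (s * real (Suc n)))) \<longlonglongrightarrow> (0 + k) / 1"
  unfolding J_def
  using LIMSEQ_Suc[OF cauchyT_far[OF wi s]] LIMSEQ_Suc[OF Wf_far[OF s, of a]]
  by (intro tendsto_intros) auto
 moreover have "J (Complex 0 (s * real (Suc n))) = c" for n
  by (rule c) (use s in \<open>auto simp: S_def\<close>)
 ultimately have "c = k" using LIMSEQ_unique[OF tendsto_const] by fastforce
 moreover have "z \<in> S" using z by (simp add: S_def s_def sgn_if)
 ultimately have "J z = k" using c by simp
 then have "cauchyT (wt a) z + k = k * Wf a z" by (simp add: J_def divide_eq_eq)
 then show ?thesis by (simp add: algebra_simps eq_diff_eq)
qed

text \<open>N = (1 - z) / (1 + z) is positive on the interval, and Im N has the sign opposite to Im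
  z. So Ln (- N) is Ln N + i pi above the interval and Ln N - i pi below it.\<close>

lemma Wf_boundary:
 assumes t: "-1 < t" "t < 1"
 shows "((%y. Wf a (Complex t y)) \<longlongrightarrow> wt a t * exp (\<i> * pi * a)) (at_right 0)"
  and "((%y. Wf a (Complex t (-y))) \<longlongrightarrow> wt a t * exp (- (\<i> * pi * a))) (at_right 0)"
proof -
 define N where "N z = (1 - z) / (1 + z)" for z :: complex
 have Nm: "(z - 1) / (z + 1) = - N z" for z by (simp add: N_def add.commute minus_divide_left)
 have c: "((%y. Complex t (s * y)) \<longlongrightarrow> of_real t) (at_right 0)" for s
 proof -
  have "((%y. Complex t (s * y)) \<longlongrightarrow> Complex t (s * 0)) (at_right 0)"
   unfolding Complex_eq by (intro tendsto_intros)
  then show ?thesis by (simp add: complex_of_real_def)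
 qed
 have t0: "1 + cr t ~= 0" using t by (auto simp: complex_eq_iff)
 have Nt: "N (of_real t) = of_real ((1 - t) / (1 + t))" by (simp add: N_def)
 have u: "0 < (1 - t) / (1 + t)" using t by simp
 have "((%y. N (Complex t (s * y))) \<longlongrightarrow> N (of_real t)) (at_right 0)" for s
  unfolding N_def using t0 by (intro tendsto_intros c)
 then have L: "((%y. Ln (N (Complex t (s * y)))) \<longlongrightarrow> of_real (ln ((1 - t) / (1 + t)))) (at_right 0)" for s
 proof -
  define u0 where "u0 = (1 - t) / (1 + t)"
  have "cr u0 \<notin> \<real>\<^sub>\<le>\<^sub>0" using u unfolding u0_def[symmetric] by (simp add: complex_nonpos_Reals_iff)
  from tendsto_Ln[OF \<open>!!s. ((%y. N (Complex t (s * y))) \<longlongrightarrow> N (of_real t)) (at_right 0)\<close>[of s, unfolded Nt, folded u0_def] this]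
  show ?thesis using Ln_of_real[of u0] u unfolding u0_def[symmetric] by simp
 qed
 have E: "((%y. exp (a * (Ln (N (Complex t (s * y))) + b))) \<longlongrightarrow> wt a t * exp (a * b)) (at_right 0)" for s b
 proof -
  have "((%y. exp (a * (Ln (N (Complex t (s * y))) + b))) \<longlongrightarrow> exp (a * (of_real (ln ((1 - t) / (1 + t))) + b))) (at_right 0)"
   by (intro tendsto_intros L)
  then show ?thesis using t by (simp add: wt_def distrib_left exp_add)
 qed
 have ImN: "Im (N z) = - (2 * Im z / (norm (z + 1))^2)" for z
  using Im_moebius[of z] unfolding Nm by simp
 have pos: "(norm (z + 1))^2 > 0" if "Im z ~= 0" for z using moebius_nz(1)[OF that] by simp
 have "\<forall>\<^sub>F y in at_right 0. exp (a * (Ln (N (Complex t (1 * y))) + \<i> * pi)) = Wf a (Complex t y)"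
  using eventually_at_right_less[of "0::real"]
 proof eventually_elim
  case (elim y)
  have "Im (N (Complex t y)) < 0" using ImN[of "Complex t y"] pos[of "Complex t y"] elim by simp
  moreover from this have "N (Complex t y) ~= 0" by auto
  ultimately show ?case unfolding Wf_def Nm using Ln_minus[of "N (Complex t y)"] by auto
 qed
 from Lim_transform_eventually[OF E[of 1 "\<i> * pi"] this]
 show "((%y. Wf a (Complex t y)) \<longlongrightarrow> wt a t * exp (\<i> * pi * a)) (at_right 0)" by (simp add: mult_ac)
 have "\<forall>\<^sub>F y in at_right 0. exp (a * (Ln (N (Complex t ((-1) * y))) + - (\<i> * pi))) = Wf a (Complex t (-y))"
  using eventually_at_right_less[of "0::real"]
 proof eventually_elim
  case (elim y)
  have "Im (N (Complex t (-y))) > 0" using ImN[of "Complex t (-y)"] pos[of "Complex t (-y)"] elim by simp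
  moreover from this have "N (Complex t (-y)) ~= 0" by auto
  ultimately show ?case unfolding Wf_def Nm using Ln_minus[of "N (Complex t (-y))"] by auto
 qed
 from Lim_transform_eventually[OF E[of "-1" "- (\<i> * pi)"] this]
 show "((%y. Wf a (Complex t (-y))) \<longlongrightarrow> wt a t * exp (- (\<i> * pi * a))) (at_right 0)" by (simp add: mult_ac)
qed

text \<open>The constant is found by comparing the jump of k (W - 1) with 2 pi i w at one Lebesgue
  point of the interval. This gives pi = k sin (pi a), and with it that the sine does not
  vanish.\<close>

theorem cauchyT_wt:
 fixes a :: complex
 assumes a: "\<bar>Re a\<bar> < 1" "a ~= 0"
 shows "sin (pi * a) ~= 0"
  and "Im z ~= 0 ==> cauchyT (wt a) z = pi / sin (pi * a) * (Wf a z - 1)"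
proof -
 note wi = wt_integrable[OF a(1)]
 define k where "k = (LBINT x. wt a x) / (2 * a)"
 have "AE t in lborel. lebesgue_point (wt a) t" by (rule AE_lebesgue_point[OF wi])
 have "\<exists>t\<in>{-1<..<1}. lebesgue_point (wt a) t"
 proof (rule ccontr)
  assume "\<not> ?thesis"
  with \<open>AE t in lborel. lebesgue_point (wt a) t\<close> have "AE t in lborel. t \<notin> {-1<..<1::real}"
   by (auto elim: eventually_mono)
  then have "{-1<..<1::real} \<in> null_sets lborel" by (subst (asm) AE_iff_null_sets[symmetric]) auto
  then show False by (auto simp: null_sets_def)
 qed
 then obtain t where t: "-1 < t" "t < 1" and lp: "lebesgue_point (wt a) t" by auto
 have "((%y. 2 * of_real pi * \<i> * poisson (wt a) y t) \<longlongrightarrow> 2 * of_real pi * \<i> * wt a t) (at_right 0)"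
  by (intro tendsto_intros poisson_tendsto[OF weighted_of_integrable[OF wi] lp])
 moreover have "\<forall>\<^sub>F y in at_right 0. 2 * of_real pi * \<i> * poisson (wt a) y t = k * (Wf a (Complex t y) - 1) - k * (Wf a (Complex t (-y)) - 1)"
  using eventually_at_right_less[of "0::real"]
 proof eventually_elim
  case (elim y)
  then show ?case using cauchyT_jump[OF wi elim, of t] cauchyT_wt_aux[OF a, of "Complex t y"] cauchyT_wt_aux[OF a, of "Complex t (-y)"]
   by (simp add: k_def)
 qed
 ultimately have "((%y. k * (Wf a (Complex t y) - 1) - k * (Wf a (Complex t (-y)) - 1)) \<longlongrightarrow> 2 * of_real pi * \<i> * wt a t) (at_right 0)"
  by (rule Lim_transform_eventually)
 moreover have "((%y. k * (Wf a (Complex t y) - 1) - k * (Wf a (Complex t (-y)) - 1)) \<longlongrightarrow> k * (wt a t * exp (\<i> * pi * a) - 1) - k * (wt a t * exp (- (\<i> * pi * a)) - 1)) (at_right 0)"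
  by (intro tendsto_intros Wf_boundary t)
 ultimately have "2 * of_real pi * \<i> * wt a t = k * (wt a t * exp (\<i> * pi * a) - 1) - k * (wt a t * exp (- (\<i> * pi * a)) - 1)"
  using tendsto_unique[OF trivial_limit_at_right_real] by blast
 also have "... = wt a t * (k * (exp (\<i> * (pi * a)) - exp (- (\<i> * (pi * a)))))" by (simp add: algebra_simps)
 also have "exp (\<i> * (pi * a)) - exp (- (\<i> * (pi * a))) = 2 * \<i> * sin (pi * a)"
  by (simp add: sin_exp_eq)
 finally have "wt a t * (2 * of_real pi * \<i>) = wt a t * (k * (2 * \<i> * sin (pi * a)))" by (simp add: mult_ac)
 moreover have "wt a t ~= 0" using t by (simp add: wt_def)
 ultimately have "2 * of_real pi * \<i> = k * (2 * \<i> * sin (pi * a))" by (simp only: mult_left_cancel not_False_eq_True)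
 then have ks: "of_real pi = k * sin (pi * a)" by simp
 then show s: "sin (pi * a) ~= 0" using pi_neq_zero by (metis mult_zero_right of_real_eq_0_iff)
 have "k = pi / sin (pi * a)" using ks s by (simp add: eq_divide_eq)
 then show "Im z ~= 0 ==> cauchyT (wt a) z = pi / sin (pi * a) * (Wf a z - 1)"
  using cauchyT_wt_aux[OF a, of z] by (simp add: k_def)
qed

section \<open>Test functions with an explicit Hilbert transform\<close>

lemma norm_Wf: "norm (Wf a z) = exp (Re a * Re (Ln ((z - 1) / (z + 1))) - Im a * Im (Ln ((z - 1) / (z + 1))))"
 by (simp add: Wf_def)

lemma Im_Ln_moebius:
 assumes z: "Im z ~= 0"
 shows "- pi < Im (Ln ((z - 1) / (z + 1)))" "Im (Ln ((z - 1) / (z + 1))) < pi"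
 using Im_Ln_less_pi[OF moebius_nz(4)[OF z]] mpi_less_Im_Ln[of "(z - 1) / (z + 1)"] moebius_nz(1,2)[OF z] by auto

lemma norm_Wf_le:
 assumes z: "Im z ~= 0"
 shows "norm (Wf a z) <= (norm (z - 1) / norm (z + 1)) powr (Re a) * exp (pi * \<bar>Im a\<bar>)"
proof -
 note nz = moebius_nz[OF z]
 define L where "L = Im (Ln ((z - 1) / (z + 1)))"
 have "\<bar>L\<bar> <= pi" using Im_Ln_moebius[OF z] by (simp add: L_def)
 then have "\<bar>Im a\<bar> * \<bar>L\<bar> <= \<bar>Im a\<bar> * pi" by (rule mult_left_mono) simp
 then have 1: "- (Im a * L) <= pi * \<bar>Im a\<bar>" using abs_ge_minus_self[of "Im a * L"] by (simp add: abs_mult mult.commute)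
 have "norm (Wf a z) = exp (Re a * ln (norm (z - 1) / norm (z + 1)) + - (Im a * L))"
  unfolding norm_Wf L_def using nz by (simp add: norm_divide)
 also have "... = (norm (z - 1) / norm (z + 1)) powr (Re a) * exp (- (Im a * L))"
  unfolding exp_add using nz by (simp add: powr_def)
 also have "... <= (norm (z - 1) / norm (z + 1)) powr (Re a) * exp (pi * \<bar>Im a\<bar>)"
  using 1 by (intro mult_left_mono) auto
 finally show ?thesis .
qed

lemma Wf_uminus: "Wf (- a) z = 1 / Wf a z"
 by (simp add: Wf_def exp_minus inverse_eq_divide)

text \<open>\<open>e\<close> is 0 for purely imaginary exponents, where \<open>wt a\<close> is
  bounded, and 1 for 0 < Re a < 1, where the factor 1 + x removes the singularity of
  \<open>wt a\<close> at -1.\<close>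

definition test_fun :: "complex => complex => complex => real => complex" where
 "test_fun a e z0 x = (1 + e * of_real x) * wt a x / (of_real x - z0)"

text \<open>The finite Hilbert transform of \<open>test_fun\<close>: partial fractions reduce it to
  that of \<open>wt a\<close>, and cos (pi a) w is the mean of the two boundary values of
  \<open>Wf a\<close>.\<close>

definition test_hil :: "complex => complex => complex => real => complex" where
 "test_hil a e z0 t = ((1 + e * z0) * (of_real pi / sin (of_real pi * a) * (Wf a z0 - 1)) -
   (1 + e * of_real t) * (of_real pi / sin (of_real pi * a) * (cos (of_real pi * a) * wt a t - 1))) / (of_real pi * \<i> * (z0 - of_real t))"

lemma cauchyT_test_fun:
 fixes a e :: complex
 assumes a: "\<bar>Re a\<bar> < 1" "a ~= 0" and z0: "Im z0 ~= 0" and z: "Im z ~= 0" "z ~= z0"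
 shows "cauchyT (test_fun a e z0) z = ((1 + e * z0) * (of_real pi / sin (of_real pi * a) * (Wf a z0 - 1)) - (1 + e * z) * (of_real pi / sin (of_real pi * a) * (Wf a z - 1))) / (z0 - z)"
proof -
 note wi = wt_integrable[OF a(1)]
 have nz: "z0 - z ~= 0" using z by auto
 have "test_fun a e z0 x / (of_real x - z) = (1 + e * z0) / (z0 - z) * (wt a x / (of_real x - z0)) - (1 + e * z) / (z0 - z) * (wt a x / (of_real x - z))" for x
 proof -
  have n: "cr x - z0 ~= 0" "cr x - z ~= 0" using cauchy_denom_nz[OF z0] cauchy_denom_nz[OF z(1)] by auto
  have "(1 + e * of_real x) / ((of_real x - z0) * (of_real x - z)) = (1 + e * z0) / (z0 - z) * (1 / (of_real x - z0)) - (1 + e * z) / (z0 - z) * (1 / (of_real x - z))"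
   using n nz by (simp add: divide_simps) (simp add: algebra_simps)
  from arg_cong[OF this, of "%s. s * wt a x"] show ?thesis by (simp add: test_fun_def algebra_simps)
 qed
 then have "cauchyT (test_fun a e z0) z = (1 + e * z0) / (z0 - z) * cauchyT (wt a) z0 - (1 + e * z) / (z0 - z) * cauchyT (wt a) z"
  unfolding cauchyT_def
  by (simp only: integral_sub[OF integrable_mult_right[OF cauchy_integrable[OF wi z0]] integrable_mult_right[OF cauchy_integrable[OF wi z(1)]]] integral_mult_right_zero)
 then show ?thesis unfolding cauchyT_wt(2)[OF a z0] cauchyT_wt(2)[OF a z(1)] by (simp add: diff_divide_distrib mult_ac)
qed

text \<open>The Cauchy transform is bounded in two regimes: for |Im z| < \<delta> by the closed
  form, whose denominator z0 - z stays away from 0, and for larger |Im z| by the L1 norm over |Im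
  z|. The limits are read off from the boundary values of \<open>Wf a\<close>.\<close>

lemma hilbert_pair_test:
 fixes a e :: complex
 assumes a: "\<bar>Re a\<bar> < 1" "a ~= 0" and z0: "Im z0 ~= 0"
  and bW: "!!z. Im z ~= 0 ==> \<bar>Im z\<bar> <= 1 ==> \<bar>Re z\<bar> < 1 ==> norm ((1 + e * z) * Wf a z) <= BW"
  and bw: "!!x. x \<in> {-1<..<1} ==> norm ((1 + e * of_real x) * wt a x) <= Bw"
 shows "hilbert_pair (test_fun a e z0) (test_hil a e z0)"
proof -
 define k where "k = of_real pi / sin (of_real pi * a)"
 define A where "A = (1 + e * z0) * (k * (Wf a z0 - 1))"
 define \<delta> where "\<delta> = \<bar>Im z0\<bar> / 2"
 have \<delta>: "\<delta> > 0" using z0 by (simp add: \<delta>_def)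
 have tm [measurable]: "test_fun a e z0 \<in> bm borel" unfolding test_fun_def by measurable
 have hm: "test_hil a e z0 \<in> bm borel" unfolding test_hil_def by measurable
 have Bw0: "Bw >= 0" by (rule order_trans[OF norm_ge_zero bw[of 0]]) simp
 have tb: "norm (test_fun a e z0 x) <= Bw / \<bar>Im z0\<bar>" for x
 proof (cases "x \<in> {-1<..<1}")
  case True
  have "norm (test_fun a e z0 x) <= norm ((1 + e * of_real x) * wt a x) / \<bar>Im z0\<bar>"
   unfolding test_fun_def by (rule norm_cauchy_integrand[OF z0])
  also have "... <= Bw / \<bar>Im z0\<bar>" by (rule divide_right_mono[OF bw[OF True]]) simp
  finally show ?thesis .
 qed (use Bw0 in \<open>simp add: test_fun_def wt_outside\<close>)
 have ts: "test_fun a e z0 x = 0" if "x \<notin> {-1<..<1}" for x using that by (simp add: test_fun_def wt_outside)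
 have ti: "L1 (test_fun a e z0)" by (rule bounded_support_integrable[OF tm tb ts])
 have C: "cauchyT (test_fun a e z0) z = (A - (1 + e * z) * (k * (Wf a z - 1))) / (z0 - z)" if "Im z ~= 0" "z ~= z0" for z
  unfolding A_def k_def by (rule cauchyT_test_fun[OF a z0 that])
 define M where "M = (LBINT x. norm (test_fun a e z0 x))"
 have M0: "M >= 0" by (simp add: M_def)
 define N where "N = norm A + norm k * (BW + (1 + 2 * norm e))"
 have bC: "norm (cauchyT (test_fun a e z0) z) <= (M + N) / \<delta>" if z: "Im z ~= 0" "\<bar>Im z\<bar> <= 1" "\<bar>Re z\<bar> < 1" for z
 proof -
  have zb: "norm z <= 2" using norm_complex_def[of z] cmod_le[of z] z by linarith
  have ez: "norm (1 + e * z) <= 1 + 2 * norm e"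
   using norm_triangle_ineq[of 1 "e * z"] mult_left_mono[OF zb norm_ge_zero[of e]] by (simp add: norm_mult mult.commute)
  have N1: "norm (A - (1 + e * z) * (k * (Wf a z - 1))) <= N"
  proof -
   have "(1 + e * z) * (k * (Wf a z - 1)) = k * ((1 + e * z) * Wf a z - (1 + e * z))" by (simp add: algebra_simps)
   then have "norm ((1 + e * z) * (k * (Wf a z - 1))) = norm k * norm ((1 + e * z) * Wf a z - (1 + e * z))" by (simp only: norm_mult[of k])
   also have "... <= norm k * (BW + (1 + 2 * norm e))"
    using norm_triangle_ineq4[of "(1 + e * z) * Wf a z" "1 + e * z"] bW[OF z] ez by (intro mult_left_mono) auto
   finally show ?thesis unfolding N_def using norm_triangle_ineq4[of A "(1 + e * z) * (k * (Wf a z - 1))"] by linarith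
  qed
  then have N0: "N >= 0" by (rule order_trans[OF norm_ge_zero])
  show ?thesis
  proof (cases "\<bar>Im z\<bar> < \<delta>")
   case True
   have "\<delta> <= \<bar>Im (z0 - z)\<bar>" using True unfolding \<delta>_def by (simp add: abs_if split: if_splits)
   then have d: "\<delta> <= norm (z0 - z)" using abs_Im_le_cmod[of "z0 - z"] by linarith
   then have "z ~= z0" using \<delta> by auto
   have "norm (cauchyT (test_fun a e z0) z) = norm (A - (1 + e * z) * (k * (Wf a z - 1))) / norm (z0 - z)"
    unfolding C[OF z(1) \<open>z ~= z0\<close>] by (rule norm_divide)
   also have "... <= N / \<delta>" using N1 d \<delta> N0 by (intro frac_le) auto
   also have "... <= (M + N) / \<delta>" using M0 \<delta> by (intro divide_right_mono) auto
   finally show ?thesis .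
  next
   case False
   have "norm (cauchyT (test_fun a e z0) z) <= M / \<bar>Im z\<bar>" unfolding M_def by (rule cauchyT_bound[OF ti z(1)])
   also have "... <= (M + N) / \<delta>" using False \<delta> M0 N0 by (intro frac_le) auto
   finally show ?thesis .
  qed
 qed
 define K where "K = (M + N) / \<delta>"
 note bK = bC[folded K_def]
 have cp: "norm (cpoisson (test_fun a e z0) y t) <= K" if y: "0 < y" "y <= 1" and t: "t \<in> {-1<..<1}" for y t
 proof -
  have "norm (cauchyT (test_fun a e z0) (Complex t y) + cauchyT (test_fun a e z0) (Complex t (-y))) <= 2 * K"
   using bK[of "Complex t y"] bK[of "Complex t (-y)"] y t
    norm_triangle_ineq[of "cauchyT (test_fun a e z0) (Complex t y)" "cauchyT (test_fun a e z0) (Complex t (-y))"]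
   by (simp add: abs_less_iff)
  from divide_right_mono[OF this, of "2 * pi"]
  have "norm (cpoisson (test_fun a e z0) y t) <= 2 * K / (2 * pi)"
   unfolding cpoisson_def norm_divide norm_mult by simp
  also have "... <= 2 * K / 2"
  proof (rule divide_left_mono)
   show "0 <= 2 * K" using order_trans[OF norm_ge_zero bK[of "Complex t y"]] y t by (simp add: abs_less_iff)
  qed (use pi_gt3 in auto)
  finally show ?thesis by simp
 qed
 have lim: "((%y. cpoisson (test_fun a e z0) y t) \<longlongrightarrow> test_hil a e z0 t) (at_right 0)" if t: "t \<in> {-1<..<1}" for t
 proof -
  have t': "-1 < t" "t < 1" using t by auto
  have zt: "z0 - of_real t ~= 0" using z0 by (auto simp: complex_eq_iff)
  have c: "((%y. Complex t (s * y)) \<longlongrightarrow> of_real t) (at_right 0)" for s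
  proof -
   have "((%y. Complex t (s * y)) \<longlongrightarrow> Complex t (s * 0)) (at_right 0)"
    unfolding Complex_eq by (intro tendsto_intros)
   then show ?thesis by (simp add: complex_of_real_def)
  qed
  note c1 = c[of 1, simplified] and c2 = c[of "-1", simplified]
  have "((%y. ((A - (1 + e * Complex t y) * (k * (Wf a (Complex t y) - 1))) / (z0 - Complex t y) + (A - (1 + e * Complex t (-y)) * (k * (Wf a (Complex t (-y)) - 1))) / (z0 - Complex t (-y))) / (2 * of_real pi * \<i>))
    \<longlongrightarrow> ((A - (1 + e * of_real t) * (k * (wt a t * exp (\<i> * pi * a) - 1))) / (z0 - of_real t) + (A - (1 + e * of_real t) * (k * (wt a t * exp (- (\<i> * pi * a)) - 1))) / (z0 - of_real t)) / (2 * of_real pi * \<i>)) (at_right 0)"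
   using zt by (intro tendsto_intros c1 c2 Wf_boundary t') auto
  moreover have "((A - (1 + e * of_real t) * (k * (wt a t * exp (\<i> * pi * a) - 1))) / (z0 - of_real t) + (A - (1 + e * of_real t) * (k * (wt a t * exp (- (\<i> * pi * a)) - 1))) / (z0 - of_real t)) / (2 * of_real pi * \<i>) = test_hil a e z0 t"
  proof -
   have co: "cos (of_real pi * a) = (exp (\<i> * pi * a) + exp (- (\<i> * pi * a))) / 2"
    by (simp add: cos_exp_eq mult.assoc)
   have "(A - (1 + e * of_real t) * (k * (wt a t * exp (\<i> * pi * a) - 1))) + (A - (1 + e * of_real t) * (k * (wt a t * exp (- (\<i> * pi * a)) - 1))) = 2 * (A - (1 + e * of_real t) * (k * (cos (of_real pi * a) * wt a t - 1)))"
    unfolding co by (simp add: algebra_simps)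
   then show ?thesis unfolding test_hil_def A_def k_def add_divide_distrib[symmetric]
    using zt by (simp add: divide_simps)
  qed
  moreover have "\<forall>\<^sub>F y in at_right 0. ((A - (1 + e * Complex t y) * (k * (Wf a (Complex t y) - 1))) / (z0 - Complex t y) + (A - (1 + e * Complex t (-y)) * (k * (Wf a (Complex t (-y)) - 1))) / (z0 - Complex t (-y))) / (2 * of_real pi * \<i>) = cpoisson (test_fun a e z0) y t"
  proof -
   have "\<forall>\<^sub>F y in at_right (0::real). y < \<delta>" using \<delta> by (simp add: eventually_at_right_less eventually_at_right_real order_tendstoD(2)[OF tendsto_ident_at])
   with eventually_at_right_less[of "0::real"] show ?thesis
   proof eventually_elim
    case (elim y)
    have "Complex t y ~= z0" "Complex t (-y) ~= z0" using elim unfolding \<delta>_def by auto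
    then show ?case using C[of "Complex t y"] C[of "Complex t (-y)"] elim by (simp add: cpoisson_def)
   qed
  qed
  ultimately show ?thesis using Lim_transform_eventually by force
 qed
 show ?thesis unfolding hilbert_pair_def
  using tm hm tb ts cp lim by (intro conjI) blast+
qed

text \<open>For the value - i cot (pi a) the terms containing \<open>wt a\<close> cancel. What
  remains has numerator (1 + e z0) (W - 1) + (1 + e t) = (1 + e z0) W + e (t - z0), which explains
  the Cauchy kernel and the constant \<open>e\<close>.\<close>

lemma test_identity:
 fixes a e :: complex
 assumes S: "sin (of_real pi * a) ~= 0" and z0: "Im z0 ~= 0"
 shows "(- \<i> * cos (of_real pi * a) / sin (of_real pi * a)) * test_fun a e z0 t - test_hil a e z0 t = (1 / (\<i> * sin (of_real pi * a))) * ((1 + e * z0) * Wf a z0 / (of_real t - z0) + e)"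
proof -
 define s c w W D where "s = sin (of_real pi * a)" and "c = cos (of_real pi * a)" and "w = wt a t" and "W = Wf a z0" and "D = cr t - z0"
 have D: "D ~= 0" unfolding D_def by (rule cauchy_denom_nz[OF z0])
 have t: "cr t = z0 + D" by (simp add: D_def)
 have zt: "z0 - cr t = - D" by (simp add: D_def)
 have s: "s ~= 0" using S by (simp add: s_def)
 have hil: "test_hil a e z0 t = ((1 + e * z0) * (W - 1) - (1 + e * (z0 + D)) * (c * w - 1)) / (\<i> * s * (- D))"
 proof -
  have "test_hil a e z0 t = (pi / s) * ((1 + e * z0) * (W - 1) - (1 + e * (z0 + D)) * (c * w - 1)) / (of_real pi * \<i> * (- D))"
   unfolding test_hil_def zt unfolding t s_def[symmetric] c_def[symmetric] w_def[symmetric] W_def[symmetric]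
   by (simp only: mult.left_commute[of _ "of_real pi / s"] right_diff_distrib[symmetric])
  then show ?thesis using s D by (simp add: divide_simps mult.commute mult.left_commute)
 qed
 have "(- \<i> * c / s) * ((1 + e * (z0 + D)) * w / D) - ((1 + e * z0) * (W - 1) - (1 + e * (z0 + D)) * (c * w - 1)) / (\<i> * s * (- D)) = (1 / (\<i> * s)) * ((1 + e * z0) * W / D + e)"
  using s D by (simp add: divide_simps) (simp add: algebra_simps)
 note eq = this
 have tf: "test_fun a e z0 t = (1 + e * (z0 + D)) * w / D" by (simp add: test_fun_def D_def w_def)
 show ?thesis unfolding tf hil s_def[symmetric] c_def[symmetric] W_def[symmetric] D_def[symmetric] by (rule eq)
qed

section \<open>Solving the resolvent equation for Cauchy kernels\<close>

definition resolvent_dense :: "complex => bool" where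
 "resolvent_dense \<mu> \<longleftrightarrow> (\<forall>z0 \<epsilon>. Im z0 ~= 0 --> 0 < \<epsilon> -->
   (\<exists>g g'. hilbert_pair g g' & (\<forall>t\<in>{-1<..<1}. norm (\<mu> * g t - g' t - 1 / (of_real t - z0)) <= \<epsilon>)))"

text \<open>Here \<open>v\<close> is a solution of \<open>T v = - \<mu> v\<close>.\<close>

definition resolvent_codim1 :: "complex => real => (real => complex) => (complex => complex) => bool" where
 "resolvent_codim1 \<mu> r v d \<longleftrightarrow> 0 < r & r < 1 & L1 v & (\<forall>x. x \<notin> {-1<..<1} --> v x = 0) \<and>
   (\<forall>x\<in>{-1<..<1}. norm (v x) = (1 - x) powr (-r) * (1 + x) powr (r - 1)) & (LBINT x. v x) ~= 0 \<and>
   (\<forall>z0. Im z0 ~= 0 --> d z0 ~= 0 & cauchyT v z0 = - (LBINT x. v x) / d z0 \<and>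
    (\<exists>g g'. hilbert_pair g g' & (\<forall>t\<in>{-1<..<1}. \<mu> * g t - g' t = d z0 / (of_real t - z0) + 1)))"

text \<open>Here |w| = 1, and the only error comes from the mismatch of \<mu> and - i cot (pi a). It
  is zero if \<open>a\<close> solves the exponent equation, and it can be made small for \<mu> = 1
  and \<mu> = -1. A uniform error can be used against integrable functions as well as in the norm of
  \<open>X\<close>.\<close>

lemma imaginary_weight:
 fixes \<eta> :: real and \<mu> z0 :: complex
 assumes \<eta>: "\<eta> ~= 0" and z0: "Im z0 ~= 0"
 defines "a \<equiv> \<i> * of_real \<eta>"
 shows "\<exists>g g'. hilbert_pair g g' & (\<forall>t\<in>{-1<..<1}. norm (\<mu> * g t - g' t - 1 / (of_real t - z0)) <=
   norm (\<mu> * sin (of_real pi * a) + \<i> * cos (of_real pi * a)) / (norm (Wf a z0) * \<bar>Im z0\<bar>))"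
proof -
 have a: "\<bar>Re a\<bar> < 1" "a ~= 0" using \<eta> by (auto simp: a_def)
 note S = cauchyT_wt(1)[OF a]
 have hp: "hilbert_pair (test_fun a 0 z0) (test_hil a 0 z0)"
 proof (rule hilbert_pair_test[OF a z0])
  show "norm ((1 + 0 * z) * Wf a z) <= exp (pi * \<bar>Im a\<bar>)" if "Im z ~= 0" for z
   using norm_Wf_le[OF that, of a] moebius_nz[OF that] by (simp add: a_def)
  show "norm ((1 + 0 * cr x) * wt a x) <= 1" if "x \<in> {-1<..<1}" for x
   using that norm_wt[of x a] by (simp add: a_def)
 qed
 define c where "c = \<i> * sin (of_real pi * a) / Wf a z0"
 show ?thesis
 proof (intro exI conjI ballI)
  show "hilbert_pair (%x. c * test_fun a 0 z0 x) (%x. c * test_hil a 0 z0 x)" by (rule hilbert_pair_cmult[OF hp])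
  fix t :: real assume t: "t \<in> {-1<..<1}"
  define \<mu>a where "\<mu>a = - \<i> * cos (of_real pi * a) / sin (of_real pi * a)"
  have "\<mu>a * test_fun a 0 z0 t - test_hil a 0 z0 t = (1 / (\<i> * sin (of_real pi * a))) * (Wf a z0 / (of_real t - z0))"
   unfolding \<mu>a_def using test_identity[OF S z0, of 0 t] by simp
  then have "c * (\<mu>a * test_fun a 0 z0 t - test_hil a 0 z0 t) = 1 / (of_real t - z0)"
   unfolding c_def using S by simp
  then have "\<mu> * (c * test_fun a 0 z0 t) - c * test_hil a 0 z0 t - 1 / (of_real t - z0) = (\<mu> - \<mu>a) * c * test_fun a 0 z0 t"
   by (simp add: algebra_simps)
  also have "(\<mu> - \<mu>a) * c = \<i> * (\<mu> * sin (of_real pi * a) + \<i> * cos (of_real pi * a)) / Wf a z0"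
   unfolding \<mu>a_def c_def using S by (simp add: divide_simps)
  finally have "norm (\<mu> * (c * test_fun a 0 z0 t) - c * test_hil a 0 z0 t - 1 / (of_real t - z0))
    = norm (\<mu> * sin (of_real pi * a) + \<i> * cos (of_real pi * a)) / norm (Wf a z0) * norm (test_fun a 0 z0 t)"
   by (simp add: norm_mult norm_divide)
  also have "... <= norm (\<mu> * sin (of_real pi * a) + \<i> * cos (of_real pi * a)) / norm (Wf a z0) * (1 / \<bar>Im z0\<bar>)"
  proof (rule mult_left_mono)
   have "norm (test_fun a 0 z0 t) <= norm (wt a t) / \<bar>Im z0\<bar>"
    using norm_cauchy_integrand[OF z0, of "wt a t" t] by (simp add: test_fun_def)
   then show "norm (test_fun a 0 z0 t) <= 1 / \<bar>Im z0\<bar>" using t norm_wt[of t a] by (simp add: a_def)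
  qed simp
  finally show "norm (\<mu> * (c * test_fun a 0 z0 t) - c * test_hil a 0 z0 t - 1 / (of_real t - z0)) <=
   norm (\<mu> * sin (of_real pi * a) + \<i> * cos (of_real pi * a)) / (norm (Wf a z0) * \<bar>Im z0\<bar>)" by simp
 qed
qed

text \<open>For a = i \<eta> one has - i cot (pi a) = - coth (pi \<eta>), which tends to s along
  \<eta> = - s n. The mismatch is exp (- pi n), whereas |W| = exp (s n L) with |L| < pi, so the
  quotient still decays.\<close>

lemma resolvent_dense_unit:
 fixes s :: real
 assumes s: "s = 1 \<or> s = -1"
 shows "resolvent_dense (of_real s)"
 unfolding resolvent_dense_def
proof (intro allI impI)
 fix z0 :: complex and \<epsilon> :: real assume z0: "Im z0 ~= 0" and \<epsilon>: "0 < \<epsilon>"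
 define L where "L = Im (Ln ((z0 - 1) / (z0 + 1)))"
 have L: "0 < pi + s * L" using Im_Ln_moebius[OF z0] s by (auto simp: L_def)
 obtain n :: nat where n: "ln (1 / (\<epsilon> * \<bar>Im z0\<bar>)) < real n * (pi + s * L)" "n > 0"
 proof -
  obtain m :: nat where "ln (1 / (\<epsilon> * \<bar>Im z0\<bar>)) / (pi + s * L) < real m" using reals_Archimedean2 by blast
  then have "ln (1 / (\<epsilon> * \<bar>Im z0\<bar>)) < real m * (pi + s * L)" using L by (simp add: pos_divide_less_eq)
  also have "... <= real (Suc m) * (pi + s * L)" using L by (intro mult_right_mono) auto
  finally show ?thesis using that[of "Suc m"] by simp
 qed
 define \<eta> where "\<eta> = - s * real n"
 have \<eta>: "\<eta> ~= 0" using n s by (auto simp: \<eta>_def)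
 define a where "a = \<i> * cr \<eta>"
 have A: "norm (of_real s * sin (of_real pi * a) + \<i> * cos (of_real pi * a)) = exp (- (pi * real n))"
 proof -
  have "of_real s * sin (of_real pi * a) + \<i> * cos (of_real pi * a) = \<i> * exp (- (\<i> * (s * (pi * a))))"
   using s by (auto simp: sin_exp_eq cos_exp_eq divide_simps) (simp_all add: algebra_simps)
  also have "- (\<i> * (cr s * (pi * a))) = of_real (- (pi * real n))"
   using s by (auto simp: a_def \<eta>_def algebra_simps)
  finally show ?thesis by (simp add: norm_mult norm_exp_eq_Re)
 qed
 have B: "norm (Wf a z0) = exp (s * real n * L)"
  unfolding norm_Wf L_def[symmetric] by (simp add: a_def \<eta>_def)
 have "exp (- (pi * real n)) / (exp (s * real n * L) * \<bar>Im z0\<bar>) = exp (- (real n * (pi + s * L))) / \<bar>Im z0\<bar>"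
  by (simp add: exp_minus exp_add[symmetric] divide_simps) (simp add: algebra_simps exp_add[symmetric])
 also have "... <= \<epsilon>"
 proof -
  have "1 / (\<epsilon> * \<bar>Im z0\<bar>) < exp (real n * (pi + s * L))"
  proof -
   have "exp (ln (1 / (\<epsilon> * \<bar>Im z0\<bar>))) < exp (real n * (pi + s * L))" using n(1) by simp
   then show ?thesis using \<epsilon> z0 by (subst (asm) exp_ln) auto
  qed
  then have "1 < exp (real n * (pi + s * L)) * (\<epsilon> * \<bar>Im z0\<bar>)" using \<epsilon> z0 by (simp add: pos_divide_less_eq)
  then show ?thesis using z0 by (simp add: exp_minus divide_simps) (simp add: mult_ac)
 qed
 finally have le: "norm (of_real s * sin (of_real pi * a) + \<i> * cos (of_real pi * a)) / (norm (Wf a z0) * \<bar>Im z0\<bar>) <= \<epsilon>"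
  unfolding A B .
 show "\<exists>g g'. hilbert_pair g g' & (\<forall>t\<in>{-1<..<1}. norm (of_real s * g t - g' t - 1 / (of_real t - z0)) <= \<epsilon>)"
  using imaginary_weight[OF \<eta> z0, of "of_real s"] le unfolding a_def by (meson order_trans)
qed

text \<open>The equation means exp (2 pi i a) = (\<mu> + 1) / (\<mu> - 1). The principal logarithm
  gives a solution with real part in (-1/2, 1/2], and a negative real part is raised by 1.\<close>

lemma exponent_exists:
 fixes \<mu> :: complex
 assumes \<mu>: "\<mu> ~= 1" "\<mu> ~= -1"
 obtains a :: complex where "a ~= 0" "0 <= Re a" "Re a < 1" "\<mu> * sin (of_real pi * a) + \<i> * cos (of_real pi * a) = 0"
proof -
 define E where "E = (\<mu> + 1) / (\<mu> - 1)"
 have m: "\<mu> - 1 ~= 0" "\<mu> + 1 ~= 0" using \<mu> by (simp_all add: add_eq_0_iff2)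
 have E: "E ~= 0" "E ~= 1" using m by (auto simp: E_def divide_eq_1_iff)
 define b where "b = Ln E / (2 * pi * \<i>)"
 have Reb: "Re b = Im (Ln E) / (2 * pi)" by (simp add: b_def Re_divide power2_eq_square)
 have bb: "- (1/2) < Re b" "Re b <= 1/2"
  unfolding Reb using mpi_less_Im_Ln[OF E(1)] Im_Ln_le_pi[OF E(1)] by (auto simp: divide_simps)
 define a where "a = (if Re b < 0 then b + 1 else b)"
 have ea: "exp (2 * pi * \<i> * a) = E"
 proof -
  have "exp (2 * pi * \<i> * b) = E" using E by (simp add: b_def)
  moreover have "exp (2 * pi * \<i> * (b + 1)) = exp (2 * pi * \<i> * b) * exp (2 * pi * \<i>)" by (simp add: distrib_left exp_add)
  moreover have "exp (2 * pi * \<i>) = 1" by (simp add: exp_eq_1)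
  ultimately show ?thesis by (simp add: a_def)
 qed
 have "a ~= 0" using ea E(2) by auto
 moreover have "0 <= Re a" "Re a < 1" using bb by (auto simp: a_def)
 moreover have "\<mu> * sin (of_real pi * a) + \<i> * cos (of_real pi * a) = 0"
 proof -
  define x where "x = exp (\<i> * (pi * a))"
  have x0: "x ~= 0" by (simp add: x_def)
  have "x * x = exp (2 * pi * \<i> * a)" by (simp add: x_def exp_add[symmetric] algebra_simps)
  then have "x * x * (\<mu> - 1) = \<mu> + 1" using ea m by (simp add: E_def)
  then have xx: "\<mu> * (x * x - 1) = x * x + 1" by (simp add: algebra_simps)
  have mi: "exp (- (\<i> * (pi * a))) = 1 / x" by (simp add: x_def exp_minus inverse_eq_divide)
  have "\<mu> * sin (of_real pi * a) + \<i> * cos (of_real pi * a) = (\<mu> * (x - 1 / x) - (x + 1 / x)) / (2 * \<i>)"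
   unfolding sin_exp_eq cos_exp_eq mi x_def[symmetric] by (simp add: divide_simps) (simp add: algebra_simps)
  also have "\<mu> * (x - 1 / x) - (x + 1 / x) = (\<mu> * (x * x - 1) - (x * x + 1)) / x"
   using x0 by (simp add: field_simps)
  finally show ?thesis unfolding xx by simp
 qed
 ultimately show thesis using that by blast
qed

text \<open>\<open>v\<close> is 1 / ((1 + x) w), up to constants a boundary function of 1 / ((1 + z)
  W). Its Cauchy transform follows from that of \<open>wt (- a)\<close> by splitting off 1 + x,
  which leaves the integral \<open>m\<close> of \<open>v\<close> as an unknown constant.\<close>

lemma resolvent_codim1_weight:
 fixes \<mu> a :: complex
 assumes a: "0 < Re a" "Re a < 1" and \<mu>: "\<mu> * sin (of_real pi * a) + \<i> * cos (of_real pi * a) = 0"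
 shows "\<exists>v d. resolvent_codim1 \<mu> (Re a) v d"
proof -
 have a': "\<bar>Re a\<bar> < 1" "a ~= 0" "\<bar>Re (- a)\<bar> < 1" "- a ~= 0" using a by auto
 note S = cauchyT_wt(1)[OF a'(1,2)]
 define r where "r = Re a"
 define v where "v x = wt (- a) x / (1 + of_real x)" for x
 define d where "d z = (1 + z) * Wf a z" for z
 have vs: "v x = 0" if "x \<notin> {-1<..<1}" for x using that by (simp add: v_def wt_outside)
 have vn: "norm (v x) = (1 - x) powr (-r) * (1 + x) powr (r - 1)" if x: "x \<in> {-1<..<1}" for x
 proof -
  have "norm (1 + cr x) = 1 + x" using x norm_of_real[of "1 + x", where 'a = complex] by simp
  then have "norm (v x) = (1 - x) powr (-r) * (1 + x) powr r / (1 + x)"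
   using x norm_wt[of x "- a"] by (simp add: v_def norm_divide r_def)
  also have "... = (1 - x) powr (-r) * ((1 + x) powr r / (1 + x))" by simp
  also have "(1 + x) powr r / (1 + x) = (1 + x) powr (r - 1)" using x by (simp add: powr_diff)
  finally show ?thesis .
 qed
 have vm [measurable]: "v \<in> bm borel" unfolding v_def by measurable
 have vi: "L1 v"
 proof (rule integrable_dominated)
  show "L1 (%x. indicator {-1<..<1} x * (1 + x) powr (- (1 - r)) + indicator {-1<..<1} x * (1 - x) powr (-r))"
   using powr_sing_integrable(1)[of "1 - r"] powr_sing_integrable(2)[of r] a unfolding r_def by (intro integrable_plus) auto
  show "AE x in lborel. norm (v x) <= norm (indicator {-1<..<1} x * (1 + x) powr (- (1 - r)) + indicator {-1<..<1} x * (1 - x) powr (-r))"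
  proof (rule AE_I2)
   fix x
   show "norm (v x) <= norm (indicator {-1<..<1} x * (1 + x) powr (- (1 - r)) + indicator {-1<..<1} x * (1 - x) powr (-r))"
   proof (cases "x \<in> {-1<..<1}")
    case True
    have p: "0 <= (1 + x) powr (r - 1)" "0 <= (1 - x) powr (-r)" by auto
    have "(1 - x) powr (-r) * (1 + x) powr (r - 1) <= (1 + x) powr (r - 1) + (1 - x) powr (-r)"
    proof (cases "x <= 0")
     case True
     have "(1 - x) powr (-r) <= 1 powr (-r)" using True a unfolding r_def by (intro powr_mono2') auto
     then have "(1 - x) powr (-r) * (1 + x) powr (r - 1) <= 1 * (1 + x) powr (r - 1)" by (intro mult_right_mono) auto
     then show ?thesis using p by linarith
    next
     case False
     have "(1 + x) powr (r - 1) <= 1 powr (r - 1)" using False a unfolding r_def by (intro powr_mono2') auto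
     then have "(1 - x) powr (-r) * (1 + x) powr (r - 1) <= (1 - x) powr (-r) * 1" by (intro mult_left_mono) auto
     then show ?thesis using p by linarith
    qed
    then show ?thesis using True vn[OF True] by simp
   qed (simp add: vs)
  qed
 qed simp
 define m where "m = (LBINT x. v x)"
 define k where "k = of_real pi / sin (of_real pi * (- a))"
 have rel: "k * (Wf (- a) z - 1) = m + (1 + z) * cauchyT v z" if z: "Im z ~= 0" for z
 proof -
  have "k * (Wf (- a) z - 1) = cauchyT (wt (- a)) z" unfolding k_def using cauchyT_wt(2)[OF a'(3,4) z] by simp
  also have "... = (LBINT x. v x + (1 + z) * (v x / (of_real x - z)))"
   unfolding cauchyT_def
  proof (rule integral_congr[OF refl])
   fix x
   have n: "cr x - z ~= 0" by (rule cauchy_denom_nz[OF z])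
   have "wt (- a) x = (1 + of_real x) * v x"
   proof (cases "x = -1")
    case False
    then have "1 + cr x ~= 0" by (auto simp: complex_eq_iff)
    then show ?thesis by (simp add: v_def)
   qed (simp add: wt_def)
   then show "wt (- a) x / (of_real x - z) = v x + (1 + z) * (v x / (of_real x - z))"
    using n by (simp add: divide_simps) (simp add: algebra_simps)
  qed
  also have "... = m + (1 + z) * cauchyT v z"
   unfolding m_def cauchyT_def
   by (simp only: integral_plus[OF vi integrable_mult_right[OF cauchy_integrable[OF vi z]]] integral_mult_right_zero)
  finally show ?thesis .
 qed
 \<comment> \<open>\<open>m\<close> is found by letting z tend to -1: there \<open>Wf (- a)\<close>
   vanishes, because Re a > 0, and so does (1 + z) times the Cauchy transform of \<open>v\<close>,
   because |1 + z| = |Im z| on this path and |v| is a majorant.\<close>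
 define zn where "zn n = Complex (-1) (eta n)" for n
 have zn: "Im (zn n) ~= 0" for n using eta_pos[of n] by (simp add: zn_def)
 have l1: "(%n. (1 + zn n) * cauchyT v (zn n)) \<longlonglongrightarrow> 0"
 proof -
  have e: "(1 + zn n) * cauchyT v (zn n) = (LBINT x. (1 + zn n) * (v x / (of_real x - zn n)))" for n
   unfolding cauchyT_def by (rule integral_mult_right_zero[symmetric])
  have i: "1 + zn n = \<i> * of_real (eta n)" for n by (simp add: zn_def complex_eq_iff)
  have "(%n. (LBINT x. (1 + zn n) * (v x / (of_real x - zn n)))) \<longlonglongrightarrow> (\<integral>x. 0 \<partial>(lborel :: real measure))"
  proof (rule integral_dominated_convergence[where w = "%x. norm (v x)"])
   show "AE x in lborel. (%n. (1 + zn n) * (v x / (of_real x - zn n))) \<longlonglongrightarrow> 0"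
   proof (rule AE_I2)
    fix x
    show "(%n. (1 + zn n) * (v x / (of_real x - zn n))) \<longlonglongrightarrow> 0"
    proof (cases "x \<in> {-1<..<1}")
     case True
     have zl: "zn \<longlonglongrightarrow> -1"
     proof -
      have "(%n. Complex (-1) (eta n)) \<longlonglongrightarrow> Complex (-1) 0" unfolding Complex_eq by (intro tendsto_intros eta_tendsto)
      moreover have "Complex (-1) 0 = -1" by (simp add: complex_eq_iff)
      ultimately show ?thesis by (simp add: zn_def[abs_def])
     qed
     have "cr x - (-1) ~= 0" using True by (auto simp: complex_eq_iff)
     then have "(%n. (1 + zn n) * (v x / (of_real x - zn n))) \<longlonglongrightarrow> (1 + (-1)) * (v x / (of_real x - (-1)))"
      by (intro tendsto_intros zl)
     then show ?thesis by simp
    qed (simp add: vs)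
   qed
   show "AE x in lborel. norm ((1 + zn n) * (v x / (of_real x - zn n))) <= norm (v x)" for n
   proof (rule AE_I2)
    fix x
    have "norm (v x / (of_real x - zn n)) <= norm (v x) / eta n"
     using norm_cauchy_integrand[OF zn[of n], of "v x" x] abs_of_pos[OF eta_pos[of n]] by (simp add: zn_def)
    from mult_left_mono[OF this, of "eta n"]
    show "norm ((1 + zn n) * (v x / (of_real x - zn n))) <= norm (v x)"
     unfolding i norm_mult[of "\<i> * of_real (eta n)"] using eta_pos[of n] by (simp add: norm_mult)
   qed
  qed (use vi in auto)
  then show ?thesis unfolding e by simp
 qed
 have l2: "(%n. Wf (- a) (zn n)) \<longlonglongrightarrow> 0"
 proof (rule Lim_null_comparison)
  show "\<forall>\<^sub>F n in sequentially. norm (Wf (- a) (zn n)) <= (eta n) powr r * exp (pi * \<bar>Im (- a)\<bar>)"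
  proof (rule always_eventually, rule allI)
   fix n
   have e: "norm (zn n + 1) = eta n" using eta_pos[of n] by (simp add: zn_def cmod_def)
   have "2 <= norm (zn n - 1)" using abs_Re_le_cmod[of "zn n - 1"] by (simp add: zn_def)
   then have "1 / eta n <= norm (zn n - 1) / norm (zn n + 1)" unfolding e using eta_pos[of n] by (intro divide_right_mono) auto
   then have "(norm (zn n - 1) / norm (zn n + 1)) powr (- r) <= (1 / eta n) powr (- r)"
    using a eta_pos[of n] unfolding r_def by (intro powr_mono2') auto
   also have "... = (eta n) powr r" using eta_pos[of n] by (simp add: powr_minus powr_divide)
   finally have "(norm (zn n - 1) / norm (zn n + 1)) powr (Re (- a)) * exp (pi * \<bar>Im (- a)\<bar>) <= (eta n) powr r * exp (pi * \<bar>Im (- a)\<bar>)"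
    by (intro mult_right_mono) (auto simp: r_def)
   then show "norm (Wf (- a) (zn n)) <= (eta n) powr r * exp (pi * \<bar>Im (- a)\<bar>)"
    using norm_Wf_le[OF zn, of "- a" n] by linarith
  qed
  have "(%n. (eta n) powr r) \<longlonglongrightarrow> 0 powr r"
   using a eta_pos unfolding r_def by (intro tendsto_powr' eta_tendsto tendsto_const) (auto simp: less_imp_le)
  then have "(%n. (eta n) powr r) \<longlonglongrightarrow> 0" by simp
  then show "(%n. (eta n) powr r * exp (pi * \<bar>Im (- a)\<bar>)) \<longlonglongrightarrow> 0" by (rule tendsto_mult_left_zero)
 qed
 have mk: "m = - k"
 proof -
  have "(%n. k * (Wf (- a) (zn n) - 1) - (1 + zn n) * cauchyT v (zn n)) \<longlonglongrightarrow> k * (0 - 1) - 0"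
   by (intro tendsto_intros l1 l2)
  moreover have "k * (Wf (- a) (zn n) - 1) - (1 + zn n) * cauchyT v (zn n) = m" for n using rel[OF zn, of n] by simp
  ultimately show ?thesis using LIMSEQ_unique[OF tendsto_const] by fastforce
 qed
 have k0: "k ~= 0" using cauchyT_wt(1)[OF a'(3,4)] by (simp add: k_def)
 \<comment> \<open>Up to the factor exp (pi |Im a|), |1 + z| |W| is at most |z - 1|^(Re a) |z +
   1|^(1 - Re a), which is bounded near the interval since 0 < Re a < 1.\<close>
 have hp: "hilbert_pair (test_fun a 1 z0) (test_hil a 1 z0)" if z0: "Im z0 ~= 0" for z0
 proof (rule hilbert_pair_test[OF a'(1,2) z0])
  show "norm ((1 + 1 * z) * Wf a z) <= 9 * exp (pi * \<bar>Im a\<bar>)" if z: "Im z ~= 0" "\<bar>Im z\<bar> <= 1" "\<bar>Re z\<bar> < 1" for z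
  proof -
   have n3: "norm (z - 1) <= 3" "norm (z + 1) <= 3"
    using cmod_le[of z] norm_triangle_ineq4[of z 1] norm_triangle_ineq[of z 1] z by auto
   have p: "0 < norm (z + 1)" using moebius_nz(1)[OF z(1)] by simp
   have b3: "x powr q <= 3" if "0 <= x" "x <= 3" "0 <= q" "q <= 1" for x q :: real
   proof -
    have "x powr q <= 3 powr q" using that by (intro powr_mono2) auto
    also have "... <= 3 powr 1" using that by (intro powr_mono) auto
    finally show ?thesis by simp
   qed
   have "norm ((1 + 1 * z) * Wf a z) = norm (z + 1) * norm (Wf a z)" by (simp add: norm_mult add.commute)
   also have "... <= norm (z + 1) * ((norm (z - 1) / norm (z + 1)) powr (Re a) * exp (pi * \<bar>Im a\<bar>))"
    by (rule mult_left_mono[OF norm_Wf_le[OF z(1)]]) simp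
   also have "... = norm (z - 1) powr (Re a) * norm (z + 1) powr (1 - Re a) * exp (pi * \<bar>Im a\<bar>)"
    using p by (simp add: powr_divide powr_diff)
   also have "... <= 3 * 3 * exp (pi * \<bar>Im a\<bar>)"
    using n3 a by (intro mult_right_mono mult_mono b3) auto
   finally show ?thesis by simp
  qed
  show "norm ((1 + 1 * cr x) * wt a x) <= 4" if x: "x \<in> {-1<..<1}" for x
  proof -
   have n: "norm (1 + cr x) = 1 + x" using x norm_of_real[of "1 + x", where 'a = complex] by simp
   have "norm ((1 + 1 * cr x) * wt a x) = (1 + x) * ((1 - x) powr (Re a) * (1 + x) powr (- Re a))"
    using x n norm_wt[of x a] by (simp add: norm_mult)
   also have "... = (1 - x) powr (Re a) * (1 + x) powr (1 - Re a)" using x by (simp add: powr_diff powr_minus divide_simps)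
   also have "... <= 2 * 2" using x a by (intro mult_mono powr_le_2) auto
   finally show ?thesis by simp
  qed
 qed
 have "resolvent_codim1 \<mu> r v d"
  unfolding resolvent_codim1_def m_def[symmetric]
 proof (intro conjI allI impI ballI)
  show "0 < r" "r < 1" using a by (auto simp: r_def)
  show "m ~= 0" using mk k0 by simp
  fix z0 :: complex assume z0: "Im z0 ~= 0"
  have z1: "1 + z0 ~= 0" using moebius_nz(1)[OF z0] by (simp add: add.commute)
  show d0: "d z0 ~= 0" using z1 by (simp add: d_def)
  have rel': "(1 + z0) * cauchyT v z0 = k * Wf (- a) z0" using rel[OF z0] mk by (simp add: algebra_simps)
  have "Wf a z0 ~= 0" by (simp add: Wf_def)
  with rel' have "cauchyT v z0 * d z0 = - m" by (simp add: d_def Wf_uminus mk field_simps)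
  then show "cauchyT v z0 = - m / d z0" using nonzero_eq_divide_eq[OF d0] by blast
  define c where "c = \<i> * sin (of_real pi * a)"
  show "\<exists>g g'. hilbert_pair g g' & (\<forall>t\<in>{-1<..<1}. \<mu> * g t - g' t = d z0 / (of_real t - z0) + 1)"
  proof (intro exI conjI ballI)
   show "hilbert_pair (%x. c * test_fun a 1 z0 x) (%x. c * test_hil a 1 z0 x)" by (rule hilbert_pair_cmult[OF hp[OF z0]])
   fix t :: real
   have "\<mu> = - \<i> * cos (of_real pi * a) / sin (of_real pi * a)" using \<mu> S by (simp add: eq_divide_eq add_eq_0_iff)
   then have "\<mu> * test_fun a 1 z0 t - test_hil a 1 z0 t = (1 / c) * (d z0 / (of_real t - z0) + 1)"
    using test_identity[OF S z0, of 1 t] by (simp add: d_def c_def)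
   then have "c * (\<mu> * test_fun a 1 z0 t - test_hil a 1 z0 t) = d z0 / (of_real t - z0) + 1" using S by (simp add: c_def)
   then show "\<mu> * (c * test_fun a 1 z0 t) - c * test_hil a 1 z0 t = d z0 / (of_real t - z0) + 1" by (simp add: algebra_simps)
  qed
 qed (use vi vs vn in auto)
 then show ?thesis unfolding r_def by blast
qed

text \<open>The cases are: \<mu> is 1 or -1 and no exponent exists; the exponent is purely imaginary
  and the error is zero; the exponent has real part in (0, 1).\<close>

theorem resolvent_dichotomy:
 obtains "resolvent_dense \<mu>" | r v d where "resolvent_codim1 \<mu> r v d"
proof (cases "\<mu> = 1 \<or> \<mu> = -1")
 case True
 then have "resolvent_dense \<mu>" using resolvent_dense_unit[of 1] resolvent_dense_unit[of "-1"] by auto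
 then show thesis using that by blast
next
 case False
 then obtain a :: complex where a: "a ~= 0" "0 <= Re a" "Re a < 1" "\<mu> * sin (of_real pi * a) + \<i> * cos (of_real pi * a) = 0"
  using exponent_exists by blast
 show thesis
 proof (cases "Re a = 0")
  case False
  then show thesis using resolvent_codim1_weight[of a \<mu>] a that by auto
 next
  case True
  then have ai: "a = \<i> * of_real (Im a)" by (simp add: complex_eq_iff)
  then have i0: "Im a ~= 0" using a(1) by auto
  have "resolvent_dense \<mu>" unfolding resolvent_dense_def
  proof (intro allI impI)
   fix z0 :: complex and \<epsilon> :: real assume z0: "Im z0 ~= 0" and \<epsilon>: "0 < \<epsilon>"
   obtain g g' where "hilbert_pair g g'" and le: "!!t. t \<in> {-1<..<1} ==> norm (\<mu> * g t - g' t - 1 / (of_real t - z0)) <= 0"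
    using imaginary_weight[OF i0 z0, of \<mu>] a(4) unfolding ai[symmetric] by auto
   then show "\<exists>g g'. hilbert_pair g g' & (\<forall>t\<in>{-1<..<1}. norm (\<mu> * g t - g' t - 1 / (of_real t - z0)) <= \<epsilon>)"
    using order_trans[OF le less_imp_le[OF \<epsilon>]] by blast
  qed
  then show thesis using that by blast
 qed
qed

section \<open>Rearrangement invariant spaces\<close>

lemma rep_L0_measurable [measurable]: "rep_L0 f \<in> bm leb_I"
 using Quotient3_rep_reflp[OF Quotient3_L0, of f] by (simp add: ae_eq_def)

lemma abs_rep_L0 [simp]: "abs_L0 (rep_L0 f) = f"
 by (rule Quotient3_abs_rep[OF Quotient3_L0])

lemma rep_abs_L0:
 assumes "f \<in> bm leb_I"
 shows "AE x in leb_I. rep_L0 (abs_L0 f) x = f x"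
proof -
 have "ae_eq f f" using assms by (simp add: ae_eq_def)
 then have "ae_eq (rep_L0 (abs_L0 f)) f" using Quotient3_L0 by (metis Quotient3_rep_abs)
 then show ?thesis by (simp add: ae_eq_def)
qed

lemma abs_L0_eqI:
 assumes "f \<in> bm leb_I" "g \<in> bm leb_I" "AE x in leb_I. f x = g x"
 shows "abs_L0 f = abs_L0 g"
 using assms Quotient3_rel_abs[OF Quotient3_L0, of f g] by (simp add: ae_eq_def)

lemma L0_eqI: "(AE x in leb_I. rep_L0 f x = rep_L0 g x) ==> f = g"
 using abs_L0_eqI[of "rep_L0 f" "rep_L0 g"] by simp

lemma ae_eq_refl: "f \<in> bm leb_I ==> ae_eq f f"
 by (simp add: ae_eq_def)

lemma abs_L0_add:
 "f \<in> bm leb_I ==> g \<in> bm leb_I ==> abs_L0 f + abs_L0 g = abs_L0 (%x. f x + g x)"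
 by (rule plus_L0.abs_eq) (simp_all add: ae_eq_refl)

lemma abs_L0_diff:
 "f \<in> bm leb_I ==> g \<in> bm leb_I ==> abs_L0 f - abs_L0 g = abs_L0 (%x. f x - g x)"
 by (rule minus_L0.abs_eq) (simp_all add: ae_eq_refl)

lemma abs_L0_scale:
 "f \<in> bm leb_I ==> scale_L0 c (abs_L0 f) = abs_L0 (%x. c * f x)"
 by (rule scale_L0.abs_eq) (simp_all add: ae_eq_refl)

lemma abs_L0_zero: "0 = abs_L0 (%x. 0)"
 by (rule zero_L0.abs_eq)

lemma rep_L0_add: "AE x in leb_I. rep_L0 (f + g) x = rep_L0 f x + rep_L0 g x"
 using rep_abs_L0[of "%x. rep_L0 f x + rep_L0 g x"] abs_L0_add[of "rep_L0 f" "rep_L0 g"] by simp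

lemma rep_L0_diff: "AE x in leb_I. rep_L0 (f - g) x = rep_L0 f x - rep_L0 g x"
 using rep_abs_L0[of "%x. rep_L0 f x - rep_L0 g x"] abs_L0_diff[of "rep_L0 f" "rep_L0 g"] by simp

lemma rep_L0_scale: "AE x in leb_I. rep_L0 (scale_L0 c f) x = c * rep_L0 f x"
 using rep_abs_L0[of "%x. c * rep_L0 f x"] abs_L0_scale[of "rep_L0 f" c] by simp

lemma rep_L0_zero: "AE x in leb_I. rep_L0 0 x = 0"
 using rep_abs_L0[of "%x. 0"] abs_L0_zero by simp

lemma rep_L0_sum: "AE x in leb_I. rep_L0 (\<Sum>i<n. F i) x = (\<Sum>i<n. rep_L0 (F i) x)" for n :: nat
proof (induction n)
 case 0
 then show ?case using rep_L0_zero by simp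
next
 case (Suc n)
 from Suc rep_L0_add[of "\<Sum>i<n. F i" "F n"] show ?case
  by eventually_elim simp
qed

lemma emeasure_leb_I: "A \<in> sets lebesgue ==> A \<subseteq> {-1<..<1} ==> emeasure leb_I A = emeasure lebesgue A"
 by (rule emeasure_restrict_space) auto

lemma finite_measure_leb_I: "finite_measure leb_I"
 by (rule finite_measureI) (simp add: emeasure_leb_I)

lemma measure_leb_I: "A \<in> sets lebesgue ==> A \<subseteq> {-1<..<1} ==> measure leb_I A = measure lebesgue A"
 by (simp add: measure_def emeasure_leb_I)

lemma measure_leb_I_le: "measure leb_I A <= 2"
proof -
 have "measure leb_I A <= measure leb_I (space leb_I)"
  using finite_measure.bounded_measure[OF finite_measure_leb_I] .
 also have "... = 2" by (simp add: measure_leb_I)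
 finally show ?thesis .
qed

lemma AE_leb_I_iff: "(AE x in leb_I. P x) \<longleftrightarrow> (AE x in lebesgue. x \<in> {-1<..<1} --> P x)"
 by (rule AE_restrict_space_iff) simp

section \<open>Distribution functions and decreasing rearrangements\<close>

definition dist_fn :: "L0 => real => real" where
 "dist_fn f s = measure leb_I {x \<in> space leb_I. s < norm (rep_L0 f x)}"

lemma dist_fn_nonneg [simp]: "0 <= dist_fn f s" and dist_fn_le_2: "dist_fn f s <= 2"
 by (simp_all add: dist_fn_def measure_leb_I_le)

lemma measure_leb_I_cong_AE:
 assumes "AE x in leb_I. P x = Q x" "Measurable.pred leb_I P" "Measurable.pred leb_I Q"
 shows "measure leb_I {x \<in> space leb_I. P x} = measure leb_I {x \<in> space leb_I. Q x}"
proof (rule finite_measure.finite_measure_eq_AE[OF finite_measure_leb_I])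
 show "{x \<in> space leb_I. P x} \<in> sets leb_I" "{x \<in> space leb_I. Q x} \<in> sets leb_I"
  using assms(2,3) unfolding pred_def by blast+
qed (use assms(1) in \<open>auto elim!: eventually_mono\<close>)

lemma measure_leb_I_mono_AE:
 assumes "AE x in leb_I. P x --> Q x" "Measurable.pred leb_I Q"
 shows "measure leb_I {x \<in> space leb_I. P x} <= measure leb_I {x \<in> space leb_I. Q x}"
proof (rule finite_measure.finite_measure_mono_AE[OF finite_measure_leb_I])
 show "{x \<in> space leb_I. Q x} \<in> sets leb_I"
  using assms(2) unfolding pred_def by blast
qed (use assms(1) in \<open>auto elim!: eventually_mono\<close>)

lemma dist_fn_abs_L0:
 assumes [measurable]: "f \<in> bm leb_I"
 shows "dist_fn (abs_L0 f) s = measure leb_I {x \<in> space leb_I. s < norm (f x)}"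
 unfolding dist_fn_def
proof (rule measure_leb_I_cong_AE)
 show "AE x in leb_I. (s < norm (rep_L0 (abs_L0 f) x)) = (s < norm (f x))"
  using rep_abs_L0[OF assms] by eventually_elim simp
qed measurable

lemma dist_fn_mono_AE:
 assumes "AE x in leb_I. norm (rep_L0 g x) <= norm (rep_L0 f x)"
 shows "dist_fn g s <= dist_fn f s"
 unfolding dist_fn_def
 by (rule measure_leb_I_mono_AE) (use assms in \<open>auto elim!: eventually_mono\<close>)

lemma dist_fn_antimono: "s <= s' ==> dist_fn f s' <= dist_fn f s"
 unfolding dist_fn_def by (rule measure_leb_I_mono_AE) auto

lemma dist_fn_scale:
 assumes "c ~= 0"
 shows "dist_fn (scale_L0 c f) s = dist_fn f (s / norm c)"
 unfolding dist_fn_def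
proof (rule measure_leb_I_cong_AE)
 show "AE x in leb_I. (s < norm (rep_L0 (scale_L0 c f) x)) = (s / norm c < norm (rep_L0 f x))"
  using rep_L0_scale[of c f] by eventually_elim (use assms in \<open>simp add: norm_mult field_simps\<close>)
qed measurable

lemma dist_fn_right_continuous: "(%n. dist_fn f (s + 1 / real (Suc n))) \<longlonglongrightarrow> dist_fn f s"
proof -
 let ?A = "%n. {x \<in> space leb_I. s + 1 / real (Suc n) < norm (rep_L0 f x)}"
 have "(%n. measure leb_I (?A n)) \<longlonglongrightarrow> measure leb_I (\<Union>n. ?A n)"
 proof (rule finite_measure.finite_Lim_measure_incseq[OF finite_measure_leb_I])
  show "range ?A \<subseteq> sets leb_I" by (rule image_subsetI) measurable
  show "incseq ?A"
  proof (rule incseq_SucI, safe)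
   fix n x assume "s + 1 / real (Suc n) < norm (rep_L0 f x)"
   moreover have "1 / real (Suc (Suc n)) <= 1 / real (Suc n)" by (rule divide_left_mono) auto
   ultimately show "s + 1 / real (Suc (Suc n)) < norm (rep_L0 f x)" by linarith
  qed
 qed
 moreover have "(\<Union>n. ?A n) = {x \<in> space leb_I. s < norm (rep_L0 f x)}"
 proof safe
  fix n x assume "s + 1 / real (Suc n) < norm (rep_L0 f x)"
  moreover have "0 < 1 / real (Suc n)" by simp
  ultimately show "s < norm (rep_L0 f x)" by linarith
 next
  fix x assume x: "x \<in> space leb_I" "s < norm (rep_L0 f x)"
  then obtain n where "1 / real (Suc n) < norm (rep_L0 f x) - s"
   using nat_approx_posE[of "norm (rep_L0 f x) - s"] by auto
  then show "x \<in> (\<Union>n. ?A n)" using x by (auto intro!: exI[of _ n])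
 qed
 ultimately show ?thesis by (simp add: dist_fn_def)
qed

lemma rearr_eq: "rearr f t = Inf {s :: ennreal. emeasure leb_I {x \<in> space leb_I. s < ennreal (norm (rep_L0 f x))} <= ennreal t}"
 using rearr.abs_eq[of "rep_L0 f"] by (simp add: ae_eq_refl)

lemma emeasure_dist_fn:
 "0 <= s ==> emeasure leb_I {x \<in> space leb_I. ennreal s < ennreal (norm (rep_L0 f x))} = ennreal (dist_fn f s)"
 unfolding dist_fn_def using finite_measure.emeasure_eq_measure[OF finite_measure_leb_I]
 by (simp add: ennreal_less_iff)

text \<open>A Galois connection, which lets all comparisons of rearrangements be made on
  distribution functions. From left to right it rests on the right continuity of
  \<open>dist_fn\<close>: the infimum in \<open>rearr\<close> is attained.\<close>

lemma rearr_le_iff: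
 assumes t: "0 <= t" and s: "0 <= s"
 shows "rearr f t <= ennreal s \<longleftrightarrow> dist_fn f s <= t"
proof
 assume "dist_fn f s <= t"
 then have "emeasure leb_I {x \<in> space leb_I. ennreal s < ennreal (norm (rep_L0 f x))} <= ennreal t"
  using emeasure_dist_fn[OF s, of f] t by (simp add: ennreal_le_iff)
 then show "rearr f t <= ennreal s" unfolding rearr_eq by (intro Inf_lower) simp
next
 assume le: "rearr f t <= ennreal s"
 have "dist_fn f (s + 1 / real (Suc n)) <= t" for n
 proof -
  have "ennreal s < ennreal (s + 1 / real (Suc n))" using s by (simp add: ennreal_less_iff)
  with le have "Inf {s :: ennreal. emeasure leb_I {x \<in> space leb_I. s < ennreal (norm (rep_L0 f x))} <= ennreal t} < ennreal (s + 1 / real (Suc n))"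
   unfolding rearr_eq by (rule le_less_trans)
  then obtain s' where s': "emeasure leb_I {x \<in> space leb_I. s' < ennreal (norm (rep_L0 f x))} <= ennreal t" "s' < ennreal (s + 1 / real (Suc n))"
   by (auto simp: Inf_less_iff)
  then obtain r where r: "s' = ennreal r" "0 <= r"
   by (cases s') auto
  have "dist_fn f r <= t" using s'(1) emeasure_dist_fn[OF r(2), of f] r t by (simp add: ennreal_le_iff)
  moreover have "r <= s + 1 / real (Suc n)" using s'(2) r by (simp add: ennreal_less_iff)
  ultimately show ?thesis using dist_fn_antimono order_trans by blast
 qed
 then show "dist_fn f s <= t"
  using LIMSEQ_le_const2[OF dist_fn_right_continuous] by blast
qed

lemma rearr_leI:
 assumes "!!s. 0 <= s ==> dist_fn g s <= dist_fn f s" and t: "0 <= t"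
 shows "rearr g t <= rearr f t"
proof (cases "rearr f t")
 case (real s)
 then have "dist_fn f s <= t" using rearr_le_iff[OF t, of s f] by simp
 then have "dist_fn g s <= t" using assms(1)[of s] real by simp
 then show ?thesis using rearr_le_iff[OF t, of s g] real by simp
qed simp

lemma dist_fn_tendsto_0: "(%n. dist_fn f (real n)) \<longlonglongrightarrow> 0"
proof -
 let ?A = "%n::nat. {x \<in> space leb_I. real n < norm (rep_L0 f x)}"
 have "(%n. measure leb_I (?A n)) \<longlonglongrightarrow> measure leb_I (\<Inter>n. ?A n)"
 proof (rule finite_measure.finite_Lim_measure_decseq[OF finite_measure_leb_I])
  show "range ?A \<subseteq> sets leb_I" by (rule image_subsetI) measurable
  show "decseq ?A" by (rule decseq_SucI) auto
 qed
 moreover have "(\<Inter>n. ?A n) = {}"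
 proof -
  have "\<exists>n. norm (rep_L0 f x) <= real n" for x using real_arch_simple by blast
  then show ?thesis by (force simp: not_less[symmetric])
 qed
 ultimately show ?thesis by (simp add: dist_fn_def)
qed

lemma rearr_finite:
 assumes t: "0 < t"
 shows "rearr f t < \<infinity>"
proof -
 have "\<forall>\<^sub>F n in sequentially. dist_fn f (real n) < t"
  by (rule order_tendstoD(2)[OF dist_fn_tendsto_0 t])
 then obtain n where "dist_fn f (real n) < t" by (auto simp: eventually_sequentially)
 then have "rearr f t <= ennreal (real n)" using rearr_le_iff[of t "real n" f] t by simp
 then show ?thesis by (simp add: le_less_trans)
qed

lemma rearr_antimono: "0 <= t ==> t <= t' ==> rearr f t' <= rearr f t"
 unfolding rearr_eq by (rule Inf_superset_mono) (auto intro: order_trans ennreal_leI)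

text \<open>\<open>rearr f 0\<close> may be infinite, while for t > 0 the rearrangement is finite;
  the value 0 elsewhere gives a Borel function on the whole line.\<close>

definition rearr_real :: "L0 => real => real" where
 "rearr_real f t = (if 0 < t then enn2real (rearr f t) else 0)"

lemma rearr_real_gt_iff: "0 < t ==> 0 <= s ==> s < rearr_real f t \<longleftrightarrow> t < dist_fn f s"
 using rearr_le_iff[of t s f] rearr_finite[of t f]
 by (cases "rearr f t") (auto simp: rearr_real_def not_le[symmetric])

lemma rearr_real_nonneg: "0 <= rearr_real f t"
 by (simp add: rearr_real_def)

lemma ennreal_rearr_real: "0 < t ==> ennreal (rearr_real f t) = rearr f t"
 using rearr_finite[of t f] by (simp add: rearr_real_def)

lemma rearr_real_borel [measurable]: "rearr_real f \<in> bm borel"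
proof -
 have "{t. c < rearr_real f t} \<in> sets borel" for c
 proof (cases "c < 0")
  case True
  then have "{t. c < rearr_real f t} = UNIV" using rearr_real_nonneg[of f] by (auto intro: less_le_trans)
  then show ?thesis by simp
 next
  case False
  then have "{t. c < rearr_real f t} = {0<..<dist_fn f c}"
   using rearr_real_gt_iff[of _ c f] by (auto simp: rearr_real_def)
  then show ?thesis by simp
 qed
 then show ?thesis by (simp add: borel_measurable_iff_greater)
qed

text \<open>The decreasing rearrangement, read from the right end of the interval and stretched by \<open>n\<close>.\<close>

definition stretched :: "real => L0 => real => complex" where
 "stretched n f x = cr (rearr_real f ((1 - x) / n))"

lemma stretched_borel [measurable]: "stretched n f \<in> bm borel"
 unfolding stretched_def by measurable

lemma leb_I_meas: "f \<in> bm borel ==> f \<in> bm leb_I"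
 by (intro measurable_restrict_space1 measurable_completion) simp

lemma stretched_gt_iff:
 "-1 < x ==> x < 1 ==> 0 < n ==> 0 <= s ==> s < norm (stretched n f x) \<longleftrightarrow> 1 - x < n * dist_fn f s"
 using rearr_real_gt_iff[of "(1 - x) / n" s f] rearr_real_nonneg[of f "(1 - x) / n"]
 by (simp add: stretched_def field_simps)

lemma dist_fn_stretched:
 assumes n: "0 < n" and s: "0 <= s"
 shows "dist_fn (abs_L0 (stretched n f)) s = min 2 (n * dist_fn f s)"
proof -
 have "dist_fn (abs_L0 (stretched n f)) s = measure leb_I {x \<in> space leb_I. s < norm (stretched n f x)}"
  by (rule dist_fn_abs_L0) (simp add: leb_I_meas)
 also have "{x \<in> space leb_I. s < norm (stretched n f x)} = {1 - min 2 (n * dist_fn f s)<..<1}"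
  using stretched_gt_iff[OF _ _ n s, of _ f] n by auto
 also have "measure leb_I ... = min 2 (n * dist_fn f s)"
  using n by (subst measure_leb_I) auto
 finally show ?thesis .
qed

definition chi :: "real set => L0" where
 "chi A = abs_L0 (%x. indicator A x)"

lemma indicator_leb_I_measurable:
 "A \<in> sets lebesgue ==> (%x. indicator A x :: complex) \<in> bm leb_I"
 by (intro measurable_restrict_space1 borel_measurable_indicator)

lemma rep_chi: "A \<in> sets lebesgue ==> AE x in leb_I. rep_L0 (chi A) x = indicator A x"
 unfolding chi_def by (rule rep_abs_L0[OF indicator_leb_I_measurable])

lemma dist_fn_chi:
 assumes A: "A \<in> sets lebesgue" and s: "0 <= s"
 shows "dist_fn (chi A) s = (if s < 1 then measure lebesgue (A \<inter> {-1<..<1}) else 0)"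
proof -
 have "dist_fn (chi A) s = measure leb_I {x \<in> space leb_I. s < norm (indicator A x :: complex)}"
  unfolding chi_def by (rule dist_fn_abs_L0[OF indicator_leb_I_measurable[OF A]])
 also have "{x \<in> space leb_I. s < norm (indicator A x :: complex)} = (if s < 1 then A \<inter> {-1<..<1} else {})"
  using s by (auto simp: indicator_def)
 finally show ?thesis using measure_leb_I[OF sets.Int[OF A, of "{-1<..<1}"]] by simp
qed

section \<open>Comparison of distribution functions in a rearrangement invariant space\<close>

locale ri =
 fixes X :: "L0 set" and N :: "L0 => real"
 assumes ri: "ri_space X N"
begin

lemma norm_on: "norm_on X N"
 using ri by (simp add: ri_space_def banach_on_def)

lemma subsp: "L0.subspace X" using norm_on by (simp add: norm_on_def)
lemma N_nonneg: "f \<in> X ==> 0 <= N f" using norm_on by (simp add: norm_on_def)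
lemma N_eq_0: "f \<in> X ==> N f = 0 \<longleftrightarrow> f = 0" using norm_on by (simp add: norm_on_def)
lemma N_scale: "f \<in> X ==> N (scale_L0 c f) = norm c * N f" using norm_on by (simp add: norm_on_def)
lemma N_add: "f \<in> X ==> g \<in> X ==> N (f + g) <= N f + N g" using norm_on by (simp add: norm_on_def)
lemma X_add: "f \<in> X ==> g \<in> X ==> f + g \<in> X" using subsp by (rule L0.subspace_add)
lemma X_diff: "f \<in> X ==> g \<in> X ==> f - g \<in> X" using subsp by (rule L0.subspace_diff)
lemma X_scale: "f \<in> X ==> scale_L0 c f \<in> X" using subsp by (rule L0.subspace_scale)
lemma X_0: "0 \<in> X" using subsp by (rule L0.subspace_0)
lemma N_0: "N 0 = 0" using N_eq_0 X_0 by blast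

lemma N_diff: "f \<in> X ==> g \<in> X ==> N (f - g) <= N f + N g"
 using N_add[of f "scale_L0 (-1) g"] N_scale[of g "-1"] X_scale[of g "-1"] by simp

lemma N_diff_commute: "f \<in> X ==> g \<in> X ==> N (f - g) = N (g - f)"
 using N_scale[of "f - g" "-1"] X_diff[of f g] by simp

lemma X_dist_fn:
 assumes "f \<in> X" "!!s. 0 <= s ==> dist_fn g s <= dist_fn f s"
 shows "g \<in> X" "N g <= N f"
proof -
 have "rearr_le g f" unfolding rearr_le_def using rearr_leI[OF assms(2)] by auto
 then show "g \<in> X" "N g <= N f" using ri assms(1) unfolding ri_space_def by blast+
qed

lemma X_mono:
 assumes "f \<in> X" "AE x in leb_I. norm (rep_L0 g x) <= norm (rep_L0 f x)"
 shows "g \<in> X" "N g <= N f"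
 using X_dist_fn[OF assms(1) dist_fn_mono_AE[OF assms(2)]] by blast+

lemma X_sum: "(!!i. i < n ==> F i \<in> X) ==> (\<Sum>i<n. F i) \<in> X & N (\<Sum>i<n. F i) <= (\<Sum>i<n. N (F i))" for n :: nat
proof (induction n)
 case (Suc n)
 then have 1: "(\<Sum>i<n. F i) \<in> X" "N (\<Sum>i<n. F i) <= (\<Sum>i<n. N (F i))" "F n \<in> X" by auto
 then show ?case using X_add[OF 1(1,3)] N_add[OF 1(1,3)] by simp
qed (simp add: X_0 N_0)

text \<open>Each dyadic block (2^-k, 2^(1 - k)] is cut into 2 n equal pieces, and \<open>A i\<close>
  collects the i-th piece of every block. Points at distance below \<open>m\<close> from the end lie
  in blocks k >= k0, the least index with 2^-k0 < m, and the lengths 2^-k / (2 n) of the pieces sum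
  to 2^-k0 / n.\<close>

lemma chunk_aux:
 fixes n :: nat and m :: real
 assumes n: "n > 0" and m: "0 <= m"
 defines "A \<equiv> %i. (\<Union>k::nat. {(1/2)^k * (1 + real i / (2 * real n)) <.. (1/2)^k * (1 + (real i + 1) / (2 * real n))})"
 shows "measure lebesgue ({x. 1 - x \<in> A i & 1 - x < m} \<inter> {-1<..<1}) <= m / n"
proof -
 define S where "S = {x. 1 - x \<in> A i & 1 - x < m} \<inter> {-1<..<1}"
 define J where "J k = {1 - (1/2)^k * (1 + (real i + 1) / (2 * real n)) ..< 1 - (1/2)^k * (1 + real i / (2 * real n))}" for k :: nat
 have J: "emeasure lebesgue (J k) = ennreal ((1/2)^k / (2 * real n))" for k
 proof -
  have "(1/2)^k * (1 + (real i + 1) / (2 * real n)) - (1/2)^k * (1 + real i / (2 * real n)) = (1/2)^k / (2 * real n)"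
   using n by (simp add: field_simps)
  moreover have "0 <= (1/2)^k / (2 * real n)" by simp
  ultimately show ?thesis unfolding J_def
   by (subst emeasure_completion) (auto simp: algebra_simps)
 qed
 have "\<exists>k::nat. (1/2)^k < m" if "m > 0" using real_arch_pow_inv[of m "1/2"] that by auto
 then show ?thesis
 proof (cases "m > 0")
  case False
  then have "S = {}" using m unfolding S_def by auto
  then show ?thesis using m unfolding S_def[symmetric] by simp
 next
  case True
  then obtain k0 where k0: "(1/2)^k0 < m" "!!k. k < k0 ==> \<not> (1/2)^k < m"
   using real_arch_pow_inv[of m "1/2"] exists_least_iff[of "%k. (1/2)^k < m"] by auto
  have sub: "S \<subseteq> (\<Union>j. J (k0 + j))"
  proof
   fix x assume "x \<in> S"
   then obtain k where k: "1 - x \<in> {(1/2)^k * (1 + real i / (2 * real n)) <.. (1/2)^k * (1 + (real i + 1) / (2 * real n))}" and xm: "1 - x < m"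
    unfolding S_def A_def by auto
   have "(1/2)^k * 1 <= (1/2)^k * (1 + real i / (2 * real n))" by (rule mult_left_mono) auto
   moreover have "(1/2)^k * (1 + real i / (2 * real n)) < 1 - x" using k by simp
   ultimately have "(1/2)^k < m" using xm by linarith
   then have "k >= k0" using k0(2) not_le by blast
   then have "x \<in> J (k0 + (k - k0))" using k unfolding J_def by auto
   then show "x \<in> (\<Union>j. J (k0 + j))" by blast
  qed
  have "emeasure lebesgue S <= emeasure lebesgue (\<Union>j. J (k0 + j))"
   by (rule emeasure_mono[OF sub]) (auto simp: J_def)
  also have "... <= (\<Sum>j. emeasure lebesgue (J (k0 + j)))"
   by (rule emeasure_subadditive_countably) (auto simp: J_def)
  also have "... = (\<Sum>j. ennreal ((1/2)^(k0 + j) / (2 * real n)))" by (simp add: J)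
  also have "... = ennreal ((1/2)^k0 / n)"
  proof (rule suminf_ennreal_eq)
   have "(%j. (1/2)^k0 / (2 * real n) * (1/2)^j) sums ((1/2)^k0 / (2 * real n) * (1 / (1 - 1/2)))"
    by (intro sums_mult geometric_sums) auto
   then show "(%j. (1/2)^(k0 + j) / (2 * real n)) sums ((1/2)^k0 / n)"
    by (simp add: power_add mult.commute)
  qed simp
  also have "... <= ennreal (m / n)" using k0(1) n by (intro ennreal_leI divide_right_mono) auto
  finally show ?thesis unfolding S_def[symmetric] using m by (simp add: measure_def enn2real_leI)
 qed
qed

text \<open>The stretched rearrangement \<open>H\<close> dominates \<open>g\<close> in distribution
  and is bounded by the sum of its restrictions to the 2 n sets \<open>A i\<close>, each dominated
  in distribution by \<open>f\<close>. So multiplying a distribution function by \<open>n\<close>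
  does not lead out of \<open>X\<close>; the dyadic blocks lose a factor 2, hence 2 n
  pieces.\<close>

lemma X_chunk:
 fixes n :: nat
 assumes f: "f \<in> X" and n: "n > 0" and g: "!!s. 0 <= s ==> dist_fn g s <= real n * dist_fn f s"
 shows "g \<in> X & N g <= 2 * real n * N f"
proof -
 define A where "A i = (\<Union>k::nat. {(1/2)^k * (1 + real i / (2 * real n)) <.. (1/2)^k * (1 + (real i + 1) / (2 * real n))})" for i :: nat
 have [measurable]: "A i \<in> sets borel" for i unfolding A_def by auto
 define H where "H = stretched (real n) f"
 define h where "h i x = (if 1 - x \<in> A i then H x else 0)" for i x
 have [measurable]: "H \<in> bm borel" unfolding H_def by simp
 have hb: "h i \<in> bm borel" for i unfolding h_def by measurable
 note hm [measurable] = leb_I_meas[OF hb]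
 have hX: "abs_L0 (h i) \<in> X" "N (abs_L0 (h i)) <= N f" for i
 proof -
  have "dist_fn (abs_L0 (h i)) s <= dist_fn f s" if s: "0 <= s" for s
  proof -
   have "dist_fn (abs_L0 (h i)) s = measure leb_I {x \<in> space leb_I. s < norm (h i x)}"
    by (rule dist_fn_abs_L0[OF hm])
   also have "{x \<in> space leb_I. s < norm (h i x)} = {x. 1 - x \<in> A i & 1 - x < real n * dist_fn f s} \<inter> {-1<..<1}"
    using stretched_gt_iff[OF _ _ _ s, of _ "real n" f] n s by (auto simp: h_def H_def)
   also have "measure leb_I ... = measure lebesgue ..."
    by (rule measure_leb_I) auto
   also have "... <= real n * dist_fn f s / real n"
    unfolding A_def by (rule chunk_aux[OF n]) simp
   finally show ?thesis using n by simp
  qed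
  then show "abs_L0 (h i) \<in> X" "N (abs_L0 (h i)) <= N f" using X_dist_fn[OF f] by blast+
 qed
 define G where "G = (\<Sum>i<2*n. abs_L0 (h i))"
 have G: "G \<in> X" "N G <= (\<Sum>i<2*n. N (abs_L0 (h i)))"
  using X_sum[of "2*n" "%i. abs_L0 (h i)"] hX by (auto simp: G_def)
 have "(\<Sum>i<2*n. N (abs_L0 (h i))) <= (\<Sum>i<2*n. N f)" using hX by (intro sum_mono) auto
 then have NG: "N G <= 2 * real n * N f" using G by simp
 have repG: "AE x in leb_I. rep_L0 G x = (\<Sum>i<2*n. h i x)"
 proof -
  have "AE x in leb_I. \<forall>i. rep_L0 (abs_L0 (h i)) x = h i x"
   unfolding AE_all_countable using rep_abs_L0[OF hm] by blast
  with rep_L0_sum[of "%i. abs_L0 (h i)" "2*n"] show ?thesis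
   unfolding G_def by eventually_elim simp
 qed
 \<comment> \<open>A point at distance \<tau> from the end lies in the block of the least
   \<open>k\<close> with 2^-k < \<tau>, and \<open>r\<close> is its position there, scaled to (0, 2
   n]. The ceiling minus one matches pieces that are open on the left.\<close>
 have big: "norm (H x) <= norm (\<Sum>i<2*n. h i x)" if x: "x \<in> {-1<..<1}" for x
 proof -
  define \<tau> where "\<tau> = 1 - x"
  have \<tau>: "0 < \<tau>" "\<tau> < 2" using x by (auto simp: \<tau>_def)
  obtain k where k: "(1/2)^k < \<tau>" "!!j. j < k ==> \<not> (1/2)^j < \<tau>"
   using real_arch_pow_inv[of \<tau> "1/2"] \<tau> exists_least_iff[of "%k. (1/2)^k < \<tau>"] by auto
  have ub: "\<tau> <= 2 * (1/2)^k"
  proof (cases k)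
   case 0
   then show ?thesis using \<tau> by simp
  next
   case (Suc j)
   then show ?thesis using k(2)[of j] by simp
  qed
  define r where "r = (\<tau> * 2^k - 1) * (2 * real n)"
  have p2: "(1/2::real)^k * 2^k = 1" by (simp add: power_mult_distrib[symmetric])
  have r: "0 < r" "r <= 2 * real n"
  proof -
   have "(1/2)^k * 2^k < \<tau> * 2^k" using k(1) by (intro mult_strict_right_mono) auto
   then show "0 < r" using n p2 by (simp add: r_def)
   have "\<tau> * 2^k <= 2 * (1/2)^k * 2^k" using ub by (intro mult_right_mono) auto
   then have "\<tau> * 2^k - 1 <= 1" using p2 by (simp add: mult.assoc)
   then show "r <= 2 * real n" using n mult_right_mono[of "\<tau> * 2^k - 1" 1 "2 * real n"] by (simp add: r_def)
  qed
  define i where "i = nat (\<lceil>r\<rceil> - 1)"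
  have i: "real i < r" "r <= real i + 1" "i < 2 * n"
   using r unfolding i_def by linarith+
  have \<tau>r: "\<tau> = (1/2)^k * (1 + r / (2 * real n))"
   using n p2 unfolding r_def by (simp add: field_simps)
  have mem: "\<tau> \<in> A i"
   unfolding A_def \<tau>r using i n by (auto intro!: exI[of _ k] divide_strict_right_mono divide_right_mono)
  have "norm (H x) = norm (h i x)" using mem by (simp add: h_def \<tau>_def)
  also have hr: "h j x = cr (if 1 - x \<in> A j then rearr_real f ((1 - x) / real n) else 0)" for j
   by (simp add: h_def H_def stretched_def)
  have "norm (h i x) = (if 1 - x \<in> A i then rearr_real f ((1 - x) / real n) else 0)"
   unfolding hr by (simp add: rearr_real_nonneg)
  also have "... <= (\<Sum>j<2*n. (if 1 - x \<in> A j then rearr_real f ((1 - x) / real n) else 0))"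
   by (rule member_le_sum) (use i in \<open>auto simp: rearr_real_nonneg\<close>)
  also have "... = norm (\<Sum>j<2*n. h j x)"
   unfolding hr of_real_sum[symmetric] norm_of_real by (simp add: sum_nonneg rearr_real_nonneg)
  finally show ?thesis .
 qed
 have "dist_fn g s <= dist_fn G s" if s: "0 <= s" for s
 proof -
  have "dist_fn g s <= min 2 (real n * dist_fn f s)" using g[OF s] dist_fn_le_2 by simp
  also have "... = dist_fn (abs_L0 H) s" unfolding H_def using dist_fn_stretched[of "real n" s f] n s by simp
  also have "... <= dist_fn G s"
  proof (rule dist_fn_mono_AE)
   have "AE x in leb_I. rep_L0 (abs_L0 H) x = H x" by (rule rep_abs_L0) (simp add: leb_I_meas)
   moreover have "AE x in leb_I. x \<in> space leb_I" by (rule AE_space)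
   ultimately show "AE x in leb_I. norm (rep_L0 (abs_L0 H) x) <= norm (rep_L0 G x)"
    using repG by eventually_elim (use big in auto)
  qed
  finally show ?thesis .
 qed
 then show ?thesis using X_dist_fn[OF G(1), of g] NG by force
qed

end

section \<open>Dilations, the fundamental function and the Boyd indices\<close>

lemma sets_leb_I_iff: "A \<in> sets leb_I \<longleftrightarrow> A \<subseteq> {-1<..<1} & A \<in> sets lebesgue"
 by (subst sets_restrict_space_iff) auto

lemma dilation_fun_measurable:
 fixes f :: "real => complex"
 assumes "f \<in> bm leb_I"
 shows "(%s. if t > 0 & -1 < s * t & s * t < 1 then f (s * t) else 0) \<in> bm leb_I"
 using dilation.rsp ae_eq_refl[OF assms] unfolding rel_fun_def ae_eq_def by blast

lemma dilation_abs_L0: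
 assumes "f \<in> bm leb_I"
 shows "dilation t (abs_L0 f) = abs_L0 (%s. if t > 0 & -1 < s * t & s * t < 1 then f (s * t) else 0)"
 by (rule dilation.abs_eq[OF ae_eq_refl[OF assms]])

lemma dilation_scale: "dilation t (scale_L0 c f) = scale_L0 c (dilation t f)"
proof -
 let ?f = "rep_L0 f"
 have m: "?f \<in> bm leb_I" by simp
 have "dilation t (scale_L0 c (abs_L0 ?f)) = dilation t (abs_L0 (%x. c * ?f x))"
  using abs_L0_scale[OF m, of c] by simp
 also have "... = abs_L0 (%s. if t > 0 & -1 < s * t & s * t < 1 then c * ?f (s * t) else 0)"
  by (rule dilation_abs_L0) simp
 also have "(%s. if t > 0 & -1 < s * t & s * t < 1 then c * ?f (s * t) else 0) =
   (%s. c * (if t > 0 & -1 < s * t & s * t < 1 then ?f (s * t) else 0))"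
  by auto
 also have "abs_L0 ... = scale_L0 c (dilation t (abs_L0 ?f))"
  unfolding dilation_abs_L0[OF m] by (rule abs_L0_scale[symmetric]) (rule dilation_fun_measurable[OF m])
 finally show ?thesis by simp
qed

lemma dilation_chi:
 assumes "0 < r" "b <= 1"
 shows "dilation r (chi {-b<..<b}) = chi {-(b/r)<..<b/r}"
proof -
 have "(%s. if r > 0 & -1 < s * r & s * r < 1 then indicator {-b<..<b} (s * r) else 0) = (%x. indicator {-(b/r)<..<b/r} x :: complex)"
  using assms by (auto simp: indicator_def field_simps fun_eq_iff)
 then show ?thesis unfolding chi_def by (subst dilation_abs_L0) (simp_all add: indicator_leb_I_measurable)
qed

text \<open>Superlevel sets are scaled by 1 / r and then cut by the interval, which can only lose
  measure.\<close>

lemma dist_fn_dilation_le: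
 assumes r: "0 < r" and s: "0 <= s"
 shows "dist_fn (dilation r f) s <= dist_fn f s / r"
proof -
 let ?f = "rep_L0 f"
 let ?g = "%x. if r > 0 & -1 < x * r & x * r < 1 then ?f (x * r) else 0"
 have gm [measurable]: "?g \<in> bm leb_I" by (rule dilation_fun_measurable) simp
 define B where "B = {x \<in> space leb_I. s < norm (?f x)}"
 have "B \<in> sets leb_I" unfolding B_def by measurable
 then have B: "B \<in> sets lebesgue" "B \<subseteq> {-1<..<1}" by (simp_all add: sets_leb_I_iff)
 have Il: "(%x. x / r) ` B \<in> lmeasurable"
 proof (rule bounded_set_imp_lmeasurable)
  have "(%x. r * x) \<in> lebesgue \<rightarrow>\<^sub>M lebesgue"
   using lebesgue_measurable_scaling[where 'a = real, of r] by (simp add: real_scaleR_def[abs_def])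
  from measurable_sets[OF this B(1)] have "(%x. r * x) -` B \<in> sets lebesgue" by simp
  moreover have "(%x. r * x) -` B = (%x. x / r) ` B"
  proof safe
   fix x assume "r * x \<in> B"
   then show "x \<in> (%x. x / r) ` B" using r by (intro image_eqI[of _ _ "r * x"]) auto
  qed (use r in simp)
  ultimately show "(%x. x / r) ` B \<in> sets lebesgue" by simp
  have "(%x. x / r) ` B \<subseteq> {-(1/r)..1/r}" using B(2) r by (auto simp: field_simps)
  then show "bounded ((%x. x / r) ` B)" by (rule bounded_subset[OF bounded_closed_interval])
 qed
 have A: "{x \<in> space leb_I. s < norm (?g x)} \<in> sets lebesgue" (is "?A \<in> _")
 proof -
  have "?A \<in> sets leb_I" by measurable
  then show ?thesis unfolding sets_leb_I_iff by (rule conjunct2)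
 qed
 have "dist_fn (dilation r f) s = measure leb_I ?A"
  using dilation_abs_L0[of ?f r] dist_fn_abs_L0[OF gm, of s] by simp
 also have "... = measure lebesgue ?A" by (rule measure_leb_I[OF A]) auto
 also have "... <= measure lebesgue ((%x. x / r) ` B)"
 proof (rule measure_mono_fmeasurable[OF _ A Il])
  show "?A \<subseteq> (%x. x / r) ` B"
  proof
   fix x assume "x \<in> ?A"
   then have "x * r \<in> B" using r s by (auto simp: B_def split: if_splits)
   then show "x \<in> (%x. x / r) ` B" using r by (intro image_eqI[of _ _ "x * r"]) auto
  qed
 qed
 also have "(%x. x / r) ` B = (%x. (1 / r) *\<^sub>R x + 0) ` B" by (simp add: divide_inverse mult.commute)
 also have "measure lebesgue ... = \<bar>1 / r\<bar> ^ DIM(real) * measure lebesgue B" by (rule measure_lebesgue_affine)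
 also have "... = dist_fn f s / r"
  unfolding dist_fn_def B_def[symmetric] using r measure_leb_I[OF B] by simp
 finally show ?thesis .
qed

context ri
begin

text \<open>Some \<open>f\<close> in \<open>X\<close> exceeds a level \<open>s0\<close> > 0 on a set
  of positive measure. A multiple \<open>n\<close> of this measure exceeds 2, so
  \<open>X_chunk\<close> applies to f / s0.\<close>

lemma chi_mem:
 assumes A: "A \<in> sets lebesgue"
 shows "chi A \<in> X"
proof -
 obtain f where f: "f \<in> X" "f ~= 0" using ri X_0 unfolding ri_space_def by blast
 have "dist_fn f 0 ~= 0"
 proof
  assume 0: "dist_fn f 0 = 0"
  have "dist_fn f s <= dist_fn 0 s" if "0 <= s" for s
  proof -
   have "dist_fn f s = 0" using dist_fn_antimono[OF that, of f] 0 dist_fn_nonneg[of f s] by simp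
   then show ?thesis by simp
  qed
  then have "N f <= 0" using X_dist_fn(2)[OF X_0] N_0 by metis
  then show False using N_nonneg[OF f(1)] N_eq_0[OF f(1)] f(2) by simp
 qed
 then have "0 < dist_fn f 0" using dist_fn_nonneg[of f 0] by (simp add: less_le)
 then have "\<forall>\<^sub>F n in sequentially. 0 < dist_fn f (0 + 1 / real (Suc n))"
  by (rule order_tendstoD(1)[OF dist_fn_right_continuous])
 then obtain m where "0 < dist_fn f (0 + 1 / real (Suc m))" by (auto simp: eventually_sequentially)
 moreover define s0 where "s0 = 1 / real (Suc m)"
 ultimately have d: "0 < dist_fn f s0" and s0: "0 < s0" by simp_all
 define F where "F = scale_L0 (1 / s0) f"
 obtain n :: nat where "2 / dist_fn f s0 < real n" using reals_Archimedean2 by blast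
 then have n: "2 < real n * dist_fn f s0" using d by (simp add: pos_divide_less_eq)
 then have n0: "n > 0" by (cases n) auto
 have "dist_fn (chi A) s <= real n * dist_fn F s" if s: "0 <= s" for s
 proof (cases "s < 1")
  case True
  have "s * s0 <= s0" using True s0 by simp
  then have "dist_fn f s0 <= dist_fn F s"
   unfolding F_def using s0 by (subst dist_fn_scale) (auto simp: norm_divide intro!: dist_fn_antimono)
  then have "real n * dist_fn f s0 <= real n * dist_fn F s" by (intro mult_left_mono) auto
  then show ?thesis using n dist_fn_le_2[of "chi A" s] by linarith
 qed (use dist_fn_chi[OF A s] in simp)
 then show ?thesis using X_chunk[OF X_scale[OF f(1)] n0, of "chi A" "1 / s0"] unfolding F_def by blast
qed

lemma N_chi_mono:
 assumes "A \<in> sets lebesgue" "B \<in> sets lebesgue" "measure lebesgue (A \<inter> {-1<..<1}) <= measure lebesgue (B \<inter> {-1<..<1})"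
 shows "N (chi A) <= N (chi B)"
 by (rule X_dist_fn[OF chi_mem]) (use assms in \<open>auto simp: dist_fn_chi\<close>)

lemma N_chi_pos:
 assumes "A \<in> sets lebesgue" "0 < measure lebesgue (A \<inter> {-1<..<1})"
 shows "0 < N (chi A)"
proof -
 have "chi A ~= 0"
 proof
  assume "chi A = 0"
  also have "0 = chi {}" by (simp add: chi_def abs_L0_zero)
  finally have "dist_fn (chi A) 0 = dist_fn (chi {}) 0" by simp
  then show False using assms by (simp add: dist_fn_chi)
 qed
 then show ?thesis using N_nonneg[OF chi_mem[OF assms(1)]] N_eq_0[OF chi_mem[OF assms(1)]] by simp
qed

lemma bounded_mem:
 assumes f: "f \<in> bm leb_I" and M: "0 <= M" and le: "AE x in leb_I. norm (f x) <= M"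
 shows "abs_L0 f \<in> X" "N (abs_L0 f) <= M * N (chi UNIV)"
proof -
 have "AE x in leb_I. rep_L0 (chi UNIV) x = indicator UNIV x" by (rule rep_chi) simp
 with rep_abs_L0[OF f] le rep_L0_scale[of "of_real M" "chi UNIV"]
 have "AE x in leb_I. norm (rep_L0 (abs_L0 f) x) <= norm (rep_L0 (scale_L0 (of_real M) (chi UNIV)) x)"
  by eventually_elim (use M in \<open>simp add: norm_mult\<close>)
 moreover have "scale_L0 (of_real M) (chi UNIV) \<in> X" by (intro X_scale chi_mem) simp
 ultimately have *: "abs_L0 f \<in> X" "N (abs_L0 f) <= N (scale_L0 (of_real M) (chi UNIV))" using X_mono by blast+
 show "abs_L0 f \<in> X" "N (abs_L0 f) <= M * N (chi UNIV)"
  using * N_scale[OF chi_mem[of UNIV], of "of_real M"] M by simp_all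
qed

text \<open>The fundamental function of \<open>X\<close> at the measure 2 b, for 0 <= b <= 1.
  Symmetric intervals are used because dilations map them to each other.\<close>

definition fund :: "real => real" where
 "fund b = N (chi {-b<..<b})"

lemma measure_sym_interval: "0 <= b ==> b <= 1 ==> measure lebesgue ({-b<..<b} \<inter> {-1<..<1::real}) = 2 * b"
proof -
 assume b: "0 <= b" "b <= 1"
 then have "{-b<..<b} \<inter> {-1<..<1::real} = {-b<..<b}" by auto
 then show ?thesis using b by simp
qed

lemma fund_mono: "b <= b' ==> fund b <= fund b'"
 unfolding fund_def
proof (rule N_chi_mono)
 assume "b <= b'"
 then show "measure lebesgue ({- b<..<b} \<inter> {- 1<..<1}) <= measure lebesgue ({- b'<..<b'} \<inter> {- 1<..<1})"
  by (intro measure_mono_fmeasurable) (auto intro!: bounded_set_imp_lmeasurable bounded_Int)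
qed auto

lemma fund_nonneg: "0 <= fund b"
 unfolding fund_def by (intro N_nonneg chi_mem) simp

lemma fund_1_pos: "0 < fund 1"
 unfolding fund_def by (rule N_chi_pos) auto

text \<open>Chebyshev's inequality in \<open>X\<close>: f / s dominates in distribution the
  characteristic function of an interval of measure \<open>dist_fn f s\<close>.\<close>

lemma fund_dist_fn_le:
 assumes f: "f \<in> X" and s: "0 < s"
 shows "s * fund (dist_fn f s / 2) <= N f"
proof -
 have "N (chi {-(dist_fn f s / 2)<..<dist_fn f s / 2}) <= N (scale_L0 (of_real (1 / s)) f)"
 proof (rule X_dist_fn(2)[OF X_scale[OF f]])
  fix u :: real assume u: "0 <= u"
  have "measure lebesgue ({-(dist_fn f s / 2)<..<dist_fn f s / 2} \<inter> {-1<..<1}) = dist_fn f s"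
   using measure_sym_interval[of "dist_fn f s / 2"] dist_fn_le_2[of f s] by simp
  moreover have "dist_fn (scale_L0 (of_real (1 / s)) f) u = dist_fn f (u * s)"
   using s by (subst dist_fn_scale) (auto simp: norm_divide)
  moreover have "dist_fn f s <= dist_fn f (u * s)" if "u < 1" using that s by (intro dist_fn_antimono) auto
  ultimately show "dist_fn (chi {-(dist_fn f s / 2)<..<dist_fn f s / 2}) u <= dist_fn (scale_L0 (of_real (1 / s)) f) u"
   using dist_fn_chi[OF _ u, of "{-(dist_fn f s / 2)<..<dist_fn f s / 2}"] by auto
 qed
 then show ?thesis using s N_scale[OF f, of "of_real (1 / s)"] mult_left_mono[of _ _ s] by (fastforce simp: fund_def norm_divide)
qed

text \<open>A dilation by \<open>r\<close> multiplies distribution functions by at most 1 / r, so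
  \<open>X_chunk\<close> bounds it. This also makes the supremum in \<open>opnorm_on\<close> one
  over a bounded set.\<close>

lemma dilation_mem:
 assumes r: "0 < r"
 shows "\<exists>K. \<forall>f\<in>X. dilation r f \<in> X & N (dilation r f) <= K * N f"
proof -
 obtain n :: nat where n: "1 / r < real n" using reals_Archimedean2 by blast
 have "0 < 1 / r" using r by simp
 with n have n0: "n > 0" by (cases n) auto
 have "dilation r f \<in> X & N (dilation r f) <= 2 * real n * N f" if f: "f \<in> X" for f
 proof (rule X_chunk[OF f n0])
  fix s :: real assume s: "0 <= s"
  have "dist_fn (dilation r f) s <= 1 / r * dist_fn f s" using dist_fn_dilation_le[OF r s, of f] by simp
  also have "... <= real n * dist_fn f s" using n by (intro mult_right_mono) auto
  finally show "dist_fn (dilation r f) s <= real n * dist_fn f s" .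
 qed
 then show ?thesis by blast
qed

lemma N_dilation_le:
 assumes r: "0 < r" and f: "f \<in> X"
 shows "N (dilation r f) <= opnorm_on X N (dilation r) * N f"
  and opnorm_dilation_nonneg: "0 <= opnorm_on X N (dilation r)"
proof -
 obtain K where K: "!!f. f \<in> X ==> dilation r f \<in> X" "!!f. f \<in> X ==> N (dilation r f) <= K * N f"
  using dilation_mem[OF r] by blast
 have bdd: "bdd_above ((%f. N (dilation r f)) ` {f\<in>X. N f <= 1})"
 proof (rule bdd_aboveI2)
  fix f assume "f \<in> {f \<in> X. N f <= 1}"
  then have f: "f \<in> X" "N f <= 1" by auto
  have "K * N f <= \<bar>K\<bar> * 1" using f N_nonneg[of f] by (intro mult_mono) auto
  then show "N (dilation r f) <= \<bar>K\<bar>" using K(2)[OF f(1)] by simp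
 qed
 have up: "N (dilation r f) <= opnorm_on X N (dilation r)" if "f \<in> X" "N f <= 1" for f
  unfolding opnorm_on_def by (rule cSUP_upper[OF _ bdd]) (use that in simp)
 have "0 <= N (dilation r 0)" using K(1)[OF X_0] by (rule N_nonneg)
 also have "... <= opnorm_on X N (dilation r)" using up[OF X_0] N_0 by simp
 finally show "0 <= opnorm_on X N (dilation r)" .
 show "N (dilation r f) <= opnorm_on X N (dilation r) * N f"
 proof (cases "N f = 0")
  case True
  then show ?thesis using K(2)[OF f] by simp
 next
  case False
  then have p: "0 < N f" using N_nonneg[OF f] by simp
  define g where "g = scale_L0 (of_real (1 / N f)) f"
  have "N g = 1" using N_scale[OF f, of "of_real (1 / N f)"] p by (simp add: g_def norm_divide)
  then have "N (dilation r g) <= opnorm_on X N (dilation r)" using up[of g] X_scale[OF f] by (simp add: g_def)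
  moreover have "N (dilation r g) = N (dilation r f) / N f"
   unfolding g_def dilation_scale using N_scale[OF K(1)[OF f], of "of_real (1 / N f)"] p by (simp add: norm_divide)
  ultimately have "N (dilation r f) / N f <= opnorm_on X N (dilation r)" by simp
  then show ?thesis unfolding pos_divide_le_eq[OF p] .
 qed
qed

lemma fund_dilation:
 assumes "0 < t" "b <= 1"
 shows "fund (t * b) <= opnorm_on X N (dilation (1 / t)) * fund b"
 using N_dilation_le(1)[of "1 / t" "chi {-b<..<b}"] dilation_chi[of "1 / t" b] assms
 by (simp add: chi_mem fund_def mult.commute)

text \<open>An infimum below 1 yields one t > 1 at which the operator norm is below t;
  \<open>r\<close> is raised to (1 + t) / 2 if necessary, so that 1 < r < t.\<close>

lemma upper_boyd_fund:
 assumes "upper_boyd_index X N < 1"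
 obtains t r where "1 < r" "r < t" "!!b. b <= 1 ==> fund (t * b) <= r * fund b"
proof -
 let ?op = "%t. opnorm_on X N (dilation (1 / t))"
 have "\<exists>t>1. ln (?op t) / ln t < 1"
 proof (rule ccontr)
  assume "\<not> (\<exists>t>1. ln (?op t) / ln t < 1)"
  then have "1 <= upper_boyd_index X N"
   unfolding upper_boyd_index_def by (intro cINF_greatest) (auto simp only: not_less greaterThan_iff greaterThan_non_empty)
  then show False using assms by simp
 qed
 then obtain t where t: "1 < t" "ln (?op t) / ln t < 1" by blast
 have "ln (?op t) < ln t" using t by (simp add: pos_divide_less_eq ln_gt_zero)
 then have op: "?op t < t"
  using opnorm_dilation_nonneg[of "1 / t" 0] X_0 t(1) by (cases "?op t = 0") (auto simp: less_le)
 define r where "r = max (?op t) ((1 + t) / 2)"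
 show thesis
 proof (rule that[of r t])
  show "1 < r" "r < t" using op t(1) by (auto simp: r_def less_max_iff_disj)
  show "fund (t * b) <= r * fund b" if "b <= 1" for b
  proof -
   have "fund (t * b) <= ?op t * fund b" using fund_dilation[OF _ that, of t] t(1) by simp
   also have "... <= r * fund b" using fund_nonneg by (intro mult_right_mono) (auto simp: r_def)
   finally show ?thesis .
  qed
 qed
qed

text \<open>A positive supremum yields one t < 1 with a positive quotient. As ln t < 0, the operator
  norm is below 1 there, and it is not 0 because \<open>ln 0\<close> is 0.\<close>

lemma lower_boyd_fund:
 assumes "0 < lower_boyd_index X N"
 obtains t r where "0 < t" "t < 1" "0 < r" "r < 1" "!!b. b <= 1 ==> fund (t * b) <= r * fund b"
proof -
 let ?op = "%t. opnorm_on X N (dilation (1 / t))"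
 have "\<exists>t\<in>{0<..<1}. 0 < ln (?op t) / ln t"
 proof (rule ccontr)
  assume "\<not> (\<exists>t\<in>{0<..<1}. 0 < ln (?op t) / ln t)"
  then have "ln (?op t) / ln t <= 0" if "t \<in> {0<..<1}" for t using that not_less by blast
  then have "lower_boyd_index X N <= 0"
   unfolding lower_boyd_index_def by (intro cSUP_least) auto
  then show False using assms by simp
 qed
 then obtain t where t: "0 < t" "t < 1" "0 < ln (?op t) / ln t" by auto
 then have ln: "ln (?op t) < 0" by (simp add: zero_less_divide_iff)
 then have "?op t ~= 0" by auto
 then have op: "0 < ?op t" using opnorm_dilation_nonneg[of "1 / t" 0] X_0 t(1) by (simp add: less_le)
 show thesis
  by (rule that[OF t(1,2) op]) (use ln op fund_dilation t in auto)
qed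

text \<open>Iteration of the Boyd estimate bounds \<open>fund (t ^ n)\<close> by a geometric
  sequence.\<close>

lemma fund_tendsto_0:
 assumes "0 < lower_boyd_index X N" "0 < \<epsilon>"
 obtains \<delta> where "0 < \<delta>" "\<delta> <= 1" "fund \<delta> < \<epsilon>"
proof -
 obtain t r where tr: "0 < t" "t < 1" "0 < r" "r < 1" "!!b. b <= 1 ==> fund (t * b) <= r * fund b"
  using lower_boyd_fund[OF assms(1)] by blast
 have p: "fund (t ^ n) <= r ^ n * fund 1" for n
 proof (induction n)
  case (Suc n)
  have "fund (t * t ^ n) <= r * fund (t ^ n)" using tr by (intro tr(5)) (auto intro: power_le_one)
  also have "... <= r * (r ^ n * fund 1)" using Suc tr by (intro mult_left_mono) auto
  finally show ?case by (simp add: mult.assoc)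
 qed simp
 have "(%n. r ^ n * fund 1) \<longlonglongrightarrow> 0 * fund 1" using tr by (intro tendsto_intros LIMSEQ_power_zero) auto
 then have "\<forall>\<^sub>F n in sequentially. r ^ n * fund 1 < \<epsilon>" using assms(2) by (intro order_tendstoD(2)) auto
 then obtain n where "r ^ n * fund 1 < \<epsilon>" by (auto simp: eventually_sequentially)
 then show thesis using p[of n] tr by (intro that[of "t ^ n"]) (auto intro: power_le_one)
qed

text \<open>Iterating the Boyd estimate downwards gives fund (t^-n) >= r^-n fund 1. With Chebyshev's
  inequality this forces dist_fn f (K r^n) <= 2 t^-n, and the layers of |f|^p are summable as soon
  as r^p < t.\<close>

lemma Lp_integrable:
 assumes "upper_boyd_index X N < 1"
 obtains p where "1 < p" "p < 2" "!!f. f \<in> X ==> (\<integral>\<^sup>+x. ennreal (norm (rep_L0 f x) powr p) \<partial>leb_I) < \<infinity>"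
proof -
 obtain t r where tr: "1 < r" "r < t" "!!b. b <= 1 ==> fund (t * b) <= r * fund b"
  using upper_boyd_fund[OF assms] by blast
 have t: "1 < t" using tr by simp
 have low: "fund 1 <= r ^ n * fund ((1 / t) ^ n)" for n
 proof (induction n)
  case (Suc n)
  have "(1 / t) ^ Suc n <= 1" using t by (intro power_le_one) auto
  then have "fund (t * (1 / t) ^ Suc n) <= r * fund ((1 / t) ^ Suc n)" by (rule tr(3))
  moreover have "t * (1 / t) ^ Suc n = (1 / t) ^ n" using t by simp
  ultimately have "fund ((1 / t) ^ n) <= r * fund ((1 / t) ^ Suc n)" by simp
  then have "r ^ n * fund ((1 / t) ^ n) <= r ^ n * (r * fund ((1 / t) ^ Suc n))" using tr by (intro mult_left_mono) auto
  then show ?case using Suc by (simp add: mult_ac)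
 qed simp
 \<comment> \<open>ln t / ln r > 1 is the critical exponent; \<open>p\<close> is at most the
   midpoint of 1 and this number, and at most 3/2 to stay below 2.\<close>
 define p where "p = min (3/2) ((1 + ln t / ln r) / 2)"
 have lr: "0 < ln r" "ln r < ln t" using tr by (auto simp: ln_gt_zero)
 then have ratio: "1 < ln t / ln r" by simp
 have p: "1 < p" "p < 2" using ratio by (auto simp: p_def)
 have "p <= (1 + ln t / ln r) / 2" unfolding p_def by (rule min.cobounded2)
 moreover have "u < v" if "u <= (1 + v) / 2" "1 < v" for u v :: real using that by (simp add: field_simps)
 ultimately have "p < ln t / ln r" using ratio by blast
 then have "p * ln r < ln t" using lr by (simp add: pos_less_divide_eq)
 then have rp: "r powr p < t" using tr t by (subst ln_less_cancel_iff[symmetric]) (auto simp: ln_powr)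
 show thesis
 proof (rule that[OF p])
  fix f assume f: "f \<in> X"
  \<comment> \<open>Because of the added 1, K fund 1 exceeds \<open>N f\<close> strictly.\<close>
  define K where "K = (N f + 1) / fund 1"
  have K: "0 < K" using N_nonneg[OF f] fund_1_pos by (simp add: K_def)
  have d: "dist_fn f (K * r ^ n) <= 2 * (1 / t) ^ n" for n
  proof (rule ccontr)
   assume "\<not> ?thesis"
   then have "fund ((1 / t) ^ n) <= fund (dist_fn f (K * r ^ n) / 2)" by (intro fund_mono) simp
   then have "K * (r ^ n * fund ((1 / t) ^ n)) <= K * (r ^ n * fund (dist_fn f (K * r ^ n) / 2))"
    using K tr by (intro mult_left_mono) auto
   moreover have "K * fund 1 <= K * (r ^ n * fund ((1 / t) ^ n))" using K low by (intro mult_left_mono) auto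
   moreover have "K * (r ^ n * fund (dist_fn f (K * r ^ n) / 2)) <= N f"
    using fund_dist_fn_le[OF f, of "K * r ^ n"] K tr by (simp add: mult_ac)
   moreover have "K * fund 1 = N f + 1" using fund_1_pos by (simp add: K_def)
   ultimately show False by linarith
  qed
  define S where "S n = {x \<in> space leb_I. K * r ^ n < norm (rep_L0 f x)}" for n
  \<comment> \<open>On the layer K r^n < |f| <= K r^(n + 1) the n-th term alone majorises |f|^p;
    where |f| <= K the constant K^p does.\<close>
  let ?g = "%n x. ennreal ((K * r ^ Suc n) powr p) * indicator (S n) x"
  have m [measurable]: "S n \<in> sets leb_I" for n unfolding S_def by measurable
  have "(\<integral>\<^sup>+x. ennreal (norm (rep_L0 f x) powr p) \<partial>leb_I) <= (\<integral>\<^sup>+x. ennreal (K powr p) + (\<Sum>n. ?g n x) \<partial>leb_I)"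
  proof (rule nn_integral_mono)
   fix x assume x: "x \<in> space leb_I"
   show "ennreal (norm (rep_L0 f x) powr p) <= ennreal (K powr p) + (\<Sum>n. ?g n x)"
   proof (cases "norm (rep_L0 f x) <= K")
    case True
    then have "norm (rep_L0 f x) powr p <= K powr p" using p by (intro powr_mono2) auto
    then have "ennreal (norm (rep_L0 f x) powr p) <= ennreal (K powr p)" by (rule ennreal_leI)
    also have "... <= ennreal (K powr p) + (\<Sum>n. ?g n x)" by simp
    finally show ?thesis .
   next
    case False
    obtain j where "norm (rep_L0 f x) / K < r ^ j" using real_arch_pow[OF tr(1)] by blast
    then have "norm (rep_L0 f x) <= K * r ^ j" using K by (simp add: pos_divide_less_eq mult.commute)
    then obtain m where m': "norm (rep_L0 f x) <= K * r ^ m" "!!j. j < m ==> \<not> norm (rep_L0 f x) <= K * r ^ j"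
     using exists_least_iff[of "%m. norm (rep_L0 f x) <= K * r ^ m"] by auto
    have "m ~= 0" using m'(1) False by (intro notI) simp
    then obtain n where n: "m = Suc n" by (cases m) auto
    have "norm (rep_L0 f x) powr p <= (K * r ^ Suc n) powr p" using m'(1) p n by (intro powr_mono2) auto
    then have "ennreal (norm (rep_L0 f x) powr p) <= ?g n x"
     using m'(2)[of n] n x by (auto simp: ennreal_leI indicator_def S_def)
    also have "... <= (\<Sum>n. ?g n x)"
     using sum_le_suminf[of "%n. ?g n x" "{n}"] by (simp only: sum.insert sum.empty finite.intros summableI zero_le simp_thms empty_iff add_0_right not_False_eq_True if_False)
    also have "... <= ennreal (K powr p) + (\<Sum>n. ?g n x)" by simp
    finally show ?thesis .
   qed
  qed
  also have "... = (\<integral>\<^sup>+x. ennreal (K powr p) \<partial>leb_I) + (\<Sum>n. \<integral>\<^sup>+x. ?g n x \<partial>leb_I)"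
  proof -
   have gm: "?g n \<in> bm leb_I" for n by measurable
   have "(%x. \<Sum>n. ?g n x) \<in> bm leb_I" by (intro borel_measurable_suminf_order gm)
   from nn_integral_add[OF borel_measurable_const this] show ?thesis unfolding nn_integral_suminf[OF gm] .
  qed
  also have "... < \<infinity>"
  proof -
   have "(\<integral>\<^sup>+x. ?g n x \<partial>leb_I) <= ennreal (2 * (K * r) powr p * (r powr p / t) ^ n)" for n
   proof -
    have "(\<integral>\<^sup>+x. ?g n x \<partial>leb_I) = ennreal ((K * r ^ Suc n) powr p) * ennreal (dist_fn f (K * r ^ n))"
     unfolding dist_fn_def S_def[symmetric] nn_integral_cmult_indicator[OF m]
     using finite_measure.emeasure_eq_measure[OF finite_measure_leb_I] by simp
    also have "... = ennreal ((K * r ^ Suc n) powr p * dist_fn f (K * r ^ n))" by (simp add: ennreal_mult)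
    also have "... <= ennreal ((K * r ^ Suc n) powr p * (2 * (1 / t) ^ n))"
     using d by (intro ennreal_leI mult_left_mono) auto
    also have "(K * r ^ Suc n) powr p * (2 * (1 / t) ^ n) = 2 * (K * r) powr p * (r powr p / t) ^ n"
    proof -
     have "K * r ^ Suc n = (K * r) * r ^ n" by simp
     also have "... powr p = (K * r) powr p * (r ^ n) powr p" by (rule powr_mult)
     also have "(r ^ n) powr p = (r powr p) ^ n" using tr by (simp add: powr_realpow[symmetric] powr_powr mult.commute)
     finally show ?thesis by (simp add: power_divide mult_ac)
    qed
    finally show ?thesis .
   qed
   then have "(\<Sum>n. \<integral>\<^sup>+x. ?g n x \<partial>leb_I) <= (\<Sum>n. ennreal (2 * (K * r) powr p * (r powr p / t) ^ n))"
    by (intro suminf_le) auto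
   also have "... = ennreal (2 * (K * r) powr p * (1 / (1 - r powr p / t)))"
    using rp t by (intro suminf_ennreal_eq sums_mult geometric_sums) auto
   finally show ?thesis
    by (simp add: emeasure_leb_I ennreal_mult_less_top le_less_trans)
  qed
  finally show "(\<integral>\<^sup>+x. ennreal (norm (rep_L0 f x) powr p) \<partial>leb_I) < \<infinity>" .
 qed
qed

end

section \<open>Power functions in the space and in Lorentz spaces\<close>

lemma AE_leb_I_neq: "AE x in leb_I. x ~= a"
proof -
 have "AE x in lborel. x ~= a" by (rule AE_lborel_singleton)
 then have "AE x in lebesgue. x ~= a" by (rule AE_completion)
 then show ?thesis unfolding AE_leb_I_iff by (rule eventually_mono) simp
qed

lemma abs_power_measurable: "(%x. cr (\<bar>x\<bar> powr a)) \<in> bm leb_I"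
 by (rule leb_I_meas) measurable

context ri
begin

lemma fatou:
 assumes "!!n. F n \<in> X" "!!n. N (F n) <= K"
  and "AE x in leb_I. (\<forall>n. 0 <= rep_L0 (F n) x) & incseq (%n. rep_L0 (F n) x) & (%n. rep_L0 (F n) x) \<longlonglongrightarrow> rep_L0 f x"
 shows "f \<in> X" "(%n. N (F n)) \<longlonglongrightarrow> N f"
proof -
 have "bdd_above (range (%n. N (F n)))" using assms(2) by (rule bdd_aboveI2)
 moreover have "fatou_property X N" using ri by (simp add: ri_space_def)
 note this[unfolded fatou_property_def, rule_format, of F f]
 ultimately show "f \<in> X" "(%n. N (F n)) \<longlonglongrightarrow> N f" using assms(1,3) by auto
qed

text \<open>On the layer t^(k + 1) <= |x| < t^k the power |x|^-b is at most t^(- b (k + 1)). So its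
  truncations are dominated by \<open>G n\<close>, whose norms are bounded by partial sums of a
  geometric series of ratio t^-b r, and the Fatou property yields the limit.\<close>

lemma abs_power_mem:
 assumes "0 < lower_boyd_index X N"
 obtains b where "0 < b" "b < 1" "abs_power (-b) \<in> X"
proof -
 obtain t r where tr: "0 < t" "t < 1" "0 < r" "r < 1" "!!b. b <= 1 ==> fund (t * b) <= r * fund b"
  using lower_boyd_fund[OF assms(1)] by blast
 have p: "fund (t ^ n) <= r ^ n * fund 1" for n
 proof (induction n)
  case (Suc n)
  have "fund (t * t ^ n) <= r * fund (t ^ n)" using tr by (intro tr(5)) (auto intro: power_le_one)
  also have "... <= r * (r ^ n * fund 1)" using Suc tr by (intro mult_left_mono) auto
  finally show ?case by (simp add: mult.assoc)
 qed simp
 \<comment> \<open>The condition t^-b r < 1 is equivalent to b < ln r / ln t; half of this bound is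
   taken, and at most 1/2.\<close>
 define b where "b = min (1/2) (ln r / ln t / 2)"
 have l: "ln t < 0" "ln r < 0" using tr by auto
 then have ratio: "0 < ln r / ln t" by (simp add: zero_less_divide_iff)
 have b: "0 < b" "b < 1" using ratio by (auto simp: b_def)
 have "b <= ln r / ln t / 2" unfolding b_def by (rule min.cobounded2)
 moreover have "u < v" if "u <= v / 2" "0 < v" for u v :: real using that by linarith
 ultimately have "b < ln r / ln t" using ratio by blast
 then have "ln r < b * ln t" using l by (simp add: neg_less_divide_eq)
 then have tb: "t powr (-b) * r < 1" using tr
  by (subst ln_less_cancel_iff[symmetric]) (auto simp: ln_mult ln_powr)
 define F where "F n = (%x::real. if t ^ n <= \<bar>x\<bar> then cr (\<bar>x\<bar> powr (-b)) else 0)" for n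
 have Fm: "F n \<in> bm leb_I" for n
  unfolding F_def by (rule leb_I_meas) measurable
 define G where "G n = (\<Sum>k<n. scale_L0 (of_real (t powr (- b * (real k + 1)))) (chi {-(t^k)<..<t^k}))" for n
 have G: "G n \<in> X" "N (G n) <= t powr (-b) * fund 1 / (1 - t powr (-b) * r)" for n
 proof -
  have "N (scale_L0 (of_real (t powr (- b * (real k + 1)))) (chi {-(t^k)<..<t^k})) <= t powr (-b) * fund 1 * (t powr (-b) * r) ^ k" for k
  proof -
   have "N (scale_L0 (of_real (t powr (- b * (real k + 1)))) (chi {-(t^k)<..<t^k})) = t powr (- b * (real k + 1)) * fund (t ^ k)"
    by (subst N_scale) (auto simp: chi_mem fund_def)
   also have "... <= t powr (- b * (real k + 1)) * (r ^ k * fund 1)" using p by (intro mult_left_mono) auto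
   also have "t powr (- b * (real k + 1)) * (r ^ k * fund 1) = t powr (-b) * (t powr (-b)) ^ k * (r ^ k * fund 1)"
    using tr by (simp add: powr_realpow[symmetric] powr_powr powr_add[symmetric] algebra_simps)
   finally show ?thesis by (simp add: power_mult_distrib mult_ac)
  qed
  moreover have *: "G n \<in> X & N (G n) <= (\<Sum>k<n. N (scale_L0 (of_real (t powr (- b * (real k + 1)))) (chi {-(t^k)<..<t^k})))"
   unfolding G_def by (rule X_sum) (auto intro!: X_scale chi_mem)
  ultimately have "N (G n) <= (\<Sum>k<n. t powr (-b) * fund 1 * (t powr (-b) * r) ^ k)"
   by (meson order_trans sum_mono)
  also have "... = t powr (-b) * fund 1 * (\<Sum>k<n. (t powr (-b) * r) ^ k)" by (simp add: sum_distrib_left)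
  also have "... <= t powr (-b) * fund 1 * (1 / (1 - t powr (-b) * r))"
  proof (rule mult_left_mono)
   have "(\<Sum>k<n. (t powr (-b) * r) ^ k) <= (\<Sum>k. (t powr (-b) * r) ^ k)"
    using tb tr by (intro sum_le_suminf summable_geometric) auto
   also have "... = 1 / (1 - t powr (-b) * r)" using tb tr by (intro suminf_geometric) auto
   finally show "(\<Sum>k<n. (t powr (-b) * r) ^ k) <= 1 / (1 - t powr (-b) * r)" .
  qed (use fund_nonneg in simp)
  finally show "N (G n) <= t powr (-b) * fund 1 / (1 - t powr (-b) * r)" by simp
  show "G n \<in> X" using * by simp
 qed
 have FG: "AE x in leb_I. norm (rep_L0 (abs_L0 (F n)) x) <= norm (rep_L0 (G n) x)" for n
 proof -
  have "AE x in leb_I. \<forall>k. rep_L0 (scale_L0 (of_real (t powr (- b * (real k + 1)))) (chi {-(t^k)<..<t^k})) x = of_real (t powr (- b * (real k + 1))) * indicator {-(t^k)<..<t^k} x"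
   unfolding AE_all_countable
  proof
   fix k
   show "AE x in leb_I. rep_L0 (scale_L0 (of_real (t powr (- b * (real k + 1)))) (chi {-(t^k)<..<t^k})) x = of_real (t powr (- b * (real k + 1))) * indicator {-(t^k)<..<t^k} x"
    by (rule eventually_elim2[OF rep_chi[of "{-(t^k)<..<t^k}"] rep_L0_scale[of "of_real (t powr (- b * (real k + 1)))" "chi {-(t^k)<..<t^k}"]]) (auto simp del: greaterThanLessThan_iff)
  qed
  moreover have "AE x in leb_I. x \<in> space leb_I" by (rule AE_space)
  ultimately show ?thesis using rep_abs_L0[OF Fm, of n] rep_L0_sum[of "%k. scale_L0 (of_real (t powr (- b * (real k + 1)))) (chi {-(t^k)<..<t^k})" n]
   unfolding G_def[symmetric]
  proof eventually_elim
   case (elim x)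
   let ?h = "%k. t powr (- b * (real k + 1)) * indicator {-(t^k)<..<t^k} x"
   have "rep_L0 (G n) x = of_real (\<Sum>k<n. ?h k)"
    using elim by (simp add: indicator_def)
   then have "norm (rep_L0 (G n) x) = \<bar>\<Sum>k<n. ?h k\<bar>" by (simp only: norm_of_real)
   then have g: "norm (rep_L0 (G n) x) = (\<Sum>k<n. ?h k)" by (simp only: abs_of_nonneg[OF sum_nonneg] zero_le_mult_iff powr_ge_zero indicator_pos_le simp_thms)
   show ?case
   proof (cases "t ^ n <= \<bar>x\<bar>")
    case True
    obtain m where m: "t ^ m <= \<bar>x\<bar>" "!!j. j < m ==> \<not> t ^ j <= \<bar>x\<bar>"
     using True exists_least_iff[of "%m. t ^ m <= \<bar>x\<bar>"] by auto
    have "m ~= 0" using m(1) elim(2) by (intro notI) auto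
    then obtain k where k: "m = Suc k" by (cases m) auto
    have kn: "k < n" using m(2)[of n] True k by (metis Suc_less_eq not_less_eq)
    have "norm (F n x) = \<bar>x\<bar> powr (-b)" using True by (simp add: F_def)
    also have "... <= (t ^ m) powr (-b)" using m(1) tr b by (intro powr_mono2') auto
    also have "... = t powr (- b * (real k + 1))"
     using tr k by (simp add: powr_realpow[symmetric] powr_powr algebra_simps del: power_Suc)
    also have "... = ?h k" using m(2)[of k] k by (simp add: indicator_def abs_less_iff not_le)
    also have "... <= (\<Sum>k<n. ?h k)" by (rule member_le_sum) (use kn in auto)
    finally show ?thesis using elim g by simp
   next
    case False
    then show ?thesis using elim by (simp add: F_def)
   qed
  qed
 qed
 have FX: "abs_L0 (F n) \<in> X" "N (abs_L0 (F n)) <= t powr (-b) * fund 1 / (1 - t powr (-b) * r)" for n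
  using X_mono[OF G(1) FG, of n] G(2)[of n] by auto
 have ap: "abs_power (-b) = abs_L0 (%x. cr (\<bar>x\<bar> powr (-b)))" by (simp add: abs_power_def)
 have "AE x in leb_I. (\<forall>n. 0 <= rep_L0 (abs_L0 (F n)) x) & incseq (%n. rep_L0 (abs_L0 (F n)) x) \<and>
   (%n. rep_L0 (abs_L0 (F n)) x) \<longlonglongrightarrow> rep_L0 (abs_power (-b)) x"
 proof -
  have "AE x in leb_I. \<forall>n. rep_L0 (abs_L0 (F n)) x = F n x"
   unfolding AE_all_countable using rep_abs_L0[OF Fm] by blast
  moreover have "AE x in leb_I. rep_L0 (abs_power (-b)) x = cr (\<bar>x\<bar> powr (-b))"
   unfolding ap by (rule rep_abs_L0[OF abs_power_measurable])
  moreover have "AE x in leb_I. x ~= 0"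
   by (rule AE_leb_I_neq)
  ultimately show ?thesis
  proof eventually_elim
   case (elim x)
   obtain m where m: "t ^ m < \<bar>x\<bar>" using real_arch_pow_inv[of "\<bar>x\<bar>" t] elim(3) tr by auto
   have dec: "t ^ n <= t ^ m" if "m <= n" for m n using tr that by (intro power_decreasing) auto
   have inc: "F n x <= F n' x" if "n <= n'" for n n'
    using dec[OF that] by (auto simp: F_def less_eq_complex_def)
   have "\<forall>\<^sub>F n in sequentially. cr (\<bar>x\<bar> powr (-b)) = F n x"
    using eventually_ge_at_top[of m]
   proof eventually_elim
    case (elim n)
    then show ?case using m dec[of m n] by (simp add: F_def)
   qed
   then have "(%n. F n x) \<longlonglongrightarrow> cr (\<bar>x\<bar> powr (-b))" by (rule Lim_transform_eventually[OF tendsto_const])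
   moreover have "0 <= F n x" for n by (simp add: F_def less_eq_complex_def)
   ultimately show ?case using elim inc by (simp add: incseq_def)
  qed
 qed
 then have "abs_power (-b) \<in> X" by (rule fatou(1)[OF FX])
 then show thesis using that b by blast
qed

end

text \<open>At t in (0, 1] the rearrangement of |x|^-b is at least t^-b, and 1 / q <= b makes the
  Lorentz integrand at least 1 / t, whose integral diverges logarithmically.\<close>

lemma abs_power_notin_lorentz:
 assumes b: "0 < b" "b < 1" and q: "1 / b <= q"
 shows "abs_power (-b) \<notin> lorentz_p1 q"
proof
 assume "abs_power (-b) \<in> lorentz_p1 q"
 then have fin: "(\<integral>\<^sup>+t\<in>{0<..2}. ennreal (t powr (1 / q - 1)) * rearr (abs_power (-b)) t \<partial>lborel) < \<infinity>"
  by (simp add: lorentz_p1_def)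
 have "0 < 1 / b" using b(1) by simp
 then have q0: "0 < q" using q by (rule less_le_trans)
 have q1: "1 / q <= b" using q q0 b(1) by (simp add: divide_simps mult.commute)
 have low: "ennreal (1 / t) <= ennreal (t powr (1 / q - 1)) * rearr (abs_power (-b)) t" if t: "0 < t" "t <= 1" for t
 proof -
  have "t powr (-b) <= rearr_real (abs_power (-b)) t"
  proof (rule dense_le)
   fix u assume u: "u < t powr (-b)"
   show "u <= rearr_real (abs_power (-b)) t"
   proof (cases "0 < u")
    case False
    then show ?thesis using rearr_real_nonneg[of "abs_power (-b)" t] by linarith
   next
    case True
    have "dist_fn (abs_power (-b)) u = measure leb_I {x \<in> space leb_I. u < norm (cr (\<bar>x\<bar> powr (-b)))}"
     unfolding abs_power_def map_fun_apply id_def by (rule dist_fn_abs_L0[OF abs_power_measurable])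
    moreover have "measure leb_I {x \<in> space leb_I. -t < x & x < t} <= measure leb_I {x \<in> space leb_I. u < norm (cr (\<bar>x\<bar> powr (-b)))}"
    proof (rule measure_leb_I_mono_AE)
     have "AE x in leb_I. x ~= 0"
      by (rule AE_leb_I_neq)
     then show "AE x in leb_I. -t < x & x < t --> u < norm (cr (\<bar>x\<bar> powr (-b)))"
     proof eventually_elim
      case (elim x)
      have "t powr (-b) <= \<bar>x\<bar> powr (-b)" if "-t < x & x < t" using that elim b by (intro powr_mono2') auto
      then show ?case using u by auto
     qed
     show "Measurable.pred leb_I (%x. u < norm (cr (\<bar>x\<bar> powr (-b))))"
      using abs_power_measurable[of "-b"] by measurable
    qed
    moreover have "{x \<in> space leb_I. -t < x & x < t} = {-t<..<t}" using t by auto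
    moreover have "measure leb_I {-t<..<t} = 2 * t" using t by (subst measure_leb_I) auto
    ultimately have "t < dist_fn (abs_power (-b)) u" using t by simp
    then show ?thesis using rearr_real_gt_iff[of t u "abs_power (-b)"] t True by simp
   qed
  qed
  then have "ennreal (t powr (1 / q - 1) * t powr (-b)) <= ennreal (t powr (1 / q - 1) * rearr_real (abs_power (-b)) t)"
   by (intro ennreal_leI mult_left_mono) auto
  also have "... = ennreal (t powr (1 / q - 1)) * rearr (abs_power (-b)) t"
   using t by (simp add: ennreal_mult rearr_real_nonneg ennreal_rearr_real)
  finally have *: "ennreal (t powr (1 / q - 1) * t powr (-b)) <= ennreal (t powr (1 / q - 1)) * rearr (abs_power (-b)) t" .
  have "1 / t = t powr (-1)" using t by (simp add: powr_minus_divide)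
  also have "... <= t powr (1 / q - 1 - b)" using t q1 by (intro powr_mono') auto
  also have "... = t powr (1 / q - 1) * t powr (-b)" by (simp add: powr_add[symmetric])
  finally show ?thesis using * ennreal_leI order_trans by blast
 qed
 have "ennreal (- ln e) <= (\<integral>\<^sup>+t\<in>{0<..2}. ennreal (t powr (1 / q - 1)) * rearr (abs_power (-b)) t \<partial>lborel)" if e: "0 < e" "e <= 1" for e
 proof -
  have "(NN t. ennreal (1 / t) * indicator {e..1} t) = ennreal (ln 1 - ln e)"
   by (rule nn_integral_FTC_Icc) (use e in \<open>auto intro!: derivative_eq_intros simp: divide_simps\<close>)
  moreover have "(NN t. ennreal (1 / t) * indicator {e..1} t) <= (\<integral>\<^sup>+t\<in>{0<..2}. ennreal (t powr (1 / q - 1)) * rearr (abs_power (-b)) t \<partial>lborel)"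
   by (rule nn_integral_mono) (use e low in \<open>auto simp: indicator_def\<close>)
  ultimately show ?thesis by simp
 qed
 from this[of "exp (- m)" for m] have up: "ennreal m <= (\<integral>\<^sup>+t\<in>{0<..2}. ennreal (t powr (1 / q - 1)) * rearr (abs_power (-b)) t \<partial>lborel)" if "0 <= m" for m
  using that by simp
 obtain M where M: "0 <= M" "(\<integral>\<^sup>+t\<in>{0<..2}. ennreal (t powr (1 / q - 1)) * rearr (abs_power (-b)) t \<partial>lborel) = ennreal M"
  using fin by (cases "(\<integral>\<^sup>+t\<in>{0<..2}. ennreal (t powr (1 / q - 1)) * rearr (abs_power (-b)) t \<partial>lborel)") auto
 show False using up[of "M + 1"] M by (simp add: ennreal_le_iff)
qed

context ri
begin

text \<open>\<open>q_index\<close> is a supremum of reals and informative only for a set bounded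
  above; a power |x|^-b in \<open>X\<close> supplies the bound 1 / b.\<close>

lemma lorentz_bdd_above:
 assumes "0 < lower_boyd_index X N"
 shows "bdd_above {q. 1 < q & X \<subseteq> lorentz_p1 q}"
proof -
 obtain b where b: "0 < b" "b < 1" "abs_power (-b) \<in> X" using abs_power_mem[OF assms] by blast
 show ?thesis
 proof (rule bdd_aboveI[of _ "1 / b"])
  fix q assume "q \<in> {q. 1 < q & X \<subseteq> lorentz_p1 q}"
  then have "abs_power (-b) \<in> lorentz_p1 q" using b(3) by auto
  then show "q <= 1 / b" using abs_power_notin_lorentz[OF b(1,2), of q] by (meson linear)
 qed
qed

end

section \<open>Truncations, separability and bounded convergence\<close>

definition part :: "real set => L0 => L0" where
 "part B f = abs_L0 (%x. if norm (rep_L0 f x) \<in> B then rep_L0 f x else 0)"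

text \<open>The modulus of \<open>part\<close>, with the same norm in \<open>X\<close>: the Fatou
  property concerns increasing sequences of nonnegative functions and cannot be applied to complex
  values.\<close>

definition abs_part :: "real set => L0 => L0" where
 "abs_part B f = abs_L0 (%x. if norm (rep_L0 f x) \<in> B then of_real (norm (rep_L0 f x)) else 0)"

lemma part_measurable:
 assumes [measurable]: "B \<in> sets borel"
 shows "(%x. if norm (rep_L0 f x) \<in> B then rep_L0 f x else 0) \<in> bm leb_I"
  and "(%x. if norm (rep_L0 f x) \<in> B then cr (norm (rep_L0 f x)) else 0) \<in> bm leb_I"
 by measurable

lemma rep_part:
 assumes "B \<in> sets borel"
 shows "AE x in leb_I. rep_L0 (part B f) x = (if norm (rep_L0 f x) \<in> B then rep_L0 f x else 0)"
  and "AE x in leb_I. rep_L0 (abs_part B f) x = (if norm (rep_L0 f x) \<in> B then of_real (norm (rep_L0 f x)) else 0)"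
 unfolding part_def abs_part_def by (intro rep_abs_L0 part_measurable[OF assms])+

lemma diff_part: "f - part {..M} f = part {M<..} f"
proof (rule L0_eqI)
 show "AE x in leb_I. rep_L0 (f - part {..M} f) x = rep_L0 (part {M<..} f) x"
  using rep_L0_diff[of f "part {..M} f"] rep_part(1)[of "{..M}" f, simplified] rep_part(1)[of "{M<..}" f, simplified]
  by eventually_elim auto
qed

lemma uncountable_nat_sets: "uncountable (UNIV :: nat set set)"
proof
 assume "countable (UNIV :: nat set set)"
 then have "range (from_nat_into (UNIV :: nat set set)) = Pow UNIV"
  using range_from_nat_into[of "UNIV :: nat set set"] by simp
 then show False using Cantors_theorem by blast
qed

context ri
begin

lemma part_mem:
 assumes f: "f \<in> X" and B: "B \<in> sets borel"
 shows "part B f \<in> X" "abs_part B f \<in> X" "N (abs_part B f) = N (part B f)"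
proof -
 have "AE x in leb_I. norm (rep_L0 (part B f) x) <= norm (rep_L0 f x)"
  using rep_part(1)[OF B, of f] by eventually_elim simp
 then show p: "part B f \<in> X" by (rule X_mono[OF f])
 have 1: "AE x in leb_I. norm (rep_L0 (abs_part B f) x) <= norm (rep_L0 (part B f) x)"
  using rep_part(1)[OF B, of f] rep_part(2)[OF B, of f] by eventually_elim simp
 show a: "abs_part B f \<in> X" by (rule X_mono[OF p 1])
 have 2: "AE x in leb_I. norm (rep_L0 (part B f) x) <= norm (rep_L0 (abs_part B f) x)"
  using rep_part(1)[OF B, of f] rep_part(2)[OF B, of f] by eventually_elim simp
 show "N (abs_part B f) = N (part B f)" using X_mono(2)[OF p 1] X_mono(2)[OF a 2] by simp
qed

text \<open>By the Fatou property the norm of the tail of \<open>f\<close> above level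
  \<open>c\<close> is the limit of the norms of its bounded slabs.\<close>

lemma N_part_bounded_lower:
 assumes f: "f \<in> X" and e: "e < N (part {c<..} f)"
 shows "\<exists>m::nat. e < N (part {c<..c + real m} f)"
proof -
 have "(%m. N (abs_part {c<..c + real m} f)) \<longlonglongrightarrow> N (abs_part {c<..} f)"
 proof (rule fatou(2))
  show "abs_part {c<..c + real m} f \<in> X" for m by (rule part_mem[OF f]) simp
  show "N (abs_part {c<..c + real m} f) <= N f" for m
  proof (rule X_mono(2)[OF f])
   show "AE x in leb_I. norm (rep_L0 (abs_part {c<..c + real m} f) x) <= norm (rep_L0 f x)"
    by (rule eventually_mono[OF rep_part(2)[of "{c<..c + real m}" f]]) auto
  qed
  have "AE x in leb_I. \<forall>m::nat. rep_L0 (abs_part {c<..c + real m} f) x = (if norm (rep_L0 f x) \<in> {c<..c + real m} then of_real (norm (rep_L0 f x)) else 0)"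
   unfolding AE_all_countable by (intro allI rep_part(2)) simp
  moreover have "AE x in leb_I. rep_L0 (abs_part {c<..} f) x = (if norm (rep_L0 f x) \<in> {c<..} then of_real (norm (rep_L0 f x)) else 0)"
   by (rule rep_part(2)) simp
  ultimately show "AE x in leb_I. (\<forall>m. 0 <= rep_L0 (abs_part {c<..c + real m} f) x) \<and>
    incseq (%m. rep_L0 (abs_part {c<..c + real m} f) x) & (%m. rep_L0 (abs_part {c<..c + real m} f) x) \<longlonglongrightarrow> rep_L0 (abs_part {c<..} f) x"
  proof eventually_elim
   case (elim x)
   obtain m0 :: nat where m0: "norm (rep_L0 f x) - c <= real m0" using real_arch_simple by blast
   have "\<forall>\<^sub>F m in sequentially. rep_L0 (abs_part {c<..} f) x = rep_L0 (abs_part {c<..c + real m} f) x"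
    using eventually_ge_at_top[of m0]
   proof eventually_elim
    fix m assume "m0 <= m"
    then have "real m0 <= real m" by simp
    then show "rep_L0 (abs_part {c<..} f) x = rep_L0 (abs_part {c<..c + real m} f) x"
     using m0 elim by auto
   qed
   then have "(%m. rep_L0 (abs_part {c<..c + real m} f) x) \<longlonglongrightarrow> rep_L0 (abs_part {c<..} f) x"
    by (rule Lim_transform_eventually[OF tendsto_const])
   moreover have "incseq (%m. rep_L0 (abs_part {c<..c + real m} f) x)"
    unfolding incseq_def using elim(1) by (auto simp: less_eq_complex_def)
   ultimately show ?case using elim(1) by (simp add: less_eq_complex_def)
  qed
 qed
 then have "(%m. N (part {c<..c + real m} f)) \<longlonglongrightarrow> N (part {c<..} f)"
  using part_mem(3)[OF f] by simp
 then have "\<forall>\<^sub>F m in sequentially. e < N (part {c<..c + real m} f)" using e by (rule order_tendstoD(1))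
 then show ?thesis by (auto simp: eventually_sequentially)
qed

text \<open>If the truncations of \<open>f\<close> did not converge, disjoint pieces of \<open>f\<close> of norm bounded below
 would yield uncountably many separated elements, one for each set of naturals.\<close>

lemma bounded_dense:
 assumes sep: "separable_space (ntopology X N)" and f: "f \<in> X" and e: "0 < e"
 shows "\<exists>M::nat. N (f - part {..real M} f) < e"
proof (rule ccontr)
 assume "\<not> ?thesis"
 then have ge: "e <= N (part {real n<..} f)" for n :: nat unfolding diff_part by (simp add: not_less)
 have "\<forall>n::nat. \<exists>m::nat. e / 2 < N (part {real n<..real n + real m} f)"
 proof
  fix n :: nat
  have "e / 2 < N (part {real n<..} f)" using ge[of n] e by linarith
  then show "\<exists>m::nat. e / 2 < N (part {real n<..real n + real m} f)" by (rule N_part_bounded_lower[OF f])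
 qed
 then obtain st :: "nat => nat" where st: "!!n. e / 2 < N (part {real n<..real n + real (st n)} f)" by metis
 \<comment> \<open>Cut points chosen recursively: the slab \<open>I k\<close> between
   \<open>a k\<close> and \<open>a (Suc k)\<close> is one of those with norm above e / 2, and
   different slabs are disjoint.\<close>
 define a where "a = rec_nat 0 (%k n. n + st n)"
 have aS: "a (Suc k) = a k + st (a k)" for k by (simp add: a_def)
 have a_mono: "a j <= a k" if "j <= k" for j k
  by (rule lift_Suc_mono_le[OF _ that]) (simp add: aS)
 define I where "I k = {real (a k)<..real (a (Suc k))}" for k
 have big: "e / 2 < N (part (I k) f)" for k using st[of "a k"] by (simp add: I_def aS)
 have disj: "j = k" if "y \<in> I j" "y \<in> I k" for y j k
 proof (rule ccontr)
  have no: False if "i < l" "y \<in> I i" "y \<in> I l" for i l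
   using a_mono[of "Suc i" l] that by (auto simp: I_def)
  assume "j ~= k"
  then show False using no[of j k] no[of k j] that by (auto simp: neq_iff)
 qed
 define U where "U S = (\<Union>k\<in>S. I k)" for S
 have U: "U S \<in> sets borel" for S unfolding U_def I_def by auto
 define F where "F S = part (U S) f" for S
 have FX: "F S \<in> X" for S unfolding F_def by (rule part_mem[OF f U])
 have sep1: "e / 2 < N (F S - F T)" if k: "k \<in> S" "k \<notin> T" for S T k
 proof -
  have "AE x in leb_I. norm (rep_L0 (part (I k) f) x) <= norm (rep_L0 (F S - F T) x)"
  proof -
   have "AE x in leb_I. rep_L0 (part (I k) f) x = (if norm (rep_L0 f x) \<in> I k then rep_L0 f x else 0)"
    by (rule rep_part(1)) (simp add: I_def)
   then show ?thesis using rep_part(1)[OF U, of S f] rep_part(1)[OF U, of T f] rep_L0_diff[of "F S" "F T"]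
    unfolding F_def[symmetric]
   proof eventually_elim
    case (elim x)
    show ?case
    proof (cases "norm (rep_L0 f x) \<in> I k")
     case True
     then have "norm (rep_L0 f x) \<in> U S" "norm (rep_L0 f x) \<notin> U T" using k disj unfolding U_def by blast+
     then show ?thesis using elim by simp
    qed (use elim in simp)
   qed
  qed
  then have "N (part (I k) f) <= N (F S - F T)" by (rule X_mono(2)[OF X_diff[OF FX FX]])
  then show ?thesis using big[of k] by simp
 qed
 have sep2: "e / 2 < N (F S - F T)" if "S ~= T" for S T :: "nat set"
 proof -
  from that obtain k where "k \<in> S & k \<notin> T \<or> k \<in> T & k \<notin> S" by blast
  then show ?thesis using sep1[of k S T] sep1[of k T S] N_diff_commute[OF FX FX, of S T] by auto
 qed
 interpret M: Metric_space X "ndist X N" by (rule Metric_space_ndist[OF norm_on])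
 obtain D where D: "countable D" "D \<subseteq> X" "M.mtopology closure_of D = X"
  using sep unfolding separable_space_def by auto
 have "\<exists>d\<in>D. N (F S - d) < e / 4" for S
 proof -
  have "F S \<in> M.mtopology closure_of D" using D(3) FX by simp
  then obtain d where "d \<in> D" "d \<in> M.mball (F S) (e / 4)"
   unfolding M.metric_closure_of using e by (auto dest!: spec[of _ "e / 4"])
  then show ?thesis using D(2) by (auto simp: ndist_def)
 qed
 then obtain d where d: "!!S. d S \<in> D" "!!S. N (F S - d S) < e / 4" by metis
 have "inj d"
 proof (rule injI, rule ccontr)
  fix S T assume eq: "d S = d T" and ne: "S ~= T"
  have dX: "d S \<in> X" for S using d(1) D(2) by blast
  have "N ((F S - d S) - (F T - d T)) <= N (F S - d S) + N (F T - d T)" by (intro N_diff X_diff FX dX)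
  then show False using sep2[OF ne] d(2)[of S] d(2)[of T] eq by simp
 qed
 moreover have "countable (range d)" using D(1) d(1) by (meson countable_subset image_subsetI)
 ultimately show False using uncountable_nat_sets countable_image_inj_on by blast
qed

text \<open>A positive lower Boyd index makes the fundamental function tend to 0 at 0. The
  difference is at most e, plus K on a set \<open>A n\<close> whose measure tends to 0, and so the
  norm of its characteristic function tends to 0.\<close>

lemma bounded_convergence:
 assumes lb: "0 < lower_boyd_index X N"
  and h [measurable]: "h \<in> bm leb_I" and q [measurable]: "!!n. q n \<in> bm leb_I"
  and K: "!!n x. x \<in> {-1<..<1} ==> norm (h x - q n x) <= K"
  and lim: "AE x in leb_I. (%n. q n x) \<longlonglongrightarrow> h x"
 shows "(%n. N (abs_L0 h - abs_L0 (q n))) \<longlonglongrightarrow> 0"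
proof (rule LIMSEQ_I)
 fix r :: real assume r: "0 < r"
 define c where "c = N (chi UNIV)"
 have c: "0 <= c" unfolding c_def by (intro N_nonneg chi_mem) simp
 have K0: "0 <= K" using order_trans[OF norm_ge_zero K[of 0 0]] by simp
 define e where "e = r / (2 * (c + 1))"
 have e: "0 < e" "e * c < r / 2"
 proof -
  show "0 < e" using r c by (simp add: e_def)
  have "e * (c + 1) = r / 2" using c by (simp add: e_def field_simps)
  then show "e * c < r / 2" using \<open>0 < e\<close> by (simp add: algebra_simps)
 qed
 have "0 < r / (2 * (K + 1))" using r K0 by simp
 from fund_tendsto_0[OF lb this] obtain \<delta> where \<delta>: "0 < \<delta>" "\<delta> <= 1" "fund \<delta> < r / (2 * (K + 1))" by blast
 define A where "A n = {x \<in> space leb_I. e < norm (h x - q n x)}" for n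
 have Am [measurable]: "A n \<in> sets leb_I" for n unfolding A_def by measurable
 have Al: "A n \<in> sets lebesgue" "A n \<subseteq> {-1<..<1}" for n using Am[of n] unfolding sets_leb_I_iff by blast+
 have "(%n. \<integral>x. indicator (A n) x \<partial>leb_I) \<longlonglongrightarrow> (\<integral>x. (0::real) \<partial>leb_I)"
 proof (rule integral_dominated_convergence[where w = "%_. 1"])
  show "integrable leb_I (%_. 1::real)" using finite_measure.integrable_const[OF finite_measure_leb_I] .
  show "AE x in leb_I. (%n. indicator (A n) x :: real) \<longlonglongrightarrow> 0"
   using lim
  proof eventually_elim
   case (elim x)
   then have "(%n. norm (h x - q n x)) \<longlonglongrightarrow> norm (h x - h x)" by (intro tendsto_intros)
   then have "\<forall>\<^sub>F n in sequentially. norm (h x - q n x) < e" using e(1) by (intro order_tendstoD(2)) auto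
   then have "\<forall>\<^sub>F n in sequentially. (0::real) = indicator (A n) x"
    by eventually_elim (simp add: A_def)
   then show ?case by (rule Lim_transform_eventually[OF tendsto_const])
  qed
 qed auto
 moreover have AI: "A n \<inter> {-1<..<1} = A n" for n using Al(2) by blast
 ultimately have "(%n. measure leb_I (A n)) \<longlonglongrightarrow> 0" by simp
 then have "\<forall>\<^sub>F n in sequentially. measure leb_I (A n) < 2 * \<delta>" using \<delta>(1) by (intro order_tendstoD(2)) auto
 then have "\<forall>\<^sub>F n in sequentially. norm (N (abs_L0 h - abs_L0 (q n)) - 0) < r"
 proof eventually_elim
  case (elim n)
  let ?b = "scale_L0 (of_real e) (chi UNIV) + scale_L0 (of_real K) (chi (A n))"
  have bX: "?b \<in> X" by (intro X_add X_scale chi_mem Al) simp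
  have le: "AE x in leb_I. norm (rep_L0 (abs_L0 h - abs_L0 (q n)) x) <= norm (rep_L0 ?b x)"
  proof -
   have "AE x in leb_I. rep_L0 (chi UNIV) x = indicator UNIV x" by (rule rep_chi) simp
   moreover have "AE x in leb_I. x \<in> space leb_I" by (rule AE_space)
   ultimately show ?thesis
    using rep_chi[OF Al(1), of n] rep_L0_add[of "scale_L0 (of_real e) (chi UNIV)" "scale_L0 (of_real K) (chi (A n))"]
     rep_L0_scale[of "of_real e" "chi UNIV"] rep_L0_scale[of "of_real K" "chi (A n)"]
     rep_L0_diff[of "abs_L0 h" "abs_L0 (q n)"] rep_abs_L0[OF h] rep_abs_L0[OF q, of n]
   proof eventually_elim
    case (elim x)
    have "rep_L0 ?b x = of_real (e + K * indicator (A n) x)" using elim by (simp add: indicator_def)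
    then have b: "norm (rep_L0 ?b x) = e + K * indicator (A n) x"
     using e(1) K0 by (simp only: norm_of_real) (simp add: indicator_def)
    have "norm (h x - q n x) <= e + K * indicator (A n) x"
    proof (cases "x \<in> A n")
     case True
     then show ?thesis using K[of x n] elim(2) e(1) by auto
    qed (use elim(2) in \<open>auto simp: A_def\<close>)
    then show ?case using b elim by simp
   qed
  qed
  have "N (abs_L0 h - abs_L0 (q n)) <= N ?b" by (rule X_mono(2)[OF bX le])
  also have "... <= N (scale_L0 (of_real e) (chi UNIV)) + N (scale_L0 (of_real K) (chi (A n)))"
   by (intro N_add X_scale chi_mem Al) simp
  also have "... = e * c + K * N (chi (A n))"
   using N_scale[OF chi_mem[of UNIV], of "of_real e"] N_scale[OF chi_mem[OF Al(1)], of "of_real K" n] e(1) K0 by (simp add: c_def)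
  also have "N (chi (A n)) <= fund \<delta>"
   unfolding fund_def
  proof (rule N_chi_mono[OF Al(1)])
   show "measure lebesgue (A n \<inter> {-1<..<1}) <= measure lebesgue ({-\<delta><..<\<delta>} \<inter> {-1<..<1})"
    using AI[of n] elim measure_leb_I[OF Al] measure_sym_interval[of \<delta>] \<delta> by simp
  qed simp
  also have "K * fund \<delta> <= K * (r / (2 * (K + 1)))" using \<delta>(3) K0 by (intro mult_left_mono) auto
  also have "... <= r / 2" using K0 r by (simp add: field_simps)
  finally have "N (abs_L0 h - abs_L0 (q n)) < r" using e(2) K0 by (simp add: mult_left_mono)
  moreover have "0 <= N (abs_L0 h - abs_L0 (q n))" by (rule N_nonneg) (rule X_mono(1)[OF bX le])
  ultimately show ?case by simp
 qed
 then show "\<exists>no. \<forall>n\<ge>no. norm (N (abs_L0 h - abs_L0 (q n)) - 0) < r" by (simp add: eventually_sequentially)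
qed

end

section \<open>The critical power -1/2 and the indices of the space\<close>

lemma dist_fn_abs_power_half:
 assumes u: "0 <= u"
 shows "dist_fn (abs_power (- 1 / 2)) u = 2 * (if u <= 1 then 1 else u powr (-2))"
proof -
 define m where "m = (if u <= 1 then 1 else u powr (-2))"
 have m: "0 < m" "m <= 1" using u by (auto simp: m_def powr_minus_divide one_le_power)
 have "dist_fn (abs_power (- 1 / 2)) u = measure leb_I {x \<in> space leb_I. u < norm (cr (\<bar>x\<bar> powr (- 1 / 2)))}"
  unfolding abs_power_def map_fun_apply id_def by (rule dist_fn_abs_L0[OF abs_power_measurable])
 also have "... = measure leb_I {x \<in> space leb_I. -m < x & x < m}"
 proof (rule measure_leb_I_cong_AE)
  have "AE x in leb_I. x \<in> space leb_I" by (rule AE_space)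
  with AE_leb_I_neq[of 0]
  show "AE x in leb_I. (u < norm (cr (\<bar>x\<bar> powr (- 1 / 2)))) = (-m < x & x < m)"
  proof eventually_elim
   case (elim x)
   have "u < \<bar>x\<bar> powr (- 1 / 2) \<longleftrightarrow> \<bar>x\<bar> < m"
   proof (cases "u <= 1")
    case True
    have "\<bar>x\<bar> < 1" using elim by auto
    then have "1 < \<bar>x\<bar> powr (- 1 / 2)" using elim powr_less_mono2_neg[of "- 1 / 2" "\<bar>x\<bar>" 1] by simp
    then show ?thesis using True elim by (auto simp: m_def)
   next
    case False
    then have mu: "m powr (- 1 / 2) = u" by (simp add: m_def powr_powr)
    show ?thesis using powr_less_mono2_neg[of "- 1 / 2" "\<bar>x\<bar>" m] powr_less_mono2_neg[of "- 1 / 2" m "\<bar>x\<bar>"] m mu elim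
     by (cases "\<bar>x\<bar>" m rule: linorder_cases) auto
   qed
   then show ?case by auto
  qed
  show "Measurable.pred leb_I (%x. u < norm (cr (\<bar>x\<bar> powr (- 1 / 2))))"
   using abs_power_measurable[of "- 1 / 2"] by measurable
  show "Measurable.pred leb_I (%x. -m < x & x < m)"
   by (rule measurable_restrict_space1, rule measurable_completion) measurable
 qed
 also have "{x \<in> space leb_I. -m < x & x < m} = {-m<..<m}" using m by auto
 also have "measure leb_I {-m<..<m} = 2 * m" using m by (subst measure_leb_I) auto
 finally show ?thesis by (simp add: m_def)
qed

text \<open>The weight \<open>(1 - x)\<^sup>-\<^sup>r (1 + x)\<^sup>r\<^sup>-\<^sup>1\<close> has exponent at most \<open>- 1 / 2\<close> at one of the end points.\<close>

definition half_weight :: "real => (real => complex) => bool" where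
 "half_weight \<sigma> v \<longleftrightarrow> (\<sigma> = 1 \<or> \<sigma> = -1) \<and>
   (\<forall>x\<in>{-1<..<1}. 0 <= \<sigma> * x --> (1 - \<sigma> * x) powr (- 1 / 2) <= 2 * norm (v x))"

text \<open>For r >= 1/2 the strong singularity is at 1, otherwise 1 - r > 1/2 and it is at -1. The
  other factor has the form y^-s with 0 < s < 1 and 0 < y < 2, hence is at least 1/2; this accounts
  for the 2 in the definition.\<close>

lemma half_weightI:
 fixes v :: "real => complex"
 assumes r: "0 < r" "r < 1" and v: "!!x. x \<in> {-1<..<1} ==> norm (v x) = (1 - x) powr (-r) * (1 + x) powr (r - 1)"
 obtains \<sigma> where "half_weight \<sigma> v"
proof -
 have 2: "1 / 2 <= y powr (-s)" if "0 < s" "s < 1" "0 < y" "y < 2" for y s :: real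
 proof -
  have "2 powr (-1) <= 2 powr (-s)" using that by (intro powr_mono) auto
  also have "... <= y powr (-s)" using that by (intro powr_mono2') auto
  finally show ?thesis by (simp add: powr_minus_divide)
 qed
 have half: "y powr (- 1 / 2) <= y powr (-s)" if "1 / 2 <= s" "0 < y" "y <= 1" for y s :: real
  using that by (intro powr_mono') auto
 show thesis
 proof (cases "1 / 2 <= r")
  case True
  have "half_weight 1 v" unfolding half_weight_def
  proof (intro conjI ballI impI)
   fix x :: real assume x: "x \<in> {-1<..<1}" "0 <= 1 * x"
   have "(1 - x) powr (- 1 / 2) * (1 / 2) <= (1 - x) powr (-r) * (1 + x) powr (-(1 - r))"
    using x r True by (intro mult_mono half 2) auto
   then show "(1 - 1 * x) powr (- 1 / 2) <= 2 * norm (v x)" using v[OF x(1)] by simp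
  qed simp
  then show thesis by (rule that)
 next
  case False
  have "half_weight (-1) v" unfolding half_weight_def
  proof (intro conjI ballI impI)
   fix x :: real assume x: "x \<in> {-1<..<1}" "0 <= -1 * x"
   have "(1 / 2) * (1 + x) powr (- 1 / 2) <= (1 - x) powr (-r) * (1 + x) powr (-(1 - r))"
    using x r False by (intro mult_mono half 2) auto
   then show "(1 - -1 * x) powr (- 1 / 2) <= 2 * norm (v x)" using v[OF x(1)] by simp
  qed simp
  then show thesis by (rule that)
 qed
qed

lemma measure_leb_I_end_interval:
 assumes "\<sigma> = 1 \<or> \<sigma> = -1" "0 <= m" "m <= 2"
 shows "measure leb_I {x \<in> space leb_I. 1 - \<sigma> * x < m} = m"
 using assms(1)
proof
 assume "\<sigma> = 1"
 then have eq: "{x \<in> space leb_I. 1 - \<sigma> * x < m} = {1 - m<..<1}" using assms by auto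
 show ?thesis unfolding eq using assms by (subst measure_leb_I) auto
next
 assume "\<sigma> = -1"
 then have eq: "{x \<in> space leb_I. 1 - \<sigma> * x < m} = {-1<..<m - 1}" using assms by auto
 show ?thesis unfolding eq using assms by (subst measure_leb_I) auto
qed

context ri
begin

text \<open>Near its end point 2 |v| is at least the distance to the power -1/2, so the distribution
  function of |x|^(-1/2) is at most twice that of 2 v, and \<open>X_chunk\<close> puts |x|^(-1/2)
  into \<open>X\<close>. Hence the index is 2; it is attained because every function in weak L^2 is
  dominated in distribution by a multiple of this power.\<close>

lemma half_weight_notin:
 assumes p: "2 <= p_index X" "p_index X = 2 --> \<not> p_index_attained X"
  and v: "v \<in> bm leb_I" "half_weight \<sigma> v"
 shows "abs_L0 v \<notin> X"
proof
 assume X: "abs_L0 v \<in> X"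
 have ap: "abs_power (- 1 / 2) \<in> X"
 proof (rule conjunct1[OF X_chunk[where n = 2 and f = "scale_L0 2 (abs_L0 v)"]])
  show "scale_L0 2 (abs_L0 v) \<in> X" by (rule X_scale[OF X])
  fix s :: real assume s: "0 <= s"
  define m where "m = (if s <= 1 then 1 else s powr (-2))"
  have m: "0 < m" "m <= 1" using s by (auto simp: m_def powr_minus_divide one_le_power)
  have ms: "s <= m powr (- 1 / 2)"
   by (simp add: m_def powr_powr)
  have "m = measure leb_I {x \<in> space leb_I. 1 - \<sigma> * x < m}"
   using measure_leb_I_end_interval[of \<sigma> m] m v(2) by (simp add: half_weight_def)
  also have "... <= measure leb_I {x \<in> space leb_I. s / 2 < norm (v x)}"
  proof (rule measure_leb_I_mono_AE)
   show "AE x in leb_I. 1 - \<sigma> * x < m --> s / 2 < norm (v x)"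
   proof (rule AE_I2, rule impI)
    fix x assume x: "x \<in> space leb_I" "1 - \<sigma> * x < m"
    have p: "0 < 1 - \<sigma> * x" using x v(2) by (auto simp: half_weight_def)
    have "m powr (- 1 / 2) < (1 - \<sigma> * x) powr (- 1 / 2)"
     using x(2) p by (intro powr_less_mono2_neg) auto
    also have "... <= 2 * norm (v x)" using v(2) x m unfolding half_weight_def by auto
    finally show "s / 2 < norm (v x)" using ms by simp
   qed
   show "Measurable.pred leb_I (%x. s / 2 < norm (v x))" using v(1) by measurable
  qed
  also have "... = dist_fn (scale_L0 2 (abs_L0 v)) s"
   using dist_fn_abs_L0[OF v(1)] by (subst dist_fn_scale) auto
  finally have "m <= dist_fn (scale_L0 2 (abs_L0 v)) s" .
  then show "dist_fn (abs_power (- 1 / 2)) s <= real 2 * dist_fn (scale_L0 2 (abs_L0 v)) s"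
   using dist_fn_abs_power_half[OF s] by (simp add: m_def)
 qed simp
 have "p_index X <= 2" unfolding p_index_def
  by (rule cInf_lower) (use ap in \<open>auto intro!: bdd_belowI[of _ 1]\<close>)
 then have p2: "p_index X = 2" using p(1) by simp
 have "weak_Lp 2 \<subseteq> X"
 proof
  fix f assume "f \<in> weak_Lp 2"
  then obtain M0 where M0: "!!t. t \<in> {0<..2} ==> rearr f t <= ennreal (M0 * t powr (- 1 / 2))"
   unfolding weak_Lp_def by blast
  \<comment> \<open>At least 1, so that division by \<open>M\<close> in the scaling of distribution
    functions is legitimate.\<close>
  define M where "M = max M0 1"
  have M: "1 <= M" "rearr f t <= ennreal (M * t powr (- 1 / 2))" if "t \<in> {0<..2}" for t
  proof -
   show "1 <= M" by (simp add: M_def)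
   have "M0 * t powr (- 1 / 2) <= M * t powr (- 1 / 2)" by (intro mult_right_mono) (auto simp: M_def)
   then show "rearr f t <= ennreal (M * t powr (- 1 / 2))" using M0[OF that] ennreal_leI order_trans by blast
  qed
  have M1: "1 <= M" using M(1)[of 1] by simp
  show "f \<in> X"
  proof (rule X_dist_fn(1)[where f = "scale_L0 (of_real M) (abs_power (- 1 / 2))"])
   show "scale_L0 (of_real M) (abs_power (- 1 / 2)) \<in> X" by (rule X_scale[OF ap])
   fix s :: real assume s: "0 <= s"
   have eq: "dist_fn (scale_L0 (of_real M) (abs_power (- 1 / 2))) s = 2 * (if s <= M then 1 else (s / M) powr (-2))"
    using M1 s dist_fn_scale[of "of_real M" "abs_power (- 1 / 2)" s] dist_fn_abs_power_half[of "s / M"] by simp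
   show "dist_fn f s <= dist_fn (scale_L0 (of_real M) (abs_power (- 1 / 2))) s"
   proof (cases "s <= M")
    case True
    then show ?thesis using eq dist_fn_le_2[of f s] by simp
   next
    case False
    define t where "t = (s / M) powr (-2)"
    have sM: "1 < s / M" using False M1 by simp
    have "t <= (s / M) powr 0" unfolding t_def using sM by (intro powr_mono) auto
    moreover have "(s / M) powr 0 = 1" "0 < (s / M) powr (-2)" using sM by auto
    ultimately have t: "0 < t" "t <= 1" unfolding t_def by linarith+
    have "t powr (- 1 / 2) = s / M" using sM s M1 by (simp add: t_def powr_powr)
    then have "M * t powr (- 1 / 2) = s" using M1 by simp
    then have "rearr f t <= ennreal s" using M(2)[of t] t by simp
    then have "dist_fn f s <= t" using rearr_le_iff[of t s f] t s by simp
    moreover have "dist_fn (scale_L0 (of_real M) (abs_power (- 1 / 2))) s = 2 * t"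
     using eq False by (simp add: t_def)
    ultimately show ?thesis using t by linarith
   qed
  qed
 qed
 then show False using p(2) p2 by (simp add: p_index_attained_def p2)
qed

lemma cnj_borel [measurable]: "cnj \<in> bm borel"
 by (intro borel_measurable_continuous_onI continuous_intros)

text \<open>Apply the functional to the rearrangement of \<open>f\<close>, placed at the singular
  end of \<open>v\<close> and with the phase of \<open>v\<close> cancelled. This bounds the integral
  of t^(-1/2) times the rearrangement, so \<open>X\<close> is contained in L^{2,1} and the index 2
  is attained.\<close>

lemma half_weight_unbounded:
 assumes lb: "0 < lower_boyd_index X N" and q: "q_index X <= 2" "q_index X = 2 --> \<not> q_index_attained X"
  and v: "half_weight \<sigma> v" and vi: "L1 v"
  and C: "!!h k. h \<in> bm borel ==> (!!x. norm (h x) <= k) ==> norm (LBINT x. h x * v x) <= C * N (abs_L0 h)"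
 shows False
proof -
 have C0: "0 <= \<bar>C\<bar>" by simp
 have vb [measurable]: "v \<in> bm borel" using vi by simp
 have \<sigma>: "\<sigma> = 1 \<or> \<sigma> = -1" using v by (simp add: half_weight_def)
 have "X \<subseteq> lorentz_p1 2"
 proof
  fix f assume f: "f \<in> X"
  define w where "w x = (if x \<in> {-1<..<1} & 0 < \<sigma> * x then 1 else 0 :: real)" for x
  \<comment> \<open>The rearrangement of \<open>f\<close> read from the end point \<sigma>,
    truncated at \<open>k\<close> to be a bounded function; \<open>w\<close> restricts to the half
    of the interval where |v| is bounded below.\<close>
  define G where "G k x = min (rearr_real f (1 - \<sigma> * x)) (real k) * w x" for k :: nat and x
  have wb [measurable]: "w \<in> bm borel" unfolding w_def by measurable
  have Gb [measurable]: "G k \<in> bm borel" for k unfolding G_def by measurable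
  have G0: "0 <= G k x" "G k x <= real k" for k x by (auto simp: G_def w_def rearr_real_nonneg)
  define h where "h k x = of_real (G k x) * cnj (sgn (v x))" for k x
  have hb: "h k \<in> bm borel" for k unfolding h_def sgn_div_norm by measurable
  have nh: "norm (h k x) <= G k x" for k x using G0[of k x] by (simp add: h_def norm_mult norm_sgn)
  have hv: "h k x * v x = of_real (G k x * norm (v x))" for k x
  proof -
   have "cnj (sgn (v x)) * v x = of_real (norm (v x))"
   proof (cases "v x = 0")
    case False
    have "cnj (v x) * v x = (of_real (norm (v x)))^2"
     using complex_norm_square[of "v x"] by (simp add: mult.commute)
    then show ?thesis using False by (simp add: sgn_eq power2_eq_square)
   qed simp
   then show ?thesis by (simp add: h_def)
  qed
  have hX: "N (abs_L0 (h k)) <= N f" for k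
  proof (rule X_dist_fn(2)[OF f])
   fix s :: real assume s: "0 <= s"
   have "dist_fn (abs_L0 (h k)) s = measure leb_I {x \<in> space leb_I. s < norm (h k x)}"
    by (rule dist_fn_abs_L0[OF leb_I_meas[OF hb]])
   also have "... <= measure leb_I {x \<in> space leb_I. 1 - \<sigma> * x < dist_fn f s}"
   proof (rule measure_leb_I_mono_AE)
    show "AE x in leb_I. s < norm (h k x) --> 1 - \<sigma> * x < dist_fn f s"
    proof (rule AE_I2, rule impI)
     fix x assume x: "x \<in> space leb_I" "s < norm (h k x)"
     have p: "0 < 1 - \<sigma> * x" using x(1) \<sigma> by auto
     have "s < G k x" using x(2) nh[of k x] by simp
     also have "G k x <= rearr_real f (1 - \<sigma> * x)" by (auto simp: G_def w_def rearr_real_nonneg)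
     finally show "1 - \<sigma> * x < dist_fn f s" using rearr_real_gt_iff[OF p s] by simp
    qed
    show "Measurable.pred leb_I (%x. 1 - \<sigma> * x < dist_fn f s)" by (rule measurable_restrict_space1, rule measurable_completion) measurable
   qed
   also have "... = dist_fn f s" by (rule measure_leb_I_end_interval[OF \<sigma>]) (auto simp: dist_fn_le_2)
   finally show "dist_fn (abs_L0 (h k)) s <= dist_fn f s" .
  qed
  have int: "L1 (%x. G k x * norm (v x))" for k
  proof (rule integrable_dominated[where f = "%x. real k * norm (v x)"])
   show "AE x in lborel. norm (G k x * norm (v x)) <= norm (real k * norm (v x))"
    using G0 by (intro AE_I2) (auto simp: abs_mult intro!: mult_right_mono)
  qed (use vi in auto)
  have kb: "(NN x. ennreal (G k x * norm (v x))) <= ennreal (\<bar>C\<bar> * N f)" for k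
  proof -
   have "(LBINT x. h k x * v x) = of_real (LBINT x. G k x * norm (v x))"
    unfolding hv by (rule integral_of_real[OF int])
   then have "(LBINT x. G k x * norm (v x)) <= norm (LBINT x. h k x * v x)" by simp
   also have "... <= C * N (abs_L0 (h k))"
   proof (rule C[OF hb, of k "real k"])
    show "norm (h k x) <= real k" for x using nh[of k x] G0(2)[of k x] by linarith
   qed
   also have "... <= \<bar>C\<bar> * N (abs_L0 (h k))"
   proof (rule mult_right_mono)
    have "abs_L0 (h k) \<in> X"
    proof (rule bounded_mem(1)[OF leb_I_meas[OF hb], of "real k"])
     show "AE x in leb_I. norm (h k x) <= real k"
      using nh G0(2) by (intro AE_I2) (meson order_trans)
    qed simp
    then show "0 <= N (abs_L0 (h k))" by (rule N_nonneg)
   qed simp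
   also have "... <= \<bar>C\<bar> * N f" using hX by (intro mult_left_mono) auto
   finally have "(LBINT x. G k x * norm (v x)) <= \<bar>C\<bar> * N f" .
   moreover have "(NN x. ennreal (G k x * norm (v x))) = ennreal (LBINT x. G k x * norm (v x))"
    by (rule nn_integral_eq_integral[OF int]) (use G0 in auto)
   ultimately show ?thesis by (simp add: ennreal_leI)
  qed
  have sup: "(NN x. (SUP k. ennreal (G k x * norm (v x)))) <= ennreal (\<bar>C\<bar> * N f)"
  proof -
   have "(NN x. (SUP k. ennreal (G k x * norm (v x)))) = (SUP k. \<integral>\<^sup>+x. ennreal (G k x * norm (v x)) \<partial>lborel)"
   proof (rule nn_integral_monotone_convergence_SUP)
    show "incseq (%k x. ennreal (G k x * norm (v x)))"
     by (intro incseq_SucI le_funI ennreal_leI mult_right_mono) (auto simp: G_def w_def)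
   qed measurable
   then show ?thesis using kb by (auto intro: SUP_least)
  qed
  let ?F = "%t. ennreal (t powr (1 / 2 - 1)) * rearr f t"
  \<comment> \<open>The Lorentz integrand for t < 1, to be transported by t = 1 - \<sigma> x. For t
    >= 1 the integrand is at most the value of the rearrangement at 1.\<close>
  let ?H = "%t. ennreal (t powr (- 1 / 2) * rearr_real f t) * indicator {0<..<1} t"
  have "(NN t. ?H t) = ennreal \<bar>-\<sigma>\<bar> * (NN x. ?H (1 + (-\<sigma>) * x))"
   by (rule nn_integral_real_affine) (use \<sigma> in auto)
  also have "... = (NN x. ?H (1 - \<sigma> * x))" using \<sigma> by auto
  also have "... <= (NN x. 2 * (SUP k. ennreal (G k x * norm (v x))))"
  proof (rule nn_integral_mono)
   fix x :: real
   show "?H (1 - \<sigma> * x) <= 2 * (SUP k. ennreal (G k x * norm (v x)))"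
   proof (cases "1 - \<sigma> * x \<in> {0<..<1}")
    case True
    then have x: "x \<in> {-1<..<1}" "0 < \<sigma> * x" using \<sigma> by auto
    obtain k :: nat where k: "rearr_real f (1 - \<sigma> * x) <= real k" using real_arch_simple by blast
    have "(1 - \<sigma> * x) powr (- 1 / 2) * rearr_real f (1 - \<sigma> * x) <= (2 * norm (v x)) * rearr_real f (1 - \<sigma> * x)"
     using v x unfolding half_weight_def by (intro mult_right_mono) (auto simp: rearr_real_nonneg)
    also have "... = 2 * (G k x * norm (v x))" using k x by (simp add: G_def w_def)
    finally have "?H (1 - \<sigma> * x) <= ennreal (2 * (G k x * norm (v x)))" using True by (simp add: ennreal_leI)
    also have "... = 2 * ennreal (G k x * norm (v x))" using G0 by (simp add: ennreal_mult)
    also have "... <= 2 * (SUP k. ennreal (G k x * norm (v x)))" by (intro mult_left_mono SUP_upper) auto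
    finally show ?thesis .
   qed simp
  qed
  also have "... = 2 * (NN x. (SUP k. ennreal (G k x * norm (v x))))"
   by (rule nn_integral_cmult) measurable
  also have "... < \<infinity>" using sup by (simp add: ennreal_mult_less_top le_less_trans[OF sup])
  finally have H: "(NN t. ?H t) < \<infinity>" .
  have "(\<integral>\<^sup>+t\<in>{0<..2}. ?F t \<partial>lborel) <= (NN t. ?H t + ennreal (rearr_real f 1) * indicator {1..2::real} t)"
  proof (rule nn_integral_mono)
   fix t :: real
   show "?F t * indicator {0<..2} t <= ?H t + ennreal (rearr_real f 1) * indicator {1..2::real} t"
   proof (cases "t \<in> {0<..2}")
    case True
    have F: "?F t = ennreal (t powr (- 1 / 2) * rearr_real f t)"
     using True by (simp add: ennreal_mult rearr_real_nonneg ennreal_rearr_real)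
    show ?thesis
    proof (cases "t < 1")
     case True
     then show ?thesis using F \<open>t \<in> {0<..2}\<close> by simp
    next
     case False
     have "t powr (- 1 / 2) <= 1" using False powr_mono2'[of "- 1 / 2" 1 t] by simp
     moreover have "rearr_real f t <= rearr_real f 1"
      using rearr_antimono[of 1 t f] rearr_finite[of 1 f] False by (simp add: rearr_real_def enn2real_mono)
     ultimately have "t powr (- 1 / 2) * rearr_real f t <= 1 * rearr_real f 1"
      by (intro mult_mono) (auto simp: rearr_real_nonneg)
     then show ?thesis using F False True by (simp add: ennreal_leI)
    qed
   qed simp
  qed
  also have "... = (NN t. ?H t) + (NN t. ennreal (rearr_real f 1) * indicator {1..2::real} t)"
   by (rule nn_integral_add) measurable
  also have "... < \<infinity>" using H by (simp add: nn_integral_cmult_indicator ennreal_mult_less_top)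
  finally show "f \<in> lorentz_p1 2" by (simp add: lorentz_p1_def)
 qed
 then have "2 <= q_index X" unfolding q_index_def by (intro cSup_upper lorentz_bdd_above[OF lb]) simp
 then have q2: "q_index X = 2" using q(1) by simp
 then show False using q(2) \<open>X \<subseteq> lorentz_p1 2\<close> by (simp add: q_index_attained_def)
qed

end

section \<open>Kernel and range of the resolvent\<close>

lemma AE_leb_I_iff_lborel: "(AE x in leb_I. P x) \<longleftrightarrow> (AE x in lborel. x \<in> {-1<..<1} --> P x)"
 unfolding AE_leb_I_iff AE_completion_iff ..

text \<open>Elements of \<open>L0\<close> are Lebesgue measurable, while the integrals above are
  taken on \<open>lborel\<close>; a Borel version extended by 0 links the two.\<close>

lemma borel_representative:
 obtains f where "f \<in> bm borel" "!!x. x \<notin> {-1<..<1} ==> f x = 0" "abs_L0 f = F"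
proof -
 define g where "g x = (if x \<in> {-1<..<1} then rep_L0 F x else 0)" for x
 have g: "g \<in> bm lebesgue" unfolding g_def by (rule borel_measurable_if_I) auto
 have "(%x. Re (g x)) \<in> bm lebesgue" "(%x. Im (g x)) \<in> bm lebesgue"
  using g by measurable
 from completion_ex_borel_measurable_real[OF this(1)] completion_ex_borel_measurable_real[OF this(2)]
 obtain u v where uv: "u \<in> bm lborel" "AE x in lborel. Re (g x) = u x"
  "v \<in> bm lborel" "AE x in lborel. Im (g x) = v x" by blast
 have [measurable]: "u \<in> bm borel" "v \<in> bm borel" using uv by simp_all
 define f where "f x = (if x \<in> {-1<..<1} then of_real (u x) + \<i> * of_real (v x) else 0)" for x
 have f: "f \<in> bm borel" unfolding f_def by measurable
 have "AE x in leb_I. f x = rep_L0 F x"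
  unfolding AE_leb_I_iff_lborel using uv(2,4)
 proof eventually_elim
  case (elim x)
  have "f x = rep_L0 F x" if x: "x \<in> {-1<..<1}"
  proof -
   have "g x = rep_L0 F x" unfolding g_def using x by (rule if_P)
   moreover have "f x = of_real (u x) + \<i> * of_real (v x)" unfolding f_def using x by (rule if_P)
   ultimately show ?thesis using elim by (simp add: complex_eq_iff)
  qed
  then show ?case by blast
 qed
 then have "abs_L0 f = abs_L0 (rep_L0 F)" by (rule abs_L0_eqI[OF leb_I_meas[OF f] rep_L0_measurable])
 moreover have "f x = 0" if "x \<notin> {-1<..<1}" for x unfolding f_def using that by (rule if_not_P)
 ultimately show thesis using f that by simp
qed

lemma fht_fun_trunc:
 assumes f: "L1 f" and fs: "!!x. x \<notin> {-1<..<1} ==> f x = 0"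
 shows "fht_fun f t = Lim (at_right 0) (%y. trunc_hilbert f y t)"
proof -
 have fb [measurable]: "f \<in> bm borel" using f by simp
 have "\<forall>\<^sub>F y in at_right 0. 1 / (cr pi * \<i>) *
   ((LINT x:{-1<..<t-y}|lebesgue. f x / cr (x - t)) +
   (LINT x:{t+y<..<1}|lebesgue. f x / cr (x - t))) = trunc_hilbert f y t"
  using eventually_at_right_less[of "0::real"]
 proof eventually_elim
  case (elim y)
  let ?k = "%x. f x / cr (x - t)"
  have int: "L1 (%x. indicator A x *\<^sub>R ?k x)" if A [measurable]: "A \<in> sets borel" and far: "!!x. x \<in> A ==> y <= \<bar>x - t\<bar>" for A
  proof (rule integrable_dominated[where f = "%x. f x / of_real y"])
   show "L1 (%x. f x / cr y)" using f by simp
   show "(%x. indicator A x *\<^sub>R ?k x) \<in> bm lborel" by measurable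
   show "AE x in lborel. norm (indicator A x *\<^sub>R ?k x) <= norm (f x / cr y)"
   proof (rule AE_I2)
    fix x
    show "norm (indicator A x *\<^sub>R ?k x) <= norm (f x / cr y)"
    proof (cases "x \<in> A")
     case True
     have "norm (?k x) = norm (f x) / \<bar>x - t\<bar>" by (simp only: norm_divide norm_of_real)
     also have "... <= norm (f x) / y" using far[OF True] elim by (intro divide_left_mono) auto
     finally show ?thesis using True elim by (simp add: norm_divide)
    qed (use elim in simp)
   qed
  qed
  have eq: "(LINT x:A|lebesgue. ?k x) = (LBINT x. indicator A x *\<^sub>R ?k x)" if [measurable]: "A \<in> sets borel" for A
   unfolding set_lebesgue_integral_def by (rule integral_completion) measurable
  have "(LINT x:{-1<..<t-y}|lebesgue. ?k x) + (LINT x:{t+y<..<1}|lebesgue. ?k x)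
    = (LBINT x. indicator {-1<..<t-y} x *\<^sub>R ?k x + indicator {t+y<..<1} x *\<^sub>R ?k x)"
  proof -
   have e: "(LINT x:{-1<..<t-y}|lebesgue. ?k x) = (LBINT x. indicator {-1<..<t-y} x *\<^sub>R ?k x)"
    "(LINT x:{t+y<..<1}|lebesgue. ?k x) = (LBINT x. indicator {t+y<..<1} x *\<^sub>R ?k x)"
    by (rule eq, simp)+
   have i: "L1 (%x. indicator {-1<..<t-y} x *\<^sub>R ?k x)" "L1 (%x. indicator {t+y<..<1} x *\<^sub>R ?k x)"
    by (rule int; use elim in auto)+
   show ?thesis unfolding e using integral_plus[OF i] by simp
  qed
  also have "... = (LBINT x. (if \<bar>x - t\<bar> > y then ?k x else 0))"
  proof (rule integral_congr[OF refl])
   fix x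
   show "indicator {-1<..<t-y} x *\<^sub>R ?k x + indicator {t+y<..<1} x *\<^sub>R ?k x = (if \<bar>x - t\<bar> > y then ?k x else 0)"
   proof (cases "x \<in> {-1<..<1}")
    case True
    then show ?thesis using elim by (auto simp: indicator_def)
   next
    case False
    then show ?thesis using fs[OF False] by simp
   qed
  qed
  finally show ?case by (simp add: trunc_hilbert_def)
 qed
 then show ?thesis unfolding fht_fun_def Topological_Spaces.Lim_def by (simp add: tendsto_cong)
qed

text \<open>\<open>fht\<close> takes the class of a pointwise \<open>Lim\<close>, whose
  measurability is not evident; it follows from a.e. equality with the Borel function
  \<open>H\<close>, as Lebesgue measure is complete.\<close>

lemma fht_eqI:
 assumes f: "L1 f" and fs: "!!x. x \<notin> {-1<..<1} ==> f x = 0"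
  and H: "H \<in> bm borel"
  and lim: "AE t in lborel. t \<in> {-1<..<1} --> ((%y. trunc_hilbert f y t) \<longlongrightarrow> H t) (at_right 0)"
 shows "fht (abs_L0 f) = abs_L0 H"
proof -
 have ae: "AE t in leb_I. fht_fun f t = H t"
  unfolding AE_leb_I_iff_lborel using lim
 proof eventually_elim
  case (elim t)
  show ?case
  proof
   assume "t \<in> {-1<..<1}"
   with elim have "((%y. trunc_hilbert f y t) \<longlongrightarrow> H t) (at_right 0)" by blast
   moreover have "fht_fun f t = Lim (at_right 0) (%y. trunc_hilbert f y t)" by (rule fht_fun_trunc[OF f fs])
   ultimately show "fht_fun f t = H t" using tendsto_Lim[OF trivial_limit_at_right_real] by metis
  qed
 qed
 have "(%x. if x \<in> {-1<..<1} then fht_fun f x else 0) \<in> bm lebesgue"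
 proof (rule borel_measurable_AE)
  show "(%x. if x \<in> {-1<..<1} then H x else 0) \<in> bm lebesgue"
   using H by (intro borel_measurable_if_I leb_I_meas) auto
  show "AE x in lebesgue. (if x \<in> {-1<..<1} then H x else 0) = (if x \<in> {-1<..<1} then fht_fun f x else 0)"
   using ae unfolding AE_leb_I_iff by eventually_elim auto
 qed
 then have "fht_fun f \<in> bm leb_I"
  by (rule borel_measurable_if_D)
 then have "abs_L0 (fht_fun f) = abs_L0 H" by (rule abs_L0_eqI[OF _ leb_I_meas[OF H] ae])
 moreover have "f \<in> bm borel" using f by simp
 ultimately show ?thesis using fht_abs_L0[OF leb_I_meas] by simp
qed

lemma trunc_hilbert_lincomb:
 assumes f: "L1 f" and g: "L1 g" and y: "0 < y"
 shows "trunc_hilbert (%x. a * f x + g x) y t = a * trunc_hilbert f y t + trunc_hilbert g y t"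
proof -
 have int: "L1 (%x. if \<bar>x - t\<bar> > y then h x / cr (x - t) else 0)" if h: "L1 h" for h :: "real => complex"
 proof (rule integrable_dominated[where f = "%x. h x / of_real y"])
  have [measurable]: "h \<in> bm borel" using h by simp
  show "L1 (%x. h x / cr y)" using h by simp
  show "(%x. if \<bar>x - t\<bar> > y then h x / cr (x - t) else 0) \<in> bm lborel" by measurable
  show "AE x in lborel. norm (if \<bar>x - t\<bar> > y then h x / cr (x - t) else 0) <= norm (h x / cr y)"
  proof (rule AE_I2)
   fix x
   have "norm (h x / cr (x - t)) <= norm (h x / cr y)" if "\<bar>x - t\<bar> > y"
   proof -
    have "norm (h x / cr (x - t)) = norm (h x) / \<bar>x - t\<bar>" by (simp only: norm_divide norm_of_real)
    also have "... <= norm (h x) / y" using that y by (intro divide_left_mono) auto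
    finally show ?thesis using y by (simp add: norm_divide)
   qed
   then show "norm (if \<bar>x - t\<bar> > y then h x / cr (x - t) else 0) <= norm (h x / cr y)"
    by simp
  qed
 qed
 have "(LBINT x. (if \<bar>x - t\<bar> > y then (a * f x + g x) / of_real (x - t) else 0))
   = (LBINT x. a * (if \<bar>x - t\<bar> > y then f x / of_real (x - t) else 0) + (if \<bar>x - t\<bar> > y then g x / of_real (x - t) else 0))"
  by (rule integral_congr) (auto simp: add_divide_distrib)
 also have "... = a * (LBINT x. (if \<bar>x - t\<bar> > y then f x / of_real (x - t) else 0)) + (LBINT x. (if \<bar>x - t\<bar> > y then g x / of_real (x - t) else 0))"
  using int[OF f] int[OF g] by (subst integral_plus) auto
 finally show ?thesis by (simp add: trunc_hilbert_def add_divide_distrib)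
qed

text \<open>A vanishing Cauchy transform has no jump, so all Poisson integrals of \<open>f\<close>
  vanish, and these converge to \<open>f\<close> at Lebesgue points.\<close>

lemma cauchyT_eq_0_imp:
 assumes f: "L1 f" and 0: "!!z. Im z ~= 0 ==> cauchyT f z = 0"
 shows "AE x in lborel. f x = 0"
 using AE_lebesgue_point[OF f]
proof eventually_elim
 case (elim t)
 have "((%y. poisson f y t) \<longlongrightarrow> f t) (at_right 0)"
  by (rule poisson_tendsto[OF weighted_of_integrable[OF f] elim])
 moreover have "\<forall>\<^sub>F y in at_right 0. poisson f y t = 0"
  using eventually_at_right_less[of "0::real"]
 proof eventually_elim
  case (elim y)
  then show ?case using cauchyT_jump[OF f elim, of t] 0[of "Complex t y"] 0[of "Complex t (-y)"] by simp
 qed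
 ultimately have "((%y::real. 0) \<longlongrightarrow> f t) (at_right 0)" by (rule Lim_transform_eventually)
 then show "f t = 0" using tendsto_unique[OF trivial_limit_at_right_real _ tendsto_const] by blast
qed

section \<open>The linear span of the Cauchy kernels and its density\<close>

inductive cauchy_sum :: "(real => complex) => bool" where
 zero: "cauchy_sum (%x. 0)"
| step: "cauchy_sum q ==> Im z ~= 0 ==> cauchy_sum (%x. q x + c / (of_real x - z))"

lemma cauchy_sum_add: "cauchy_sum p ==> cauchy_sum q ==> cauchy_sum (%x. q x + p x)"
proof (induction rule: cauchy_sum.induct)
 case (step p z c)
 then have "cauchy_sum (%x. (q x + p x) + c / (of_real x - z))" by (intro cauchy_sum.step) auto
 then show ?case by (simp add: add.assoc)
qed simp

lemma cauchy_sum_cmult: "cauchy_sum p ==> cauchy_sum (%x. a * p x)"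
proof (induction rule: cauchy_sum.induct)
 case (step p z c)
 then have "cauchy_sum (%x. a * p x + a * c / (of_real x - z))" by (intro cauchy_sum.step) auto
 then show ?case by (simp add: distrib_left)
qed (simp add: cauchy_sum.zero)

lemma cauchy_sum_sum: "(!!j. j < n ==> Im (z j) ~= 0) ==> cauchy_sum (%x. \<Sum>j<n. c j / (of_real x - z j))" for n :: nat
 by (induction n) (simp_all add: cauchy_sum.zero cauchy_sum.step)

lemma cauchy_sum_borel: "cauchy_sum q ==> q \<in> bm borel"
 by (induction rule: cauchy_sum.induct) simp_all

text \<open>Riemann sums of the Cauchy integral converge uniformly off the real line.\<close>

lemma cauchyT_riemann_sum:
 assumes f: "L1 f" and fs: "!!x. x \<notin> {-1<..<1} ==> f x = 0" and y: "y ~= 0" and e: "0 < e"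
 shows "\<exists>q. cauchy_sum q & (\<forall>x. norm (cauchyT f (Complex x y) - q x) <= e)"
proof -
 have fb [measurable]: "f \<in> bm borel" using f by simp
 define L where "L = (LBINT x. norm (f x))"
 have L: "0 <= L" unfolding L_def by simp
 obtain n0 :: nat where "2 * L / (y^2 * e) < real n0" using reals_Archimedean2 by blast
 then obtain n :: nat where n: "n > 0" "2 * L / (y^2 * e) < real n"
  using that[of "Suc n0"] by fastforce
 \<comment> \<open>\<open>s k\<close> is the left end of the k-th of n intervals of length 2 / n,
   and \<open>j t\<close> is the index of the interval containing \<open>t\<close>. Replacing t by
   \<open>s (j t)\<close> changes the kernel by at most (2 / n) / y^2.\<close>
 define j where "j t = nat \<lfloor>(t + 1) * real n / 2\<rfloor>" for t :: real
 define s where "s k = -1 + 2 / real n * real k" for k :: nat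
 have [measurable]: "j \<in> borel \<rightarrow>\<^sub>M count_space UNIV" unfolding j_def[abs_def] by measurable
 have jt: "j t < n" "norm (cr (s (j t)) - of_real t) <= 2 / real n" if t: "t \<in> {-1<..<1}" for t
 proof -
  define u where "u = (t + 1) * real n / 2"
  have u: "0 <= u" "u < real n" using t n by (auto simp: u_def)
  have ju: "real (j t) <= u" "u < real (j t) + 1" using u unfolding j_def u_def[symmetric] by linarith+
  then show "j t < n" using u by linarith
  have tu: "t = -1 + 2 / real n * u" using n by (simp add: u_def field_simps)
  have "s (j t) - t = 2 / real n * (real (j t) - u)" unfolding s_def tu by (simp add: algebra_simps)
  moreover have "\<bar>2 / real n * (real (j t) - u)\<bar> = 2 / real n * \<bar>real (j t) - u\<bar>" by (subst abs_mult) simp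
  ultimately have "\<bar>s (j t) - t\<bar> = 2 / real n * \<bar>real (j t) - u\<bar>" by simp
  also have "... <= 2 / real n * 1" using ju by (intro mult_left_mono) auto
  finally show "norm (cr (s (j t)) - of_real t) <= 2 / real n"
   unfolding of_real_diff[symmetric] norm_of_real by simp
 qed
 define fk where "fk k t = (if j t = k then f t else 0)" for k t
 have fki: "L1 (fk k)" for k
 proof (rule integrable_dominated[OF f])
  show "fk k \<in> bm lborel" unfolding fk_def by measurable
 qed (simp add: fk_def)
 define a where "a k = (LBINT t. fk k t)" for k
 \<comment> \<open>1 / (s - (x + i y)) = - 1 / (x - (s - i y)): as a function of x this is again a
   Cauchy kernel, with its pole at height - y.\<close>
 define q where "q x = (\<Sum>k<n. (- a k) / (of_real x - Complex (s k) (- y)))" for x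
 have "cauchy_sum q" unfolding q_def by (rule cauchy_sum_sum) (use y in simp)
 moreover have "norm (cauchyT f (Complex x y) - q x) <= e" for x
 proof -
  define z where "z = Complex x y"
  have z: "Im z ~= 0" "\<bar>Im z\<bar> = \<bar>y\<bar>" using y by (simp_all add: z_def)
  have nz: "cr t - z ~= 0" for t by (rule cauchy_denom_nz[OF z(1)])
  have qx: "q x = (\<Sum>k<n. a k / (of_real (s k) - z))"
   unfolding q_def
  proof (rule sum.cong[OF refl])
   fix k
   have "of_real x - Complex (s k) (- y) = - (of_real (s k) - z)" by (simp add: z_def complex_eq_iff)
   then show "(- a k) / (of_real x - Complex (s k) (- y)) = a k / (of_real (s k) - z)" by (simp only: minus_divide_divide)
  qed
  have "q x = (LBINT t. (\<Sum>k<n. fk k t / (of_real (s k) - z)))"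
   unfolding qx a_def using fki by (subst Bochner_Integration.integral_sum) auto
  then have "cauchyT f z - q x = (LBINT t. f t / (of_real t - z) - (\<Sum>k<n. fk k t / (of_real (s k) - z)))"
   unfolding cauchyT_def using cauchy_integrable[OF f z(1)] fki by (subst integral_sub) auto
  also have "norm ... <= (LBINT t. norm (f t) * (2 / real n / y^2))"
  proof (rule integral_norm_le)
   show "L1 (%t. f t / (of_real t - z) - (\<Sum>k<n. fk k t / (of_real (s k) - z)))"
    using cauchy_integrable[OF f z(1)] fki by auto
   show "L1 (%t. norm (f t) * (2 / real n / y^2))" using f by simp
   fix t
   show "norm (f t / (of_real t - z) - (\<Sum>k<n. fk k t / (of_real (s k) - z))) <= norm (f t) * (2 / real n / y^2)"
   proof (cases "t \<in> {-1<..<1}")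
    case True
    note J = jt[OF True]
    have "(\<Sum>k<n. fk k t / (of_real (s k) - z)) = (\<Sum>k<n. if k = j t then f t / (of_real (s (j t)) - z) else 0)"
     by (rule sum.cong) (auto simp: fk_def)
    also have "... = f t / (of_real (s (j t)) - z)" using J(1) by simp
    finally have "f t / (of_real t - z) - (\<Sum>k<n. fk k t / (of_real (s k) - z))
      = f t * ((of_real (s (j t)) - of_real t) / ((of_real t - z) * (of_real (s (j t)) - z)))"
     using nz[of t] nz[of "s (j t)"] by (simp add: divide_simps) (simp add: algebra_simps)
    then have "norm (f t / (of_real t - z) - (\<Sum>k<n. fk k t / (of_real (s k) - z)))
     = norm (f t) * (norm (cr (s (j t)) - of_real t) / (norm (cr t - z) * norm (cr (s (j t)) - z)))"
     by (simp add: norm_mult norm_divide)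
    also have "... <= norm (f t) * (2 / real n / (\<bar>y\<bar> * \<bar>y\<bar>))"
    proof (intro mult_left_mono frac_le mult_mono)
     show "\<bar>y\<bar> <= norm (cr t - z)" "\<bar>y\<bar> <= norm (cr (s (j t)) - z)"
      using norm_cauchy_denom[of z] z(2) by simp_all
     show "0 < \<bar>y\<bar> * \<bar>y\<bar>" using y by (intro mult_pos_pos) simp_all
    qed (use J in auto)
    finally show ?thesis by (simp add: power2_eq_square abs_mult_self)
   next
    case False
    have "fk k t = 0" for k using fs[OF False] by (simp add: fk_def)
    then show ?thesis using fs[OF False] by simp
   qed
  qed
  also have "... = 2 * L / y^2 / real n" unfolding L_def by (simp add: mult.commute)
  also have "... <= e"
  proof -
   have "2 * L < real n * (y^2 * e)" using n(2) y e by (simp add: pos_divide_less_eq)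
   then show ?thesis using n(1) y e by (simp add: divide_le_eq mult_ac)
  qed
  finally show ?thesis unfolding z_def .
 qed
 ultimately show ?thesis by blast
qed

text \<open>Poisson integrals of \<open>h\<close> are bounded by \<open>K\<close> and converge to
  \<open>h\<close> a.e. By the jump relation each is a difference of two Cauchy transforms on
  horizontal lines, which Riemann sums approximate uniformly.\<close>

lemma cauchy_sum_approx:
 assumes h: "h \<in> bm borel" and K: "!!x. norm (h x) <= K" and hs: "!!x. x \<notin> {-1<..<1} ==> h x = 0"
 obtains q where "!!n::nat. cauchy_sum (q n)" "!!n x. norm (q n x) <= K + 1" "AE x in lborel. (%n. q n x) \<longlonglongrightarrow> h x"
proof -
 have hi: "L1 h" by (rule bounded_support_integrable[OF h K hs])
 have "\<exists>q. cauchy_sum q & (\<forall>x. norm (poisson h (eta n) x - q x) <= eta n)" for n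
 proof -
  have ne: "eta n ~= 0" "- eta n ~= 0" using eta_pos[of n] by simp_all
  obtain q1 where q1: "cauchy_sum q1" "!!x. norm (cauchyT h (Complex x (eta n)) - q1 x) <= eta n"
   using cauchyT_riemann_sum[OF hi hs ne(1) eta_pos[of n]] by blast
  obtain q2 where q2: "cauchy_sum q2" "!!x. norm (cauchyT h (Complex x (- eta n)) - q2 x) <= eta n"
   using cauchyT_riemann_sum[OF hi hs ne(2) eta_pos[of n]] by blast
  define c where "c = 2 * of_real pi * \<i>"
  have c: "c ~= 0" "2 <= norm c" using pi_gt3 by (auto simp: c_def norm_mult)
  define q where "q x = (1 / c) * (q1 x + (-1) * q2 x)" for x
  have "cauchy_sum q" unfolding q_def by (intro cauchy_sum_cmult cauchy_sum_add q1 q2)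
  moreover have "norm (poisson h (eta n) x - q x) <= eta n" for x
  proof -
   have "poisson h (eta n) x - q x = ((cauchyT h (Complex x (eta n)) - q1 x) - (cauchyT h (Complex x (- eta n)) - q2 x)) / c"
    using cauchyT_jump[OF hi eta_pos[of n], of x] c(1) unfolding q_def c_def[symmetric] by (simp add: field_simps)
   then have "norm (poisson h (eta n) x - q x) = norm ((cauchyT h (Complex x (eta n)) - q1 x) - (cauchyT h (Complex x (- eta n)) - q2 x)) / norm c"
    by (simp only: norm_divide)
   also have "... <= (eta n + eta n) / 2"
    using c(2) eta_pos[of n] order_trans[OF norm_triangle_ineq4 add_mono[OF q1(2) q2(2)], of x x]
    by (intro frac_le) auto
   finally show ?thesis by simp
  qed
  ultimately show ?thesis by blast
 qed
 then obtain q where q: "!!n. cauchy_sum (q n)" "!!n x. norm (poisson h (eta n) x - q n x) <= eta n" by metis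
 have P: "norm (poisson h y x) <= K" if y: "0 < y" for x y
 proof -
  have "norm (LBINT s. (y / ((s - x)^2 + y^2)) *\<^sub>R h s) <= (LBINT s. y / ((s - x)^2 + y^2) * K)"
  proof (rule integral_norm_le)
   show "L1 (%s. (y / ((s - x)^2 + y^2)) *\<^sub>R h s)"
    by (rule poisson_integrable[OF weighted_of_integrable[OF hi] y])
   show "L1 (%s. y / ((s - x)^2 + y^2) * K)"
    by (intro integrable_mult_left poisson_kernel_integral(1)[OF y])
   show "norm ((y / ((s - x)^2 + y^2)) *\<^sub>R h s) <= y / ((s - x)^2 + y^2) * K" for s
    using y K[of s] by (auto intro!: mult_left_mono divide_right_mono simp: abs_mult)
  qed
  also have "... = pi * K" unfolding integral_mult_left_zero poisson_kernel_integral(2)[OF y] ..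
  finally show ?thesis by (simp add: poisson_def norm_divide pos_divide_le_eq mult.commute)
 qed
 show thesis
 proof (rule that[OF q(1)])
  show "norm (q n x) <= K + 1" for n x
  proof -
   have "norm (q n x) <= norm (poisson h (eta n) x) + norm (poisson h (eta n) x - q n x)"
    using norm_triangle_ineq4[of "poisson h (eta n) x" "poisson h (eta n) x - q n x"] by simp
   then show ?thesis using P[OF eta_pos, of n x] q(2)[of n x] eta_le_1[of n] by linarith
  qed
  show "AE x in lborel. (%n. q n x) \<longlonglongrightarrow> h x"
   using AE_lebesgue_point[OF hi]
  proof eventually_elim
   case (elim x)
   have "(%n. poisson h (eta n) x) \<longlonglongrightarrow> h x"
    by (rule filterlim_compose[OF poisson_tendsto[OF weighted_of_integrable[OF hi] elim] eta_at_right])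
   moreover have "(%n. poisson h (eta n) x - q n x) \<longlonglongrightarrow> 0"
    by (rule Lim_null_comparison[OF _ eta_tendsto]) (use q(2) in simp)
   ultimately have "(%n. poisson h (eta n) x - (poisson h (eta n) x - q n x)) \<longlonglongrightarrow> h x - 0"
    by (rule tendsto_diff)
   then show "(%n. q n x) \<longlonglongrightarrow> h x" by simp
  qed
 qed
qed


section \<open>Annihilators of the range, and eigenvectors\<close>

lemma hilbert_pair_bounded:
 assumes "hilbert_pair g g'"
 obtains B where "!!x. norm (g x) <= B" "AE x in lborel. x \<in> {-1<..<1} --> norm (g' x) <= B"
proof -
 obtain B1 B2 where B1: "!!x. norm (g x) <= B1"
  and B2: "!!y t. 0 < y ==> y <= 1 ==> t \<in> {-1<..<1} ==> norm (cpoisson g y t) <= B2"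
  and lim: "AE t in lborel. t \<in> {-1<..<1} --> ((%y. cpoisson g y t) \<longlongrightarrow> g' t) (at_right 0)"
  using assms unfolding hilbert_pair_def by blast
 have "AE x in lborel. x \<in> {-1<..<1} --> norm (g' x) <= B2"
  using lim
 proof eventually_elim
  case (elim t)
  show ?case
  proof
   assume t: "t \<in> {-1<..<1}"
   have "\<forall>\<^sub>F y in at_right 0. norm (cpoisson g y t) <= B2"
    unfolding eventually_at_right_field using B2[OF _ _ t] by (intro exI[of _ 1]) auto
   then show "norm (g' t) <= B2"
    using tendsto_upperbound[OF tendsto_norm] elim t trivial_limit_at_right_real by blast
  qed
 qed
 then have "AE x in lborel. x \<in> {-1<..<1} --> norm (g' x) <= max B1 B2"
  by eventually_elim auto
 moreover have "norm (g x) <= max B1 B2" for x using B1[of x] by simp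
 ultimately show thesis using that by blast
qed

text \<open>Inserting the solutions of the resolvent equation, the annihilation condition says that
  the Cauchy transform of \<open>f\<close> is 0 in the dense case, and that \<open>d z\<close> times
  it is minus the integral of \<open>f\<close> in the other case. The function \<open>v\<close>
  obeys the latter too, so f - \<kappa> v, with \<kappa> the ratio of the integrals, has Cauchy
  transform 0.\<close>

lemma annihilator:
 assumes f: "L1 f" and fs: "!!x. x \<notin> {-1<..<1} ==> f x = 0"
  and ann: "!!g g'. hilbert_pair g g' ==> (LBINT x. f x * (\<mu> * g x - g' x)) = 0"
 shows "resolvent_dense \<mu> ==> AE x in lborel. f x = 0"
  and "resolvent_codim1 \<mu> r v d ==> \<exists>\<kappa>. AE x in lborel. f x = \<kappa> * v x"
proof -
 have fi: "L1 (%x. f x / (of_real x - z))" if "Im z ~= 0" for z by (rule cauchy_integrable[OF f that])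
 have fb [measurable]: "f \<in> bm borel" using f by simp
 show "AE x in lborel. f x = 0" if dense: "resolvent_dense \<mu>"
 proof (rule cauchyT_eq_0_imp[OF f])
  fix z :: complex assume z: "Im z ~= 0"
  define L where "L = (LBINT x. norm (f x))"
  have "norm (cauchyT f z) <= e * L" if e: "0 < e" for e
  proof -
   obtain g g' where g: "hilbert_pair g g'" "!!t. t \<in> {-1<..<1} ==> norm (\<mu> * g t - g' t - 1 / (of_real t - z)) <= e"
    using dense z e unfolding resolvent_dense_def by blast
   have [measurable]: "g \<in> bm borel" "g' \<in> bm borel"
    using g(1) unfolding hilbert_pair_def by blast+
   let ?k = "%x. f x * (\<mu> * g x - g' x - 1 / (of_real x - z))"
   have bd: "norm (?k x) <= e * norm (f x)" for x
   proof (cases "x \<in> {-1<..<1}")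
    case True
    then show ?thesis using mult_left_mono[OF g(2)[OF True] norm_ge_zero[of "f x"]] by (simp add: norm_mult mult.commute)
   qed (simp add: fs)
   have ki: "L1 ?k"
   proof (rule integrable_dominated)
    show "L1 (%x. e * norm (f x))" using f by simp
    show "?k \<in> bm lborel" by measurable
    show "AE x in lborel. norm (?k x) <= norm (e * norm (f x))" using bd e by (intro AE_I2) (simp add: abs_mult)
   qed
   have "(LBINT x. f x * (\<mu> * g x - g' x)) = (LBINT x. ?k x + f x / (of_real x - z))"
    by (rule integral_congr[OF refl]) (simp add: right_diff_distrib)
   also have "... = (LBINT x. ?k x) + cauchyT f z"
    unfolding cauchyT_def by (rule integral_plus[OF ki fi[OF z]])
   finally have "cauchyT f z = - (LBINT x. ?k x)" using ann[OF g(1)] by (simp add: add_eq_0_iff)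
   then have "norm (cauchyT f z) = norm (LBINT x. ?k x)" by (simp only: norm_minus_cancel)
   also have "... <= (LBINT x. e * norm (f x))"
    by (rule integral_norm_le[OF ki]) (use f bd in auto)
   finally show ?thesis by (simp add: L_def)
  qed
  note b = this
  have L: "0 <= L" by (simp add: L_def)
  have "norm (cauchyT f z) <= 0 + e" if e: "0 < e" for e
  proof -
   have "e / (L + 1) * L <= e" using L e by (simp add: divide_le_eq mult_left_mono)
   then show ?thesis using b[of "e / (L + 1)"] L e by simp
  qed
  then have "norm (cauchyT f z) <= 0" by (rule field_le_epsilon)
  then show "cauchyT f z = 0" by simp
 qed
 show "\<exists>\<kappa>. AE x in lborel. f x = \<kappa> * v x" if cod: "resolvent_codim1 \<mu> r v d"
 proof -
  have v: "L1 v" "(LBINT x. v x) ~= 0" using cod unfolding resolvent_codim1_def by blast+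
  define \<kappa> where "\<kappa> = (LBINT x. f x) / (LBINT x. v x)"
  have "AE x in lborel. f x - \<kappa> * v x = 0"
  proof (rule cauchyT_eq_0_imp)
   show "L1 (%x. f x - \<kappa> * v x)" using f v by simp
   fix z :: complex assume z: "Im z ~= 0"
   obtain g g' where d: "d z ~= 0" "cauchyT v z = - (LBINT x. v x) / d z"
    and g: "hilbert_pair g g'" "!!t. t \<in> {-1<..<1} ==> \<mu> * g t - g' t = d z / (of_real t - z) + 1"
    using cod z unfolding resolvent_codim1_def by blast
   have "(LBINT x. f x * (\<mu> * g x - g' x)) = (LBINT x. d z * (f x / (of_real x - z)) + f x)"
   proof (rule integral_congr[OF refl])
    fix x
    show "f x * (\<mu> * g x - g' x) = d z * (f x / (of_real x - z)) + f x"
     using g(2)[of x] fs[of x] by (cases "x \<in> {-1<..<1}") (simp_all add: algebra_simps)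
   qed
   also have "... = d z * cauchyT f z + (LBINT x. f x)"
   proof -
    have "L1 (%x. d z * (f x / (of_real x - z)))" by (intro integrable_mult_right fi z)
    from integral_plus[OF this f] show ?thesis unfolding cauchyT_def integral_mult_right_zero .
   qed
   finally have "d z * cauchyT f z = - (LBINT x. f x)" using ann[OF g(1)] by (simp add: add_eq_0_iff2)
   then have "cauchyT f z = - (LBINT x. f x) / d z" using nonzero_eq_divide_eq[OF d(1)] by (metis mult.commute)
   moreover have "cauchyT (%x. f x - \<kappa> * v x) z = cauchyT f z - \<kappa> * cauchyT v z"
    using cauchyT_diff[OF f _ z, of "%x. \<kappa> * v x"] v(1) by (simp add: cauchyT_cmult)
   ultimately show "cauchyT (%x. f x - \<kappa> * v x) z = 0" using v(2) d by (simp add: \<kappa>_def)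
  qed
  then have "AE x in lborel. f x = \<kappa> * v x" by eventually_elim simp
  then show ?thesis by blast
 qed
qed

context ri
begin

text \<open>\<open>X\<close> embeds into some L^p with 1 < p < 2, so an element has a representative
  to which the theory of boundary values applies. The last clause is the Parseval formula between
  \<open>X\<close> and Hilbert pairs.\<close>

lemma X_representative:
 assumes ub: "upper_boyd_index X N < 1" and F: "F \<in> X"
 obtains f H where "L1 f" "!!x. x \<notin> {-1<..<1} ==> f x = 0" "abs_L0 f = F"
  "H \<in> bm borel" "fht F = abs_L0 H" "AE t in lborel. ((%y. trunc_hilbert f y t) \<longlongrightarrow> H t) (at_right 0)"
  "!!g g'. hilbert_pair g g' ==> (LBINT t. H t * g t) = - (LBINT t. f t * g' t)"
proof -
 obtain p where p: "1 < p" "p < 2" "!!f. f \<in> X ==> (\<integral>\<^sup>+x. ennreal (norm (rep_L0 f x) powr p) \<partial>leb_I) < \<infinity>"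
  using Lp_integrable[OF ub] by blast
 obtain f where f: "f \<in> bm borel" "!!x. x \<notin> {-1<..<1} ==> f x = 0" "abs_L0 f = F"
  using borel_representative[of F] by blast
 note [measurable] = f(1)
 have ae: "AE x in leb_I. rep_L0 F x = f x" using rep_abs_L0[OF leb_I_meas[OF f(1)]] f(3) by simp
 have fin: "(NN x. ennreal (norm (f x) powr p)) < \<infinity>"
 proof -
  have "(\<integral>\<^sup>+x. ennreal (norm (rep_L0 F x) powr p) \<partial>leb_I) = (\<integral>\<^sup>+x. ennreal (norm (f x) powr p) \<partial>leb_I)"
   by (rule nn_integral_cong_AE) (use ae in eventually_elim, simp)
  also have "... = (\<integral>\<^sup>+x. ennreal (norm (f x) powr p) * indicator {-1<..<1} x \<partial>lebesgue)"
   by (rule nn_integral_restrict_space) simp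
  also have "... = (\<integral>\<^sup>+x. ennreal (norm (f x) powr p) \<partial>lebesgue)"
   by (rule nn_integral_cong) (use f(2) p in \<open>auto simp: indicator_def\<close>)
  also have "... = (NN x. ennreal (norm (f x) powr p))" by (rule nn_integral_completion)
  finally show ?thesis using p(3)[OF F] by simp
 qed
 have fp: "L1 (%x. norm (f x) powr p)"
  by (rule integrableI_nonneg) (use fin in auto)
 have fi: "L1 f"
 proof (rule integrable_dominated)
  show "L1 (%x. indicator {-1<..<1::real} x + norm (f x) powr p)"
   using fp by (intro integrable_plus integrable_real_indicator) auto
  show "AE x in lborel. norm (f x) <= norm (indicator {-1<..<1} x + norm (f x) powr p)"
  proof (rule AE_I2)
   fix x
   have "norm (f x) <= indicator {-1<..<1} x + norm (f x) powr p"
   proof (cases "x \<in> {-1<..<1} & norm (f x) <= 1")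
    case True
    then show ?thesis by (simp add: add_increasing2)
   next
    case False
    show ?thesis
    proof (cases "x \<in> {-1<..<1}")
     case True
     then have "1 < norm (f x)" using False by auto
     then have "norm (f x) powr 1 <= norm (f x) powr p" using p(1) by (intro powr_mono) auto
     then show ?thesis using True by simp
    qed (simp add: f(2))
   qed
   then show "norm (f x) <= norm (indicator {-1<..<1} x + norm (f x) powr p)" by simp
  qed
 qed simp
 have "f x = 0" if "\<bar>x\<bar> > 1" for x using that by (intro f(2)) auto
 from cpoisson_boundary[OF p(1,2) fi this fp] obtain H where H: "L1 (%x. H x / cr (1 + x^2))"
  "(%n. \<integral>t. norm (cpoisson f (eta n) t - H t) / (1 + t^2) \<partial>lborel) \<longlonglongrightarrow> 0"
  "AE t in lborel. ((%y. trunc_hilbert f y t) \<longlongrightarrow> H t) (at_right 0)" by blast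
 have Hb: "H \<in> bm borel" using weighted_borel[OF H(1)] by simp
 have "AE t in lborel. t \<in> {-1<..<1} --> ((%y. trunc_hilbert f y t) \<longlongrightarrow> H t) (at_right 0)"
  using H(3) by eventually_elim simp
 then have "fht F = abs_L0 H" using fht_eqI[OF fi f(2) Hb] f(3) by blast
 then show thesis using that[OF fi f(2,3) Hb _ H(3)] hilbert_parseval[OF fi f(2) H(1,2)] by blast
qed

text \<open>\<open>fht\<close> is defined through \<open>Lim\<close>, which is linear only where the
  limits exist; for elements of \<open>X\<close> this is the case a.e.\<close>

lemma fht_lincomb:
 assumes ub: "upper_boyd_index X N < 1" and F: "F \<in> X" and G: "G \<in> X"
 shows "fht (scale_L0 a F + G) = scale_L0 a (fht F) + fht G"
proof -
 obtain f Hf where f: "L1 f" "!!x. x \<notin> {-1<..<1} ==> f x = 0" "abs_L0 f = F"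
  "Hf \<in> bm borel" "fht F = abs_L0 Hf" "AE t in lborel. ((%y. trunc_hilbert f y t) \<longlongrightarrow> Hf t) (at_right 0)"
  "!!h h'. hilbert_pair h h' ==> (LBINT t. Hf t * h t) = - (LBINT t. f t * h' t)"
  by (rule X_representative[OF ub F]) (rule that; assumption)
 obtain g Hg where g: "L1 g" "!!x. x \<notin> {-1<..<1} ==> g x = 0" "abs_L0 g = G"
  "Hg \<in> bm borel" "fht G = abs_L0 Hg" "AE t in lborel. ((%y. trunc_hilbert g y t) \<longlongrightarrow> Hg t) (at_right 0)"
  "!!h h'. hilbert_pair h h' ==> (LBINT t. Hg t * h t) = - (LBINT t. g t * h' t)"
  by (rule X_representative[OF ub G]) (rule that; assumption)
 have b [measurable]: "f \<in> bm borel" "g \<in> bm borel" using f(1) g(1) by simp_all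
 note [measurable] = f(4) g(4)
 note m = leb_I_meas[OF b(1)] leb_I_meas[OF b(2)] leb_I_meas[OF f(4)] leb_I_meas[OF g(4)]
 have af: "(%x. a * f x) \<in> bm leb_I" "(%x. a * Hf x) \<in> bm leb_I"
  by (rule leb_I_meas, measurable)+
 have "scale_L0 a F + G = abs_L0 (%x. a * f x + g x)"
  unfolding f(3)[symmetric] g(3)[symmetric] abs_L0_scale[OF m(1)] by (rule abs_L0_add[OF af(1) m(2)])
 also have "fht ... = abs_L0 (%x. a * Hf x + Hg x)"
 proof (rule fht_eqI)
  show "L1 (%x. a * f x + g x)" using f(1) g(1) by simp
  show "(%x. a * Hf x + Hg x) \<in> bm borel" by measurable
  show "AE t in lborel. t \<in> {-1<..<1} --> ((%y. trunc_hilbert (%x. a * f x + g x) y t) \<longlongrightarrow> a * Hf t + Hg t) (at_right 0)"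
   using f(6) g(6)
  proof eventually_elim
   case (elim t)
   then have "((%y. a * trunc_hilbert f y t + trunc_hilbert g y t) \<longlongrightarrow> a * Hf t + Hg t) (at_right 0)"
    by (intro tendsto_intros)
   moreover have "\<forall>\<^sub>F y in at_right 0. a * trunc_hilbert f y t + trunc_hilbert g y t = trunc_hilbert (%x. a * f x + g x) y t"
    using eventually_at_right_less[of "0::real"]
    by eventually_elim (rule trunc_hilbert_lincomb[OF f(1) g(1), symmetric])
   ultimately have "((%y. trunc_hilbert (%x. a * f x + g x) y t) \<longlongrightarrow> a * Hf t + Hg t) (at_right 0)"
    by (rule Lim_transform_eventually)
   then show ?case by simp
  qed
 qed (use f(2) g(2) in simp)
 also have "abs_L0 (%x. a * Hf x + Hg x) = scale_L0 a (abs_L0 Hf) + abs_L0 Hg"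
  unfolding abs_L0_scale[OF m(3)] by (rule abs_L0_add[OF af(2) m(4), symmetric])
 finally show ?thesis unfolding f(5) g(5) .
qed

lemma shifted_fht_lincomb:
 assumes "upper_boyd_index X N < 1" "F \<in> X" "G \<in> X"
 shows "shifted fht c (scale_L0 a F + G) = scale_L0 a (shifted fht c F) + shifted fht c G"
 unfolding shifted_def fht_lincomb[OF assms]
 by (simp add: L0.scale_right_distrib L0.scale_right_diff_distrib L0.scale_left_commute algebra_simps)

text \<open>Bounded functions belong to \<open>X\<close>, and \<open>fht_eqI\<close> identifies the
  operator on them with the second component of the pair.\<close>

lemma hilbert_pair_mem:
 assumes "hilbert_pair g g'"
 shows "abs_L0 g \<in> X" "shifted fht c (abs_L0 g) = abs_L0 (%x. c * g x - g' x)" "shifted fht c (abs_L0 g) \<in> X"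
proof -
 have b [measurable]: "g \<in> bm borel" "g' \<in> bm borel"
  using assms unfolding hilbert_pair_def by blast+
 note m = leb_I_meas[OF b(1)] leb_I_meas[OF b(2)]
 have gs: "!!x. x \<notin> {-1<..<1} ==> g x = 0" using assms unfolding hilbert_pair_def by blast
 obtain B where B: "!!x. norm (g x) <= B" "AE x in lborel. x \<in> {-1<..<1} --> norm (g' x) <= B"
  using hilbert_pair_bounded[OF assms] by blast
 have B0: "0 <= B" using order_trans[OF norm_ge_zero B(1)] .
 show gX: "abs_L0 g \<in> X" by (rule bounded_mem(1)[OF m(1) B0]) (use B(1) in simp)
 have g'X: "abs_L0 g' \<in> X"
  by (rule bounded_mem(1)[OF m(2) B0]) (use B(2) in \<open>simp add: AE_leb_I_iff_lborel\<close>)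
 have fht: "fht (abs_L0 g) = abs_L0 g'"
  by (rule fht_eqI[OF hilbert_pair_integrable[OF assms] gs b(2) hilbert_pair_trunc[OF assms]])
 have "(%x. c * g x) \<in> bm leb_I" by (rule leb_I_meas) measurable
 then show "shifted fht c (abs_L0 g) = abs_L0 (%x. c * g x - g' x)"
  unfolding shifted_def fht abs_L0_scale[OF m(1)] by (rule abs_L0_diff[OF _ m(2)])
 show "shifted fht c (abs_L0 g) \<in> X"
  unfolding shifted_def fht by (intro X_diff X_scale gX g'X)
qed

text \<open>For T F = c F the skew symmetry shows that f (- c g - g') integrates to 0 for every
  Hilbert pair; this is why the dichotomy is applied to \<mu> = - c. Either F = 0 or F is a multiple
  of \<open>v\<close>, and the multiple is 0 because \<open>v\<close> is not in
  \<open>X\<close>.\<close>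

lemma no_eigenvalue:
 assumes ub: "upper_boyd_index X N < 1" and p: "2 <= p_index X" "p_index X = 2 --> \<not> p_index_attained X"
  and F: "F \<in> X" "fht F = scale_L0 c F"
 shows "F = 0"
proof -
 obtain f H where f: "L1 f" "!!x. x \<notin> {-1<..<1} ==> f x = 0" "abs_L0 f = F"
  and H: "H \<in> bm borel" "fht F = abs_L0 H" "AE t in lborel. ((%y. trunc_hilbert f y t) \<longlongrightarrow> H t) (at_right 0)"
  and par: "!!g g'. hilbert_pair g g' ==> (LBINT t. H t * g t) = - (LBINT t. f t * g' t)"
  by (rule X_representative[OF ub F(1)]) (rule that; assumption)
 have fb [measurable]: "f \<in> bm borel" using f(1) by simp
 have cf: "(%x. c * f x) \<in> bm leb_I" by (rule leb_I_meas) measurable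
 have "abs_L0 H = abs_L0 (%x. c * f x)" using F(2) f(3) H(2) abs_L0_scale[OF leb_I_meas[OF fb]] by simp
 note HF = this
 have "AE x in leb_I. H x = c * f x"
  using rep_abs_L0[OF leb_I_meas[OF H(1)]] rep_abs_L0[OF cf] by eventually_elim (use HF in simp)
 then have Hae: "AE x in lborel. x \<in> {-1<..<1} --> H x = c * f x" unfolding AE_leb_I_iff_lborel .
 have ann: "(LBINT x. f x * (- c * g x - g' x)) = 0" if g: "hilbert_pair g g'" for g g'
 proof -
  have [measurable]: "g \<in> bm borel" "g' \<in> bm borel" "H \<in> bm borel"
   using g H(1) unfolding hilbert_pair_def by blast+
  have gs: "!!x. x \<notin> {-1<..<1} ==> g x = 0" using g unfolding hilbert_pair_def by blast
  obtain B where B: "!!x. norm (g x) <= B" "AE x in lborel. x \<in> {-1<..<1} --> norm (g' x) <= B"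
   using hilbert_pair_bounded[OF g] by blast
  have B0: "0 <= B" using order_trans[OF norm_ge_zero B(1)] .
  have bd: "L1 (%x. B * norm (f x))" using f(1) by simp
  have i1: "L1 (%x. f x * g x)"
  proof (rule integrable_dominated[OF bd])
   show "AE x in lborel. norm (f x * g x) <= norm (B * norm (f x))"
   proof (rule AE_I2)
    fix x
    show "norm (f x * g x) <= norm (B * norm (f x))"
     using mult_right_mono[OF B(1)[of x] norm_ge_zero[of "f x"]] B0 by (simp add: norm_mult mult.commute)
   qed
  qed measurable
  have i2: "L1 (%x. f x * g' x)"
  proof (rule integrable_dominated[OF bd])
   show "AE x in lborel. norm (f x * g' x) <= norm (B * norm (f x))"
    using B(2)
   proof eventually_elim
    case (elim x)
    show ?case
    proof (cases "x \<in> {-1<..<1}")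
     case True
     then have "norm (g' x) <= B" using elim by blast
     then show ?thesis
      using mult_right_mono[OF _ norm_ge_zero[of "f x"], of "norm (g' x)" B] B0 by (simp add: norm_mult mult.commute)
    qed (use f(2) in simp)
   qed
  qed measurable
  have "(LBINT t. H t * g t) = (LBINT t. c * (f t * g t))"
  proof (rule integral_cong_AE)
   show "AE x in lborel. H x * g x = c * (f x * g x)" using Hae by eventually_elim (use gs in auto)
  qed measurable
  then have "c * (LBINT t. f t * g t) = - (LBINT t. f t * g' t)" using par[OF g] by simp
  moreover have "(LBINT x. f x * (- c * g x - g' x)) = (LBINT x. - c * (f x * g x) - f x * g' x)"
   by (rule integral_congr[OF refl]) (simp add: algebra_simps)
  moreover have "... = - c * (LBINT t. f t * g t) - (LBINT t. f t * g' t)"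
   using i1 i2 by (subst integral_sub) auto
  ultimately show ?thesis by simp
 qed
 have F0: "F = 0" if "AE x in lborel. f x = 0"
  unfolding f(3)[symmetric] abs_L0_zero
  by (rule abs_L0_eqI[OF leb_I_meas[OF fb]]) (use that in \<open>auto simp: AE_leb_I_iff_lborel elim: eventually_mono\<close>)
 show ?thesis
 proof (rule resolvent_dichotomy[of "- c"])
  assume "resolvent_dense (- c)"
  then show ?thesis using annihilator(1)[OF f(1,2) ann] F0 by blast
 next
  fix r v d assume cod: "resolvent_codim1 (- c) r v d"
  then obtain \<kappa> where \<kappa>: "AE x in lborel. f x = \<kappa> * v x" using annihilator(2)[OF f(1,2) ann] by blast
  have v: "L1 v" "0 < r" "r < 1" "!!x. x \<in> {-1<..<1} ==> norm (v x) = (1 - x) powr (-r) * (1 + x) powr (r - 1)"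
   using cod unfolding resolvent_codim1_def by blast+
  have vm: "v \<in> bm leb_I" using v(1) by (intro leb_I_meas) simp
  obtain \<sigma> where "half_weight \<sigma> v" using half_weightI[OF v(2-4)] by blast
  then have nX: "abs_L0 v \<notin> X" by (rule half_weight_notin[OF p vm])
  have Fv: "F = scale_L0 \<kappa> (abs_L0 v)"
   unfolding f(3)[symmetric] abs_L0_scale[OF vm]
  proof (rule abs_L0_eqI[OF leb_I_meas[OF fb]])
   show "(%x. \<kappa> * v x) \<in> bm leb_I" using vm by measurable
   show "AE x in leb_I. f x = \<kappa> * v x" unfolding AE_leb_I_iff_lborel using \<kappa> by eventually_elim simp
  qed
  have "\<kappa> = 0"
  proof (rule ccontr)
   assume "\<kappa> ~= 0"
   then have "abs_L0 v = scale_L0 (1 / \<kappa>) F" unfolding Fv by simp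
   then show False using nX X_scale[OF F(1)] by simp
  qed
  then show "F = 0" using Fv by simp
 qed
qed

text \<open>The closure of the range of c - T within \<open>X\<close>, expressed by
  \<open>N\<close>. That the image lies in \<open>X\<close> is demanded explicitly, since
  \<open>N\<close> has a meaning only there.\<close>

definition range_closure :: "complex => L0 set" where
 "range_closure c = {F\<in>X. \<forall>e>0. \<exists>G\<in>X. shifted fht c G \<in> X & N (F - shifted fht c G) < e}"

lemma range_closureI:
 assumes "G \<in> X" "shifted fht c G \<in> X"
 shows "shifted fht c G \<in> range_closure c"
 using assms by (auto simp: range_closure_def N_0 intro!: bexI[of _ G])

lemma range_closure_closed:
 assumes F: "F \<in> X" and ap: "!!e. 0 < e ==> \<exists>F'\<in>range_closure c. N (F - F') < e"
 shows "F \<in> range_closure c"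
 unfolding range_closure_def
proof (intro CollectI conjI allI impI F)
 fix e :: real assume e: "0 < e"
 then have e2: "0 < e / 2" by simp
 obtain F' where F': "F' \<in> range_closure c" "N (F - F') < e / 2" using ap[OF e2] by blast
 then have F'X: "F' \<in> X" by (simp add: range_closure_def)
 obtain G where G: "G \<in> X" "shifted fht c G \<in> X" "N (F' - shifted fht c G) < e / 2"
  using F'(1) e2 unfolding range_closure_def by blast
 have "N ((F - F') + (F' - shifted fht c G)) <= N (F - F') + N (F' - shifted fht c G)"
  by (intro N_add X_diff F F'X G)
 then have "N (F - shifted fht c G) < e" using F'(2) G(3) by simp
 then show "\<exists>G\<in>X. shifted fht c G \<in> X & N (F - shifted fht c G) < e" using G by blast
qed

lemma range_closure_lincomb:
 assumes ub: "upper_boyd_index X N < 1" and F: "F \<in> range_closure c" "F' \<in> range_closure c"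
 shows "scale_L0 a F + F' \<in> range_closure c"
 unfolding range_closure_def
proof (intro CollectI conjI allI impI)
 have FX: "F \<in> X" "F' \<in> X" using F by (auto simp: range_closure_def)
 then show "scale_L0 a F + F' \<in> X" by (intro X_add X_scale)
 fix e :: real assume e: "0 < e"
 define \<delta> where "\<delta> = e / (norm a + 1)"
 have \<delta>: "0 < \<delta>" "(norm a + 1) * \<delta> = e"
 proof -
  have p: "0 < norm a + 1" by (rule add_nonneg_pos) simp_all
  show "0 < \<delta>" unfolding \<delta>_def using e p by (rule divide_pos_pos)
  show "(norm a + 1) * \<delta> = e" unfolding \<delta>_def using p by simp
 qed
 obtain G where G: "G \<in> X" "shifted fht c G \<in> X" "N (F - shifted fht c G) < \<delta>"
  using F(1) \<delta>(1) unfolding range_closure_def by blast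
 obtain G' where G': "G' \<in> X" "shifted fht c G' \<in> X" "N (F' - shifted fht c G') < \<delta>"
  using F(2) \<delta>(1) unfolding range_closure_def by blast
 note sh = shifted_fht_lincomb[OF ub G(1) G'(1), of c a]
 show "\<exists>G\<in>X. shifted fht c G \<in> X & N (scale_L0 a F + F' - shifted fht c G) < e"
 proof (intro bexI conjI)
  show "scale_L0 a G + G' \<in> X" by (intro X_add X_scale G G')
  show "shifted fht c (scale_L0 a G + G') \<in> X" unfolding sh by (intro X_add X_scale G G')
  have "scale_L0 a F + F' - shifted fht c (scale_L0 a G + G') = scale_L0 a (F - shifted fht c G) + (F' - shifted fht c G')"
   unfolding sh by (simp add: L0.scale_right_diff_distrib)
  note eq = this
  have "N (scale_L0 a F + F' - shifted fht c (scale_L0 a G + G')) <= N (scale_L0 a (F - shifted fht c G)) + N (F' - shifted fht c G')"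
   unfolding eq by (rule N_add[OF X_scale[OF X_diff[OF FX(1) G(2)]] X_diff[OF FX(2) G'(2)]])
  also have "N (scale_L0 a (F - shifted fht c G)) = norm a * N (F - shifted fht c G)"
   by (rule N_scale[OF X_diff[OF FX(1) G(2)]])
  also have "norm a * N (F - shifted fht c G) + N (F' - shifted fht c G') < norm a * \<delta> + \<delta>"
   using G(3) G'(3) by (intro add_le_less_mono mult_left_mono) auto
  finally show "N (scale_L0 a F + F' - shifted fht c (scale_L0 a G + G')) < e"
   using \<delta>(2) by (simp add: algebra_simps)
 qed
qed

lemma zero_range_closure:
 assumes ub: "upper_boyd_index X N < 1"
 shows "0 \<in> range_closure c"
proof -
 have "shifted fht c (scale_L0 1 0 + 0) = scale_L0 1 (shifted fht c 0) + shifted fht c 0"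
  by (rule shifted_fht_lincomb[OF ub X_0 X_0])
 then have "shifted fht c 0 = 0" by simp
 then show ?thesis using range_closureI[OF X_0, of c] X_0 by simp
qed

lemma cauchy_kernel_measurable: "(%x. a / (cr x - z)) \<in> bm leb_I"
 by (rule leb_I_meas) measurable

lemma cauchy_sum_range_closure:
 assumes ub: "upper_boyd_index X N < 1"
  and k: "!!z. Im z ~= 0 ==> abs_L0 (%x. 1 / (cr x - z)) \<in> range_closure c"
 shows "cauchy_sum q ==> abs_L0 q \<in> range_closure c"
proof (induction rule: cauchy_sum.induct)
 case zero
 then show ?case using zero_range_closure[OF ub] abs_L0_zero by simp
next
 case (step q z a)
 have "scale_L0 a (abs_L0 (%x. 1 / (cr x - z))) = abs_L0 (%x. a * (1 / (cr x - z)))"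
  by (rule abs_L0_scale[OF cauchy_kernel_measurable])
 then have "scale_L0 a (abs_L0 (%x. 1 / (cr x - z))) + abs_L0 q = abs_L0 (%x. a / (cr x - z) + q x)"
  using abs_L0_add[OF cauchy_kernel_measurable leb_I_meas[OF cauchy_sum_borel[OF step(1)]]] by simp
 also have "... = abs_L0 (%x. q x + a / (cr x - z))" by (simp add: add.commute)
 finally show ?case using range_closure_lincomb[OF ub k[OF step(2)] step.IH, of a] by simp
qed

lemma range_closure_bounded:
 assumes lb: "0 < lower_boyd_index X N" and ub: "upper_boyd_index X N < 1"
  and k: "!!z. Im z ~= 0 ==> abs_L0 (%x. 1 / (cr x - z)) \<in> range_closure c"
  and h: "h \<in> bm borel" "!!x. norm (h x) <= K" "!!x. x \<notin> {-1<..<1} ==> h x = 0"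
 shows "abs_L0 h \<in> range_closure c"
proof (rule range_closure_closed)
 have K0: "0 <= K" using order_trans[OF norm_ge_zero h(2)] .
 show "abs_L0 h \<in> X" by (rule bounded_mem(1)[OF leb_I_meas[OF h(1)] K0]) (use h(2) in simp)
 fix e :: real assume e: "0 < e"
 obtain q where q: "!!n::nat. cauchy_sum (q n)" "!!n x. norm (q n x) <= K + 1" "AE x in lborel. (%n. q n x) \<longlonglongrightarrow> h x"
  using cauchy_sum_approx[OF h] by metis
 have "(%n. N (abs_L0 h - abs_L0 (q n))) \<longlonglongrightarrow> 0"
 proof (rule bounded_convergence[OF lb leb_I_meas[OF h(1)] leb_I_meas[OF cauchy_sum_borel[OF q(1)]]])
  show "norm (h x - q n x) <= K + (K + 1)" for n x
   by (rule order_trans[OF norm_triangle_ineq4 add_mono[OF h(2) q(2)]])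
  show "AE x in leb_I. (%n. q n x) \<longlonglongrightarrow> h x"
   unfolding AE_leb_I_iff_lborel using q(3) by eventually_elim simp
 qed
 then have "\<forall>\<^sub>F n in sequentially. N (abs_L0 h - abs_L0 (q n)) < e" using e by (rule order_tendstoD(2))
 then obtain n where "N (abs_L0 h - abs_L0 (q n)) < e" by (auto simp: eventually_sequentially)
 then show "\<exists>F'\<in>range_closure c. N (abs_L0 h - F') < e"
  using cauchy_sum_range_closure[OF ub k q(1)] by blast
qed

text \<open>Three approximations are composed: elements of \<open>X\<close> by truncations, which is
  where separability enters; bounded functions by Cauchy sums; and Cauchy sums by elements of the
  range.\<close>

lemma range_closure_eq:
 assumes sep: "separable_space (ntopology X N)" and lb: "0 < lower_boyd_index X N" and ub: "upper_boyd_index X N < 1"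
  and k: "!!z. Im z ~= 0 ==> abs_L0 (%x. 1 / (cr x - z)) \<in> range_closure c"
 shows "range_closure c = X"
proof
 show "range_closure c \<subseteq> X" by (auto simp: range_closure_def)
 show "X \<subseteq> range_closure c"
 proof
  fix F assume F: "F \<in> X"
  show "F \<in> range_closure c"
  proof (rule range_closure_closed[OF F])
   fix e :: real assume "0 < e"
   then obtain M :: nat where M: "N (F - part {..real M} F) < e" using bounded_dense[OF sep F] by blast
   obtain f where f: "f \<in> bm borel" "!!x. x \<notin> {-1<..<1} ==> f x = 0" "abs_L0 f = F"
    using borel_representative[of F] by blast
   note [measurable] = f(1)
   define h where "h x = (if norm (f x) \<in> {..real M} then f x else 0)" for x
   have hb: "h \<in> bm borel" unfolding h_def by measurable
   have ae: "AE x in leb_I. rep_L0 F x = f x" using rep_abs_L0[OF leb_I_meas[OF f(1)]] f(3) by simp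
   have "part {..real M} F = abs_L0 h"
    unfolding part_def
   proof (rule abs_L0_eqI[OF part_measurable(1) leb_I_meas[OF hb]])
    show "AE x in leb_I. (if norm (rep_L0 F x) \<in> {..real M} then rep_L0 F x else 0) = h x"
     using ae by eventually_elim (simp add: h_def)
   qed simp
   moreover have "abs_L0 h \<in> range_closure c"
    by (rule range_closure_bounded[OF lb ub k hb, of "real M"]) (auto simp: h_def f(2))
   ultimately show "\<exists>F'\<in>range_closure c. N (F - F') < e" using M by metis
  qed
 qed
qed

text \<open>In the one-codimensional case the range annihilates \<open>v\<close>.  If \<open>1\<close> were at a positive distance
 from the range, then integration against \<open>v\<close> would be a bounded functional.\<close>

lemma codim1_constant:
 assumes lb: "0 < lower_boyd_index X N" and ub: "upper_boyd_index X N < 1"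
  and q: "q_index X <= 2" "q_index X = 2 --> \<not> q_index_attained X"
  and cod: "resolvent_codim1 c r v d"
 shows "abs_L0 (%x. 1) \<in> range_closure c"
proof (rule ccontr)
 let ?one = "abs_L0 (%x. 1)"
 assume not: "?one \<notin> range_closure c"
 have oneX: "?one \<in> X" by (rule bounded_mem(1)[of _ 1]) simp_all
 obtain e where e: "0 < e" "!!G. G \<in> X ==> shifted fht c G \<in> X ==> e <= N (?one - shifted fht c G)"
  using not oneX unfolding range_closure_def by (auto simp: not_less)
 have v: "L1 v" "0 < r" "r < 1" "!!x. x \<in> {-1<..<1} ==> norm (v x) = (1 - x) powr (-r) * (1 + x) powr (r - 1)"
  and vs: "!!x. x \<notin> {-1<..<1} ==> v x = 0"
  using cod unfolding resolvent_codim1_def by blast+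
 have [measurable]: "v \<in> bm borel" using v(1) by simp
 obtain \<sigma> where \<sigma>: "half_weight \<sigma> v" using half_weightI[OF v(2-4)] by blast
 define V where "V = (LBINT x. v x)"
 \<comment> \<open>Each Cauchy sum is an element of the range minus \<kappa> times the constant 1,
   and its integral against \<open>v\<close> is - \<kappa> V. For a single kernel a / (x - z) the
   coefficient is a / d(z), by the resolvent equation and the value of the Cauchy transform of
   \<open>v\<close>.\<close>
 have rel: "L1 (%x. p x * v x) & (\<exists>\<kappa> G. G \<in> X & shifted fht c G \<in> X \<and>
   abs_L0 p = shifted fht c G - scale_L0 \<kappa> ?one & (LBINT x. p x * v x) = - \<kappa> * V)" if "cauchy_sum p" for p
  using that
 proof (induction rule: cauchy_sum.induct)
  case zero
  have "shifted fht c (scale_L0 1 0 + 0) = scale_L0 1 (shifted fht c 0) + shifted fht c 0"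
   by (rule shifted_fht_lincomb[OF ub X_0 X_0])
  then have "shifted fht c 0 = 0" by simp
  then show ?case using X_0 abs_L0_zero by (auto intro!: exI[of _ 0])
 next
  case (step p z a)
  obtain \<kappa> G where G: "G \<in> X" "shifted fht c G \<in> X" "abs_L0 p = shifted fht c G - scale_L0 \<kappa> ?one"
   "(LBINT x. p x * v x) = - \<kappa> * V" and pi: "L1 (%x. p x * v x)"
   using step.IH by blast
  obtain g g' where d: "d z ~= 0" "cauchyT v z = - V / d z"
   and g: "hilbert_pair g g'" "!!t. t \<in> {-1<..<1} ==> c * g t - g' t = d z / (of_real t - z) + 1"
   using cod step(2) unfolding resolvent_codim1_def V_def by blast
  have vz: "L1 (%x. a * (v x / (of_real x - z)))" by (intro integrable_mult_right cauchy_integrable v(1) step(2))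
  have eq: "(p x + a / (of_real x - z)) * v x = p x * v x + a * (v x / (of_real x - z))" for x
   by (simp add: distrib_right)
  have i: "L1 (%x. (p x + a / (of_real x - z)) * v x)"
   unfolding eq by (rule integrable_plus[OF pi vz])
  have "(LBINT x. (p x + a / (of_real x - z)) * v x) = - \<kappa> * V + a * cauchyT v z"
   unfolding eq integral_plus[OF pi vz] integral_mult_right_zero cauchyT_def G(4) ..
  then have I: "(LBINT x. (p x + a / (of_real x - z)) * v x) = - (\<kappa> + a / d z) * V"
   unfolding d(2) using d(1) by (simp add: algebra_simps)
  define G' where "G' = scale_L0 (a / d z) (abs_L0 g) + G"
  have sh: "shifted fht c G' = scale_L0 (a / d z) (shifted fht c (abs_L0 g)) + shifted fht c G"
   unfolding G'_def by (rule shifted_fht_lincomb[OF ub hilbert_pair_mem(1)[OF g(1)] G(1)])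
  have gm [measurable]: "g \<in> bm borel" "g' \<in> bm borel"
   using g(1) unfolding hilbert_pair_def by blast+
  have "abs_L0 (%x. p x + a / (of_real x - z)) = shifted fht c G' - scale_L0 (\<kappa> + a / d z) ?one"
  proof -
   have "shifted fht c (abs_L0 g) = abs_L0 (%x. d z / (of_real x - z) + 1)"
    unfolding hilbert_pair_mem(2)[OF g(1)]
   proof (rule abs_L0_eqI)
    show "(%x. c * g x - g' x) \<in> bm leb_I" by (rule leb_I_meas) measurable
    show "(%x. d z / (of_real x - z) + 1) \<in> bm leb_I" by (rule leb_I_meas) measurable
    show "AE x in leb_I. c * g x - g' x = d z / (of_real x - z) + 1"
     unfolding AE_leb_I_iff_lborel using g(2) by simp
   qed
   also have "... = abs_L0 (%x. d z / (of_real x - z)) + ?one"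
    by (rule abs_L0_add[OF cauchy_kernel_measurable, symmetric]) simp
   also have "abs_L0 (%x. d z / (of_real x - z)) = scale_L0 (d z) (abs_L0 (%x. 1 / (of_real x - z)))"
    using abs_L0_scale[OF cauchy_kernel_measurable, of "d z" 1 z] by simp
   finally have 1: "scale_L0 (a / d z) (shifted fht c (abs_L0 g)) = scale_L0 a (abs_L0 (%x. 1 / (of_real x - z))) + scale_L0 (a / d z) ?one"
    using d(1) by (simp add: L0.scale_right_distrib)
   have "abs_L0 (%x. p x + a / (of_real x - z)) = abs_L0 p + abs_L0 (%x. a / (of_real x - z))"
    by (rule abs_L0_add[OF leb_I_meas[OF cauchy_sum_borel[OF step(1)]] cauchy_kernel_measurable, symmetric])
   also have "abs_L0 (%x. a / (of_real x - z)) = scale_L0 a (abs_L0 (%x. 1 / (of_real x - z)))"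
    using abs_L0_scale[OF cauchy_kernel_measurable, of a 1 z] by simp
   finally show ?thesis unfolding sh 1 G(3) by (simp add: L0.scale_left_distrib algebra_simps)
  qed
  moreover have "G' \<in> X" "shifted fht c G' \<in> X"
   unfolding sh unfolding G'_def by (intro X_add X_scale G hilbert_pair_mem[OF g(1)])+
  ultimately show ?case using i I by blast
 qed
 define C where "C = norm V / e"
 have C: "0 <= C" using e by (simp add: C_def)
 \<comment> \<open>After division by \<kappa> the constant 1 is at distance at most N (abs_L0 p) /
   |\<kappa>| from the range, and this distance is at least \<open>e\<close>. So |\<kappa>| is at
   most N (abs_L0 p) / e, which explains C = |V| / e.\<close>
 have cs: "norm (LBINT x. p x * v x) <= C * N (abs_L0 p)" if p: "cauchy_sum p" for p
 proof -
  obtain \<kappa> G where G: "G \<in> X" "shifted fht c G \<in> X" "abs_L0 p = shifted fht c G - scale_L0 \<kappa> ?one"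
   "(LBINT x. p x * v x) = - \<kappa> * V" using rel[OF p] by blast
  have pX: "abs_L0 p \<in> X" unfolding G(3) by (intro X_diff X_scale G oneX)
  show ?thesis
  proof (cases "\<kappa> = 0")
   case True
   then show ?thesis using G(4) C N_nonneg[OF pX] by simp
  next
   case False
   have "shifted fht c (scale_L0 (1 / \<kappa>) G + 0) = scale_L0 (1 / \<kappa>) (shifted fht c G) + shifted fht c 0"
    by (rule shifted_fht_lincomb[OF ub G(1) X_0])
   moreover have "shifted fht c (scale_L0 1 0 + 0) = scale_L0 1 (shifted fht c 0) + shifted fht c 0"
    by (rule shifted_fht_lincomb[OF ub X_0 X_0])
   ultimately have sh: "shifted fht c (scale_L0 (1 / \<kappa>) G) = scale_L0 (1 / \<kappa>) (shifted fht c G)" by simp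
   have "e <= N (?one - scale_L0 (1 / \<kappa>) (shifted fht c G))"
    using e(2)[OF X_scale[OF G(1)], of "1 / \<kappa>"] X_scale[OF G(2), of "1 / \<kappa>"] unfolding sh by blast
   also have "?one - scale_L0 (1 / \<kappa>) (shifted fht c G) = scale_L0 (- 1 / \<kappa>) (abs_L0 p)"
    unfolding G(3) using False by (simp add: L0.scale_right_diff_distrib)
   also have "N ... = N (abs_L0 p) / norm \<kappa>" using N_scale[OF pX, of "- 1 / \<kappa>"] by (simp add: norm_divide)
   finally have "norm \<kappa> * e <= N (abs_L0 p)" using False by (simp add: pos_le_divide_eq mult.commute)
   then have "C * (norm \<kappa> * e) <= C * N (abs_L0 p)" using C by (rule mult_left_mono)
   moreover have "C * (norm \<kappa> * e) = norm (- \<kappa> * V)" using e(1) by (simp add: C_def norm_mult)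
   ultimately show ?thesis unfolding G(4) by simp
  qed
 qed
 \<comment> \<open>The inequality passes from Cauchy sums to bounded functions: the integrals
   converge by dominated convergence, the norms by \<open>bounded_convergence\<close>.\<close>
 have main: "norm (LBINT x. h x * v x) <= C * N (abs_L0 h)"
  if h: "h \<in> bm borel" "!!x. norm (h x) <= K" "!!x. x \<notin> {-1<..<1} ==> h x = 0" for h K
 proof -
  note [measurable] = h(1)
  have K0: "0 <= K" using order_trans[OF norm_ge_zero h(2)] .
  have hX: "abs_L0 h \<in> X" by (rule bounded_mem(1)[OF leb_I_meas[OF h(1)] K0]) (use h(2) in simp)
  obtain q where q: "!!n::nat. cauchy_sum (q n)" "!!n x. norm (q n x) <= K + 1" "AE x in lborel. (%n. q n x) \<longlonglongrightarrow> h x"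
   using cauchy_sum_approx[OF h] by metis
  have [measurable]: "q n \<in> bm borel" for n by (rule cauchy_sum_borel[OF q(1)])
  have qX: "abs_L0 (q n) \<in> X" for n
   by (rule bounded_mem(1)[of _ "K + 1"]) (use q(2) K0 in \<open>auto intro: leb_I_meas\<close>)
  have lim: "(%n. N (abs_L0 h - abs_L0 (q n))) \<longlonglongrightarrow> 0"
  proof (rule bounded_convergence[OF lb leb_I_meas[OF h(1)] leb_I_meas[OF cauchy_sum_borel[OF q(1)]]])
   show "norm (h x - q n x) <= K + (K + 1)" for n x
    by (rule order_trans[OF norm_triangle_ineq4 add_mono[OF h(2) q(2)]])
   show "AE x in leb_I. (%n. q n x) \<longlonglongrightarrow> h x"
    unfolding AE_leb_I_iff_lborel using q(3) by eventually_elim simp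
  qed
  have "(%n. \<integral>x. q n x * v x \<partial>lborel) \<longlonglongrightarrow> (LBINT x. h x * v x)"
  proof (rule integral_dominated_convergence[where w = "%x. (K + 1) * norm (v x)"])
   show "L1 (%x. (K + 1) * norm (v x))" using v(1) by simp
   show "AE x in lborel. (%n. q n x * v x) \<longlonglongrightarrow> h x * v x"
    using q(3) by eventually_elim (intro tendsto_intros)
   show "AE x in lborel. norm (q n x * v x) <= (K + 1) * norm (v x)" for n
    using q(2) by (intro AE_I2) (auto simp: norm_mult intro!: mult_right_mono)
  qed measurable
  then have L: "(%n. norm (LBINT x. q n x * v x)) \<longlonglongrightarrow> norm (LBINT x. h x * v x)" by (rule tendsto_norm)
  have "(%n. C * (N (abs_L0 h) + N (abs_L0 h - abs_L0 (q n)))) \<longlonglongrightarrow> C * (N (abs_L0 h) + 0)"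
   by (intro tendsto_intros lim)
  moreover have "norm (LBINT x. q n x * v x) <= C * (N (abs_L0 h) + N (abs_L0 h - abs_L0 (q n)))" for n
  proof -
   have "N (abs_L0 h - (abs_L0 h - abs_L0 (q n))) <= N (abs_L0 h) + N (abs_L0 h - abs_L0 (q n))"
    by (intro N_diff X_diff hX qX)
   then show ?thesis using cs[OF q(1), of n] mult_left_mono[OF _ C] by fastforce
  qed
  ultimately show ?thesis using LIMSEQ_le[OF L] by simp
 qed
 show False
 proof (rule half_weight_unbounded[OF lb q \<sigma> v(1)])
  fix h :: "real => complex" and k :: real
  assume h [measurable]: "h \<in> bm borel" and k: "!!x. norm (h x) <= k"
  define h' where "h' x = (if x \<in> {-1<..<1} then h x else 0)" for x
  have k0: "0 <= k" using order_trans[OF norm_ge_zero k] .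
  have h'b: "h' \<in> bm borel" unfolding h'_def by measurable
  have "norm (LBINT x. h' x * v x) <= C * N (abs_L0 h')"
   by (rule main[of h' k]) (use h'b k k0 in \<open>auto simp: h'_def\<close>)
  moreover have "h' x * v x = h x * v x" for x using vs[of x] by (auto simp: h'_def)
  moreover have "abs_L0 h' = abs_L0 h"
   by (rule abs_L0_eqI[OF leb_I_meas[OF h'b] leb_I_meas[OF h]]) (simp add: AE_leb_I_iff_lborel h'_def)
  ultimately show "norm (LBINT x. h x * v x) <= C * N (abs_L0 h)" by simp
 qed
qed

text \<open>By \<open>range_closure_eq\<close> it suffices to reach the Cauchy kernels. In the dense
  case they are approximated uniformly, hence in norm; in the other case d(z) / (x - z) + 1 is in
  the range and the constant 1 in its closure.\<close>

lemma dense_range: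
 assumes sep: "separable_space (ntopology X N)" and lb: "0 < lower_boyd_index X N" and ub: "upper_boyd_index X N < 1"
  and q: "q_index X <= 2" "q_index X = 2 --> \<not> q_index_attained X"
 shows "dense_range_on X N (shifted fht c)"
proof -
 have k: "abs_L0 (%x. 1 / (cr x - z)) \<in> range_closure c" if z: "Im z ~= 0" for z
 proof (rule resolvent_dichotomy[of c])
  assume dense: "resolvent_dense c"
  show ?thesis
  proof (rule range_closure_closed)
   have kb: "norm (1 / (cr x - z)) <= 1 / \<bar>Im z\<bar>" for x
    using norm_cauchy_integrand[OF z, of 1 x] by simp
   show "abs_L0 (%x. 1 / (cr x - z)) \<in> X"
    by (rule bounded_mem(1)[OF cauchy_kernel_measurable, of "1 / \<bar>Im z\<bar>"]) (use kb in auto)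
   fix e :: real assume e: "0 < e"
   define M where "M = N (chi UNIV)"
   have M: "0 <= M" unfolding M_def by (intro N_nonneg chi_mem) simp
   define \<epsilon> where "\<epsilon> = e / (M + 1)"
   have \<epsilon>: "0 < \<epsilon>" "\<epsilon> * M < e"
   proof -
    show p: "0 < \<epsilon>" using e M by (simp add: \<epsilon>_def)
    have "\<epsilon> * (M + 1) = e" using M by (simp add: \<epsilon>_def)
    then show "\<epsilon> * M < e" using p by (simp add: algebra_simps)
   qed
   obtain g g' where g: "hilbert_pair g g'" "!!t. t \<in> {-1<..<1} ==> norm (c * g t - g' t - 1 / (of_real t - z)) <= \<epsilon>"
    using dense z \<epsilon>(1) unfolding resolvent_dense_def by blast
   have [measurable]: "g \<in> bm borel" "g' \<in> bm borel"
    using g(1) unfolding hilbert_pair_def by blast+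
   have gm: "(%x. c * g x - g' x) \<in> bm leb_I" by (rule leb_I_meas) measurable
   have "abs_L0 (%x. 1 / (cr x - z)) - shifted fht c (abs_L0 g) = abs_L0 (%x. 1 / (cr x - z) - (c * g x - g' x))"
    unfolding hilbert_pair_mem(2)[OF g(1)] by (rule abs_L0_diff[OF cauchy_kernel_measurable gm])
   also have "N ... <= \<epsilon> * N (chi UNIV)"
   proof (rule bounded_mem(2))
    show "(%x. 1 / (cr x - z) - (c * g x - g' x)) \<in> bm leb_I"
     by (intro borel_measurable_diff cauchy_kernel_measurable gm)
    show "AE x in leb_I. norm (1 / (cr x - z) - (c * g x - g' x)) <= \<epsilon>"
    proof (rule AE_I2)
     fix x assume "x \<in> space leb_I"
     then have "norm (c * g x - g' x - 1 / (of_real x - z)) <= \<epsilon>" by (intro g(2)) simp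
     then show "norm (1 / (cr x - z) - (c * g x - g' x)) <= \<epsilon>" by (subst norm_minus_commute)
    qed
   qed (use \<epsilon> in simp)
   also have "... < e" using \<epsilon>(2) by (simp add: M_def)
   finally show "\<exists>F'\<in>range_closure c. N (abs_L0 (%x. 1 / (cr x - z)) - F') < e"
    using range_closureI[OF hilbert_pair_mem(1)[OF g(1)] hilbert_pair_mem(3)[OF g(1)]] by blast
  qed
 next
  fix r v d assume cod: "resolvent_codim1 c r v d"
  have one: "abs_L0 (%x. 1) \<in> range_closure c" by (rule codim1_constant[OF lb ub q cod])
  obtain g g' where d: "d z ~= 0"
   and g: "hilbert_pair g g'" "!!t. t \<in> {-1<..<1} ==> c * g t - g' t = d z / (of_real t - z) + 1"
   using cod z unfolding resolvent_codim1_def by blast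
  have [measurable]: "g \<in> bm borel" "g' \<in> bm borel"
   using g(1) unfolding hilbert_pair_def by blast+
  have gm: "(%x. c * g x - g' x) \<in> bm leb_I" by (rule leb_I_meas) measurable
  have "abs_L0 (%x. c * g x - g' x) \<in> range_closure c"
   using range_closureI[OF hilbert_pair_mem(1)[OF g(1)] hilbert_pair_mem(3)[OF g(1)]] unfolding hilbert_pair_mem(2)[OF g(1)] .
  from range_closure_lincomb[OF ub one this, of "-1"]
  have 1: "scale_L0 (-1) (abs_L0 (%x. 1)) + abs_L0 (%x. c * g x - g' x) \<in> range_closure c" .
  have m1: "(%x. -1 * 1 :: complex) \<in> bm leb_I" by simp
  have m2: "(%x. -1 * 1 + (c * g x - g' x)) \<in> bm leb_I" by (intro borel_measurable_add m1 gm)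
  have "scale_L0 (-1) (abs_L0 (%x. 1)) + abs_L0 (%x. c * g x - g' x) = abs_L0 (%x. -1 * 1 + (c * g x - g' x))"
   by (subst abs_L0_scale, simp) (rule abs_L0_add[OF m1 gm])
  from range_closure_lincomb[OF ub 1 zero_range_closure[OF ub], of "1 / d z"]
  have 2: "scale_L0 (1 / d z) (abs_L0 (%x. -1 * 1 + (c * g x - g' x))) \<in> range_closure c"
   unfolding \<open>scale_L0 (-1) (abs_L0 (%x. 1)) + _ = _\<close> by simp
  also have "scale_L0 (1 / d z) (abs_L0 (%x. -1 * 1 + (c * g x - g' x))) = abs_L0 (%x. 1 / (cr x - z))"
   unfolding abs_L0_scale[OF m2]
  proof (rule abs_L0_eqI[OF _ cauchy_kernel_measurable])
   show "(%x. 1 / d z * (-1 * 1 + (c * g x - g' x))) \<in> bm leb_I"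
    by (intro borel_measurable_times m2) simp
   show "AE x in leb_I. 1 / d z * (-1 * 1 + (c * g x - g' x)) = 1 / (cr x - z)"
    unfolding AE_leb_I_iff_lborel using g(2) d by simp
  qed
  finally show ?thesis .
 qed
 interpret M: Metric_space X "ndist X N" by (rule Metric_space_ndist[OF norm_on])
 have "X \<subseteq> M.mtopology closure_of (shifted fht c ` X)"
 proof
  fix F assume F: "F \<in> X"
  then have "F \<in> range_closure c" using range_closure_eq[OF sep lb ub k] by blast
  then have "\<exists>y\<in>shifted fht c ` X. y \<in> M.mball F e" if "0 < e" for e
   using that F unfolding range_closure_def by (fastforce simp: ndist_def)
  then show "F \<in> M.mtopology closure_of (shifted fht c ` X)"
   unfolding M.metric_closure_of using F by blast
 qed
 moreover have "M.mtopology closure_of (shifted fht c ` X) \<subseteq> X" by (metis closure_of_subset_topspace M.topspace_mtopology)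
 ultimately show ?thesis unfolding dense_range_on_def by blast
qed

end

theorem proposition6p4:
  fixes X :: "L0 set" and N :: "L0 \<Rightarrow> real"
  assumes "ri_space X N"
    and "separable_space (ntopology X N)"
    and "0 < lower_boyd_index X N"
    and "lower_boyd_index X N \<le> upper_boyd_index X N"
    and "upper_boyd_index X N < 1"
    and "2 \<le> p_index X" and "q_index X \<le> 2"
    and "p_index X = 2 \<Longrightarrow> \<not> p_index_attained X"
    and "q_index X = 2 \<Longrightarrow> \<not> q_index_attained X"
  shows "point_spectrum_on X fht = {} \<and>
         residual_spectrum_on X N fht = {} \<and>
         continuous_spectrum_on X N fht = spectrum_on X N fht"
proof -
 interpret ri X N by standard (rule assms(1))
 have p: "p_index X = 2 --> \<not> p_index_attained X" and q: "q_index X = 2 --> \<not> q_index_attained X"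
  using assms(8,9) by blast+
 have eig: "F = 0" if "F \<in> X" "fht F = scale_L0 c F" for F c
  by (rule no_eigenvalue[OF assms(5,6) p that])
 have inj: "inj_on (shifted fht c) X" for c
 proof (rule inj_onI)
  fix F G assume F: "F \<in> X" and G: "G \<in> X" and eq: "shifted fht c F = shifted fht c G"
  have "shifted fht c (scale_L0 (-1) G + F) = 0"
   unfolding shifted_fht_lincomb[OF assms(5) G F] using eq by simp
  then have "fht (F - G) = scale_L0 c (F - G)" by (simp add: shifted_def)
  then have "F - G = 0" by (rule eig[OF X_diff[OF F G]])
  then show "F = G" by simp
 qed
 \<comment> \<open>Injectivity and dense range hold for every complex number c, so the three parts
   of the spectrum are determined whatever the spectrum itself is.\<close>
 have dense: "dense_range_on X N (shifted fht c)" for c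
  by (rule dense_range[OF assms(2,3,5,7) q])
 show ?thesis
 proof (intro conjI)
  show "point_spectrum_on X fht = {}" unfolding point_spectrum_on_def using eig by blast
  show "residual_spectrum_on X N fht = {}" unfolding residual_spectrum_on_def using dense by simp
  show "continuous_spectrum_on X N fht = spectrum_on X N fht"
   unfolding continuous_spectrum_on_def using inj dense by simp
 qed
qed

end
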